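(* Let $d=2$ and $\lambda\in\{-1,1\}$. There exists $\varepsilon_0>0$ such that the following holds. Given $\mu_0\in C^1(\mathbb{R}^2_x\times\mathbb{R}^2_v)$ satisfying $$\|\langle v\rangle\mu_0\|_{L^2_{x,v}}+\|\langle v\rangle\nabla_{x,v}\mu_0\|_{L^\infty_{x,v}}+\|\langle v\rangle^3\mu_0\|_{L^\infty_{x,v}}\le\varepsilon_0,$$ there exists a unique global solution $\mu$ of $$\partial_t\mu+v\cdot\nabla_x\mu+x\cdot\nabla_v\mu+\lambda E[\mu]\cdot\nabla_v\mu=0$$ with $\mu(t=0)=\mu_0$. Moreover, there exist $\mu_\infty\in L^2_{x,v}\cap L^\infty_{x,v}$ and $E_\infty=E[\mu_\infty]\in L^\infty_x$ such that $$\big\|\mu\big(t,\mathcal{X}(t,x-v,v),\mathcal{V}(t,x-v,v)\big)-\mu_\infty(x,v)\big\|_{L^\infty_{x,v}}\lesssim\frac{\langle t\rangle^{10}}{e^t}\quad\text{as }t\to\infty,$$ where $$\mathcal{X}(t,x,v)=x\cosh t+v\sinh t-\lambda te^{-t}E_\infty(x+v),\qquad \mathcal{V}(t,x,v)=v\cosh t+x\sinh t+\lambda te^{-t}E_\infty(x+v).$$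
   Context: $\langle y\rangle=(1+|y|^2)^{1/2}$. For $g:\mathbb{R}^2_x\times\mathbb{R}^2_v\to\mathbb{R}$ the electric field generated by $g$ is $$E[g](x)=\frac1{2\pi}\iint_{\mathbb{R}^2_y\times\mathbb{R}^2_v}\frac{x-y}{|x-y|^2}\,g^2(y,v)\,dy\,dv,$$ and for a time-dependent $\mu(t,x,v)$, $E[\mu](t,x)=E[\mu(t,\cdot,\cdot)](x)$. The equation is the Vlasov--Poisson system with repulsive harmonic potential $-|x|^2/2$ written for $\mu$, where the particle distribution function is $\mu^2$. $A\lesssim B$ means $A\le CB$ for some constant $C>0$. *)

theory Defs
  imports "HOL-Analysis.Analysis" "HOL-Probability.Essential_Supremum"
begin

type_synonym plane = "real ^ 2"
type_synonym phase = "plane \<times> plane"  \<comment> \<open>pairs (x, v) of position and velocity\<close>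

definition bracket :: "'a::real_normed_vector \<Rightarrow> real" where
  "bracket y = sqrt (1 + (norm y)\<^sup>2)"

text \<open>Norms with respect to Lebesgue measure, with values in the extended nonnegative reals.
  The essential supremum of the library is infinite on non-measurable functions, and so is the
  square norm below.\<close>

definition Linf_norm :: "('a::euclidean_space \<Rightarrow> 'b::real_normed_vector) \<Rightarrow> ennreal" where
  "Linf_norm f = esssup lborel (\<lambda>z. ennreal (norm (f z)))"

definition L2_norm :: "('a::euclidean_space \<Rightarrow> real) \<Rightarrow> ennreal" where
  "L2_norm f =
    (let I = \<integral>\<^sup>+ z. ennreal ((f z)\<^sup>2) \<partial>lborel
     in if f \<in> borel_measurable lborel \<and> I < \<infinity> then ennreal (sqrt (enn2real I)) else \<infinity>)"

definition in_L2 :: "('a::euclidean_space \<Rightarrow> real) \<Rightarrow> bool" where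
  "in_L2 f \<longleftrightarrow> f \<in> borel_measurable lborel \<and> L2_norm f < \<infinity>"

definition in_Linf :: "('a::euclidean_space \<Rightarrow> 'b::real_normed_vector) \<Rightarrow> bool" where
  "in_Linf f \<longleftrightarrow> f \<in> borel_measurable lborel \<and> Linf_norm f < \<infinity>"

definition grad :: "('a::euclidean_space \<Rightarrow> real) \<Rightarrow> 'a \<Rightarrow> 'a" where
  "grad f z = (THE D. GDERIV f z :> D)"

definition C1_fun :: "('a::euclidean_space \<Rightarrow> real) \<Rightarrow> bool" where
  "C1_fun f \<longleftrightarrow> (\<forall>z. f differentiable (at z)) \<and> continuous_on UNIV (grad f)"

definition field_integrand :: "(phase \<Rightarrow> real) \<Rightarrow> plane \<Rightarrow> phase \<Rightarrow> plane" where
  "field_integrand g x = (\<lambda>(y, v). (g (y, v))\<^sup>2 *\<^sub>R ((x - y) /\<^sub>R (norm (x - y))\<^sup>2))"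

text \<open>The Bochner integral is 0 by convention when the integrand is not integrable, so
  statements about the field are accompanied by \<open>field_defined\<close>.\<close>

definition field_defined :: "(phase \<Rightarrow> real) \<Rightarrow> bool" where
  "field_defined g \<longleftrightarrow> (\<forall>x. integrable lborel (field_integrand g x))"

definition efield :: "(phase \<Rightarrow> real) \<Rightarrow> plane \<Rightarrow> plane" where
  "efield g x = (1 / (2 * pi)) *\<^sub>R (\<integral>z. field_integrand g x z \<partial>lborel)"

text \<open>Classical solutions on \<open>[0, \<infinity>) \<times> \<real>\<^sup>2 \<times> \<real>\<^sup>2\<close>. The density is continuously
  differentiable up to \<open>t = 0\<close> (that is, all first partial derivatives exist and are jointly
  continuous, the time derivative being one-sided at 0) and square integrable at each time. Its
  electric field is given by absolutely convergent integrals, is continuous, and is bounded on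
  every finite time interval. The values of the density at negative times are irrelevant.\<close>

definition global_solution ::
  "real \<Rightarrow> (phase \<Rightarrow> real) \<Rightarrow> (real \<Rightarrow> phase \<Rightarrow> real) \<Rightarrow> bool" where
  "global_solution lam \<mu>0 \<mu> \<longleftrightarrow>
     \<mu> 0 = \<mu>0 \<and>
     (\<forall>t\<ge>0. in_L2 (\<mu> t) \<and> field_defined (\<mu> t)) \<and>
     continuous_on ({0..} \<times> UNIV) (\<lambda>(t, x). efield (\<mu> t) x) \<and>
     (\<forall>T\<ge>0. bounded ((\<lambda>(t, x). efield (\<mu> t) x) ` ({0..T} \<times> UNIV))) \<and>
     (\<exists>(dt :: real \<times> phase \<Rightarrow> real) (dx :: real \<times> phase \<Rightarrow> plane) (dv :: real \<times> phase \<Rightarrow> plane).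
        continuous_on ({0..} \<times> UNIV) dt \<and>
        continuous_on ({0..} \<times> UNIV) dx \<and>
        continuous_on ({0..} \<times> UNIV) dv \<and>
        (\<forall>t\<ge>0. \<forall>x v.
           ((\<lambda>s. \<mu> s (x, v)) has_real_derivative dt (t, x, v)) (at t within {0..}) \<and>
           GDERIV (\<lambda>y. \<mu> t (y, v)) x :> dx (t, x, v) \<and>
           GDERIV (\<lambda>w. \<mu> t (x, w)) v :> dv (t, x, v) \<and>
           dt (t, x, v) + v \<bullet> dx (t, x, v) + x \<bullet> dv (t, x, v)
             + lam * (efield (\<mu> t) x \<bullet> dv (t, x, v)) = 0))"

definition Xasym :: "real \<Rightarrow> (plane \<Rightarrow> plane) \<Rightarrow> real \<Rightarrow> plane \<Rightarrow> plane \<Rightarrow> plane" where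
  "Xasym lam Einf t x v =
     cosh t *\<^sub>R x + sinh t *\<^sub>R v - (lam * t * exp (- t)) *\<^sub>R Einf (x + v)"

definition Vasym :: "real \<Rightarrow> (plane \<Rightarrow> plane) \<Rightarrow> real \<Rightarrow> plane \<Rightarrow> plane \<Rightarrow> plane" where
  "Vasym lam Einf t x v =
     cosh t *\<^sub>R v + sinh t *\<^sub>R x + (lam * t * exp (- t)) *\<^sub>R Einf (x + v)"

end

theory Submission
  imports Defs
begin

text \<open>In the profile coordinates \<open>w = lin (- t) (x, v)\<close> the linear flow disappears, and a field of size
  \<open>exp (- t)\<close> moves the unstable component of \<open>w\<close> by a convergent amount and the stable one by \<open>O(t)\<close>.
  Along such a field the map from the velocity at time \<open>t\<close> to the initial velocity expands distances by
  \<open>cosh t / 2\<close>, so data of size \<open>\<epsilon> / \<langle>v\<rangle>\<^sup>3\<close> have spatial density \<open>O(\<epsilon>\<^sup>2 / cosh\<^sup>2 t)\<close> and generate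
  a field \<open>O(\<epsilon>\<^sup>2 exp (- t))\<close> with the same Lipschitz bound. Hence the solution is a fixed point, by
  contraction, of the map from a small field to the field of the data transported by it. Differences of
  fields are estimated by splitting the Coulomb kernel into a regularised part, integrated along
  trajectories, and an integrable remainder, integrated against densities at fixed positions.

  A competing solution has a field that is only known to be continuous. Its characteristics are replaced
  by Euler polygons, which preserve volume exactly and along which the competing density is almost
  constant; if the fields differ by at most \<open>N exp (\<Lambda> t)\<close> with \<open>\<Lambda>\<close> large, they differ by half as much.

  For the asymptotics, \<open>cosh t *\<^sub>R a t (cosh t *\<^sub>R y)\<close> converges at rate \<open>(1 + t) exp (- t)\<close> to the
  Coulomb field of the data placed at the limits of their unstable components. The stable component
  therefore drifts like \<open>- 2 lam t Einf\<close>, which is the correction in the asymptotic trajectories, and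
  the density along these is Cauchy because the weighted gradient bound absorbs the growth in \<open>v\<close>. The
  asymptotic maps preserve volume, which identifies the limit field with the field of the limit density.\<close>

text \<open>The obstacle is the Lipschitz bound of the field: the derivative of the Coulomb kernel
  has size \<open>1 / |z|^2\<close>, which in the plane is integrable neither at 0 nor at infinity.
  The splitting at a length \<open>d\<close> removes both ends. The Lipschitz constant of the
  regularised part still decays like \<open>1 / |z|\<close>, so it is controlled by the same
  integral as the field itself. The remainder decays like \<open>1 / |z|^3\<close> and has integral
  \<open>O(d)\<close>; there the increment is moved onto the density, which is Lipschitz with
  constant \<open>O(\<epsilon> exp t)\<close>, and the loss is paid by the density bound
  \<open>O(exp (- 2 t))\<close>. With \<open>d = 1\<close> this gives the Lipschitz bound and a
  contraction uniform in time, with \<open>d\<close> tending to 0 continuity and \<open>C^1\<close>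
  regularity of the field, and after rescaling by \<open>cosh t\<close> the limit field.

  Volume preservation is not obtained by differentiating a flow. Fatou's lemma passes it to limits
  of Euler maps from two sides, for a map and for its inverse, and the same two-sided argument shows
  that no mass is lost in the limit density.\<close>

lemma continuous_on_compose_pair:
  assumes "continuous_on UNIV (\<lambda>(x, y). f x y)" "continuous_on S g" "continuous_on S h"
  shows "continuous_on S (\<lambda>x. f (g x) (h x))"
  using continuous_on_compose2[OF assms(1) continuous_on_Pair[OF assms(2,3)]] by simp

lemma continuous_on_compose_triple:
  assumes "continuous_on UNIV (\<lambda>(x, y, z). f x y z)"
    "continuous_on S g" "continuous_on S h" "continuous_on S k"
  shows "continuous_on S (\<lambda>x. f (g x) (h x) (k x))"
  using continuous_on_compose2[OF assms(1) continuous_on_Pair[OF assms(2) continuous_on_Pair[OF assms(3,4)]]]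
  by simp

text \<open>Replaces Gronwall's inequality. On a compact interval the quotient \<open>y / w\<close>
  attains its maximum, so there is a best constant \<open>H\<close>; the improvement to
  \<open>c + H / 2\<close> at the point where it is attained forces \<open>H \<le> 2 * c\<close>.
  The weight \<open>w\<close> can then be fitted to the growth expected in each problem.\<close>

lemma weighted_sup_bound:
  fixes y w :: "real \<Rightarrow> real"
  assumes ab: "a \<le> b" and y: "continuous_on {a..b} y" and w: "continuous_on {a..b} w"
    and wpos: "\<And>s. s \<in> {a..b} \<Longrightarrow> w s > 0" and c: "c \<ge> 0"
    and step: "\<And>H. H \<ge> 0 \<Longrightarrow> (\<And>s. s \<in> {a..b} \<Longrightarrow> y s \<le> H * w s) \<Longrightarrow>
                 (\<And>s. s \<in> {a..b} \<Longrightarrow> y s \<le> (c + H / 2) * w s)"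
    and t: "t \<in> {a..b}"
  shows "y t \<le> 2 * c * w t"
proof -
  have "continuous_on {a..b} (\<lambda>s. y s / w s)"
    using wpos by (intro continuous_intros y w) force
  then obtain m where m: "m \<in> {a..b}" and sup: "\<And>s. s \<in> {a..b} \<Longrightarrow> y s / w s \<le> y m / w m"
    using continuous_attains_sup[of "{a..b}" "\<lambda>s. y s / w s"] ab by auto
  define H where "H = max 0 (y m / w m)"
  have H: "y s \<le> H * w s" if "s \<in> {a..b}" for s
  proof -
    have "y s / w s \<le> H" using sup[OF that] by (simp add: H_def)
    then show ?thesis using wpos[OF that] by (simp add: field_simps)
  qed
  have "H \<le> 2 * c"
  proof (cases "y m / w m \<le> 0")
    case False
    have "y m \<le> (c + H / 2) * w m"
      by (rule step[OF _ _ m]) (use H in \<open>auto simp: H_def\<close>)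
    then have "y m / w m \<le> c + H / 2"
      using wpos[OF m] by (simp add: field_simps)
    with False show ?thesis by (simp add: H_def)
  qed (use c in \<open>auto simp: H_def\<close>)
  then show ?thesis
    using H[OF t] wpos[OF t] by (meson less_imp_le mult_right_mono order_trans)
qed

lemma norm_increment_le:
  fixes f :: "real \<Rightarrow> 'a::real_normed_vector" and \<phi> :: "real \<Rightarrow> real"
  assumes ab: "a \<le> b"
    and f': "\<And>x. a \<le> x \<Longrightarrow> x \<le> b \<Longrightarrow> (f has_vector_derivative f' x) (at x)"
    and phi': "\<And>x. a \<le> x \<Longrightarrow> x \<le> b \<Longrightarrow> (\<phi> has_real_derivative \<phi>' x) (at x)"
    and bnd: "\<And>x. a \<le> x \<Longrightarrow> x \<le> b \<Longrightarrow> norm (f' x) \<le> \<phi>' x"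
  shows "norm (f b - f a) \<le> \<phi> b - \<phi> a"
proof (cases "a = b")
  case False
  show ?thesis
  proof (rule differentiable_bound_general[of a b f \<phi> f' \<phi>'])
    show "continuous_on {a..b} f"
      using f' by (auto intro!: continuous_at_imp_continuous_on has_vector_derivative_continuous)
    show "continuous_on {a..b} \<phi>"
      using phi' by (auto intro!: continuous_at_imp_continuous_on DERIV_isCont)
  qed (use assms False in \<open>auto simp: has_real_derivative_iff_has_vector_derivative[symmetric]\<close>)
qed auto

section \<open>Ordinary differential equations\<close>

text \<open>An integral over an interval with reversed end points is 0, so at most one of the two
  terms survives and the difference is the oriented integral from \<open>s\<close> to
  \<open>t\<close>.\<close>

definition primitive :: "real \<Rightarrow> (real \<Rightarrow> 'a::banach) \<Rightarrow> real \<Rightarrow> 'a" where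
  "primitive s g t = integral {s..t} g - integral {t..s} g"

lemma primitive_self [simp]: "primitive s g s = 0"
  by (simp add: primitive_def)

lemma has_vector_derivative_primitive:
  assumes g: "continuous_on UNIV g"
  shows "(primitive s g has_vector_derivative g t) (at t)"
proof -
  define a b where "a = min s t - 1" and "b = max s t + 1"
  have cont: "continuous_on A g" for A
    using g continuous_on_subset by blast
  have eq: "primitive s g u = integral {a..u} g - integral {a..s} g" if u: "u \<in> {a..b}" for u
  proof (cases "s \<le> u")
    case True
    have "integral {a..s} g + integral {s..u} g = integral {a..u} g"
      by (rule Henstock_Kurzweil_Integration.integral_combine)
         (use True in \<open>auto simp: a_def intro!: integrable_continuous_real cont\<close>)
    moreover have "integral {u..s} g = 0"
      using True by (cases "s = u") auto
    ultimately show ?thesis by (auto simp: primitive_def algebra_simps)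
  next
    case False
    have "integral {a..u} g + integral {u..s} g = integral {a..s} g"
      by (rule Henstock_Kurzweil_Integration.integral_combine)
         (use False u in \<open>auto simp: a_def intro!: integrable_continuous_real cont\<close>)
    with False show ?thesis by (simp add: primitive_def algebra_simps)
  qed
  have t: "t \<in> {a<..<b}" by (auto simp: a_def b_def)
  have "((\<lambda>u. integral {a..u} g - integral {a..s} g) has_vector_derivative g t - 0) (at t within {a..b})"
    using t by (intro has_vector_derivative_diff integral_has_vector_derivative cont) auto
  then have "((\<lambda>u. integral {a..u} g - integral {a..s} g) has_vector_derivative g t) (at t)"
    using t by (simp add: at_within_Icc_at)
  then show ?thesis
    by (rule has_vector_derivative_transform_within_open[of _ _ _ "{a<..<b}"])
       (use t eq in auto)
qed

lemma continuous_on_primitive: "continuous_on UNIV g \<Longrightarrow> continuous_on A (primitive s g)"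
  by (meson continuous_at_imp_continuous_on has_vector_derivative_continuous has_vector_derivative_primitive)

text \<open>If \<open>M\<close> is the primitive of \<open>m\<close>, then
  \<open>m * exp (2 * M)\<close> has the primitive \<open>exp (2 * M) / 2\<close>: the factor gained
  is the reciprocal of the rate in the exponent. It becomes the contraction constant of the next
  proof.\<close>

lemma norm_primitive_le:
  fixes g :: "real \<Rightarrow> 'a::banach"
  assumes g: "continuous_on UNIV g" and m: "continuous_on UNIV m" and mpos: "\<And>t. m t \<ge> 0" and c: "c \<ge> 0"
    and le: "\<And>t. norm (g t) \<le> c * (m t * exp (2 * \<bar>primitive s m t\<bar>))"
  shows "norm (primitive s g t) \<le> c / 2 * exp (2 * \<bar>primitive s m t\<bar>)"
proof -
  note der = has_vector_derivative_primitive[OF g, of s]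
  have derm: "(primitive s m has_real_derivative m x) (at x)" for x
    using has_vector_derivative_primitive[OF m, of s x]
    by (simp add: has_real_derivative_iff_has_vector_derivative)
  have mono: "primitive s m x \<le> primitive s m y" if "x \<le> y" for x y
    by (rule DERIV_nonneg_imp_nondecreasing[OF that]) (use derm mpos in blast)
  show ?thesis
  proof (cases "s \<le> t")
    case True
    have "norm (primitive s g t - primitive s g s) \<le>
        c / 2 * exp (2 * primitive s m t) - c / 2 * exp (2 * primitive s m s)"
    proof (rule norm_increment_le[OF True der])
      show "((\<lambda>x. c / 2 * exp (2 * primitive s m x)) has_real_derivative c * (m x * exp (2 * primitive s m x))) (at x)" for x
        by (auto intro!: derivative_eq_intros derm)
      show "norm (g x) \<le> c * (m x * exp (2 * primitive s m x))" if "s \<le> x" for x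
        using le[of x] mono[OF that] by simp
    qed
    then show ?thesis using mono[OF True] c by simp
  next
    case False
    then have ts: "t \<le> s" by simp
    have "norm (primitive s g s - primitive s g t) \<le>
        - c / 2 * exp (- 2 * primitive s m s) - - c / 2 * exp (- 2 * primitive s m t)"
    proof (rule norm_increment_le[OF ts der])
      show "((\<lambda>x. - c / 2 * exp (- 2 * primitive s m x)) has_real_derivative c * (m x * exp (- 2 * primitive s m x))) (at x)" for x
        by (auto intro!: derivative_eq_intros derm)
      show "norm (g x) \<le> c * (m x * exp (- 2 * primitive s m x))" if "x \<le> s" for x
        using le[of x] mono[OF that] by simp
    qed
    then show ?thesis using mono[OF ts] c by simp
  qed
qed

text \<open>Picard iteration in Bielecki's weighted sup norm. With the weight \<open>W\<close> it
  contracts by 1/2 on the whole line at once, so no local solutions have to be glued.\<close>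

lemma picard_lindelof_global:
  fixes f :: "real \<Rightarrow> 'a::banach \<Rightarrow> 'a"
  assumes f: "continuous_on UNIV (\<lambda>(t, y). f t y)" and L: "continuous_on UNIV L"
    and lip: "\<And>t y z. norm (f t y - f t z) \<le> L t * norm (y - z)"
  shows "\<exists>y. y s = y0 \<and> (\<forall>t. (y has_vector_derivative f t (y t)) (at t))"
proof -
  define m where "m t = \<bar>L t\<bar> + norm (f t y0)" for t
  define W where "W t = exp (2 * \<bar>primitive s m t\<bar>)" for t
  note fc = continuous_on_compose_pair[OF f]
  have m: "continuous_on UNIV m" unfolding m_def
    by (intro continuous_intros L fc)
  have mpos: "m t \<ge> 0" for t by (simp add: m_def)
  have W: "continuous_on UNIV W" unfolding W_def
    by (intro continuous_intros continuous_on_primitive m)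
  have W1: "W t \<ge> 1" for t by (simp add: W_def)
  \<comment> \<open>The unknown is the bounded function \<open>D\<close> with
    \<open>y = y0 + W * D\<close>, which turns the weighted norm into the sup norm of bounded
    continuous functions. The summand \<open>norm (f t y0)\<close> in \<open>m\<close> keeps the
    iterates bounded in it.\<close>
  define h where "h D t = f t (y0 + W t *\<^sub>R apply_bcontfun D t)" for D :: "real \<Rightarrow>\<^sub>C 'a" and t
  have h: "continuous_on UNIV (h D)" for D
    unfolding h_def by (intro fc continuous_intros W) auto
  define T where "T D = Bcontfun (\<lambda>t. (1 / W t) *\<^sub>R primitive s (h D) t)" for D
  have bd: "norm ((1 / W t) *\<^sub>R primitive s (h D) t) \<le> (1 + norm D) / 2" for D t
  proof -
    have "norm (h D t) \<le> (1 + norm D) * (m t * W t)" for t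
    proof -
      have "norm (h D t) \<le> norm (f t y0) + norm (h D t - f t y0)"
        by (metis add.commute diff_add_cancel norm_triangle_ineq)
      also have "norm (h D t - f t y0) \<le> L t * norm (W t *\<^sub>R D t)"
        using lip[of t "y0 + W t *\<^sub>R D t" y0] by (simp add: h_def)
      also have "\<dots> \<le> \<bar>L t\<bar> * (W t * norm D)"
        using W1[of t] norm_bounded[of D t] by (intro mult_mono) (auto intro: mult_left_mono)
      also have "\<dots> \<le> m t * (W t * norm D)"
        using W1[of t] by (intro mult_right_mono) (auto simp: m_def)
      also have "norm (f t y0) \<le> m t * W t"
        using mult_mono[of "norm (f t y0)" "m t" 1 "W t"] W1[of t] mpos[of t] by (simp add: m_def)
      finally show ?thesis by (simp add: algebra_simps)
    qed
    then have "norm (primitive s (h D) t) \<le> (1 + norm D) / 2 * W t"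
      unfolding W_def by (intro norm_primitive_le h m mpos) auto
    then show ?thesis using W1[of t] by (simp add: field_simps)
  qed
  have Tapp: "apply_bcontfun (T D) t = (1 / W t) *\<^sub>R primitive s (h D) t" for D t
  proof -
    have "(\<lambda>t. (1 / W t) *\<^sub>R primitive s (h D) t) \<in> bcontfun"
      using W1 by (intro bcontfun_normI[OF _ bd] continuous_intros W continuous_on_primitive h)
        (metis not_one_le_zero)
    then show ?thesis by (simp add: T_def Bcontfun_inverse)
  qed
  have "\<exists>!D. T D = D"
  proof (rule banach_fix_type)
    show "\<forall>D E. dist (T D) (T E) \<le> 1 / 2 * dist D E"
    proof (intro allI dist_bound)
      fix D E t
      have "norm (primitive s (\<lambda>t. h D t - h E t) t) \<le> dist D E / 2 * exp (2 * \<bar>primitive s m t\<bar>)"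
      proof (rule norm_primitive_le[OF _ m mpos])
        fix t
        have "norm (h D t - h E t) \<le> L t * norm (W t *\<^sub>R (D t - E t))"
          using lip[of t "y0 + W t *\<^sub>R D t" "y0 + W t *\<^sub>R E t"] by (simp add: h_def algebra_simps)
        also have "\<dots> \<le> m t * (W t * dist D E)"
          using W1[of t] dist_bounded[of D t E] abs_ge_self[of "L t"]
          by (intro mult_mono) (auto simp: m_def dist_norm intro: mult_left_mono add_increasing2)
        finally show "norm (h D t - h E t) \<le> dist D E * (m t * exp (2 * \<bar>primitive s m t\<bar>))"
          by (simp add: W_def ac_simps)
      qed (auto intro!: continuous_intros h)
      moreover have "primitive s (\<lambda>t. h D t - h E t) t = primitive s (h D) t - primitive s (h E) t"
        unfolding primitive_def
        by (subst (1 2) Henstock_Kurzweil_Integration.integral_diff)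
           (auto intro!: integrable_continuous_real continuous_on_subset[OF h])
      ultimately have "norm (primitive s (h D) t - primitive s (h E) t) \<le> dist D E / 2 * W t"
        by (simp add: W_def)
      then show "dist (T D t) (T E t) \<le> 1 / 2 * dist D E"
        using W1[of t] unfolding Tapp dist_norm scaleR_diff_right[symmetric] norm_scaleR
        by (simp add: divide_simps mult.commute)
    qed
  qed auto
  then obtain D where D: "T D = D" by blast
  define y where "y t = y0 + primitive s (h D) t" for t
  have y: "y t = y0 + W t *\<^sub>R D t" for t
    using Tapp[of D t] W1[of t] by (simp add: y_def D)
  have "(y has_vector_derivative 0 + h D t) (at t)" for t
    unfolding y_def by (intro has_vector_derivative_add has_vector_derivative_const has_vector_derivative_primitive h)
  moreover have "h D t = f t (y t)" for t by (simp add: h_def y)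
  ultimately show ?thesis by (intro exI[of _ y]) (auto simp: y_def)
qed

text \<open>The rate \<open>2 * L + 1\<close> fits the bootstrap: the Lipschitz term integrates to
  half of the assumed bound, and the unit left over absorbs the defect \<open>c\<close>.\<close>

lemma ode_stability_forward:
  fixes y z :: "real \<Rightarrow> 'a::real_normed_vector"
  assumes st: "s \<le> t"
    and y: "\<And>x. s \<le> x \<Longrightarrow> x \<le> t \<Longrightarrow> (y has_vector_derivative y' x) (at x)"
    and z: "\<And>x. s \<le> x \<Longrightarrow> x \<le> t \<Longrightarrow> (z has_vector_derivative z' x) (at x)"
    and le: "\<And>x. s \<le> x \<Longrightarrow> x \<le> t \<Longrightarrow> norm (y' x - z' x) \<le> L * norm (y x - z x) + c"
    and init: "norm (y s - z s) \<le> c" and L: "L \<ge> 0" and c: "c > 0"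
  shows "norm (y t - z t) \<le> 4 * c * exp ((2 * L + 1) * (t - s))"
proof -
  define M where "M = 2 * L + 1"
  define w where "w x = c * exp (M * (x - s))" for x
  have M: "M > 0" "L \<le> M / 2" "1 \<le> M" using L by (auto simp: M_def)
  have d: "((\<lambda>x. y x - z x) has_vector_derivative y' x - z' x) (at x)" if "s \<le> x" "x \<le> t" for x
    using that y z by (intro has_vector_derivative_diff) auto
  have "norm (y t - z t) \<le> 2 * 2 * w t"
  proof (rule weighted_sup_bound[OF st, of _ w])
    show "continuous_on {s..t} (\<lambda>x. norm (y x - z x))"
      by (intro continuous_on_norm continuous_at_imp_continuous_on ballI has_vector_derivative_continuous[OF d]) auto
    show "continuous_on {s..t} w" unfolding w_def by (intro continuous_intros)
    fix H r assume H: "0 \<le> H" "\<And>x. x \<in> {s..t} \<Longrightarrow> norm (y x - z x) \<le> H * w x" and r: "r \<in> {s..t}"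
    have "norm ((y r - z r) - (y s - z s)) \<le> (H / 2 + 1) * w r - (H / 2 + 1) * w s"
    proof (rule norm_increment_le)
      show "((\<lambda>x. (H / 2 + 1) * w x) has_real_derivative (H / 2 + 1) * (M * w x)) (at x)" for x
        unfolding w_def by (auto intro!: derivative_eq_intros)
      fix x assume x: "s \<le> x" "x \<le> r"
      have wc: "c \<le> w x" using x M c by (simp add: w_def)
      have "norm (y' x - z' x) \<le> L * norm (y x - z x) + c" using le x r by auto
      also have "\<dots> \<le> M / 2 * (H * w x) + M * w x"
      proof (rule add_mono)
        show "L * norm (y x - z x) \<le> M / 2 * (H * w x)"
          using H(2)[of x] x r M L by (intro mult_mono) auto
        show "c \<le> M * w x" using wc M mult_right_mono[of 1 M "w x"] c by linarith
      qed
      finally show "norm (y' x - z' x) \<le> (H / 2 + 1) * (M * w x)" by (simp add: algebra_simps)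
    qed (use r d in auto)
    moreover have "w s = c" by (simp add: w_def)
    moreover have "norm (y r - z r) \<le> norm ((y r - z r) - (y s - z s)) + norm (y s - z s)"
      by (metis diff_add_cancel norm_triangle_ineq)
    moreover have "(H / 2 + 1) * w s \<ge> c" using H \<open>w s = c\<close> c by (simp add: algebra_simps)
    moreover have "w r > 0" using c by (simp add: w_def)
    ultimately show "norm (y r - z r) \<le> (2 + H / 2) * w r" using init by (simp add: algebra_simps)
  qed (use st c in \<open>auto simp: w_def\<close>)
  then show ?thesis by (simp add: w_def M_def)
qed

lemma ode_stability:
  fixes y z :: "real \<Rightarrow> 'a::real_normed_vector"
  assumes y: "\<And>x. (y has_vector_derivative y' x) (at x)"
    and z: "\<And>x. (z has_vector_derivative z' x) (at x)"
    and le: "\<And>x. x \<in> {min s t..max s t} \<Longrightarrow> norm (y' x - z' x) \<le> L * norm (y x - z x) + c"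
    and init: "norm (y s - z s) \<le> c" and L: "L \<ge> 0" and c: "c > 0"
  shows "norm (y t - z t) \<le> 4 * c * exp ((2 * L + 1) * \<bar>t - s\<bar>)"
proof (cases "s \<le> t")
  case True
  then show ?thesis using ode_stability_forward[OF True y z _ init L c] le by auto
next
  case False
  have m: "((\<lambda>x. g (- x)) has_vector_derivative - g' (- x)) (at x)"
    if "\<And>x. (g has_vector_derivative g' x) (at x)" for g :: "real \<Rightarrow> 'a" and g' x
    using vector_diff_chain_at[of uminus "-1" x g "g' (- x)"] that
      has_vector_derivative_minus[OF has_vector_derivative_id, of "at x"]
    by (auto simp: o_def)
  have "norm ((\<lambda>x. y (- x)) (- t) - (\<lambda>x. z (- x)) (- t)) \<le> 4 * c * exp ((2 * L + 1) * (- t - (- s)))"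
  proof (rule ode_stability_forward[OF _ m[OF y] m[OF z]])
    fix x assume "- s \<le> x" "x \<le> - t"
    then show "norm (- y' (- x) - - z' (- x)) \<le> L * norm (y (- x) - z (- x)) + c"
      using le[of "- x"] False by (simp add: norm_minus_commute)
  qed (use False init L c in auto)
  then show ?thesis using False by simp
qed

lemma ode_unique:
  fixes y z :: "real \<Rightarrow> 'a::real_normed_vector"
  assumes y: "\<And>t. (y has_vector_derivative f t (y t)) (at t)"
    and z: "\<And>t. (z has_vector_derivative f t (z t)) (at t)"
    and lip: "\<And>t u v. norm (f t u - f t v) \<le> L t * norm (u - v)" and L: "continuous_on UNIV (L :: real \<Rightarrow> real)"
    and eq: "y s = z s"
  shows "y t = z t"
proof -
  have "compact (L ` {min s t..max s t})"
    by (intro compact_continuous_image continuous_on_subset[OF L]) auto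
  then obtain B where B: "B > 0" "\<And>x. x \<in> {min s t..max s t} \<Longrightarrow> \<bar>L x\<bar> \<le> B"
    using bounded_pos[of "L ` {min s t..max s t}"] by (auto dest!: compact_imp_bounded)
  have "norm (y t - z t) \<le> 4 * c * exp ((2 * B + 1) * \<bar>t - s\<bar>)" if "c > 0" for c
  proof (rule ode_stability[OF y z])
    fix x assume "x \<in> {min s t..max s t}"
    then have "L x * norm (y x - z x) \<le> B * norm (y x - z x)"
      using B(2)[of x] by (intro mult_right_mono) auto
    then show "norm (f x (y x) - f x (z x)) \<le> B * norm (y x - z x) + c"
      using lip[of x "y x" "z x"] that by linarith
  qed (use B that eq in auto)
  then have "norm (y t - z t) \<le> 0 + e" if "e > 0" for e
    using that by (auto dest: meta_spec[of _ "e / (4 * exp ((2 * B + 1) * \<bar>t - s\<bar>))"])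
  then have "norm (y t - z t) \<le> 0" by (rule field_le_epsilon)
  then show ?thesis by simp
qed

text \<open>Every nearby trajectory is compared with the one fixed trajectory through
  \<open>u0\<close> at time \<open>s0\<close> for \<open>p0\<close>. The defect is then
  \<open>f p - f p0\<close> along that trajectory alone, which is a compact curve over a bounded
  time interval.\<close>

lemma ode_parameter_continuous:
  fixes f :: "'p::metric_space \<Rightarrow> real \<Rightarrow> 'a::real_normed_vector \<Rightarrow> 'a"
  assumes f: "continuous_on UNIV (\<lambda>(p, t, y). f p t y)" and L: "continuous_on UNIV (L :: real \<Rightarrow> real)"
    and lip: "\<And>p t u v. norm (f p t u - f p t v) \<le> L t * norm (u - v)"
    and init: "\<And>p s u. Y p s u s = u"
    and der: "\<And>p s u t. (Y p s u has_vector_derivative f p t (Y p s u t)) (at t)"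
  shows "continuous_on UNIV (\<lambda>(p, s, u, t). Y p s u t)"
proof -
  have "((\<lambda>(p, s, u, t). Y p s u t) \<longlongrightarrow> Y p0 s0 u0 t0) (at (p0, s0, u0, t0))" for p0 s0 u0 t0
  proof (rule tendstoI)
    fix e :: real assume e: "e > 0"
    define T where "T = max \<bar>s0\<bar> \<bar>t0\<bar> + 1"
    let ?y = "Y p0 s0 u0"
    have cy: "continuous_on A ?y" for A
      using der by (intro continuous_at_imp_continuous_on ballI has_vector_derivative_continuous)
    have "compact (L ` {-T..T})"
      by (intro compact_continuous_image continuous_on_subset[OF L]) auto
    then obtain B where B: "B > 0" "\<And>x. x \<in> {-T..T} \<Longrightarrow> \<bar>L x\<bar> \<le> B"
      using bounded_pos[of "L ` {-T..T}"] by (auto dest!: compact_imp_bounded)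
    define c where "c = e / 2 / (8 * exp ((2 * B + 1) * (2 * T)))"
    have c: "c > 0" using e by (simp add: c_def)
    have "continuous_on (UNIV \<times> {-T..T}) (\<lambda>(p, t). f p t (?y t))"
    proof -
      have "continuous_on (UNIV \<times> {-T..T}) (\<lambda>x :: 'p \<times> real. (fst x, snd x, ?y (snd x)))"
        by (intro continuous_intros continuous_on_compose2[OF cy[of UNIV]]) auto
      then show ?thesis
        using continuous_on_compose2[OF f, of "UNIV \<times> {-T..T}" "\<lambda>x. (fst x, snd x, ?y (snd x))"]
        by (simp add: case_prod_unfold)
    qed
    \<comment> \<open>Tube lemma: compactness of the time interval gives one neighbourhood of
      \<open>p0\<close> on which the defect is at most \<open>c\<close> for all its times
      simultaneously.\<close>
    then obtain X where X: "p0 \<in> X" "open X"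
        "\<forall>p\<in>X \<inter> UNIV. \<forall>t\<in>{-T..T}. dist (case (p, t) of (p, t) \<Rightarrow> f p t (?y t)) (case (p0, t) of (p, t) \<Rightarrow> f p t (?y t)) \<le> c"
      by (rule continuous_on_prod_compactE[where e = c]) (use c in auto)
    have fst0: "(fst \<longlongrightarrow> p0) (at (p0, s0, u0, t0))"
      using tendsto_fst[OF tendsto_ident_at[of "(p0, s0, u0, t0)" UNIV]] by simp
    have s0': "((\<lambda>x. fst (snd x)) \<longlongrightarrow> s0) (at (p0, s0, u0, t0))"
      using tendsto_fst[OF tendsto_snd[OF tendsto_ident_at[of "(p0, s0, u0, t0)" UNIV]]] by simp
    have u0': "((\<lambda>x. fst (snd (snd x))) \<longlongrightarrow> u0) (at (p0, s0, u0, t0))"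
      using tendsto_fst[OF tendsto_snd[OF tendsto_snd[OF tendsto_ident_at[of "(p0, s0, u0, t0)" UNIV]]]] by simp
    have t0': "((\<lambda>x. snd (snd (snd x))) \<longlongrightarrow> t0) (at (p0, s0, u0, t0))"
      using tendsto_snd[OF tendsto_snd[OF tendsto_snd[OF tendsto_ident_at[of "(p0, s0, u0, t0)" UNIV]]]] by simp
    have yi: "(?y \<longlongrightarrow> ?y x) (at x)" for x
      using cy[of UNIV] by (simp add: continuous_on_eq_continuous_at isCont_def)
    have ys: "((\<lambda>x. ?y (fst (snd x))) \<longlongrightarrow> u0) (at (p0, s0, u0, t0))"
      using isCont_tendsto_compose[OF _ s0', of ?y] yi[of s0] init[of p0 s0 u0] unfolding isCont_def by metis
    have yt: "((\<lambda>x. ?y (snd (snd (snd x)))) \<longlongrightarrow> ?y t0) (at (p0, s0, u0, t0))"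
      using isCont_tendsto_compose[OF _ t0', of ?y] yi[of t0] unfolding isCont_def by metis
    have ev: "\<forall>\<^sub>F x in at (p0, s0, u0, t0). fst x \<in> X"
      "\<forall>\<^sub>F x in at (p0, s0, u0, t0). dist (fst (snd x)) s0 < 1"
      "\<forall>\<^sub>F x in at (p0, s0, u0, t0). dist (snd (snd (snd x))) t0 < 1"
      "\<forall>\<^sub>F x in at (p0, s0, u0, t0). dist (fst (snd (snd x))) u0 < c / 2"
      "\<forall>\<^sub>F x in at (p0, s0, u0, t0). dist (?y (fst (snd x))) u0 < c / 2"
      "\<forall>\<^sub>F x in at (p0, s0, u0, t0). dist (?y (snd (snd (snd x)))) (?y t0) < e / 2"
      using topological_tendstoD[OF fst0 X(2,1)] tendstoD[OF s0', of 1] tendstoD[OF t0', of 1]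
        tendstoD[OF u0', of "c / 2"] tendstoD[OF ys, of "c / 2"] tendstoD[OF yt, of "e / 2"] c e by auto
    show "\<forall>\<^sub>F x in at (p0, s0, u0, t0). dist (case x of (p, s, u, t) \<Rightarrow> Y p s u t) (Y p0 s0 u0 t0) < e"
      using ev
    proof eventually_elim
      case (elim x)
      obtain p s u t where x: "x = (p, s, u, t)" by (cases x)
      have st: "s \<in> {-T..T}" "t \<in> {-T..T}"
        using elim unfolding x T_def by (auto simp: dist_real_def)
      have "norm (Y p s u t - ?y t) \<le> 4 * c * exp ((2 * B + 1) * \<bar>t - s\<bar>)"
      proof (rule ode_stability[OF der der])
        fix r assume r: "r \<in> {min s t..max s t}"
        then have rT: "r \<in> {-T..T}" using st by auto
        have "norm (f p r (Y p s u r) - f p0 r (?y r)) \<le>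
            norm (f p r (Y p s u r) - f p r (?y r)) + norm (f p r (?y r) - f p0 r (?y r))"
          by (metis diff_add_cancel diff_diff_eq2 norm_triangle_ineq add_diff_eq)
        also have "norm (f p r (Y p s u r) - f p r (?y r)) \<le> B * norm (Y p s u r - ?y r)"
          using lip[of p r "Y p s u r" "?y r"] B(2)[OF rT] abs_ge_self[of "L r"]
          by (meson mult_right_mono norm_ge_zero order_trans)
        also have "norm (f p r (?y r) - f p0 r (?y r)) \<le> c"
          using X(3) elim rT by (auto simp: x dist_norm)
        finally show "norm (f p r (Y p s u r) - f p0 r (?y r)) \<le> B * norm (Y p s u r - ?y r) + c" by simp
      next
        have "dist u (?y s) < c"
          using elim dist_triangle_half_r[of u0 u c "?y s"] by (simp add: x dist_commute)
        then show "norm (Y p s u s - ?y s) \<le> c" by (simp add: init dist_norm)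
      qed (use B c in auto)
      also have "\<dots> \<le> 4 * c * exp ((2 * B + 1) * (2 * T))"
        using st B c by (intro mult_left_mono iffD2[OF exp_le_cancel_iff]) auto
      also have "\<dots> < e / 2" using e by (simp add: c_def)
      finally have "dist (Y p s u t) (?y t) < e / 2" by (simp add: dist_norm)
      moreover have "dist (?y t) (?y t0) < e / 2" using elim by (simp add: x)
      ultimately have "dist (Y p s u t) (?y t0) < e"
        using dist_triangle[of "Y p s u t" "?y t0" "?y t"] by linarith
      then show ?case by (simp add: x)
    qed
  qed
  then show ?thesis
    unfolding continuous_on_def by (auto intro: tendsto_within_subset)
qed

text \<open>Hadamard's lemma: averaging the derivative over the segment gives an operator that
  reproduces the increment exactly, not only to first order.\<close>

lemma blinfun_mean_value:
  fixes g :: "'a::real_normed_vector \<Rightarrow> 'b::banach" and D :: "'a \<Rightarrow> 'a \<Rightarrow>\<^sub>L 'b"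
  assumes g: "\<And>y. (g has_derivative blinfun_apply (D y)) (at y)" and D: "continuous_on UNIV D"
  shows "g z - g y = blinfun_apply (integral {0..1} (\<lambda>\<theta>. D (y + \<theta> *\<^sub>R (z - y)))) (z - y)"
proof -
  have c: "continuous_on {0..1} (\<lambda>\<theta>. D (y + \<theta> *\<^sub>R (z - y)))"
    by (intro continuous_on_compose2[OF D] continuous_intros) auto
  have "((\<lambda>\<theta>. D (y + \<theta> *\<^sub>R (z - y)) (z - y)) has_integral g (y + 1 *\<^sub>R (z - y)) - g (y + 0 *\<^sub>R (z - y))) {0..1}"
  proof (rule fundamental_theorem_of_calculus)
    fix x :: real
    have "((\<lambda>\<theta>. g (y + \<theta> *\<^sub>R (z - y))) has_derivative (\<lambda>h. D (y + x *\<^sub>R (z - y)) (h *\<^sub>R (z - y)))) (at x within {0..1})"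
      by (rule has_derivative_compose[OF _ g]) (auto intro!: derivative_eq_intros)
    then show "((\<lambda>\<theta>. g (y + \<theta> *\<^sub>R (z - y))) has_vector_derivative D (y + x *\<^sub>R (z - y)) (z - y)) (at x within {0..1})"
      by (simp add: has_vector_derivative_def blinfun.scaleR_right)
  qed auto
  moreover have "((\<lambda>\<theta>. D (y + \<theta> *\<^sub>R (z - y)) (z - y)) has_integral
      blinfun_apply (integral {0..1} (\<lambda>\<theta>. D (y + \<theta> *\<^sub>R (z - y)))) (z - y)) {0..1}"
    using has_integral_linear[OF integrable_integral[OF integrable_continuous_real[OF c]]
        blinfun.bounded_linear_left[of "z - y"]] by (simp add: o_def)
  ultimately show ?thesis by (simp add: has_integral_unique)
qed

text \<open>The difference of two trajectories of \<open>y' = f t y\<close> solves a linear equation whose coefficient is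
  the Hadamard slope of \<open>f t\<close> between them; the resolvent of that equation is continuous in the two
  initial points, and its value on the diagonal is the derivative of the flow.\<close>

lemma ode_flow_has_derivative:
  fixes f :: "real \<Rightarrow> 'a::banach \<Rightarrow> 'a"
  assumes f: "\<And>t y. (f t has_derivative blinfun_apply (Df t y)) (at y)"
    and Df: "continuous_on UNIV (\<lambda>(t, y). Df t y)" and L: "continuous_on UNIV (L :: real \<Rightarrow> real)"
    and bd: "\<And>t y. norm (Df t y) \<le> L t"
    and init: "\<And>s u. Y s u s = u"
    and der: "\<And>s u t. (Y s u has_vector_derivative f t (Y s u t)) (at t)"
    and Y: "continuous_on UNIV (\<lambda>(s, u, t). Y s u t)"
  obtains J :: "real \<Rightarrow> real \<Rightarrow> 'a \<Rightarrow> 'a \<Rightarrow>\<^sub>L 'a" where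
    "continuous_on UNIV (\<lambda>(s, t, u). J s t u)"
    "\<And>s t u. ((\<lambda>u. Y s u t) has_derivative blinfun_apply (J s t u)) (at u)"
proof -
  define A where "A p t = (case p of (s, u, v) \<Rightarrow>
      integral (cbox 0 1) (\<lambda>\<theta>::real. Df t (Y s u t + \<theta> *\<^sub>R (Y s v t - Y s u t))))" for p t
  define F where "F p t \<Psi> = A p t o\<^sub>L \<Psi>" for p t and \<Psi> :: "'a \<Rightarrow>\<^sub>L 'a"
  note Dfc = continuous_on_compose_pair[OF Df] and Yc = continuous_on_compose_triple[OF Y]
  have A0: "continuous_on UNIV (\<lambda>(p, t). A p t)"
    unfolding A_def case_prod_unfold
    by (intro integral_continuous_on_param) (auto simp: case_prod_unfold intro!: Dfc Yc continuous_intros)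
  note Ac = continuous_on_compose_pair[OF A0]
  have Abd: "norm (A p t) \<le> L t" for p t
  proof -
    obtain s u v where p: "p = (s, u, v)" by (cases p)
    have "norm (A p t) \<le> L t * measure lborel (cbox 0 1 :: real set)"
      unfolding p A_def prod.case
      by (intro integrable_bound integrable_continuous Dfc continuous_intros order_trans[OF _ bd])
         (use bd order_trans[OF norm_ge_zero bd] in auto)
    then show ?thesis by simp
  qed
  have Fc: "continuous_on UNIV (\<lambda>(p, t, \<Psi>). F p t \<Psi>)"
    unfolding F_def case_prod_unfold
    by (intro bounded_bilinear.continuous_on[OF bounded_bilinear_blinfun_compose] Ac continuous_intros)
  have Flip: "norm (F p t U - F p t V) \<le> L t * norm (U - V)" for p t U V
  proof -
    have "F p t U - F p t V = A p t o\<^sub>L (U - V)"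
      by (simp add: F_def blinfun_eqI blinfun.diff_left blinfun.diff_right)
    then have "norm (F p t U - F p t V) \<le> norm (A p t) * norm (U - V)"
      by (simp add: norm_blinfun_compose)
    also have "\<dots> \<le> L t * norm (U - V)" by (intro mult_right_mono Abd) auto
    finally show ?thesis .
  qed
  have Fpc: "continuous_on UNIV (\<lambda>(t, \<Psi>). F p t \<Psi>)" for p
    using continuous_on_compose_triple[OF Fc continuous_on_const continuous_on_fst[OF continuous_on_id]
        continuous_on_snd[OF continuous_on_id]] by (simp add: case_prod_unfold)
  define \<Psi> where "\<Psi> p s U = (SOME \<Psi>. \<Psi> s = U \<and> (\<forall>t. (\<Psi> has_vector_derivative F p t (\<Psi> t)) (at t)))" for p s U
  have "\<Psi> p s U s = U \<and> (\<forall>t. (\<Psi> p s U has_vector_derivative F p t (\<Psi> p s U t)) (at t))" for p s U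
    unfolding \<Psi>_def by (rule someI_ex[OF picard_lindelof_global[OF Fpc L Flip]])
  then have \<Psi>: "\<And>p s U. \<Psi> p s U s = U"
    "\<And>p s U t. (\<Psi> p s U has_vector_derivative F p t (\<Psi> p s U t)) (at t)"
    by auto
  \<comment> \<open>The starting time and the two initial points enter the linear equation as the
    parameter \<open>p\<close>, so joint continuity of the resolvent is an instance of the theorem
    on parameters.\<close>
  have \<Psi>c: "continuous_on UNIV (\<lambda>(p, s, U, t). \<Psi> p s U t)"
    by (rule ode_parameter_continuous[OF Fc L Flip \<Psi>])
  define R where "R s t u v = \<Psi> (s, u, v) s id_blinfun t" for s t u v
  have Rc: "continuous_on UNIV (\<lambda>(s, t, u, v). R s t u v)"
  proof -
    have "continuous_on UNIV (\<lambda>x :: real \<times> real \<times> 'a \<times> 'a.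
        ((fst x, snd (snd x)), fst x, id_blinfun :: 'a \<Rightarrow>\<^sub>L 'a, fst (snd x)))"
      by (intro continuous_intros)
    from continuous_on_compose2[OF \<Psi>c this] show ?thesis by (simp add: R_def case_prod_unfold)
  qed
  have diff: "Y s v t - Y s u t = R s t u v (v - u)" for s t u v
  proof (rule ode_unique[where f = "\<lambda>t. blinfun_apply (A (s, u, v) t)" and s = s])
    fix t
    have Dt: "continuous_on UNIV (Df t)"
      by (intro Dfc continuous_intros)
    have "f t (Y s v t) - f t (Y s u t) = A (s, u, v) t (Y s v t - Y s u t)"
      using blinfun_mean_value[OF f Dt] by (simp add: A_def)
    then show "((\<lambda>t. Y s v t - Y s u t) has_vector_derivative A (s, u, v) t (Y s v t - Y s u t)) (at t)"
      using has_vector_derivative_diff[OF der[of s v t] der[of s u t]] by simp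
    show "((\<lambda>t. R s t u v (v - u)) has_vector_derivative A (s, u, v) t (R s t u v (v - u))) (at t)"
      using bounded_linear.has_vector_derivative[OF blinfun.bounded_linear_left \<Psi>(2)[of "(s, u, v)" s id_blinfun t], of "v - u"]
      by (simp add: R_def F_def)
    show "norm (A (s, u, v) t x - A (s, u, v) t y) \<le> L t * norm (x - y)" for x y
      using norm_blinfun[of "A (s, u, v) t" "x - y"] mult_right_mono[OF Abd[of "(s, u, v)" t], of "norm (x - y)"]
      by (simp add: blinfun.diff_right)
  qed (use L in \<open>auto simp: init R_def \<Psi>\<close>)
  define J where "J s t u = R s t u u" for s t u
  show thesis
  proof
    show "continuous_on UNIV (\<lambda>(s, t, u). J s t u)"
    proof -
      have "continuous_on UNIV (\<lambda>x :: real \<times> real \<times> 'a. (fst x, fst (snd x), snd (snd x), snd (snd x)))"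
        by (intro continuous_intros)
      from continuous_on_compose2[OF Rc this] show ?thesis by (simp add: J_def case_prod_unfold)
    qed
    fix s t u
    have "continuous_on UNIV (\<lambda>v. R s t u v)"
    proof -
      have "continuous_on UNIV (\<lambda>v. (s, t, u, v))"
        by (intro continuous_intros)
      from continuous_on_compose2[OF Rc this] show ?thesis by simp
    qed
    then have lim: "((\<lambda>v. R s t u v) \<longlongrightarrow> J s t u) (at u)"
      by (auto simp: J_def continuous_on_def)
    show "((\<lambda>u. Y s u t) has_derivative blinfun_apply (J s t u)) (at u)"
      unfolding has_derivative_iff_norm
    proof (intro conjI blinfun.bounded_linear_right)
      have "((\<lambda>v. norm (R s t u v - J s t u)) \<longlongrightarrow> 0) (at u)"
        using lim by (simp add: tendsto_norm_zero LIM_zero)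
      then show "((\<lambda>v. norm (Y s v t - Y s u t - J s t u (v - u)) / norm (v - u)) \<longlongrightarrow> 0) (at u)"
      proof (rule Lim_null_comparison[rotated], intro always_eventually allI)
        fix v
        have "norm (Y s v t - Y s u t - J s t u (v - u)) \<le> norm (R s t u v - J s t u) * norm (v - u)"
          unfolding diff using norm_blinfun[of "R s t u v - J s t u" "v - u"] by (simp add: blinfun.diff_left)
        then show "norm (norm (Y s v t - Y s u t - J s t u (v - u)) / norm (v - u)) \<le> norm (R s t u v - J s t u)"
          by (simp add: divide_le_eq)
      qed
    qed
  qed
qed

section \<open>Profile coordinates and the flow of a small field\<close>

text \<open>The hyperbolic rotation, that is, the flow of \<open>x' = v\<close>,
  \<open>v' = x\<close> generated by the repulsive potential alone.\<close>

definition lin :: "real \<Rightarrow> phase \<Rightarrow> phase" where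
  "lin t z = (cosh t *\<^sub>R fst z + sinh t *\<^sub>R snd z, sinh t *\<^sub>R fst z + cosh t *\<^sub>R snd z)"

definition force :: "real \<Rightarrow> (real \<Rightarrow> plane \<Rightarrow> plane) \<Rightarrow> real \<Rightarrow> phase \<Rightarrow> phase" where
  "force lam a t w = (let u = lam *\<^sub>R a t (fst (lin t w)) in (- sinh t *\<^sub>R u, cosh t *\<^sub>R u))"

text \<open>Transport along \<open>x'' = x + lam a t x\<close> is written for \<open>w = lin (- t) (x, x')\<close>, which moves
  with speed \<open>force lam a t w\<close>; \<open>uns\<close> and \<open>sta\<close> are its components along the unstable and the stable
  direction of the linear flow.\<close>

definition flow :: "real \<Rightarrow> (real \<Rightarrow> plane \<Rightarrow> plane) \<Rightarrow> real \<Rightarrow> phase \<Rightarrow> real \<Rightarrow> phase" where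
  "flow lam a s w = (SOME y. y s = w \<and> (\<forall>t. (y has_vector_derivative force lam a t (y t)) (at t)))"

definition uns :: "phase \<Rightarrow> plane" where "uns w = fst w + snd w"
definition sta :: "phase \<Rightarrow> plane" where "sta w = fst w - snd w"

text \<open>The smallness 1/36 leaves room in the stability estimates: it turns the perturbation of
  the velocity map into \<open>(2 + exp t) / 12\<close>, at most half of the linear expansion
  \<open>cosh t\<close>. Negative times carry no physical meaning; with \<open>\<bar>t\<bar>\<close>
  the field lives on the whole line and the differential equation has global solutions.\<close>

definition small_field :: "(real \<Rightarrow> plane \<Rightarrow> plane) \<Rightarrow> bool" where
  "small_field a \<longleftrightarrow> continuous_on UNIV (\<lambda>(t, x). a t x) \<and>
     (\<forall>t x. norm (a t x) \<le> exp (- \<bar>t\<bar>) / 36) \<and>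
     (\<forall>t x y. norm (a t x - a t y) \<le> exp (- \<bar>t\<bar>) / 36 * norm (x - y))"

lemma lin_zero [simp]: "lin 0 z = z"
  by (simp add: lin_def)

lemma lin_lin: "lin s (lin t z) = lin (s + t) z"
  by (simp add: lin_def cosh_add sinh_add algebra_simps)

lemma lin_inverse [simp]: "lin t (lin (- t) z) = z" "lin (- t) (lin t z) = z"
  by (simp_all add: lin_lin)

lemma bounded_linear_lin: "bounded_linear (lin t)"
  unfolding lin_def
  by (intro bounded_linear_Pair bounded_linear_add bounded_linear_const_scaleR bounded_linear_fst bounded_linear_snd)

lemma lin_add: "lin t (x + y) = lin t x + lin t y"
  and lin_diff: "lin t (x - y) = lin t x - lin t y"
  and lin_scaleR: "lin t (c *\<^sub>R x) = c *\<^sub>R lin t x"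
  using bounded_linear_lin[of t] by (simp_all add: linear_simps)

lemma continuous_on_lin [continuous_intros]:
  "continuous_on S f \<Longrightarrow> continuous_on S g \<Longrightarrow> continuous_on S (\<lambda>x. lin (f x) (g x))"
  unfolding lin_def by (intro continuous_intros)

lemma cosh_plus_abs_sinh: "cosh t + \<bar>sinh t\<bar> = exp \<bar>t\<bar>" for t :: real
  using cosh_plus_sinh[of t] cosh_plus_sinh[of "- t"] by (simp add: abs_if)

lemma norm_fst_le': "norm (fst z) \<le> norm z" and norm_snd_le': "norm (snd z) \<le> norm z"
  by (metis norm_fst_le prod.collapse, metis norm_snd_le prod.collapse)

lemma norm_lin_le: "norm (lin t z) \<le> 2 * exp \<bar>t\<bar> * norm z"
proof -
  have "norm (lin t z) \<le> norm (cosh t *\<^sub>R fst z + sinh t *\<^sub>R snd z) + norm (sinh t *\<^sub>R fst z + cosh t *\<^sub>R snd z)"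
    unfolding lin_def by (rule norm_Pair_le)
  also have "\<dots> \<le> (cosh t * norm (fst z) + \<bar>sinh t\<bar> * norm (snd z)) + (\<bar>sinh t\<bar> * norm (fst z) + cosh t * norm (snd z))"
    by (intro add_mono norm_triangle_le) auto
  also have "\<dots> = (cosh t + \<bar>sinh t\<bar>) * (norm (fst z) + norm (snd z))" by (simp add: algebra_simps)
  also have "\<dots> \<le> exp \<bar>t\<bar> * (norm z + norm z)"
    unfolding cosh_plus_abs_sinh by (intro mult_left_mono add_mono norm_fst_le' norm_snd_le') auto
  finally show ?thesis by simp
qed

lemma fst_lin_eq: "fst (lin t w) = (1 / 2) *\<^sub>R (exp t *\<^sub>R uns w + exp (- t) *\<^sub>R sta w)"
  and snd_lin_eq: "snd (lin t w) = (1 / 2) *\<^sub>R (exp t *\<^sub>R uns w - exp (- t) *\<^sub>R sta w)"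
  by (simp_all add: lin_def uns_def sta_def cosh_def sinh_def algebra_simps add_divide_distrib diff_divide_distrib flip: scaleR_add_left)

lemma uns_lin: "uns (lin t w) = exp t *\<^sub>R uns w" and sta_lin: "sta (lin t w) = exp (- t) *\<^sub>R sta w"
  unfolding uns_def[of "lin t w"] sta_def[of "lin t w"] fst_lin_eq snd_lin_eq
  by (simp_all add: algebra_simps flip: scaleR_add_left)

lemma uns_diff: "uns (x - y) = uns x - uns y" and sta_diff: "sta (x - y) = sta x - sta y"
  by (simp_all add: uns_def sta_def)

lemma phase_eq_uns_sta: "w = ((1 / 2) *\<^sub>R (uns w + sta w), (1 / 2) *\<^sub>R (uns w - sta w))"
  by (cases w) (simp add: uns_def sta_def scaleR_half_double)

lemma norm_le_uns_sta: "norm w \<le> norm (uns w) + norm (sta w)"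
proof -
  have "norm w \<le> norm ((1 / 2) *\<^sub>R (uns w + sta w)) + norm ((1 / 2) *\<^sub>R (uns w - sta w))"
    by (subst phase_eq_uns_sta) (rule norm_Pair_le)
  then show ?thesis
    using norm_triangle_ineq[of "uns w" "sta w"] norm_triangle_ineq4[of "uns w" "sta w"] by simp
qed

lemma norm_uns_le: "norm (uns w) \<le> 2 * norm w" and norm_sta_le: "norm (sta w) \<le> 2 * norm w"
  using norm_triangle_ineq[of "fst w" "snd w"] norm_triangle_ineq4[of "fst w" "snd w"]
    norm_fst_le'[of w] norm_snd_le'[of w] by (simp_all add: uns_def sta_def)

text \<open>In physical coordinates the force is a pure change of velocity; the identity
  \<open>cosh\<^sup>2 - sinh\<^sup>2 = 1\<close> undoes the conjugation.\<close>

lemma force_lin: "lin t (force lam a t w) = (0, lam *\<^sub>R a t (fst (lin t w)))"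
proof -
  have l: "lin t (- sinh t *\<^sub>R u, cosh t *\<^sub>R u) = (0, ((cosh t)\<^sup>2 - (sinh t)\<^sup>2) *\<^sub>R u)" for u
    by (simp add: lin_def power2_eq_square scaleR_diff_left mult.commute)
  show ?thesis unfolding force_def Let_def l hyperbolic_pythagoras by simp
qed

text \<open>The two weights decide the dynamics: against a field of size \<open>exp (- t)\<close>
  the unstable component has speed \<open>exp (- 2 * t)\<close>, which is integrable, while the
  stable one has bounded speed.\<close>

lemma uns_force: "uns (force lam a t w) = (lam * exp (- t)) *\<^sub>R a t (fst (lin t w))"
  and sta_force: "sta (force lam a t w) = - ((lam * exp t) *\<^sub>R a t (fst (lin t w)))"
  unfolding cosh_minus_sinh[symmetric] cosh_plus_sinh[symmetric] 
  by (simp_all add: uns_def sta_def force_def Let_def algebra_simps)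

section \<open>Trajectories of a small field and their stability\<close>

locale coupling =
  fixes lam :: real
  assumes lam: "lam \<in> {-1, 1}"
begin

lemma abs_lam [simp]: "\<bar>lam\<bar> = 1"
  using lam by auto

lemma norm_force: "norm (force lam a t w) \<le> exp \<bar>t\<bar> * norm (a t (fst (lin t w)))"
proof -
  have "norm (force lam a t w) \<le> \<bar>sinh t\<bar> * norm (a t (fst (lin t w))) + cosh t * norm (a t (fst (lin t w)))"
    unfolding force_def Let_def by (rule order_trans[OF norm_Pair_le]) (simp add: abs_mult)
  also have "\<dots> = exp \<bar>t\<bar> * norm (a t (fst (lin t w)))"
    using cosh_plus_abs_sinh[of t] by (simp flip: distrib_right)
  finally show ?thesis .
qed

lemma norm_force_diff:
  "norm (force lam a t w - force lam b t z) \<le> exp \<bar>t\<bar> * norm (a t (fst (lin t w)) - b t (fst (lin t z)))"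
proof -
  have "force lam a t w - force lam b t z = force lam (\<lambda>_ _. a t (fst (lin t w)) - b t (fst (lin t z))) t 0"
    by (simp add: force_def Let_def algebra_simps)
  then show ?thesis using norm_force[of "\<lambda>_ _. a t (fst (lin t w)) - b t (fst (lin t z))" t 0] by simp
qed

lemma force_lipschitz:
  assumes "small_field a"
  shows "norm (force lam a t w - force lam a t z) \<le> exp \<bar>t\<bar> * norm (w - z)"
proof -
  have "norm (force lam a t w - force lam a t z) \<le> exp \<bar>t\<bar> * (exp (- \<bar>t\<bar>) / 36 * norm (fst (lin t w) - fst (lin t z)))"
    using assms by (intro order_trans[OF norm_force_diff] mult_left_mono) (auto simp: small_field_def)
  also have "\<dots> = norm (fst (lin t (w - z))) / 36"
    by (simp add: lin_diff exp_minus)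
  also have "\<dots> \<le> 2 * exp \<bar>t\<bar> * norm (w - z) / 36"
    using norm_fst_le'[of "lin t (w - z)"] norm_lin_le[of t "w - z"] by linarith
  also have "\<dots> \<le> exp \<bar>t\<bar> * norm (w - z)" by simp
  finally show ?thesis .
qed

lemma continuous_force:
  assumes "continuous_on UNIV (\<lambda>(t, x). a t x)"
  shows "continuous_on UNIV (\<lambda>(t, w). force lam a t w)"
proof -
  note c = continuous_on_compose_pair[OF assms]
  show ?thesis
    unfolding force_def Let_def case_prod_unfold by (intro continuous_intros c)
qed

lemma small_field_flow:
  assumes a: "small_field a"
  shows flow_init: "flow lam a s w s = w"
    and flow_deriv: "(flow lam a s w has_vector_derivative force lam a t (flow lam a s w t)) (at t)"
proof -
  have "\<exists>y. y s = w \<and> (\<forall>t. (y has_vector_derivative force lam a t (y t)) (at t))"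
    using a by (intro picard_lindelof_global[where L = "\<lambda>t. exp \<bar>t\<bar>"] force_lipschitz continuous_force)
      (auto simp: small_field_def intro!: continuous_intros)
  then have "flow lam a s w s = w \<and> (\<forall>t. (flow lam a s w has_vector_derivative force lam a t (flow lam a s w t)) (at t))"
    unfolding flow_def by (rule someI_ex)
  then show "flow lam a s w s = w" "(flow lam a s w has_vector_derivative force lam a t (flow lam a s w t)) (at t)"
    by auto
qed

lemma flow_unique:
  assumes a: "small_field a" and y: "\<And>t. (y has_vector_derivative force lam a t (y t)) (at t)" and s: "y s = w"
  shows "y t = flow lam a s w t"
  by (rule ode_unique[OF y flow_deriv[OF a] force_lipschitz[OF a], where s = s])
     (auto intro!: continuous_intros simp: s flow_init[OF a])

lemma flow_flow:
  assumes a: "small_field a"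
  shows "flow lam a t (flow lam a s w t) r = flow lam a s w r"
  by (rule flow_unique[OF a flow_deriv[OF a] refl, symmetric])

lemma continuous_flow:
  assumes a: "small_field a"
  shows "continuous_on UNIV (\<lambda>(s, w, t). flow lam a s w t)"
proof -
  have "continuous_on UNIV (\<lambda>(t, w). force lam a t w)"
    using a by (intro continuous_force) (auto simp: small_field_def)
  then have "continuous_on UNIV (\<lambda>(p :: real, t, w). force lam a t w)"
    unfolding case_prod_unfold by (intro continuous_on_compose_pair[where f = "force lam a"] continuous_intros)
      (simp add: case_prod_unfold)
  then have "continuous_on UNIV (\<lambda>(p :: real, s, w, t). flow lam a s w t)"
    by (rule ode_parameter_continuous[where L = "\<lambda>t. exp \<bar>t\<bar>"])
       (auto intro!: continuous_intros force_lipschitz a flow_init flow_deriv)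
  moreover have "continuous_on UNIV (\<lambda>x :: real \<times> phase \<times> real. (0 :: real, x))"
    by (intro continuous_intros)
  ultimately show ?thesis
    by (drule_tac continuous_on_compose2) (auto simp: case_prod_unfold)
qed

lemma uns_deriv:
  assumes "(y has_vector_derivative force lam a t (y t)) (at t)"
  shows "((\<lambda>t. uns (y t)) has_vector_derivative (lam * exp (- t)) *\<^sub>R a t (fst (lin t (y t)))) (at t)"
  using bounded_linear.has_vector_derivative[OF bounded_linear_add[OF bounded_linear_fst bounded_linear_snd] assms]
  by (simp flip: uns_def add: uns_force)

lemma sta_deriv:
  assumes "(y has_vector_derivative force lam a t (y t)) (at t)"
  shows "((\<lambda>t. sta (y t)) has_vector_derivative - ((lam * exp t) *\<^sub>R a t (fst (lin t (y t))))) (at t)"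
  using bounded_linear.has_vector_derivative[OF bounded_linear_sub[OF bounded_linear_fst bounded_linear_snd] assms]
  by (simp flip: sta_def add: sta_force)

lemma two_field_diff_le:
  assumes "small_field a" "t \<ge> 0" "\<And>x. norm (a t x - b t x) \<le> g"
  shows "norm (a t x - b t y) \<le> exp (- t) / 36 * norm (x - y) + g"
proof -
  have "norm (a t x - b t y) \<le> norm (a t x - a t y) + norm (a t y - b t y)"
    using norm_triangle_ineq[of "a t x - a t y" "a t y - b t y"] by simp
  also have "norm (a t x - a t y) \<le> exp (- t) / 36 * norm (x - y)"
    using assms(1) \<open>t \<ge> 0\<close> unfolding small_field_def by (metis abs_of_nonneg)
  finally show ?thesis using assms(3)[of y] by simp
qed

text \<open>Only the position difference \<open>d\<close> enters the force. If \<open>d\<close> is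
  of order \<open>exp r\<close>, the Lipschitz constant \<open>exp (- r) / 36\<close> makes the
  field difference bounded; then the unstable difference is bounded and the stable one of order
  \<open>exp r\<close>, which returns \<open>d\<close> of order \<open>exp r\<close> with a smaller
  constant.\<close>

lemma position_forward_stability:
  assumes a: "small_field a" and t: "t \<ge> 0"
    and y: "\<And>t. (y has_vector_derivative force lam a t (y t)) (at t)"
    and z: "\<And>t. (z has_vector_derivative force lam b t (z t)) (at t)"
    and init: "y 0 = z 0"
    and ab: "\<And>r x. 0 \<le> r \<Longrightarrow> r \<le> t \<Longrightarrow> norm (a r x - b r x) \<le> g"
  shows "norm (fst (lin t (y t)) - fst (lin t (z t))) \<le> 2 * g * exp t"
proof -
  define d where "d r = fst (lin r (y r)) - fst (lin r (z r))" for r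
  define f where "f r = a r (fst (lin r (y r))) - b r (fst (lin r (z r)))" for r
  let ?U = "\<lambda>r. uns (y r) - uns (z r)" and ?S = "\<lambda>r. sta (y r) - sta (z r)"
  have g0: "g \<ge> 0" using ab[of 0 0] t norm_ge_zero order_trans by blast
  have dU: "(?U has_vector_derivative (lam * exp (- r)) *\<^sub>R f r) (at r)" for r
    using has_vector_derivative_diff[OF uns_deriv[OF y] uns_deriv[OF z]] by (simp add: f_def algebra_simps)
  have dS: "(?S has_vector_derivative - ((lam * exp r) *\<^sub>R f r)) (at r)" for r
    using has_vector_derivative_diff[OF sta_deriv[OF y] sta_deriv[OF z]] by (simp add: f_def algebra_simps)
  have d_eq: "d r = (1 / 2) *\<^sub>R (exp r *\<^sub>R ?U r + exp (- r) *\<^sub>R ?S r)" for r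
    by (simp add: d_def fst_lin_eq algebra_simps)
  \<comment> \<open>The weight of the bootstrap has to be positive even when the fields agree and
    \<open>g = 0\<close>, so the estimate is made for \<open>h > g\<close> and \<open>h\<close> is
    then sent to \<open>g\<close>.\<close>
  have main: "norm (d t) \<le> 2 * h * exp t" if h: "h > g" for h
  proof -
    have "norm (d t) \<le> 2 * 1 * (h * exp t)"
    proof (rule weighted_sup_bound[OF t, where w = "\<lambda>r. h * exp r"])
      show "continuous_on {0..t} (\<lambda>r. norm (d r))"
      proof -
        have "continuous_on {0..t} y" "continuous_on {0..t} z"
          by (intro continuous_at_imp_continuous_on ballI has_vector_derivative_continuous[OF y]
              has_vector_derivative_continuous[OF z])+
        then show ?thesis unfolding d_def by (intro continuous_intros)
      qed
      fix H r assume H: "0 \<le> H" "\<And>r. r \<in> {0..t} \<Longrightarrow> norm (d r) \<le> H * (h * exp r)" and r: "r \<in> {0..t}"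
      have fle: "norm (f x) \<le> (H / 36 + 1) * h" if x: "0 \<le> x" "x \<le> r" for x
      proof -
        have "norm (f x) \<le> exp (- x) / 36 * norm (d x) + g"
          unfolding f_def d_def by (rule two_field_diff_le[OF a x(1)]) (use ab x r in auto)
        also have "\<dots> \<le> exp (- x) / 36 * (H * (h * exp x)) + h"
          using H(2)[of x] x r h by (intro add_mono mult_left_mono) auto
        also have "\<dots> = (H / 36 + 1) * h" by (simp add: exp_minus field_simps)
        finally show ?thesis .
      qed
      define P where "P x = - (H / 36 + 1) * h * exp (r - x)" for x
      have dP: "(P has_real_derivative exp (r - x) * ((H / 36 + 1) * h)) (at x)" for x
        unfolding P_def by (auto intro!: derivative_eq_intros simp: algebra_simps)
      have PP: "P r - P 0 \<le> (H / 36 + 1) * h * exp r" 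
      proof -
        have "0 \<le> (H / 36 + 1) * h" using h g0 H by simp
        then show ?thesis unfolding P_def by (simp add: algebra_simps)
      qed
      have "norm (exp r *\<^sub>R ?U r - exp r *\<^sub>R ?U 0) \<le> P r - P 0"
      proof (rule norm_increment_le[OF _ _ dP])
        show "((\<lambda>x. exp r *\<^sub>R ?U x) has_vector_derivative exp r *\<^sub>R ((lam * exp (- x)) *\<^sub>R f x)) (at x)" for x
          using has_vector_derivative_scaleR[OF DERIV_const dU] by simp
        fix x assume x: "0 \<le> x" "x \<le> r"
        have "norm (exp r *\<^sub>R ((lam * exp (- x)) *\<^sub>R f x)) = exp (r - x) * norm (f x)"
          by (simp add: abs_mult exp_diff exp_minus field_simps)
        also have "\<dots> \<le> exp (r - x) * ((H / 36 + 1) * h)"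
          using fle[OF x] by (intro mult_left_mono) auto
        finally show "norm (exp r *\<^sub>R ((lam * exp (- x)) *\<^sub>R f x)) \<le> exp (r - x) * ((H / 36 + 1) * h)" .
      qed (use r in auto)
      then have U: "norm (exp r *\<^sub>R ?U r) \<le> (H / 36 + 1) * h * exp r"
        unfolding init diff_self scaleR_zero_right diff_zero using PP by (rule order_trans)
      have "norm (exp (- r) *\<^sub>R ?S r - exp (- r) *\<^sub>R ?S 0) \<le> P r - P 0"
      proof (rule norm_increment_le[OF _ _ dP])
        show "((\<lambda>x. exp (- r) *\<^sub>R ?S x) has_vector_derivative exp (- r) *\<^sub>R - ((lam * exp x) *\<^sub>R f x)) (at x)" for x
          using has_vector_derivative_scaleR[OF DERIV_const dS] by simp
        fix x assume x: "0 \<le> x" "x \<le> r"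
        have "norm (exp (- r) *\<^sub>R - ((lam * exp x) *\<^sub>R f x)) = exp (x - r) * norm (f x)"
          by (simp add: abs_mult exp_diff exp_minus field_simps)
        also have "\<dots> \<le> exp (r - x) * ((H / 36 + 1) * h)"
          using fle[OF x] x by (intro mult_mono) auto
        finally show "norm (exp (- r) *\<^sub>R - ((lam * exp x) *\<^sub>R f x)) \<le> exp (r - x) * ((H / 36 + 1) * h)" .
      qed (use r in auto)
      then have S: "norm (exp (- r) *\<^sub>R ?S r) \<le> (H / 36 + 1) * h * exp r"
        unfolding init diff_self scaleR_zero_right diff_zero using PP by (rule order_trans)
      have "norm (d r) \<le> (norm (exp r *\<^sub>R ?U r) + norm (exp (- r) *\<^sub>R ?S r)) / 2"
        unfolding d_eq using norm_triangle_ineq[of "exp r *\<^sub>R ?U r" "exp (- r) *\<^sub>R ?S r"] by simp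
      also have "\<dots> \<le> (H / 36 + 1) * h * exp r"
      proof -
        have "(p + q) / 2 \<le> c" if "p \<le> c" "q \<le> c" for p q c :: real using that by simp
        then show ?thesis using U S by blast
      qed
      also have "\<dots> \<le> (H / 2 + 1) * (h * exp r)"
        using H(1) h g0 by (simp add: mult_right_mono flip: mult.assoc)
      finally show "norm (d r) \<le> (1 + H / 2) * (h * exp r)" by (simp add: add.commute)
    qed (use h g0 t in \<open>auto intro!: continuous_intros\<close>)
    then show ?thesis by simp
  qed
  have "norm (d t) \<le> 2 * g * exp t"
  proof (rule field_le_epsilon)
    fix e :: real assume "e > 0"
    then have "norm (d t) \<le> 2 * (g + e / (2 * exp t)) * exp t" by (intro main) simp
    also have "\<dots> = 2 * g * exp t + e" by (simp add: field_simps)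
    finally show "norm (d t) \<le> 2 * g * exp t + e" .
  qed
  then show ?thesis by (simp add: d_def)
qed

text \<open>Followed back from time \<open>t\<close>, the stable difference dominates. The changes
  of the two components are bounded rather than the components, because the expansion of the
  velocity map needs a lower bound: the values of the free evolution are known exactly, and the
  changes are small against them.\<close>

lemma profile_backward_stability:
  assumes a: "small_field a" and t: "t \<ge> 0"
    and y: "\<And>t. (y has_vector_derivative force lam a t (y t)) (at t)"
    and z: "\<And>t. (z has_vector_derivative force lam b t (z t)) (at t)"
    and A: "exp t * norm (uns (y t) - uns (z t)) \<le> A" and B: "exp (- t) * norm (sta (y t) - sta (z t)) \<le> B"
    and ab: "\<And>r x. 0 \<le> r \<Longrightarrow> r \<le> t \<Longrightarrow> norm (a r x - b r x) \<le> g"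
  shows "norm ((uns (y t) - uns (z t)) - (uns (y 0) - uns (z 0))) \<le> (2 * A + exp t * (B + g)) / 12 + g * exp t"
      (is "norm (?U t - ?U 0) \<le> ?C g")
    and "norm ((sta (y t) - sta (z t)) - (sta (y 0) - sta (z 0))) \<le> (2 * A + exp t * (B + g)) / 12 + g * exp t"
      (is "norm (?S t - ?S 0) \<le> _")
proof -
  define d where "d r = fst (lin r (y r)) - fst (lin r (z r))" for r
  define f where "f r = a r (fst (lin r (y r))) - b r (fst (lin r (z r)))" for r
  have A0: "A \<ge> 0" and B0: "B \<ge> 0" 
    using A B by (auto intro: order_trans[rotated])
  have g0: "g \<ge> 0" using ab[of 0 0] t norm_ge_zero order_trans by blast
  have dU: "(?U has_vector_derivative (lam * exp (- r)) *\<^sub>R f r) (at r)" for r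
    using has_vector_derivative_diff[OF uns_deriv[OF y] uns_deriv[OF z]] by (simp add: f_def algebra_simps)
  have dS: "(?S has_vector_derivative - ((lam * exp r) *\<^sub>R f r)) (at r)" for r
    using has_vector_derivative_diff[OF sta_deriv[OF y] sta_deriv[OF z]] by (simp add: f_def algebra_simps)
  have d_eq: "d r = (1 / 2) *\<^sub>R (exp r *\<^sub>R ?U r + exp (- r) *\<^sub>R ?S r)" for r
    by (simp add: d_def fst_lin_eq algebra_simps)
  have main: "norm (?U t - ?U 0) \<le> ?C h \<and> norm (?S t - ?S 0) \<le> ?C h" if h: "h > g" for h
  proof -
    \<comment> \<open>The free evolution of the final data: \<open>exp (r - t) * A\<close> from the
      unstable component and \<open>exp (t - r) * B\<close> from the stable one, with
      \<open>h\<close> for the field difference. The term \<open>exp (- r) * A\<close> is what the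
      first one produces in the stable component through the force.\<close>
    define w where "w r = exp (r - t) * A + exp (- r) * A + exp (t - r) * (B + h)" for r
    have wpos: "w r > 0" for r
      using A0 B0 g0 h unfolding w_def by (intro add_nonneg_pos add_nonneg_nonneg mult_nonneg_nonneg mult_pos_pos) auto
    have fle: "norm (f r) \<le> exp (- r) / 36 * norm (d r) + h" if "0 \<le> r" "r \<le> t" for r
    proof -
      have "norm (f r) \<le> exp (- r) / 36 * norm (d r) + g"
        unfolding f_def d_def by (rule two_field_diff_le[OF a that(1)]) (use ab that in auto)
      then show ?thesis using h by simp
    qed
    have inc: "exp r * norm (?U t - ?U r) \<le> H / 18 * w r + exp (t - r) * h"
        "exp (- r) * norm (?S t - ?S r) \<le> H / 18 * w r + exp (t - r) * h"
        "r = 0 \<Longrightarrow> norm (?U t - ?U 0) \<le> H / 36 * (2 * A + exp t * (B + h)) + exp t * h"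
        "r = 0 \<Longrightarrow> norm (?S t - ?S 0) \<le> H / 36 * (2 * A + exp t * (B + h)) + exp t * h"
      if H: "0 \<le> H" "\<And>r. r \<in> {0..t} \<Longrightarrow> norm (d r) \<le> H * w r" and r: "r \<in> {0..t}" for H r
    proof -
      define W where "W x = A * exp (x - t) - A * exp (- x) - (B + h) * exp (t - x)" for x
      define P where "P x = exp (- r) * H / 36 * W x + exp (x - r) * h" for x
      have dP: "(P has_real_derivative exp (x - r) * (exp (- x) / 36 * (H * w x) + h)) (at x)" for x
        unfolding P_def W_def w_def
        by (auto intro!: derivative_eq_intros simp: exp_minus exp_diff field_simps)
      have le: "norm (f x) \<le> exp (- x) / 36 * (H * w x) + h" if "r \<le> x" "x \<le> t" for x
        using H(2)[of x] that r by (intro order_trans[OF fle] add_right_mono mult_left_mono) auto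
      have U: "exp r * norm (?U t - ?U r) \<le> P t - P r"
      proof -
        have "norm (exp r *\<^sub>R ?U t - exp r *\<^sub>R ?U r) \<le> P t - P r"
        proof (rule norm_increment_le[OF _ _ dP])
          show "((\<lambda>x. exp r *\<^sub>R ?U x) has_vector_derivative exp r *\<^sub>R ((lam * exp (- x)) *\<^sub>R f x)) (at x)" for x
            using has_vector_derivative_scaleR[OF DERIV_const dU] by simp
          fix x assume x: "r \<le> x" "x \<le> t"
          have "norm (exp r *\<^sub>R ((lam * exp (- x)) *\<^sub>R f x)) = exp (r - x) * norm (f x)"
            by (simp add: abs_mult exp_diff exp_minus field_simps)
          also have "\<dots> \<le> exp (x - r) * (exp (- x) / 36 * (H * w x) + h)"
            using x le[OF x] by (intro mult_mono) auto
          finally show "norm (exp r *\<^sub>R ((lam * exp (- x)) *\<^sub>R f x)) \<le> exp (x - r) * (exp (- x) / 36 * (H * w x) + h)" .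
        qed (use r in auto)
        then show ?thesis by (simp flip: scaleR_diff_right)
      qed
      have S: "exp (- r) * norm (?S t - ?S r) \<le> P t - P r"
      proof -
        have "norm (exp (- r) *\<^sub>R ?S t - exp (- r) *\<^sub>R ?S r) \<le> P t - P r"
        proof (rule norm_increment_le[OF _ _ dP])
          show "((\<lambda>x. exp (- r) *\<^sub>R ?S x) has_vector_derivative exp (- r) *\<^sub>R - ((lam * exp x) *\<^sub>R f x)) (at x)" for x
            using has_vector_derivative_scaleR[OF DERIV_const dS] by simp
          fix x assume x: "r \<le> x" "x \<le> t"
          have "norm (exp (- r) *\<^sub>R - ((lam * exp x) *\<^sub>R f x)) = exp (x - r) * norm (f x)"
            by (simp add: abs_mult exp_diff exp_minus field_simps)
          also have "\<dots> \<le> exp (x - r) * (exp (- x) / 36 * (H * w x) + h)"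
            using le[OF x] by (intro mult_left_mono) auto
          finally show "norm (exp (- r) *\<^sub>R - ((lam * exp x) *\<^sub>R f x)) \<le> exp (x - r) * (exp (- x) / 36 * (H * w x) + h)" .
        qed (use r in auto)
        then show ?thesis by (simp flip: scaleR_diff_right)
      qed
      have W: "W t - W r \<le> A + A * exp (- r) + (B + h) * exp (t - r)"
        using A0 B0 h g0 by (simp add: W_def) (smt (verit) exp_ge_zero mult_nonneg_nonneg)
      have "exp (- r) * (W t - W r) \<le> exp (- r) * A + 1 * (A * exp (- r) + (B + h) * exp (t - r))"
        using mult_left_mono[OF W, of "exp (- r)"] r A0 B0 h g0
          mult_right_mono[of "exp (- r)" 1 "A * exp (- r) + (B + h) * exp (t - r)"] by (simp add: algebra_simps)
      also have "\<dots> \<le> 2 * w r"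
        using A0 B0 h g0 by (simp add: w_def algebra_simps)
      finally have "H / 36 * (exp (- r) * (W t - W r)) \<le> H / 36 * (2 * w r)"
        by (rule mult_left_mono) (use H in auto)
      moreover have Peq: "P t - P r = H / 36 * (exp (- r) * (W t - W r)) + (exp (t - r) - 1) * h"
        by (simp add: P_def algebra_simps add_divide_distrib diff_divide_distrib)
      moreover have "(exp (t - r) - 1) * h \<le> exp (t - r) * h" using h g0 by (simp add: algebra_simps)
      ultimately have P: "P t - P r \<le> H / 18 * w r + exp (t - r) * h" by simp
      show "exp r * norm (?U t - ?U r) \<le> H / 18 * w r + exp (t - r) * h"
        "exp (- r) * norm (?S t - ?S r) \<le> H / 18 * w r + exp (t - r) * h"
        using U S P by auto
      assume r0: "r = 0"
      have "H / 36 * (W t - W 0) \<le> H / 36 * (2 * A + exp t * (B + h))"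
        using W H by (intro mult_left_mono) (auto simp: r0 algebra_simps)
      then have "P t - P 0 \<le> H / 36 * (2 * A + exp t * (B + h)) + exp t * h"
      proof -
        have "P t - P 0 = H / 36 * (W t - W 0) + (exp t - 1) * h" using Peq by (simp add: r0)
        moreover have "(exp t - 1) * h \<le> exp t * h" using h g0 by (simp add: algebra_simps)
        ultimately show ?thesis
          using \<open>H / 36 * (W t - W 0) \<le> H / 36 * (2 * A + exp t * (B + h))\<close> by linarith
      qed
      then show "norm (?U t - ?U 0) \<le> H / 36 * (2 * A + exp t * (B + h)) + exp t * h"
        "norm (?S t - ?S 0) \<le> H / 36 * (2 * A + exp t * (B + h)) + exp t * h"
        using U S by (auto simp: r0)
    qed
    have sup: "norm (d r) \<le> 2 * (3 / 2) * w r" if "r \<in> {0..t}" for r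
    proof (rule weighted_sup_bound[OF t _ _ _ _ _ that])
      show "continuous_on {0..t} (\<lambda>r. norm (d r))"
      proof -
        have "continuous_on {0..t} y" "continuous_on {0..t} z"
          by (intro continuous_at_imp_continuous_on ballI has_vector_derivative_continuous[OF y]
              has_vector_derivative_continuous[OF z])+
        then show ?thesis unfolding d_def by (intro continuous_intros)
      qed
      show "continuous_on {0..t} w" unfolding w_def by (intro continuous_intros)
      fix H r assume H: "0 \<le> H" "\<And>r. r \<in> {0..t} \<Longrightarrow> norm (d r) \<le> H * w r" and r: "r \<in> {0..t}"
      have "norm (d r) \<le> (exp r * norm (?U r) + exp (- r) * norm (?S r)) / 2"
        unfolding d_eq norm_scaleR using norm_triangle_ineq[of "exp r *\<^sub>R ?U r" "exp (- r) *\<^sub>R ?S r"] by simp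
      also have "exp r * norm (?U r) \<le> exp r * (norm (?U t) + norm (?U t - ?U r))"
        by (intro mult_left_mono) (metis norm_minus_commute norm_triangle_sub, simp)
      also have "\<dots> \<le> exp (r - t) * A + (H / 18 * w r + exp (t - r) * h)"
        using inc(1)[OF H r] mult_left_mono[OF A, of "exp (r - t)"] by (simp add: algebra_simps exp_diff)
      also have "exp (- r) * norm (?S r) \<le> exp (- r) * (norm (?S t) + norm (?S t - ?S r))"
        by (intro mult_left_mono) (metis norm_minus_commute norm_triangle_sub, simp)
      also have "\<dots> \<le> exp (t - r) * B + (H / 18 * w r + exp (t - r) * h)"
      proof -
        have "exp (t - r) * (exp (- t) * norm (?S t)) = exp (- r) * norm (?S t)"
          by (simp flip: mult.assoc exp_add)
        moreover have "exp (t - r) * (exp (- t) * norm (?S t)) \<le> exp (t - r) * B"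
          using B by (intro mult_left_mono) auto
        ultimately show ?thesis using inc(2)[OF H r] unfolding distrib_left by linarith
      qed
      finally have "norm (d r) \<le> (exp (r - t) * A + exp (t - r) * B + H / 9 * w r + 2 * (exp (t - r) * h)) / 2"
        by (simp add: algebra_simps)
      moreover have "exp (r - t) * A + exp (t - r) * B + 2 * (exp (t - r) * h) \<le> 2 * w r"
        using A0 B0 h g0 by (simp add: w_def algebra_simps)
      moreover have "H * w r \<ge> 0" using H(1) wpos[of r] by simp
      ultimately show "norm (d r) \<le> (3 / 2 + H / 2) * w r" using wpos[of r] by (simp add: algebra_simps)
    qed (use wpos in auto)
    \<comment> \<open>The bootstrap yields \<open>H = 2 * (3 / 2) = 3\<close>, and
      \<open>3 / 36\<close> is the 1/12 of the claim.\<close>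
    have "3 / 36 * (2 * A + exp t * (B + h)) + exp t * h = ?C h" by simp
    then show ?thesis using inc(3,4)[of 3 0] sup t by (auto simp: mult.commute[of h])
  qed
  have lim: "u \<le> ?C g" if u: "\<And>h. h > g \<Longrightarrow> u \<le> ?C h" for u
  proof (rule field_le_epsilon)
    fix e :: real assume "e > 0"
    then have "u \<le> ?C (g + e / (2 * exp t))" by (intro u) simp
    also have "\<dots> \<le> ?C g + e" using \<open>e > 0\<close> by (simp add: field_simps)
    finally show "u \<le> ?C g + e" .
  qed
  show "norm (?U t - ?U 0) \<le> ?C g" using main by (intro lim) blast
  show "norm (?S t - ?S 0) \<le> ?C g" using main by (intro lim) blast
qed

text \<open>\<open>orig a t\<close> sends a phase point at time \<open>t\<close> to the initial
  point of its trajectory, and \<open>traj a t\<close> goes the other way. Both use physical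
  coordinates; at time 0 these agree with profile coordinates, so no conjugation appears at that
  end.\<close>

definition orig :: "(real \<Rightarrow> plane \<Rightarrow> plane) \<Rightarrow> real \<Rightarrow> phase \<Rightarrow> phase" where
  "orig a t z = flow lam a t (lin (- t) z) 0"

definition traj :: "(real \<Rightarrow> plane \<Rightarrow> plane) \<Rightarrow> real \<Rightarrow> phase \<Rightarrow> phase" where
  "traj a t w = lin t (flow lam a 0 w t)"

lemma traj_orig: "small_field a \<Longrightarrow> traj a t (orig a t z) = z"
  by (simp add: orig_def traj_def flow_flow flow_init)

lemma orig_0 [simp]: "small_field a \<Longrightarrow> orig a 0 z = z"
  by (simp add: orig_def flow_init)

lemma continuous_orig: "small_field a \<Longrightarrow> continuous_on UNIV (\<lambda>(t, z). orig a t z)"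
  unfolding orig_def case_prod_unfold
  by (intro continuous_on_compose_triple[OF continuous_flow] continuous_intros)

lemma continuous_traj: "small_field a \<Longrightarrow> continuous_on UNIV (\<lambda>(t, z). traj a t z)"
  unfolding traj_def case_prod_unfold
  by (intro continuous_intros continuous_on_compose_triple[OF continuous_flow])

text \<open>Adds up the two component estimates. The weights in \<open>A\<close> and
  \<open>B\<close> are those of the linear flow, so a physical difference of size
  \<open>\<delta>\<close> at time \<open>t\<close> has \<open>A\<close> and \<open>B\<close> at most
  \<open>2 * \<delta>\<close>.\<close>

lemma flow_backward_diff:
  assumes a: "small_field a" and b: "small_field b" and t: "t \<ge> 0"
    and A: "exp t * norm (uns (w - z)) \<le> A" and B: "exp (- t) * norm (sta (w - z)) \<le> B"
    and ab: "\<And>r x. 0 \<le> r \<Longrightarrow> r \<le> t \<Longrightarrow> norm (a r x - b r x) \<le> g"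
  shows "norm (flow lam a t w 0 - flow lam b t z 0) \<le> 2 * A + 2 * exp t * B + 3 * exp t * g"
proof -
  let ?y = "flow lam a t w" and ?z = "flow lam b t z"
  have A0: "A \<ge> 0" and B0: "B \<ge> 0" using A B by (auto intro: order_trans[rotated])
  have g0: "g \<ge> 0" using ab[of 0 0] t norm_ge_zero order_trans by blast
  have A': "exp t * norm (uns (?y t) - uns (?z t)) \<le> A" and B': "exp (- t) * norm (sta (?y t) - sta (?z t)) \<le> B"
    using A B by (simp_all add: flow_init a b uns_diff sta_diff)
  note s = profile_backward_stability[OF a t flow_deriv[OF a] flow_deriv[OF b] A' B' ab]
  have "norm (uns (?y t) - uns (?z t)) \<le> A"
    using A' t mult_right_mono[of 1 "exp t" "norm (uns (?y t) - uns (?z t))"] by simp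
  then have "norm (uns (?y 0) - uns (?z 0)) \<le> A + ((2 * A + exp t * (B + g)) / 12 + g * exp t)"
    using s(1) norm_triangle_sub[of "uns (?y 0) - uns (?z 0)" "uns (?y t) - uns (?z t)"] norm_minus_commute
    by (smt (verit, ccfv_SIG))
  moreover have "norm (sta (?y t) - sta (?z t)) \<le> exp t * B"
    using B' by (simp add: exp_minus field_simps)
  then have "norm (sta (?y 0) - sta (?z 0)) \<le> exp t * B + ((2 * A + exp t * (B + g)) / 12 + g * exp t)"
    using s(2) norm_triangle_sub[of "sta (?y 0) - sta (?z 0)" "sta (?y t) - sta (?z t)"] norm_minus_commute
    by (smt (verit, ccfv_SIG))
  moreover have "0 \<le> exp t * B" "0 \<le> exp t * g" using B0 g0 by simp_all
  moreover have "norm (?y 0 - ?z 0) \<le> norm (uns (?y 0) - uns (?z 0)) + norm (sta (?y 0) - sta (?z 0))"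
    using norm_le_uns_sta[of "?y 0 - ?z 0"] by (simp add: uns_diff sta_diff)
  moreover have "n \<le> 2 * A + 2 * b + 3 * c"
    if "u \<le> A + ((2 * A + (b + c)) / 12 + c)" "s \<le> b + ((2 * A + (b + c)) / 12 + c)" "0 \<le> b" "0 \<le> c" "n \<le> u + s"
    for u s b c n :: real
    using that A0 by (simp add: field_simps)
  ultimately show ?thesis unfolding distrib_left mult.commute[of g] mult.assoc by blast
qed

lemma orig_lipschitz:
  assumes a: "small_field a" and t: "t \<ge> 0"
  shows "norm (orig a t z1 - orig a t z2) \<le> 8 * exp t * norm (z1 - z2)"
proof -
  have "norm (flow lam a t (lin (- t) z1) 0 - flow lam a t (lin (- t) z2) 0) \<le>
      2 * (2 * norm (z1 - z2)) + 2 * exp t * (2 * norm (z1 - z2)) + 3 * exp t * 0"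
    using norm_uns_le[of "z1 - z2"] norm_sta_le[of "z1 - z2"]
    by (intro flow_backward_diff[OF a a t]) 
       (simp_all add: uns_lin sta_lin flip: lin_diff exp_add mult.assoc)
  also have "\<dots> \<le> 8 * exp t * norm (z1 - z2)"
    using t mult_right_mono[of 1 "exp t" "norm (z1 - z2)"] by simp
  finally show ?thesis by (simp add: orig_def)
qed

lemma orig_field_diff:
  assumes a: "small_field a" and b: "small_field b" and t: "t \<ge> 0"
    and ab: "\<And>r x. 0 \<le> r \<Longrightarrow> r \<le> t \<Longrightarrow> norm (a r x - b r x) \<le> g"
  shows "norm (orig a t z - orig b t z) \<le> 3 * exp t * g"
  using flow_backward_diff[OF a b t _ _ ab, of "lin (- t) z" "lin (- t) z" 0 0]
  by (simp add: orig_def uns_def sta_def)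

lemma traj_field_diff:
  assumes a: "small_field a" and b: "small_field b" and t: "t \<ge> 0"
    and ab: "\<And>r x. 0 \<le> r \<Longrightarrow> r \<le> t \<Longrightarrow> norm (a r x - b r x) \<le> g"
  shows "norm (fst (traj a t w) - fst (traj b t w)) \<le> 2 * g * exp t"
  unfolding traj_def
  by (rule position_forward_stability[OF a t flow_deriv[OF a] flow_deriv[OF b] _ ab]) (simp_all add: flow_init a b)

text \<open>Points with equal positions and velocities differing by \<open>u\<close> have profile
  differences \<open>exp (- t) * u\<close> and \<open>- exp t * u\<close>. Half of the difference of
  these two is \<open>cosh t * u\<close>, the initial velocity difference without field. The field
  changes it by at most \<open>(2 + exp t) / 12 * norm u\<close>, at most half of its size.\<close>

lemma orig_velocity_expansion:
  assumes a: "small_field a" and t: "t \<ge> 0"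
  shows "cosh t / 2 * norm (v1 - v2) \<le> norm (snd (orig a t (x, v1)) - snd (orig a t (x, v2)))"
proof -
  define w where "w v = lin (- t) (x, v)" for v
  let ?y = "flow lam a t (w v1)" and ?z = "flow lam a t (w v2)"
  let ?u = "v1 - v2"
  have d: "uns (w v1 - w v2) = exp (- t) *\<^sub>R ?u" "sta (w v1 - w v2) = - (exp t *\<^sub>R ?u)"
    by (simp_all add: w_def uns_lin sta_lin flip: lin_diff) (simp_all add: uns_def sta_def algebra_simps)
  have A: "exp t * norm (uns (?y t) - uns (?z t)) \<le> norm ?u" and B: "exp (- t) * norm (sta (?y t) - sta (?z t)) \<le> norm ?u"
    by (simp_all add: flow_init a d flip: uns_diff sta_diff exp_add mult.assoc)
  note s = profile_backward_stability[OF a t flow_deriv[OF a] flow_deriv[OF a] A B, of 0]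
  let ?e = "(2 * norm ?u + exp t * norm ?u) / 12"
  define U S where "U = uns (?y 0) - uns (?z 0)" and "S = sta (?y 0) - sta (?z 0)"
  have U: "norm (exp (- t) *\<^sub>R ?u - U) \<le> ?e" and S: "norm (- (exp t *\<^sub>R ?u) - S) \<le> ?e"
    using s by (simp_all add: flow_init a U_def S_def d flip: uns_diff[of "w v1" "w v2"] sta_diff[of "w v1" "w v2"])
  have e: "?e \<le> cosh t / 2 * norm ?u"
  proof -
    have "exp t \<le> 2 * cosh t" by (simp add: cosh_def)
    then have "(2 + exp t) / 12 \<le> cosh t / 2" using cosh_real_ge_1[of t] by simp
    from mult_right_mono[OF this norm_ge_zero[of ?u]] show ?thesis by (simp add: algebra_simps add_divide_distrib)
  qed
  have "cosh t *\<^sub>R ?u = (1 / 2) *\<^sub>R (U - S) + (1 / 2) *\<^sub>R ((exp (- t) *\<^sub>R ?u - U) - (- (exp t *\<^sub>R ?u) - S))"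
  proof -
    have "(1 / 2) *\<^sub>R (U - S) + (1 / 2) *\<^sub>R ((exp (- t) *\<^sub>R ?u - U) - (- (exp t *\<^sub>R ?u) - S))
        = (1 / 2) *\<^sub>R ((exp (- t) + exp t) *\<^sub>R ?u)"
      unfolding scaleR_add_right[symmetric] by (simp add: scaleR_add_left)
    also have "\<dots> = cosh t *\<^sub>R ?u" by (simp add: cosh_def add.commute)
    finally show ?thesis by simp
  qed
  then have "norm (cosh t *\<^sub>R ?u) \<le> norm ((1 / 2) *\<^sub>R (U - S)) + norm ((1 / 2) *\<^sub>R ((exp (- t) *\<^sub>R ?u - U) - (- (exp t *\<^sub>R ?u) - S)))"
    by (metis norm_triangle_ineq)
  also have "norm ((1 / 2) *\<^sub>R ((exp (- t) *\<^sub>R ?u - U) - (- (exp t *\<^sub>R ?u) - S))) \<le> ?e"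
    using norm_triangle_ineq4[of "exp (- t) *\<^sub>R ?u - U" "- (exp t *\<^sub>R ?u) - S"] U S by simp
  finally have "norm (cosh t *\<^sub>R ?u) \<le> norm ((1 / 2) *\<^sub>R (U - S)) + ?e"
    by simp
  from order_trans[OF this add_left_mono[OF e]]
  have "cosh t * norm ?u \<le> norm ((1 / 2) *\<^sub>R (U - S)) + cosh t / 2 * norm ?u"
    by (simp only: norm_scaleR abs_of_nonneg[OF cosh_real_nonneg])
  moreover have "(1 / 2) *\<^sub>R (U - S) = snd (?y 0) - snd (?z 0)"
    by (simp add: U_def S_def uns_def sta_def algebra_simps scaleR_half_double flip: scaleR_add_left)
  ultimately show ?thesis by (simp add: orig_def w_def)
qed

lemma uns_increment:
  assumes a: "small_field a" and st: "0 \<le> s" "s \<le> t"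
    and y: "\<And>t. (y has_vector_derivative force lam a t (y t)) (at t)"
  shows "norm (uns (y t) - uns (y s)) \<le> (exp (- 2 * s) - exp (- 2 * t)) / 72"
proof -
  have "norm (uns (y t) - uns (y s)) \<le> - exp (- 2 * t) / 72 - - exp (- 2 * s) / 72"
  proof (rule norm_increment_le[OF st(2) uns_deriv[OF y]])
    show "((\<lambda>r. - exp (- 2 * r) / 72) has_real_derivative exp (- 2 * r) / 36) (at r)" for r :: real
      by (auto intro!: derivative_eq_intros)
    fix r assume "s \<le> r"
    then have "norm (a r (fst (lin r (y r)))) \<le> exp (- r) / 36"
      using a st unfolding small_field_def by (metis abs_of_nonneg order_trans)
    then have "exp (- r) * norm (a r (fst (lin r (y r)))) \<le> exp (- r) * (exp (- r) / 36)"
      by (rule mult_left_mono) simp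
    also have "\<dots> = exp (- 2 * r) / 36" by (simp flip: exp_add)
    finally show "norm ((lam * exp (- r)) *\<^sub>R a r (fst (lin r (y r)))) \<le> exp (- 2 * r) / 36"
      by (simp add: abs_mult)
  qed
  then show ?thesis by (simp add: diff_divide_distrib)
qed

lemma sta_increment:
  assumes a: "small_field a" and st: "0 \<le> s" "s \<le> t"
    and y: "\<And>t. (y has_vector_derivative force lam a t (y t)) (at t)"
  shows "norm (sta (y t) - sta (y s)) \<le> (t - s) / 36"
proof -
  have "norm (sta (y t) - sta (y s)) \<le> t / 36 - s / 36"
  proof (rule norm_increment_le[OF st(2) sta_deriv[OF y]])
    show "((\<lambda>r. r / 36) has_real_derivative 1 / 36) (at r)" for r :: real
      by (auto intro!: derivative_eq_intros)
    fix r assume "s \<le> r"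
    then have "norm (a r (fst (lin r (y r)))) \<le> exp (- r) / 36"
      using a st unfolding small_field_def by (metis abs_of_nonneg order_trans)
    then have "exp r * norm (a r (fst (lin r (y r)))) \<le> exp r * (exp (- r) / 36)"
      by (rule mult_left_mono) simp
    also have "\<dots> = 1 / 36" by (simp flip: exp_add)
    finally show "norm (- ((lam * exp r) *\<^sub>R a r (fst (lin r (y r))))) \<le> 1 / 36"
      by (simp add: abs_mult)
  qed
  then show ?thesis by (simp add: diff_divide_distrib)
qed

end

section \<open>Maps preserving Lebesgue measure\<close>

definition mpres :: "('a::euclidean_space \<Rightarrow> 'a) \<Rightarrow> bool" where
  "mpres T \<longleftrightarrow> T \<in> borel_measurable borel \<and> distr lborel borel T = lborel"

lemma mpres_measurable: "mpres T \<Longrightarrow> T \<in> borel_measurable borel"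
  by (simp add: mpres_def)

lemma mpres_nn_integral:
  assumes "mpres T" "f \<in> borel_measurable borel"
  shows "(\<integral>\<^sup>+z. f (T z) \<partial>lborel) = (\<integral>\<^sup>+z. f z \<partial>lborel)"
  using assms nn_integral_distr[of T lborel borel f] by (simp add: mpres_def)

lemma mpres_integral:
  fixes f :: "'a::euclidean_space \<Rightarrow> 'b::{banach, second_countable_topology}"
  assumes "mpres T" "f \<in> borel_measurable borel"
  shows "(\<integral>z. f (T z) \<partial>lborel) = (\<integral>z. f z \<partial>lborel)"
  using assms integral_distr[of T lborel borel f] by (simp add: mpres_def)

lemma mpres_integrable:
  fixes f :: "'a::euclidean_space \<Rightarrow> 'b::{banach, second_countable_topology}"
  assumes "mpres T" "f \<in> borel_measurable borel"
  shows "integrable lborel (\<lambda>z. f (T z)) \<longleftrightarrow> integrable lborel f"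
  using assms integrable_distr_eq[of T lborel borel f] by (simp add: mpres_def)

lemma mpresI:
  assumes T: "T \<in> borel_measurable borel"
    and eq: "\<And>f. f \<in> borel_measurable borel \<Longrightarrow> (\<integral>\<^sup>+z. f (T z) \<partial>lborel) = (\<integral>\<^sup>+z. f z \<partial>lborel)"
  shows "mpres T"
  unfolding mpres_def
proof (intro conjI T measure_eqI)
  fix A assume A: "A \<in> sets (distr lborel borel T)"
  then have [measurable]: "A \<in> sets borel" by simp
  have "emeasure (distr lborel borel T) A = (\<integral>\<^sup>+z. indicator A z \<partial>distr lborel borel T)"
    by simp
  also have "\<dots> = (\<integral>\<^sup>+z. indicator A (T z) \<partial>lborel)"
    by (rule nn_integral_distr) (use T in auto)
  also have "\<dots> = emeasure lborel A"
    by (subst eq) auto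
  finally show "emeasure (distr lborel borel T) A = emeasure lborel A" .
qed simp

lemma mpres_compose: "mpres S \<Longrightarrow> mpres T \<Longrightarrow> mpres (\<lambda>z. S (T z))"
  by (rule mpresI) (auto intro: measurable_compose mpres_measurable simp: mpres_nn_integral measurable_compose[OF mpres_measurable] mpres_nn_integral[of T "\<lambda>z. _ (S z)"])

lemma mpres_id: "mpres (\<lambda>z. z)"
  by (rule mpresI) auto

lemma mpres_translation: "mpres (\<lambda>z. z + c)"
proof -
  have "(\<lambda>z. z + c) = (+) c" by (simp add: fun_eq_iff add.commute)
  then show ?thesis using lborel_distr_plus[of c] by (simp add: mpres_def)
qed

lemma mpres_uminus_plane: "mpres (\<lambda>z :: plane. c - z)"
proof -
  have "mpres (\<lambda>z :: plane. - z)"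
    using lborel_affine_euclidean[of "\<lambda>_. -1" 0] unfolding mpres_def
    by (auto simp: sum_negf euclidean_representation density_1 prod_constant power2_eq_square dest: sym)
  from mpres_compose[OF mpres_translation[of c] this] show ?thesis by simp
qed

lemma nn_integral_lborel_fst:
  fixes f :: "'a::euclidean_space \<times> 'b::euclidean_space \<Rightarrow> ennreal"
  assumes "f \<in> borel_measurable borel"
  shows "(\<integral>\<^sup>+z. f z \<partial>lborel) = (\<integral>\<^sup>+x. \<integral>\<^sup>+y. f (x, y) \<partial>lborel \<partial>lborel)"
  using lborel.nn_integral_fst[of f lborel] assms by (simp add: lborel_prod)

lemma nn_integral_lborel_snd:
  fixes f :: "'a::euclidean_space \<times> 'b::euclidean_space \<Rightarrow> ennreal"
  assumes "f \<in> borel_measurable borel"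
  shows "(\<integral>\<^sup>+z. f z \<partial>lborel) = (\<integral>\<^sup>+y. \<integral>\<^sup>+x. f (x, y) \<partial>lborel \<partial>lborel)"
  using lborel_pair.nn_integral_snd[of f] assms by (simp add: lborel_prod)

lemma measurable_fst_borel [measurable]: "fst \<in> borel_measurable (borel :: ('a::euclidean_space \<times> 'b::euclidean_space) measure)"
  and measurable_snd_borel [measurable]: "snd \<in> borel_measurable (borel :: ('a::euclidean_space \<times> 'b::euclidean_space) measure)"
  by (intro borel_measurable_continuous_onI continuous_intros)+

lemma mpres_shear_snd:
  fixes g :: "'a::euclidean_space \<Rightarrow> 'b::euclidean_space"
  assumes [measurable]: "g \<in> borel_measurable borel"
  shows "mpres (\<lambda>z. (fst z, snd z + g (fst z)))"
proof (rule mpresI)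
  fix f :: "'a \<times> 'b \<Rightarrow> ennreal" assume [measurable]: "f \<in> borel_measurable borel"
  have "(\<integral>\<^sup>+z. f (fst z, snd z + g (fst z)) \<partial>lborel) = (\<integral>\<^sup>+x. \<integral>\<^sup>+y. f (x, y + g x) \<partial>lborel \<partial>lborel)"
    by (subst nn_integral_lborel_fst) auto
  also have "\<dots> = (\<integral>\<^sup>+x. \<integral>\<^sup>+y. f (x, y) \<partial>lborel \<partial>lborel)"
    by (intro nn_integral_cong mpres_nn_integral[OF mpres_translation]) measurable
  also have "\<dots> = (\<integral>\<^sup>+z. f z \<partial>lborel)"
    by (subst nn_integral_lborel_fst) auto
  finally show "(\<integral>\<^sup>+z. f (fst z, snd z + g (fst z)) \<partial>lborel) = (\<integral>\<^sup>+z. f z \<partial>lborel)" .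
qed measurable

lemma mpres_shear_fst:
  fixes g :: "'b::euclidean_space \<Rightarrow> 'a::euclidean_space"
  assumes [measurable]: "g \<in> borel_measurable borel"
  shows "mpres (\<lambda>z. (fst z + g (snd z), snd z))"
proof (rule mpresI)
  fix f :: "'a \<times> 'b \<Rightarrow> ennreal" assume [measurable]: "f \<in> borel_measurable borel"
  have "(\<integral>\<^sup>+z. f (fst z + g (snd z), snd z) \<partial>lborel) = (\<integral>\<^sup>+y. \<integral>\<^sup>+x. f (x + g y, y) \<partial>lborel \<partial>lborel)"
    by (subst nn_integral_lborel_snd) auto
  also have "\<dots> = (\<integral>\<^sup>+y. \<integral>\<^sup>+x. f (x, y) \<partial>lborel \<partial>lborel)"
  proof (rule nn_integral_cong)
    fix y :: 'b
    show "(\<integral>\<^sup>+x. f (x + g y, y) \<partial>lborel) = (\<integral>\<^sup>+x. f (x, y) \<partial>lborel)"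
      by (rule mpres_nn_integral[OF mpres_translation, of "\<lambda>x. f (x, y)"]) measurable
  qed
  also have "\<dots> = (\<integral>\<^sup>+z. f z \<partial>lborel)"
    by (subst nn_integral_lborel_snd) auto
  finally show "(\<integral>\<^sup>+z. f (fst z + g (snd z), snd z) \<partial>lborel) = (\<integral>\<^sup>+z. f z \<partial>lborel)" .
qed measurable

text \<open>The hyperbolic rotation is a product of three shears.\<close>

lemma mpres_lin: "mpres (lin t)"
proof (cases "t = 0")
  case True
  then show ?thesis using mpres_id by (simp add: lin_def[abs_def])
next
  case False
  \<comment> \<open>This is \<open>tanh (t / 2)\<close>; the quotient is the reason why
    \<open>t = 0\<close> is treated apart.\<close>
  define p where "p = (cosh t - 1) / sinh t"
  have s: "sinh t \<noteq> 0" using False by simp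
  let ?S = "\<lambda>z :: phase. (fst z + p *\<^sub>R snd z, snd z)" and ?T = "\<lambda>z :: phase. (fst z, snd z + sinh t *\<^sub>R fst z)"
  have "mpres ?S" "mpres ?T"
    by (rule mpres_shear_fst mpres_shear_snd; measurable)+
  then have m: "mpres (\<lambda>z. ?S (?T (?S z)))"
    by (intro mpres_compose[of ?S "\<lambda>z. ?T (?S z)"] mpres_compose[of ?T ?S])
  have p1: "1 + p * sinh t = cosh t" using s by (simp add: p_def)
  have p2: "p + p * cosh t = sinh t"
    using s cosh_square_eq[of t] by (simp add: p_def field_simps power2_eq_square)
  have "?S (?T (?S z)) = lin t z" for z
  proof -
    have "fst z + p *\<^sub>R snd z + p *\<^sub>R (snd z + sinh t *\<^sub>R (fst z + p *\<^sub>R snd z))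
        = (1 + p * sinh t) *\<^sub>R fst z + (p + p * (1 + p * sinh t)) *\<^sub>R snd z"
      by (simp only: scaleR_add_left scaleR_add_right scaleR_scaleR distrib_left mult_1_right mult_1_left scaleR_one add_ac mult_ac)
    moreover have "snd z + sinh t *\<^sub>R (fst z + p *\<^sub>R snd z) = sinh t *\<^sub>R fst z + (1 + p * sinh t) *\<^sub>R snd z"
      by (simp add: algebra_simps)
    ultimately show ?thesis by (simp add: lin_def p1 p2)
  qed
  then show ?thesis using m by simp
qed

text \<open>Indicators of open sets are lower semicontinuous, so Fatou's lemma gives the inequality
  for open sets; outer regularity extends it to Borel sets.\<close>

lemma emeasure_vimage_le_limit:
  fixes S :: "'a::euclidean_space \<Rightarrow> 'a"
  assumes T: "\<And>n. mpres (T n)" and lim: "\<And>z. (\<lambda>n. T n z) \<longlonglongrightarrow> S z"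
    and S: "S \<in> borel_measurable borel" and A: "A \<in> sets borel"
  shows "emeasure lborel (S -` A) \<le> emeasure lborel A"
proof -
  have op: "emeasure lborel (S -` U) \<le> emeasure lborel U" if U: "open U" for U
  proof -
    have mT: "(\<lambda>z. indicator U (T n z) :: ennreal) \<in> borel_measurable lborel" for n
      using measurable_compose[OF mpres_measurable[OF T] borel_measurable_indicator[of U borel]] U by simp
    have "emeasure lborel (S -` U) = (\<integral>\<^sup>+z. indicator (S -` U) z \<partial>lborel)"
      using measurable_sets[OF S, of U] U by simp
    also have "\<dots> \<le> (\<integral>\<^sup>+z. liminf (\<lambda>n. indicator U (T n z)) \<partial>lborel)"
    proof (rule nn_integral_mono)
      fix z
      show "indicator (S -` U) z \<le> liminf (\<lambda>n. indicator U (T n z) :: ennreal)"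
      proof (cases "S z \<in> U")
        case True
        then have "\<forall>\<^sub>F n in sequentially. T n z \<in> U"
          using topological_tendstoD[OF lim U] by blast
        then have "\<forall>\<^sub>F n in sequentially. 1 \<le> (indicator U (T n z) :: ennreal)"
          by eventually_elim simp
        then have "1 \<le> liminf (\<lambda>n. indicator U (T n z) :: ennreal)"
          by (rule Liminf_bounded)
        then show ?thesis using True by simp
      qed simp
    qed
    also have "\<dots> \<le> liminf (\<lambda>n. \<integral>\<^sup>+z. indicator U (T n z) \<partial>lborel)"
      by (rule nn_integral_liminf) (rule mT)
    also have "(\<lambda>n. \<integral>\<^sup>+z. indicator U (T n z) \<partial>lborel) = (\<lambda>n. emeasure lborel U)"
      using U by (subst mpres_nn_integral[OF T]) auto
    finally show ?thesis by (simp add: Liminf_const)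
  qed
  show ?thesis
  proof (rule ennreal_le_epsilon)
    fix e :: real assume e: "e > 0"
    obtain U where U: "open U" "A \<subseteq> U" "emeasure lborel (U - A) < e"
      using outer_regular_lborel[OF A e] by blast
    have "emeasure lborel (S -` A) \<le> emeasure lborel (S -` U)"
      using U measurable_sets[OF S, of U] by (intro emeasure_mono) auto
    also have "\<dots> \<le> emeasure lborel U" by (rule op[OF U(1)])
    also have "\<dots> \<le> emeasure lborel A + emeasure lborel (U - A)"
      using emeasure_subadditive[of A lborel "U - A"] A U by (simp add: Un_absorb1)
    also have "\<dots> \<le> emeasure lborel A + ennreal e" using U(3) by (intro add_left_mono) simp
    finally show "emeasure lborel (S -` A) \<le> emeasure lborel A + ennreal e" .
  qed
qed

text \<open>Fatou gives one inequality for each limit. Applied to \<open>S'\<close> and the preimage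
  of \<open>A\<close> under \<open>S\<close>, it is the opposite inequality for \<open>S\<close>,
  because \<open>S'\<close> is a right inverse of \<open>S\<close>.\<close>

lemma mpres_limit:
  fixes S S' :: "'a::euclidean_space \<Rightarrow> 'a"
  assumes T: "\<And>n. mpres (T n)" and lim: "\<And>z. (\<lambda>n. T n z) \<longlonglongrightarrow> S z"
    and T': "\<And>n. mpres (T' n)" and lim': "\<And>z. (\<lambda>n. T' n z) \<longlonglongrightarrow> S' z"
    and S: "S \<in> borel_measurable borel" and S': "S' \<in> borel_measurable borel"
    and inv: "\<And>z. S (S' z) = z"
  shows "mpres S"
  unfolding mpres_def
proof (intro conjI S measure_eqI)
  fix A assume "A \<in> sets (distr lborel borel S)"
  then have A: "A \<in> sets borel" by simp
  have "S' -` (S -` A) = A" by (auto simp: inv)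
  then have "emeasure lborel A \<le> emeasure lborel (S -` A)"
    using emeasure_vimage_le_limit[OF T' lim' S', of "S -` A"] measurable_sets[OF S A] by simp
  then show "emeasure (distr lborel borel S) A = emeasure lborel A"
    using emeasure_vimage_le_limit[OF T lim S A] S A by (simp add: emeasure_distr)
qed simp

text \<open>Fatou in both directions shows that no mass is lost. With equal masses, Scheffe's lemma
  upgrades pointwise convergence of the transported squares to convergence in \<open>L^1\<close>, in
  place of a dominating function.\<close>

lemma tendsto_L1_transport:
  fixes f g :: "'a::euclidean_space \<Rightarrow> real"
  assumes T: "\<And>n. mpres (T n)" and T': "\<And>n. mpres (T' n)"
    and f[measurable]: "f \<in> borel_measurable borel" and g[measurable]: "g \<in> borel_measurable borel"
    and fin: "(\<integral>\<^sup>+z. ennreal ((f z)\<^sup>2) \<partial>lborel) < \<infinity>"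
    and fg: "\<And>z. (\<lambda>n. f (T' n z)) \<longlonglongrightarrow> g z" and gf: "\<And>z. (\<lambda>n. g (T n z)) \<longlonglongrightarrow> f z"
  shows "(\<integral>\<^sup>+z. ennreal ((g z)\<^sup>2) \<partial>lborel) = (\<integral>\<^sup>+z. ennreal ((f z)\<^sup>2) \<partial>lborel)"
    and "(\<lambda>n. \<integral>\<^sup>+z. ennreal \<bar>(f (T' n z))\<^sup>2 - (g z)\<^sup>2\<bar> \<partial>lborel) \<longlonglongrightarrow> 0"
proof -
  have le: "(\<integral>\<^sup>+z. ennreal ((q z)\<^sup>2) \<partial>lborel) \<le> (\<integral>\<^sup>+z. ennreal ((p z)\<^sup>2) \<partial>lborel)"
    if R: "\<And>n. mpres (R n)" and p[measurable]: "p \<in> borel_measurable borel" 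
      and pq: "\<And>z. (\<lambda>n. p (R n z)) \<longlonglongrightarrow> q z" for R p and q :: "'a \<Rightarrow> real"
  proof -
    note [measurable] = mpres_measurable[OF R]
    have "(\<integral>\<^sup>+z. ennreal ((q z)\<^sup>2) \<partial>lborel) = (\<integral>\<^sup>+z. liminf (\<lambda>n. ennreal ((p (R n z))\<^sup>2)) \<partial>lborel)"
    proof (intro nn_integral_cong)
      fix z
      have "(\<lambda>n. ennreal ((p (R n z))\<^sup>2)) \<longlonglongrightarrow> ennreal ((q z)\<^sup>2)"
        by (intro tendsto_ennrealI tendsto_power pq)
      then show "ennreal ((q z)\<^sup>2) = liminf (\<lambda>n. ennreal ((p (R n z))\<^sup>2))"
        by (intro lim_imp_Liminf[symmetric]) auto
    qed
    also have "\<dots> \<le> liminf (\<lambda>n. \<integral>\<^sup>+z. ennreal ((p (R n z))\<^sup>2) \<partial>lborel)"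
      by (rule nn_integral_liminf) measurable
    also have "(\<lambda>n. \<integral>\<^sup>+z. ennreal ((p (R n z))\<^sup>2) \<partial>lborel) = (\<lambda>n. \<integral>\<^sup>+z. ennreal ((p z)\<^sup>2) \<partial>lborel)"
      by (subst mpres_nn_integral[OF R, where f = "\<lambda>z. ennreal ((p z)\<^sup>2)"]) auto
    finally show ?thesis by (simp add: Liminf_const)
  qed
  show eq: "(\<integral>\<^sup>+z. ennreal ((g z)\<^sup>2) \<partial>lborel) = (\<integral>\<^sup>+z. ennreal ((f z)\<^sup>2) \<partial>lborel)"
    by (intro antisym le[OF T' f fg] le[OF T g gf])
  note [measurable] = mpres_measurable[OF T']
  have "(\<lambda>n. \<integral>\<^sup>+z. norm ((f (T' n z))\<^sup>2 - (g z)\<^sup>2) \<partial>lborel) \<longlonglongrightarrow> 0"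
  proof (rule Scheffe_lemma2)
    show "integrable lborel (\<lambda>z. (g z)\<^sup>2)"
      using fin eq by (intro integrableI_bounded) auto
    show "AE z in lborel. (\<lambda>n. (f (T' n z))\<^sup>2) \<longlonglongrightarrow> (g z)\<^sup>2"
      by (intro AE_I2 tendsto_power fg)
    fix n
    show "(\<integral>\<^sup>+z. norm ((f (T' n z))\<^sup>2) \<partial>lborel) \<le> (\<integral>\<^sup>+z. norm ((g z)\<^sup>2) \<partial>lborel)"
      using mpres_nn_integral[OF T', of "\<lambda>z. ennreal ((f z)\<^sup>2)"] by (simp add: eq)
  qed measurable
  then show "(\<lambda>n. \<integral>\<^sup>+z. ennreal \<bar>(f (T' n z))\<^sup>2 - (g z)\<^sup>2\<bar> \<partial>lborel) \<longlonglongrightarrow> 0" by simp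
qed

section \<open>Kernel estimates in the plane\<close>

definition coulomb :: "plane \<Rightarrow> plane" where "coulomb z = z /\<^sub>R (norm z)\<^sup>2"
definition coulomb_reg :: "real \<Rightarrow> plane \<Rightarrow> plane" where "coulomb_reg d z = z /\<^sub>R ((norm z)\<^sup>2 + d\<^sup>2)"
definition coulomb_near :: "real \<Rightarrow> plane \<Rightarrow> plane" where "coulomb_near d z = coulomb z - coulomb_reg d z"

lemma bracket_ge_1: "1 \<le> bracket y" and bracket_ge_norm: "norm y \<le> bracket y"
  and bracket_pos: "0 < bracket y"
proof -
  show *: "1 \<le> bracket y" by (simp add: bracket_def)
  show "norm y \<le> bracket y" unfolding bracket_def by (rule real_le_rsqrt) simp
  show "0 < bracket y" using * by simp
qed

lemma bracket_peetre: "bracket x \<le> (1 + norm (x - y)) * bracket y"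
proof -
  have "bracket x = norm (1 :: real, x)" for x :: 'a by (simp add: bracket_def norm_Pair)
  then have "bracket x \<le> bracket y + norm (x - y)"
    using norm_triangle_ineq[of "(1 :: real, y)" "(0, x - y)"] by (simp add: norm_Pair)
  also have "\<dots> \<le> bracket y + norm (x - y) * bracket y"
    using mult_left_mono[OF bracket_ge_1, of "norm (x - y)"] by simp
  finally show ?thesis by (simp add: algebra_simps)
qed

lemma continuous_on_bracket [continuous_intros]: "continuous_on S f \<Longrightarrow> continuous_on S (\<lambda>x. bracket (f x))"
  unfolding bracket_def by (intro continuous_intros)

lemma bracket_measurable [measurable]: "bracket \<in> borel_measurable borel"
  by (intro borel_measurable_continuous_onI continuous_intros)

lemma dyadic_above:
  fixes y :: real assumes "1 < y" obtains k where "2 ^ k < y" "y \<le> 2 ^ Suc k"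
proof -
  define m where "m = (LEAST n. y \<le> 2 ^ n)"
  have "\<exists>n. y \<le> 2 ^ n" using real_arch_pow[of 2 y] by (auto intro: less_imp_le)
  then have m: "y \<le> 2 ^ m" unfolding m_def by (rule LeastI_ex)
  then have "m \<noteq> 0" using assms by (intro notI) simp
  then obtain k where k: "m = Suc k" using not0_implies_Suc by blast
  have "\<not> y \<le> 2 ^ k" using not_less_Least[of k "\<lambda>n. y \<le> 2 ^ n"] by (simp add: m_def[symmetric] k)
  then show thesis using m that[of k] by (simp add: k)
qed

lemma eight_power: "(8 :: real) ^ k = 2 ^ k * 2 ^ k * 2 ^ k"
  by (simp flip: power_mult_distrib)

lemma emeasure_cball_plane: "r \<ge> 0 \<Longrightarrow> emeasure lborel (cball (c :: plane) r) = ennreal (pi * r\<^sup>2)"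
  by (simp add: emeasure_cball unit_ball_vol_2)

lemma le_suminf_ennreal: "f k \<le> (\<Sum>k. f k :: ennreal)"
  using sum_le_suminf[of f "{k}"] by (simp add: summableI)

text \<open>Dyadic shells take the place of polar coordinates: each shell lies in a set
  \<open>A k\<close> on which \<open>q\<close> is at most \<open>c k\<close>, and the products with
  the measures are dominated by a geometric series of sum \<open>2 * C\<close>.\<close>

lemma nn_integral_dyadic_le:
  fixes q :: "plane \<Rightarrow> ennreal"
  assumes A: "\<And>k. A k \<in> sets borel" and C: "C \<ge> 0" and c: "\<And>k. c k \<ge> 0"
    and q: "AE z in lborel. q z = 0 \<or> (\<exists>k. z \<in> A k \<and> q z \<le> ennreal (c k))"
    and vol: "\<And>k. ennreal (c k) * emeasure lborel (A k) \<le> ennreal (C * (1 / 2) ^ k)"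
  shows "(\<integral>\<^sup>+z. q z \<partial>lborel) \<le> ennreal (2 * C)"
proof -
  have "(\<integral>\<^sup>+z. q z \<partial>lborel) \<le> (\<integral>\<^sup>+z. (\<Sum>k. ennreal (c k) * indicator (A k) z) \<partial>lborel)"
  proof (rule nn_integral_mono_AE)
    show "AE z in lborel. q z \<le> (\<Sum>k. ennreal (c k) * indicator (A k) z)"
      using q
    proof eventually_elim
      case (elim z)
      then consider "q z = 0" | k where "z \<in> A k" "q z \<le> ennreal (c k)" by blast
      then show ?case
      proof cases
        case 2
        then have "q z \<le> ennreal (c k) * indicator (A k) z" by simp
        also have "\<dots> \<le> (\<Sum>k. ennreal (c k) * indicator (A k) z)"
          by (rule le_suminf_ennreal)
        finally show ?thesis .
      qed simp
    qed
  qed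
  also have "\<dots> = (\<Sum>k. \<integral>\<^sup>+z. ennreal (c k) * indicator (A k) z \<partial>lborel)"
    using A by (intro nn_integral_suminf) auto
  also have "\<dots> = (\<Sum>k. ennreal (c k) * emeasure lborel (A k))"
    using A by (simp add: nn_integral_cmult)
  also have "\<dots> \<le> (\<Sum>k. ennreal (C * (1 / 2) ^ k))"
    by (intro suminf_le vol summableI)
  also have "\<dots> = ennreal (\<Sum>k. C * (1 / 2) ^ k)"
    using C by (intro suminf_ennreal2) (auto intro!: summable_mult summable_geometric)
  also have "(\<Sum>k. C * (1 / 2) ^ k) = 2 * C"
    by (subst suminf_mult) (auto simp: suminf_geometric summable_geometric)
  finally show ?thesis .
qed

text \<open>Expansion confines the level sets: two points with \<open>norm (F v) \<le> r\<close>
  have distance at most \<open>2 * r / L\<close>, so the level set has area at most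
  \<open>4 * pi * r\<^sup>2 / L\<^sup>2\<close>. This does the work of a change of variables. The
  sum over the levels \<open>2 ^ k\<close> converges because the power 3 exceeds the dimension
  2.\<close>

lemma nn_integral_expanding_bracket:
  fixes F :: "plane \<Rightarrow> plane"
  assumes F: "F \<in> borel_measurable borel" and L: "L > 0"
    and exp: "\<And>v w. L * norm (v - w) \<le> norm (F v - F w)"
  shows "(\<integral>\<^sup>+v. ennreal (1 / bracket (F v) ^ 3) \<partial>lborel) \<le> ennreal (64 * pi / L\<^sup>2)"
proof -
  have level: "emeasure lborel {v. norm (F v) \<le> r} \<le> ennreal (4 * pi * r\<^sup>2 / L\<^sup>2)" if r: "r \<ge> 0" for r
  proof (cases "{v. norm (F v) \<le> r} = {}")
    case False
    then obtain v0 where v0: "norm (F v0) \<le> r" by blast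
    have "{v. norm (F v) \<le> r} \<subseteq> cball v0 (2 * r / L)"
    proof
      fix v assume "v \<in> {v. norm (F v) \<le> r}"
      then have "L * norm (v0 - v) \<le> 2 * r"
        using exp[of v0 v] v0 norm_triangle_ineq4[of "F v0" "F v"] by simp
      then show "v \<in> cball v0 (2 * r / L)" using L by (simp add: dist_norm field_simps)
    qed
    then have "emeasure lborel {v. norm (F v) \<le> r} \<le> emeasure lborel (cball v0 (2 * r / L))"
      by (rule emeasure_mono) simp
    also have "\<dots> = ennreal (4 * pi * r\<^sup>2 / L\<^sup>2)"
      using r L by (simp add: emeasure_cball_plane power_divide power_mult_distrib)
    finally show ?thesis .
  qed simp
  have "(\<integral>\<^sup>+v. ennreal (1 / bracket (F v) ^ 3) \<partial>lborel) \<le> ennreal (2 * (32 * pi / L\<^sup>2))"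
  \<comment> \<open>On the shell just below \<open>2 ^ k\<close> the norm exceeds half of
    \<open>2 ^ k\<close>, whence the factor 8 in \<open>c\<close>.\<close>
  proof (rule nn_integral_dyadic_le[where A = "\<lambda>k. {v. norm (F v) \<le> 2 ^ k}" and c = "\<lambda>k. 8 / 8 ^ k"])
    show "{v. norm (F v) \<le> 2 ^ k} \<in> sets borel" for k :: nat using F by measurable
    show "AE v in lborel. ennreal (1 / bracket (F v) ^ 3) = 0 \<or>
        (\<exists>k. v \<in> {v. norm (F v) \<le> 2 ^ k} \<and> ennreal (1 / bracket (F v) ^ 3) \<le> ennreal (8 / 8 ^ k))"
    proof (intro AE_I2 disjI2)
      fix v
      show "\<exists>k. v \<in> {v. norm (F v) \<le> 2 ^ k} \<and> ennreal (1 / bracket (F v) ^ 3) \<le> ennreal (8 / 8 ^ k)"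
      proof (cases "norm (F v) \<le> 1")
        case True
        have "1 / bracket (F v) ^ 3 \<le> 1" using one_le_power[OF bracket_ge_1[of "F v"], of 3] bracket_pos[of "F v"] by (simp add: divide_le_eq)
        then have "ennreal (1 / bracket (F v) ^ 3) \<le> ennreal (8 / 8 ^ 0)"
          by (intro ennreal_leI) simp
        then show ?thesis using True by (intro exI[of _ 0]) auto
      next
        case False
        then obtain k where k: "2 ^ k < norm (F v)" "norm (F v) \<le> 2 ^ Suc k"
          using dyadic_above[of "norm (F v)"] by auto
        have "(2 ^ k) ^ 3 \<le> bracket (F v) ^ 3"
          using k bracket_ge_norm[of "F v"] by (intro power_mono) auto
        also have "(2 ^ k) ^ 3 = (8 :: real) ^ k" by (simp add: eight_power power3_eq_cube)
        finally have "1 / bracket (F v) ^ 3 \<le> 8 / 8 ^ Suc k"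
          using bracket_pos[of "F v"] by (simp add: divide_simps)
        then show ?thesis using k by (intro exI[of _ "Suc k"]) (auto intro!: ennreal_leI)
      qed
    qed
    show "ennreal (8 / 8 ^ k) * emeasure lborel {v. norm (F v) \<le> 2 ^ k} \<le> ennreal (32 * pi / L\<^sup>2 * (1 / 2) ^ k)" for k
    proof -
      have "ennreal (8 / 8 ^ k) * emeasure lborel {v. norm (F v) \<le> 2 ^ k} \<le> ennreal (8 / 8 ^ k) * ennreal (4 * pi * (2 ^ k)\<^sup>2 / L\<^sup>2)"
        by (intro mult_left_mono level) auto
      also have "\<dots> = ennreal (8 / 8 ^ k * (4 * pi * (2 ^ k)\<^sup>2 / L\<^sup>2))"
        by (rule ennreal_mult[symmetric]) auto
      also have "8 / 8 ^ k * (4 * pi * (2 ^ k)\<^sup>2 / L\<^sup>2) = 32 * pi / L\<^sup>2 * (1 / 2) ^ k"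
      proof -
        show ?thesis by (simp add: eight_power power_divide power2_eq_square field_simps)
      qed
      finally show ?thesis .
    qed
  qed auto
  then show ?thesis by simp
qed

lemma AE_plane_nonzero: "AE z :: plane in lborel. z \<noteq> 0"
  by (rule AE_lborel_singleton)

lemma nn_integral_inverse_norm_ball:
  fixes k :: "plane \<Rightarrow> real"
  assumes k: "\<And>z. k z * norm z \<le> 1" and r: "r > 0"
  shows "(\<integral>\<^sup>+z. ennreal (k z) * indicator (ball 0 r) z \<partial>lborel) \<le> ennreal (4 * pi * r)"
proof -
  have "(\<integral>\<^sup>+z. ennreal (k z) * indicator (ball 0 r) z \<partial>lborel) \<le> ennreal (2 * (2 * (pi * r)))"
  proof (rule nn_integral_dyadic_le[where A = "\<lambda>j. cball 0 (r / 2 ^ j)" and c = "\<lambda>j. 2 * 2 ^ j / r"])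
    show "AE z in lborel. ennreal (k z) * indicator (ball 0 r) z = 0 \<or>
        (\<exists>j. z \<in> cball (0 :: plane) (r / 2 ^ j) \<and> ennreal (k z) * indicator (ball 0 r) z \<le> ennreal (2 * 2 ^ j / r))"
      using AE_plane_nonzero
    proof eventually_elim
      case (elim z)
      show ?case
      proof (cases "norm z < r")
        case True
        then obtain j where j: "2 ^ j < r / norm z" "r / norm z \<le> 2 ^ Suc j"
          using dyadic_above[of "r / norm z"] elim by auto
        have "k z \<le> 1 / norm z" using k[of z] elim by (simp add: field_simps)
        also have "\<dots> \<le> 2 * 2 ^ j / r" using j(2) elim r by (simp add: field_simps)
        finally show ?thesis using j(1) True elim
          by (intro disjI2 exI[of _ j]) (auto simp: field_simps intro!: ennreal_leI)
      qed simp
    qed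
    show "ennreal (2 * 2 ^ j / r) * emeasure lborel (cball (0 :: plane) (r / 2 ^ j)) \<le> ennreal (2 * (pi * r) * (1 / 2) ^ j)" for j
      using r by (simp add: emeasure_cball_plane power_divide field_simps power2_eq_square flip: ennreal_mult)
  qed (use r in auto)
  then show ?thesis by (simp add: mult.assoc)
qed

lemma norm_coulomb: "norm (coulomb z) * norm z \<le> 1"
  by (cases "z = 0") (simp_all add: coulomb_def power2_eq_square field_simps)

lemma coulomb_near_eq:
  assumes "d > 0"
  shows "coulomb_near d z = (d\<^sup>2 / ((norm z)\<^sup>2 * ((norm z)\<^sup>2 + d\<^sup>2))) *\<^sub>R z"
proof (cases "z = 0")
  case False
  have "inverse ((norm z)\<^sup>2) - inverse ((norm z)\<^sup>2 + d\<^sup>2) = d\<^sup>2 / ((norm z)\<^sup>2 * ((norm z)\<^sup>2 + d\<^sup>2))"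
    using False assms by (simp add: field_simps add_nonneg_pos)
  then show ?thesis by (simp add: coulomb_near_def coulomb_def coulomb_reg_def flip: scaleR_diff_left)
qed (simp add: coulomb_near_def coulomb_def coulomb_reg_def)

text \<open>The first bound is that of the Coulomb kernel and serves near 0. The second gains two
  powers at infinity and makes the remainder integrable over the plane.\<close>

lemma norm_coulomb_near:
  assumes d: "d > 0"
  shows "norm (coulomb_near d z) * norm z \<le> 1" and "norm (coulomb_near d z) * norm z ^ 3 \<le> d\<^sup>2"
proof -
  let ?n = "(norm z)\<^sup>2"
  have D: "?n + d\<^sup>2 > 0" using d by (simp add: add_nonneg_pos)
  have e: "norm (coulomb_near d z) = d\<^sup>2 / (?n * (?n + d\<^sup>2)) * norm z"
    using D by (simp add: coulomb_near_eq[OF d] abs_of_nonneg)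
  show "norm (coulomb_near d z) * norm z \<le> 1"
  proof (cases "z = 0")
    case False
    have "norm (coulomb_near d z) * norm z = d\<^sup>2 / (?n + d\<^sup>2)"
      using False D unfolding e by (simp add: power2_eq_square)
    also have "\<dots> \<le> 1" using D by (simp add: divide_le_eq)
    finally show ?thesis .
  qed simp
  show "norm (coulomb_near d z) * norm z ^ 3 \<le> d\<^sup>2"
  proof (cases "z = 0")
    case False
    have "norm (coulomb_near d z) * norm z ^ 3 = d\<^sup>2 * (?n / (?n + d\<^sup>2))"
      using False D unfolding e by (simp add: power2_eq_square power3_eq_cube)
    also have "\<dots> \<le> d\<^sup>2 * 1" using D by (intro mult_left_mono) auto
    finally show ?thesis by simp
  qed simp
qed

text \<open>Scaling makes the integral proportional to \<open>d\<close>: the ball of radius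
  \<open>d\<close> contributes \<open>4 * pi * d\<close> and the dyadic shells outside it
  \<open>8 * pi * d\<close>.\<close>

lemma nn_integral_coulomb_near:
  assumes d: "d > 0"
  shows "(\<integral>\<^sup>+z. ennreal (norm (coulomb_near d z)) \<partial>lborel) \<le> ennreal (12 * pi * d)"
proof -
  have [measurable]: "coulomb_near d \<in> borel_measurable borel"
    unfolding coulomb_near_def coulomb_def coulomb_reg_def by measurable
  have far: "(\<integral>\<^sup>+z. ennreal (norm (coulomb_near d z)) * indicator (- ball 0 d) z \<partial>lborel) \<le> ennreal (2 * (4 * pi * d))"
  proof (rule nn_integral_dyadic_le[where A = "\<lambda>j. cball 0 (d * 2 ^ Suc j)" and c = "\<lambda>j. 1 / (d * 8 ^ j)"])
    show "AE z in lborel. ennreal (norm (coulomb_near d z)) * indicator (- ball 0 d) z = 0 \<or>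
        (\<exists>j. z \<in> cball (0 :: plane) (d * 2 ^ Suc j) \<and>
          ennreal (norm (coulomb_near d z)) * indicator (- ball 0 d) z \<le> ennreal (1 / (d * 8 ^ j)))"
    proof (intro AE_I2 disjI2)
      fix z :: plane
      show "\<exists>j. z \<in> cball (0 :: plane) (d * 2 ^ Suc j) \<and>
        ennreal (norm (coulomb_near d z)) * indicator (- ball 0 d) z \<le> ennreal (1 / (d * 8 ^ j))"
      proof (cases "norm z \<le> d")
        case True
        show ?thesis
        proof (rule exI[of _ 0], intro conjI)
          have "norm (coulomb_near d z) \<le> 1 / d" if "norm z = d"
            using norm_coulomb_near(1)[OF d, of z] d that by (simp add: field_simps)
          then show "ennreal (norm (coulomb_near d z)) * indicator (- ball 0 d) z \<le> ennreal (1 / (d * 8 ^ 0))"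
            using True by (auto simp: indicator_def intro!: ennreal_leI)
        qed (use True d in auto)
      next
        case False
        then obtain j where j: "2 ^ j < norm z / d" "norm z / d \<le> 2 ^ Suc j"
          using dyadic_above[of "norm z / d"] d by auto
        have "(d * 2 ^ j) ^ 3 \<le> norm z ^ 3"
          using j d by (intro power_mono) (auto simp: field_simps)
        moreover have "(d * 2 ^ j) ^ 3 = d ^ 3 * 8 ^ j"
          by (simp add: eight_power power3_eq_cube)
        ultimately have "norm (coulomb_near d z) * (d ^ 3 * 8 ^ j) \<le> d\<^sup>2"
          using norm_coulomb_near(2)[OF d, of z] mult_left_mono[of "d ^ 3 * 8 ^ j" "norm z ^ 3" "norm (coulomb_near d z)"] by simp
        then have "norm (coulomb_near d z) \<le> 1 / (d * 8 ^ j)"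
          using d by (simp add: field_simps power2_eq_square power3_eq_cube)
        then show ?thesis using j d False by (intro exI[of _ j]) (auto simp: field_simps intro!: ennreal_leI)
      qed
    qed
    show "ennreal (1 / (d * 8 ^ j)) * emeasure lborel (cball (0 :: plane) (d * 2 ^ Suc j)) \<le> ennreal (4 * pi * d * (1 / 2) ^ j)" for j
    proof -
      have "1 / (d * 8 ^ j) * (pi * (d * 2 ^ Suc j)\<^sup>2) = 4 * pi * d * (1 / 2) ^ j"
        using d by (simp add: eight_power power_divide field_simps power2_eq_square)
      then show ?thesis using d by (simp add: emeasure_cball_plane flip: ennreal_mult)
    qed
  qed (use d in auto)
  have "(\<integral>\<^sup>+z. ennreal (norm (coulomb_near d z)) \<partial>lborel) =
      (\<integral>\<^sup>+z. ennreal (norm (coulomb_near d z)) * indicator (ball 0 d) z \<partial>lborel) +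
      (\<integral>\<^sup>+z. ennreal (norm (coulomb_near d z)) * indicator (- ball 0 d) z \<partial>lborel)"
    by (subst nn_integral_add[symmetric]) (auto intro!: nn_integral_cong simp: indicator_def)
  also have "\<dots> \<le> ennreal (4 * pi * d) + ennreal (2 * (4 * pi * d))"
    by (intro add_mono far nn_integral_inverse_norm_ball norm_coulomb_near d)
  also have "\<dots> = ennreal (12 * pi * d)" using d by (simp flip: ennreal_plus)
  finally show ?thesis .
qed

text \<open>The regularised kernel is the plane component of the inversion \<open>(z, d) / \<bar>(z, d)\<bar>\<^sup>2\<close> in three
  dimensions.\<close>

lemma norm_inversion_diff:
  fixes x y :: "'a::real_inner"
  assumes "x \<noteq> 0" "y \<noteq> 0"
  shows "norm (x /\<^sub>R (norm x)\<^sup>2 - y /\<^sub>R (norm y)\<^sup>2) = norm (x - y) / (norm x * norm y)"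
proof -
  have sq: "(norm (u - v))\<^sup>2 = (norm u)\<^sup>2 + (norm v)\<^sup>2 - 2 * (u \<bullet> v)" for u v :: 'a
    by (simp add: power2_norm_eq_inner inner_diff inner_commute)
  have "norm (x /\<^sub>R (norm x)\<^sup>2) = 1 / norm x" "norm (y /\<^sub>R (norm y)\<^sup>2) = 1 / norm y"
    using assms by (simp_all add: power2_eq_square divide_inverse)
  then have "(norm (x /\<^sub>R (norm x)\<^sup>2 - y /\<^sub>R (norm y)\<^sup>2))\<^sup>2 = (norm (x - y) / (norm x * norm y))\<^sup>2"
    unfolding power_divide power_mult_distrib sq using assms by (simp add: power_divide field_simps)
  then show ?thesis by (simp add: power2_eq_iff_nonneg)
qed

text \<open>Of the two norms in the denominator of the inversion identity only one is replaced by
  its minimum \<open>d\<close>. The other is kept, so the Lipschitz constant is itself a kernel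
  bounded by \<open>1 / norm y\<close> and can be integrated like the field.\<close>

lemma coulomb_reg_lipschitz:
  assumes d: "d > 0"
  shows "norm (coulomb_reg d x - coulomb_reg d y) \<le> norm (x - y) / (d * sqrt ((norm y)\<^sup>2 + d\<^sup>2))"
proof -
  have n: "(norm (z, d))\<^sup>2 = (norm z)\<^sup>2 + d\<^sup>2" for z :: plane by (simp add: norm_Pair)
  have "norm (coulomb_reg d x - coulomb_reg d y) =
      norm (fst ((x, d) /\<^sub>R (norm (x, d))\<^sup>2 - (y, d) /\<^sub>R (norm (y, d))\<^sup>2))"
    by (simp add: coulomb_reg_def n)
  also have "\<dots> \<le> norm ((x, d) /\<^sub>R (norm (x, d))\<^sup>2 - (y, d) /\<^sub>R (norm (y, d))\<^sup>2)"
    by (rule norm_fst_le')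
  also have "\<dots> = norm ((x, d) - (y, d)) / (norm (x, d) * norm (y, d))"
    using d by (intro norm_inversion_diff) (auto simp: zero_prod_def)
  also have "\<dots> \<le> norm (x - y) / (d * norm (y, d))"
  proof -
    have "d \<le> norm (x, d)" using norm_snd_le'[of "(x, d)"] d by simp
    moreover have "norm (y, d) > 0" using d by (simp add: zero_prod_def)
    ultimately have "d * norm (y, d) \<le> norm (x, d) * norm (y, d)" "0 < d * norm (y, d)"
      using d by (auto intro: mult_right_mono)
    then show ?thesis by (simp add: divide_left_mono)
  qed
  finally show ?thesis by (simp add: norm_Pair)
qed

lemma norm_coulomb_reg:
  assumes d: "d > 0"
  shows "norm (coulomb_reg d z) * norm z \<le> 1" and "norm (coulomb_reg d z) \<le> 1 / d"
    and "norm (coulomb_reg d z) \<le> norm (coulomb z)"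
proof -
  let ?n = "(norm z)\<^sup>2"
  have D: "?n + d\<^sup>2 > 0" using d by (simp add: add_nonneg_pos)
  have e: "norm (coulomb_reg d z) = norm z / (?n + d\<^sup>2)"
    using D by (simp add: coulomb_reg_def field_simps abs_of_pos)
  show "norm (coulomb_reg d z) * norm z \<le> 1"
    unfolding e using D d by (simp add: power2_eq_square divide_le_eq)
  have "norm z * d \<le> ?n + d\<^sup>2"
    using sum_squares_bound[of "norm z" d] mult_nonneg_nonneg[OF norm_ge_zero[of z], of d] d by linarith
  then show "norm (coulomb_reg d z) \<le> 1 / d" unfolding e using D d by (simp add: field_simps)
  show "norm (coulomb_reg d z) \<le> norm (coulomb z)"
  proof (cases "z = 0")
    case False
    then show ?thesis unfolding e using D d
      by (simp add: coulomb_def power2_eq_square frac_le divide_inverse[symmetric] field_simps)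
  qed (simp add: coulomb_reg_def coulomb_def)
qed

section \<open>The Euler scheme\<close>

context coupling begin

text \<open>\<open>force lam F t w\<close> does not change the position \<open>fst (lin t w)\<close> on which it depends, so an explicit
  Euler step in profile coordinates is conjugate to a shear: it is invertible and preserves volume.\<close>

primrec euler :: "(real \<Rightarrow> plane \<Rightarrow> plane) \<Rightarrow> real \<Rightarrow> nat \<Rightarrow> phase \<Rightarrow> phase" where
  "euler F h 0 w = w"
| "euler F h (Suc k) w = euler F h k w + h *\<^sub>R force lam F (k * h) (euler F h k w)"

text \<open>The last step has to be undone first, so the recursion applies the inverse of step
  \<open>k\<close> before descending.\<close>

primrec euler_back :: "(real \<Rightarrow> plane \<Rightarrow> plane) \<Rightarrow> real \<Rightarrow> nat \<Rightarrow> phase \<Rightarrow> phase" where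
  "euler_back F h 0 w = w"
| "euler_back F h (Suc k) w = euler_back F h k (w - h *\<^sub>R force lam F (k * h) w)"

lemma force_shift: "force lam F t (w + c *\<^sub>R force lam F t w) = force lam F t w"
  by (simp add: force_def[of lam F t "_ + _"] lin_add lin_scaleR force_lin) (simp add: force_def)

lemma euler_euler_back: "euler F h n (euler_back F h n w) = w"
  using force_shift[of F "real k * h" w "- h" for k w] by (induction n arbitrary: w) auto

lemma euler_back_euler: "euler_back F h n (euler F h n w) = w"
  by (induction n) (simp_all add: force_shift)

lemma mpres_euler_step:
  assumes [measurable]: "F t \<in> borel_measurable borel"
  shows "mpres (\<lambda>w. w + c *\<^sub>R force lam F t w)"
proof -
  let ?K = "\<lambda>z :: phase. (fst z, snd z + (\<lambda>x. (c * lam) *\<^sub>R F t x) (fst z))"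
  have "mpres ?K" by (rule mpres_shear_snd) measurable
  then have "mpres (\<lambda>w. lin (- t) (?K (lin t w)))"
    by (intro mpres_compose[of "lin (- t)" "\<lambda>w. ?K (lin t w)"] mpres_compose[of ?K "lin t"] mpres_lin)
  moreover have "lin (- t) (?K (lin t w)) = w + c *\<^sub>R force lam F t w" for w
  proof -
    have "?K (lin t w) = lin t (w + c *\<^sub>R force lam F t w)"
      by (simp add: lin_add lin_scaleR force_lin prod_eq_iff)
    then show ?thesis by simp
  qed
  ultimately show ?thesis by simp
qed

lemma mpres_euler:
  assumes F: "\<And>k. k < n \<Longrightarrow> F (real k * h) \<in> borel_measurable borel"
  shows "mpres (euler F h n)"
  using F
proof (induction n)
  case 0
  then show ?case using mpres_id by (simp add: euler.simps[abs_def])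
next
  case (Suc n)
  then show ?case
    using mpres_compose[OF mpres_euler_step[of F "real n * h" h], of "euler F h n"] by simp
qed

lemma mpres_euler_back:
  assumes F: "\<And>k. k < n \<Longrightarrow> F (real k * h) \<in> borel_measurable borel"
  shows "mpres (euler_back F h n)"
  using F
proof (induction n)
  case 0
  then show ?case using mpres_id by (simp add: euler_back.simps[abs_def])
next
  case (Suc n)
  then show ?case
    using mpres_compose[OF _ mpres_euler_step[of F "real n * h" "- h"], of "euler_back F h n"] by simp
qed

lemma norm_euler_diff:
  assumes h: "h \<ge> 0" and F: "\<And>k w. k < n \<Longrightarrow> norm (force lam F (real k * h) w) \<le> M"
  shows "k \<le> n \<Longrightarrow> norm (euler F h k w - w) \<le> real k * h * M"
proof (induction k)
  case (Suc k)
  have "norm (euler F h (Suc k) w - w) \<le> norm (euler F h k w - w) + norm (h *\<^sub>R force lam F (real k * h) (euler F h k w))"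
    using norm_triangle_ineq[of "euler F h k w - w" "h *\<^sub>R force lam F (real k * h) (euler F h k w)"] by (simp add: algebra_simps)
  also have "\<dots> \<le> real k * h * M + h * M"
    using Suc h mult_left_mono[OF F[of k "euler F h k w"] h] by (intro add_mono) auto
  finally show ?case by (simp add: algebra_simps)
qed simp

lemma norm_euler_back_diff:
  assumes h: "h \<ge> 0" and F: "\<And>k w. k < n \<Longrightarrow> norm (force lam F (real k * h) w) \<le> M"
  shows "norm (euler_back F h n w - w) \<le> real n * h * M"
  using norm_euler_diff[OF h F, of n n "euler_back F h n w"]
  by (simp add: euler_euler_back norm_minus_commute)

text \<open>Consistency of the scheme is a property of the flow of \<open>a\<close>, by uniform
  continuity of the velocity along its trajectories; \<open>F\<close> enters through its distance to
  \<open>a\<close>. The weight \<open>exp (\<Lambda> * r)\<close> turns the accumulated field error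
  into the factor \<open>1 / (\<Lambda> - exp t)\<close>, which is small for large
  \<open>\<Lambda>\<close>.\<close>

lemma euler_near_flow:
  assumes a: "small_field a" and t: "t \<ge> 0" and \<Lambda>: "\<Lambda> > exp t" and N: "N \<ge> 0" and \<eta>: "\<eta> > 0"
    and F: "\<And>r x. 0 \<le> r \<Longrightarrow> r \<le> t \<Longrightarrow> norm (F r x - a r x) \<le> N * exp (\<Lambda> * r)"
  shows "\<forall>\<^sub>F n in sequentially. \<forall>w. norm w \<le> R \<longrightarrow>
     norm (euler F (t / n) n w - flow lam a 0 w t) \<le> exp t * N / (\<Lambda> - exp t) * exp (\<Lambda> * t) + \<eta>"
proof -
  let ?E = "exp t"
  define \<omega> where "\<omega> = \<eta> / ((t + 1) * exp (?E * t))"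
  have \<omega>: "\<omega> > 0" using \<eta> t by (simp add: \<omega>_def)
  let ?g = "\<lambda>(r, w). force lam a r (flow lam a 0 w r)"
  have "continuous_on UNIV (\<lambda>(t, w). force lam a t w)"
    using a by (intro continuous_force) (auto simp: small_field_def)
  then have "continuous_on ({0..t} \<times> cball 0 R) ?g"
    unfolding case_prod_unfold
    by (intro continuous_on_compose_pair[where f = "force lam a"] continuous_on_compose_triple[OF continuous_flow[OF a]] continuous_intros)
      (simp add: case_prod_unfold)
  then have "uniformly_continuous_on ({0..t} \<times> cball 0 R) ?g"
    by (intro compact_uniformly_continuous compact_Times) auto
  then obtain \<delta> where \<delta>: "\<delta> > 0" "\<And>p q. p \<in> {0..t} \<times> cball 0 R \<Longrightarrow> q \<in> {0..t} \<times> cball 0 R \<Longrightarrow>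
      dist q p < \<delta> \<Longrightarrow> dist (?g q) (?g p) < \<omega>"
    using \<omega> unfolding uniformly_continuous_on_def by meson
  have main: "norm (euler F (t / n) n w - flow lam a 0 w t) \<le> ?E * N / (\<Lambda> - ?E) * exp (\<Lambda> * t) + \<eta>"
    if n: "t / real n < \<delta>" "n > 0" and w: "norm w \<le> R" for n w
  proof -
    define h where "h = t / n"
    have h: "h \<ge> 0" "h < \<delta>" "real n * h = t" using n t by (auto simp: h_def)
    let ?W = "flow lam a 0 w"
    \<comment> \<open>Chosen so that \<open>c * exp (\<Lambda> * r)\<close> is a supersolution of
      the error recursion: \<open>c * (1 + h * exp t) + h * c * (\<Lambda> - exp t) = c * (1 + h *
      \<Lambda>)\<close>.\<close>
    define c where "c = ?E * N / (\<Lambda> - ?E)"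
    have c: "c \<ge> 0" "?E * N = c * (\<Lambda> - ?E)" using N \<Lambda> by (auto simp: c_def)
    have "norm (euler F h k w - ?W (k * h)) \<le> c * exp (\<Lambda> * (k * h)) + \<omega> * (k * h) * exp (?E * (k * h))" if "k \<le> n" for k
      using that
    proof (induction k)
      case 0
      then show ?case using c by (simp add: flow_init a)
    next
      case (Suc k)
      let ?r = "real k * h" and ?z = "euler F h k w" and ?e = "norm (euler F h k w - ?W (k * h))"
      have r: "0 \<le> ?r" "?r + h \<le> t"
        using Suc.prems h mult_right_mono[of "real (Suc k)" "real n" h] by (auto simp: algebra_simps)
      have trunc: "norm (?W (?r + h) - ?W ?r - h *\<^sub>R force lam a ?r (?W ?r)) \<le> h * \<omega>"
      proof -
        have "norm ((?W (?r + h) - (?r + h) *\<^sub>R force lam a ?r (?W ?r)) - (?W ?r - ?r *\<^sub>R force lam a ?r (?W ?r)))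
            \<le> \<omega> * (?r + h) - \<omega> * ?r"
        proof (rule norm_increment_le[of ?r "?r + h" "\<lambda>s. ?W s - s *\<^sub>R force lam a ?r (?W ?r)"
              "\<lambda>s. force lam a s (?W s) - force lam a ?r (?W ?r)" "\<lambda>s. \<omega> * s" "\<lambda>s. \<omega>"])
          fix s assume s: "?r \<le> s" "s \<le> ?r + h"
          show "((\<lambda>s. ?W s - s *\<^sub>R force lam a ?r (?W ?r)) has_vector_derivative force lam a s (?W s) - force lam a ?r (?W ?r)) (at s)"
            by (auto intro!: derivative_eq_intros flow_deriv[OF a])
          have "dist (?g (s, w)) (?g (?r, w)) < \<omega>"
            by (rule \<delta>(2)) (use s r h w order_trans[OF r(1) s(1)] in \<open>auto simp: dist_Pair_Pair dist_real_def\<close>)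
          then show "norm (force lam a s (?W s) - force lam a ?r (?W ?r)) \<le> \<omega>"
            by (simp add: dist_norm)
        qed (use h in \<open>auto intro!: derivative_eq_intros\<close>)
        then show ?thesis by (simp add: algebra_simps)
      qed
      have fdiff: "norm (force lam F ?r ?z - force lam a ?r (?W ?r)) \<le> ?E * N * exp (\<Lambda> * ?r) + ?E * ?e"
      proof -
        have Er: "exp ?r \<le> ?E" using r h by simp
        have "norm (force lam F ?r ?z - force lam a ?r ?z) \<le> exp ?r * (N * exp (\<Lambda> * ?r))"
          using norm_force_diff[of F ?r ?z a ?z] F[of ?r] r h
          by (smt (verit) abs_of_nonneg exp_ge_zero mult_left_mono)
        also have "\<dots> \<le> ?E * (N * exp (\<Lambda> * ?r))" using Er N by (intro mult_right_mono) auto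
        finally have 1: "norm (force lam F ?r ?z - force lam a ?r ?z) \<le> ?E * (N * exp (\<Lambda> * ?r))" .
        have "norm (force lam a ?r ?z - force lam a ?r (?W ?r)) \<le> exp ?r * ?e"
          using force_lipschitz[OF a, of ?r ?z "?W ?r"] r by simp
        also have "\<dots> \<le> ?E * ?e" using Er by (intro mult_right_mono) auto
        finally have 2: "norm (force lam a ?r ?z - force lam a ?r (?W ?r)) \<le> ?E * ?e" .
        show ?thesis
          using norm_triangle_ineq[of "force lam F ?r ?z - force lam a ?r ?z" "force lam a ?r ?z - force lam a ?r (?W ?r)"] 1 2
          by simp
      qed
      have split: "euler F h (Suc k) w - ?W (?r + h) = (?z - ?W ?r) +
          h *\<^sub>R (force lam F ?r ?z - force lam a ?r (?W ?r)) - (?W (?r + h) - ?W ?r - h *\<^sub>R force lam a ?r (?W ?r))"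
        by (simp add: algebra_simps)
      have "norm (euler F h (Suc k) w - ?W (?r + h)) \<le> ?e +
          h * norm (force lam F ?r ?z - force lam a ?r (?W ?r)) + h * \<omega>"
      proof -
        have "norm (p + h *\<^sub>R q - r) \<le> norm p + h * norm q + norm r" for p q r :: phase
          using norm_triangle_ineq4[of "p + h *\<^sub>R q" r] norm_triangle_ineq[of p "h *\<^sub>R q"] h by simp
        from this[of "?z - ?W ?r"] show ?thesis unfolding split by (rule order_trans) (use trunc in auto)
      qed
      also have "\<dots> \<le> ?e + h * (?E * N * exp (\<Lambda> * ?r) + ?E * ?e) + h * \<omega>"
        using fdiff h by (intro add_mono mult_left_mono) auto
      also have "\<dots> = (1 + h * ?E) * ?e + h * (c * (\<Lambda> - ?E)) * exp (\<Lambda> * ?r) + h * \<omega>"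
        unfolding c(2) by (simp add: algebra_simps)
      also have "\<dots> \<le> (1 + h * ?E) * (c * exp (\<Lambda> * ?r) + \<omega> * ?r * exp (?E * ?r)) + h * (c * (\<Lambda> - ?E)) * exp (\<Lambda> * ?r) + h * \<omega>"
        using Suc h c(1) \<Lambda> by (intro add_mono mult_left_mono) auto
      also have "\<dots> = c * exp (\<Lambda> * ?r) * (1 + h * \<Lambda>) + (\<omega> * ?r * (exp (?E * ?r) * (1 + h * ?E)) + h * \<omega> * 1)"
        by (simp add: algebra_simps)
      also have "\<dots> \<le> c * exp (\<Lambda> * ?r) * exp (h * \<Lambda>) + (\<omega> * ?r * (exp (?E * ?r) * exp (h * ?E)) + h * \<omega> * exp (?E * (?r + h)))"
        using c h \<omega> r exp_ge_add_one_self[of "h * \<Lambda>"] exp_ge_add_one_self[of "h * ?E"]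
        by (intro add_mono mult_left_mono) auto
      also have "\<dots> = c * exp (\<Lambda> * (?r + h)) + \<omega> * (?r + h) * exp (?E * (?r + h))"
        by (simp add: algebra_simps exp_add)
      finally show ?case by (simp add: algebra_simps)
    qed
    from this[of n] have "norm (euler F h n w - ?W t) \<le> c * exp (\<Lambda> * t) + \<omega> * t * exp (?E * t)"
      by (simp add: h)
    also have "\<omega> * t * exp (?E * t) \<le> \<eta>"
    proof -
      have "\<omega> * t * exp (?E * t) = \<eta> * (t / (t + 1))" by (simp add: \<omega>_def)
      also have "\<dots> \<le> \<eta> * 1" using t \<eta> by (intro mult_left_mono) auto
      finally show ?thesis by simp
    qed
    finally show ?thesis by (simp add: h_def c_def)
  qed
  have "(\<lambda>n. t / real n) \<longlonglongrightarrow> 0"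
    by (rule lim_const_over_n)
  then have "\<forall>\<^sub>F n in sequentially. t / real n < \<delta>"
    using \<delta>(1) by (auto dest: order_tendstoD)
  then show ?thesis using eventually_gt_at_top[of 0]
    by eventually_elim (use main in blast)
qed

lemma flow_back_lipschitz:
  assumes a: "small_field a" and t: "t \<ge> 0"
  shows "norm (flow lam a t w 0 - flow lam a t z 0) \<le> 16 * exp (2 * t) * norm (w - z)"
proof -
  have "norm (orig a t (lin t w) - orig a t (lin t z)) \<le> 8 * exp t * norm (lin t (w - z))"
    using orig_lipschitz[OF a t] by (simp add: lin_diff)
  also have "\<dots> \<le> 8 * exp t * (2 * exp t * norm (w - z))"
    using norm_lin_le[of t "w - z"] t by (intro mult_left_mono) auto
  also have "\<dots> = 16 * exp (2 * t) * norm (w - z)" by (simp add: mult_exp_exp)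
  finally show ?thesis by (simp add: orig_def)
qed

lemma measurable_small_field: "small_field a \<Longrightarrow> a t \<in> borel_measurable borel"
  unfolding small_field_def
  by (intro borel_measurable_continuous_onI continuous_on_compose_pair[where f = a] continuous_intros) auto

text \<open>Liouville's theorem, from the exact volume preservation of the Euler maps and their
  pointwise convergence in both directions. The scheme is the one above with \<open>F = a\<close>
  and \<open>N = 0\<close>.\<close>

lemma mpres_flow:
  assumes a: "small_field a" and t: "t \<ge> 0"
  shows "mpres (\<lambda>w. flow lam a 0 w t)" and "mpres (\<lambda>w. flow lam a t w 0)"
proof -
  define T where "T n = euler a (t / real (Suc n)) (Suc n)" for n
  define T' where "T' n = euler_back a (t / real (Suc n)) (Suc n)" for n
  have bd: "norm (force lam a r w) \<le> 1" for r w
  proof -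
    have "norm (force lam a r w) \<le> exp \<bar>r\<bar> * (exp (- \<bar>r\<bar>) / 36)"
      using a by (intro order_trans[OF norm_force] mult_left_mono) (auto simp: small_field_def)
    then show ?thesis by (simp flip: exp_add)
  qed
  have T'bd: "norm (T' n w) \<le> norm w + t" for n w
  proof -
    have "norm (T' n w - w) \<le> real (Suc n) * (t / real (Suc n)) * 1"
      unfolding T'_def by (rule norm_euler_back_diff) (use t bd in auto)
    then show ?thesis using norm_triangle_sub[of "T' n w" w] by simp
  qed
  have ev: "\<forall>\<^sub>F n in sequentially. \<forall>w. norm w \<le> R \<longrightarrow> norm (T n w - flow lam a 0 w t) \<le> \<eta>" if "\<eta> > 0" for R \<eta>
  proof -
    have "\<forall>\<^sub>F n in sequentially. \<forall>w. norm w \<le> R \<longrightarrow>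
        norm (euler a (t / n) n w - flow lam a 0 w t) \<le> exp t * 0 / (exp t + 1 - exp t) * exp ((exp t + 1) * t) + \<eta>"
      by (rule euler_near_flow[OF a t]) (use that in auto)
    from eventually_sequentially_Suc[THEN iffD2, OF this] show ?thesis by (simp add: T_def del: euler.simps)
  qed
  have limT: "(\<lambda>n. T n w) \<longlonglongrightarrow> flow lam a 0 w t" for w
  proof (rule tendstoI)
    fix e :: real assume "e > 0"
    then have "\<forall>\<^sub>F n in sequentially. \<forall>z. norm z \<le> norm w \<longrightarrow> norm (T n z - flow lam a 0 z t) \<le> e / 2"
      by (intro ev) simp
    then show "\<forall>\<^sub>F n in sequentially. dist (T n w) (flow lam a 0 w t) < e"
    proof eventually_elim
      case (elim n)
      then have "norm (T n w - flow lam a 0 w t) \<le> e / 2" by blast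
      then show ?case using \<open>e > 0\<close> by (simp add: dist_norm)
    qed
  qed
  \<comment> \<open>The inverse Euler maps converge because \<open>T n\<close> undoes them:
    \<open>T' n w\<close> stays in a fixed ball, there \<open>T n\<close> is uniformly close to the
    flow, and the backward flow is Lipschitz.\<close>
  have limT': "(\<lambda>n. T' n w) \<longlonglongrightarrow> flow lam a t w 0" for w
  proof (rule tendstoI)
    fix e :: real assume e: "e > 0"
    define \<eta> where "\<eta> = e / (32 * exp (2 * t))"
    have "\<forall>\<^sub>F n in sequentially. \<forall>z. norm z \<le> norm w + t \<longrightarrow> norm (T n z - flow lam a 0 z t) \<le> \<eta>"
      using e by (intro ev) (simp add: \<eta>_def)
    then show "\<forall>\<^sub>F n in sequentially. dist (T' n w) (flow lam a t w 0) < e"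
    proof eventually_elim
      case (elim n)
      have "norm (T n (T' n w) - flow lam a 0 (T' n w) t) \<le> \<eta>" using elim T'bd by blast
      then have "norm (flow lam a 0 (T' n w) t - w) \<le> \<eta>"
        unfolding T_def T'_def euler_euler_back by (simp add: norm_minus_commute)
      then have "16 * exp (2 * t) * norm (flow lam a 0 (T' n w) t - w) \<le> 16 * exp (2 * t) * \<eta>"
        by (intro mult_left_mono) auto
      then have "norm (flow lam a t (flow lam a 0 (T' n w) t) 0 - flow lam a t w 0) \<le> 16 * exp (2 * t) * \<eta>"
        by (rule order_trans[OF flow_back_lipschitz[OF a t]])
      also have "\<dots> < e" using e by (simp add: \<eta>_def)
      finally show ?case by (simp add: flow_flow[OF a] flow_init[OF a] dist_norm)
    qed
  qed
  have m: "mpres (T n)" "mpres (T' n)" for n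
    unfolding T_def T'_def by (intro mpres_euler mpres_euler_back measurable_small_field a)+
  have c1: "(\<lambda>w. flow lam a 0 w t) \<in> borel_measurable borel" and c2: "(\<lambda>w. flow lam a t w 0) \<in> borel_measurable borel"
    by (intro borel_measurable_continuous_onI continuous_on_compose_triple[OF continuous_flow[OF a]] continuous_intros)+
  show "mpres (\<lambda>w. flow lam a 0 w t)"
    by (rule mpres_limit[OF m(1) limT m(2) limT' c1 c2]) (simp add: flow_flow flow_init a)
  show "mpres (\<lambda>w. flow lam a t w 0)"
    by (rule mpres_limit[OF m(2) limT' m(1) limT c2 c1]) (simp add: flow_flow flow_init a)
qed

lemma mpres_orig: "small_field a \<Longrightarrow> t \<ge> 0 \<Longrightarrow> mpres (orig a t)"
  unfolding orig_def by (intro mpres_compose[of "\<lambda>w. flow lam a t w 0" "lin (- t)"] mpres_flow mpres_lin)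

end

section \<open>Densities and fields of transported data\<close>

lemma cosh_bounds: "exp t / 2 \<le> cosh t" "t \<ge> 0 \<Longrightarrow> cosh t \<le> exp t" for t :: real
  by (simp_all add: cosh_def)

lemma continuous_on_integral_dominated:
  fixes f :: "'p::metric_space \<Rightarrow> 'a \<Rightarrow> 'b::{banach, second_countable_topology}"
  assumes f: "\<And>z. continuous_on S (\<lambda>p. f p z)" and m: "\<And>p. p \<in> S \<Longrightarrow> f p \<in> borel_measurable M"
    and w: "integrable M w" and le: "\<And>p z. p \<in> S \<Longrightarrow> norm (f p z) \<le> w z"
  shows "continuous_on S (\<lambda>p. \<integral>z. f p z \<partial>M)"
  unfolding continuous_on_sequentially
proof (intro allI ballI impI)
  fix x a assume a: "a \<in> S" and x: "(\<forall>n. x n \<in> S) \<and> x \<longlonglongrightarrow> a"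
  show "((\<lambda>p. \<integral>z. f p z \<partial>M) \<circ> x) \<longlonglongrightarrow> (\<integral>z. f a z \<partial>M)"
    unfolding o_def
  proof (rule integral_dominated_convergence[OF m[OF a] _ w])
    show "AE z in M. (\<lambda>n. f (x n) z) \<longlonglongrightarrow> f a z"
      using f a x by (intro AE_I2) (auto simp: continuous_on_sequentially o_def)
  qed (use x m le in auto)
qed

lemma measurable_coulomb [measurable]: "coulomb \<in> borel_measurable borel"
  unfolding coulomb_def[abs_def] by measurable

lemma measurable_coulomb_reg [measurable]: "coulomb_reg d \<in> borel_measurable borel"
  unfolding coulomb_reg_def[abs_def] by measurable

lemma measurable_coulomb_near [measurable]: "coulomb_near d \<in> borel_measurable borel"
  unfolding coulomb_near_def[abs_def] by measurable

lemma continuous_on_coulomb_reg: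
  assumes "d > 0" shows "continuous_on S (coulomb_reg d)"
proof -
  have "(norm z)\<^sup>2 + d\<^sup>2 \<noteq> 0" for z :: plane using assms by (metis add_nonneg_pos less_irrefl zero_le_power2 zero_less_power)
  then show ?thesis unfolding coulomb_reg_def[abs_def] by (intro continuous_intros) auto
qed

text \<open>The kernel depends on the position alone, so the densities may be compared after
  integration over velocities; the integral of the kernel then costs
  \<open>12 * pi * d\<close>.\<close>

lemma near_field_diff:
  fixes f g :: "phase \<Rightarrow> real"
  assumes [measurable]: "f \<in> borel_measurable borel" "g \<in> borel_measurable borel"
    and f: "integrable lborel (\<lambda>z. f z *\<^sub>R coulomb_near d (x - fst z))"
    and g: "integrable lborel (\<lambda>z. g z *\<^sub>R coulomb_near d (x - fst z))"
    and d: "d > 0" and c: "c \<ge> 0"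
    and fg: "\<And>y. (\<integral>\<^sup>+v. ennreal \<bar>f (y, v) - g (y, v)\<bar> \<partial>lborel) \<le> ennreal c"
  shows "norm ((\<integral>z. f z *\<^sub>R coulomb_near d (x - fst z) \<partial>lborel) - (\<integral>z. g z *\<^sub>R coulomb_near d (x - fst z) \<partial>lborel)) \<le> 12 * pi * d * c"
proof -
  have "ennreal (norm (\<integral>z. (f z - g z) *\<^sub>R coulomb_near d (x - fst z) \<partial>lborel))
      \<le> (\<integral>\<^sup>+z. norm ((f z - g z) *\<^sub>R coulomb_near d (x - fst z)) \<partial>lborel)"
    using Bochner_Integration.integrable_diff[OF f g]
    by (intro integral_norm_bound_ennreal) (simp add: scaleR_diff_left)
  also have "\<dots> = (\<integral>\<^sup>+y. \<integral>\<^sup>+v. ennreal (norm (coulomb_near d (x - y))) * ennreal \<bar>f (y, v) - g (y, v)\<bar> \<partial>lborel \<partial>lborel)"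
    by (subst nn_integral_lborel_fst) (auto simp: ennreal_mult' mult.commute)
  also have "\<dots> = (\<integral>\<^sup>+y. ennreal (norm (coulomb_near d (x - y))) * (\<integral>\<^sup>+v. ennreal \<bar>f (y, v) - g (y, v)\<bar> \<partial>lborel) \<partial>lborel)"
    by (intro nn_integral_cong nn_integral_cmult) measurable
  also have "\<dots> \<le> (\<integral>\<^sup>+y. ennreal (norm (coulomb_near d (x - y))) * ennreal c \<partial>lborel)"
    by (intro nn_integral_mono mult_left_mono fg) auto
  also have "\<dots> = (\<integral>\<^sup>+y. ennreal (norm (coulomb_near d y)) \<partial>lborel) * ennreal c"
    using mpres_nn_integral[OF mpres_uminus_plane, of "\<lambda>y. ennreal (norm (coulomb_near d y))" x]
    by (simp add: nn_integral_multc)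
  also have "\<dots> \<le> ennreal (12 * pi * d) * ennreal c"
    by (intro mult_right_mono nn_integral_coulomb_near d) auto
  also have "\<dots> = ennreal (12 * pi * d * c)" using d by (intro ennreal_mult[symmetric]) (auto simp: c)
  finally have "norm (\<integral>z. (f z - g z) *\<^sub>R coulomb_near d (x - fst z) \<partial>lborel) \<le> 12 * pi * d * c"
    using d c by (subst (asm) ennreal_le_iff) auto
  then show ?thesis
    using Bochner_Integration.integral_diff[OF f g] by (simp add: scaleR_diff_left)
qed

definition kernel_integral :: "(plane \<Rightarrow> plane) \<Rightarrow> (phase \<Rightarrow> real) \<Rightarrow> plane \<Rightarrow> plane" where
  "kernel_integral k g x = (\<integral>z. (g z)\<^sup>2 *\<^sub>R k (x - fst z) \<partial>lborel)"

lemma field_integrand_eq: "field_integrand g x z = (g z)\<^sup>2 *\<^sub>R coulomb (x - fst z)"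
  by (cases z) (simp add: field_integrand_def coulomb_def)

lemma efield_eq: "efield g x = (1 / (2 * pi)) *\<^sub>R kernel_integral coulomb g x"
  by (simp add: efield_def kernel_integral_def field_integrand_eq)

text \<open>The value \<open>64 * pi / L\<^sup>2\<close> of the level set estimate for the expansion
  rate \<open>L = cosh t / 2\<close>.\<close>

definition density_bound :: "real \<Rightarrow> real" where "density_bound t = 256 * pi / (cosh t)\<^sup>2"

text \<open>Up to the common factor \<open>1 / cosh t\<close>, the term
  \<open>1024 * pi\<^sup>2\<close> is \<open>density_bound\<close> times the integral
  \<open>4 * pi * cosh t\<close> of a singular kernel over the ball of radius \<open>cosh t\<close>,
  and 1 comes from the total mass outside that ball.\<close>

definition singular_const :: real where "singular_const = 1024 * pi\<^sup>2 + 1"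

lemma density_bound_pos: "density_bound t > 0"
  by (simp add: density_bound_def)

lemma singular_const_pos: "singular_const > 0"
  by (simp add: singular_const_def add_nonneg_pos)

section \<open>Transported densities\<close>

locale transported_data = coupling +
  fixes \<mu>0 :: "phase \<Rightarrow> real" and \<epsilon> :: real
  assumes eps: "\<epsilon> > 0"
    and cont: "continuous_on UNIV \<mu>0"
    and decay: "\<bar>\<mu>0 z\<bar> \<le> \<epsilon> / bracket (snd z) ^ 3"
    and lipschitz: "\<bar>\<mu>0 y - \<mu>0 z\<bar> \<le> \<epsilon> * norm (y - z)"
    and mass: "(\<integral>\<^sup>+z. ennreal ((bracket (snd z) * \<mu>0 z)\<^sup>2) \<partial>lborel) \<le> ennreal (\<epsilon>\<^sup>2)"
begin

text \<open>The two extra powers of the bracket pay for displacements that grow with the initial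
  velocity.\<close>

definition wt :: "phase \<Rightarrow> real" where "wt z = (bracket (snd z) * \<mu>0 z)\<^sup>2"

definition mu :: "(real \<Rightarrow> plane \<Rightarrow> plane) \<Rightarrow> real \<Rightarrow> phase \<Rightarrow> real" where
  "mu a t z = \<mu>0 (orig a t z)"

lemma measurable_mu0 [measurable]: "\<mu>0 \<in> borel_measurable borel"
  by (intro borel_measurable_continuous_onI cont)

lemma measurable_wt [measurable]: "wt \<in> borel_measurable borel"
  unfolding wt_def[abs_def] by measurable

text \<open>The square of \<open>\<mu>0\<close> decays with six powers of the bracket. The weight
  spends two, and the remaining four cover the three that make velocity integrals finite.\<close>

lemma wt_le: "wt z \<le> \<epsilon>\<^sup>2 * (1 / bracket (snd z) ^ 3)"
proof -
  let ?b = "bracket (snd z)"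
  have "\<bar>?b * \<mu>0 z\<bar> \<le> ?b * (\<epsilon> / ?b ^ 3)"
    using mult_left_mono[OF decay[of z] less_imp_le[OF bracket_pos]] bracket_pos[of "snd z"]
    by (simp only: abs_mult abs_of_pos)
  also have "\<dots> = \<epsilon> / ?b\<^sup>2" using bracket_pos[of "snd z"] by (simp add: power2_eq_square power3_eq_cube)
  finally have "wt z \<le> (\<epsilon> / ?b\<^sup>2)\<^sup>2"
    unfolding wt_def using abs_le_square_iff[of "?b * \<mu>0 z" "\<epsilon> / ?b\<^sup>2"] eps by simp
  also have "\<dots> = \<epsilon>\<^sup>2 * (1 / ?b ^ 4)" by (simp add: power_divide flip: power_mult)
  also have "\<dots> \<le> \<epsilon>\<^sup>2 * (1 / ?b ^ 3)"
    using bracket_pos[of "snd z"] bracket_ge_1[of "snd z"] by (intro mult_left_mono divide_left_mono power_increasing) auto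
  finally show ?thesis .
qed

lemma wt_nonneg [simp]: "wt z \<ge> 0" by (simp add: wt_def)

lemma sq_le_wt: "(\<mu>0 z)\<^sup>2 \<le> wt z"
  using mult_right_mono[OF one_le_power[OF bracket_ge_1[of "snd z"], of 2], of "(\<mu>0 z)\<^sup>2"]
  by (simp add: wt_def power_mult_distrib)

lemma mass_wt: "(\<integral>\<^sup>+z. ennreal (wt z) \<partial>lborel) \<le> ennreal (\<epsilon>\<^sup>2)"
  using mass by (simp add: wt_def)

lemma integrable_wt: "integrable lborel wt"
  using mass_wt by (intro integrableI_bounded) (auto intro: le_less_trans)

lemma integrable_sq: "integrable lborel (\<lambda>z. (\<mu>0 z)\<^sup>2)"
  by (rule Bochner_Integration.integrable_bound[OF integrable_wt]) (auto simp: sq_le_wt)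

lemma measurable_orig [measurable]: "small_field a \<Longrightarrow> orig a t \<in> borel_measurable borel"
  by (intro borel_measurable_continuous_onI continuous_on_compose_pair[where f = "orig a"] continuous_orig continuous_intros)

lemma measurable_traj [measurable]: "small_field a \<Longrightarrow> traj a t \<in> borel_measurable borel"
  by (intro borel_measurable_continuous_onI continuous_on_compose_pair[where f = "traj a"] continuous_traj continuous_intros)

lemma measurable_position [measurable]: "small_field a \<Longrightarrow> (\<lambda>z. fst (traj a t z)) \<in> borel_measurable borel"
  using measurable_compose[OF measurable_traj measurable_fst_borel] .

lemma nn_integral_velocity:
  assumes a: "small_field a" and t: "t \<ge> 0"
  shows "(\<integral>\<^sup>+v. ennreal (1 / bracket (snd (orig a t (x, v))) ^ 3) \<partial>lborel) \<le> ennreal (density_bound t)"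
proof -
  note [measurable] = measurable_orig[OF a]
  have "(\<integral>\<^sup>+v. ennreal (1 / bracket ((\<lambda>v. snd (orig a t (x, v))) v) ^ 3) \<partial>lborel) \<le> ennreal (64 * pi / (cosh t / 2)\<^sup>2)"
    by (rule nn_integral_expanding_bracket) (use orig_velocity_expansion[OF a t] in \<open>auto simp: cosh_real_pos\<close>)
  also have "64 * pi / (cosh t / 2)\<^sup>2 = density_bound t" by (simp add: density_bound_def power_divide)
  finally show ?thesis .
qed

text \<open>By duality a bound on the spatial density at time \<open>t\<close>: volume preservation
  moves the integral to time \<open>t\<close>, where \<open>q\<close> no longer depends on the
  velocity and the velocity integral is at most \<open>density_bound t\<close>.\<close>

lemma nn_integral_position_le:
  assumes a: "small_field a" and t: "t \<ge> 0"
    and q[measurable]: "q \<in> borel_measurable borel" and g[measurable]: "g \<in> borel_measurable borel"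
    and le: "\<And>z. g z \<le> c * (1 / bracket (snd z) ^ 3)" and c: "c \<ge> 0"
  shows "(\<integral>\<^sup>+z. q (fst (traj a t z)) * ennreal (g z) \<partial>lborel) \<le> ennreal (c * density_bound t) * (\<integral>\<^sup>+x. q x \<partial>lborel)"
proof -
  note [measurable] = measurable_orig[OF a] measurable_traj[OF a]
  have "(\<integral>\<^sup>+z. q (fst (traj a t z)) * ennreal (g z) \<partial>lborel) =
      (\<integral>\<^sup>+z. q (fst (traj a t (orig a t z))) * ennreal (g (orig a t z)) \<partial>lborel)"
    by (rule mpres_nn_integral[OF mpres_orig[OF a t], symmetric, of "\<lambda>z. q (fst (traj a t z)) * ennreal (g z)"]) measurable
  also have "\<dots> = (\<integral>\<^sup>+x. \<integral>\<^sup>+v. q x * ennreal (g (orig a t (x, v))) \<partial>lborel \<partial>lborel)"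
    unfolding traj_orig[OF a] by (subst nn_integral_lborel_fst) auto
  also have "\<dots> = (\<integral>\<^sup>+x. q x * (\<integral>\<^sup>+v. ennreal (g (orig a t (x, v))) \<partial>lborel) \<partial>lborel)"
    by (intro nn_integral_cong nn_integral_cmult) measurable
  also have "\<dots> \<le> (\<integral>\<^sup>+x. q x * ennreal (c * density_bound t) \<partial>lborel)"
  proof (intro nn_integral_mono mult_left_mono)
    fix x
    have "(\<integral>\<^sup>+v. ennreal (g (orig a t (x, v))) \<partial>lborel) \<le> (\<integral>\<^sup>+v. ennreal c * ennreal (1 / bracket (snd (orig a t (x, v))) ^ 3) \<partial>lborel)"
    proof (rule nn_integral_mono)
      fix v
      show "ennreal (g (orig a t (x, v))) \<le> ennreal c * ennreal (1 / bracket (snd (orig a t (x, v))) ^ 3)"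
        using ennreal_leI[OF le[of "orig a t (x, v)"]] by (simp only: ennreal_mult'[OF c])
    qed
    also have "\<dots> = ennreal c * (\<integral>\<^sup>+v. ennreal (1 / bracket (snd (orig a t (x, v))) ^ 3) \<partial>lborel)"
      by (rule nn_integral_cmult) measurable
    also have "\<dots> \<le> ennreal c * ennreal (density_bound t)"
      by (intro mult_left_mono nn_integral_velocity a t) auto
    also have "\<dots> = ennreal (c * density_bound t)"
      using c by (simp add: ennreal_mult')
    finally show "(\<integral>\<^sup>+v. ennreal (g (orig a t (x, v))) \<partial>lborel) \<le> ennreal (c * density_bound t)" .
  qed auto
  also have "\<dots> = ennreal (c * density_bound t) * (\<integral>\<^sup>+x. q x \<partial>lborel)"
    by (simp add: nn_integral_multc mult.commute)
  finally show ?thesis .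
qed

lemma nn_integral_singular_kernel:
  assumes a: "small_field a" and t: "t \<ge> 0"
    and [measurable]: "k \<in> borel_measurable borel" and k: "\<And>z. k z * norm z \<le> 1"
  shows "(\<integral>\<^sup>+z. ennreal (k (x - fst (traj a t z))) * ennreal (wt z) \<partial>lborel) \<le> ennreal (singular_const * \<epsilon>\<^sup>2 / cosh t)"
proof -
  \<comment> \<open>This radius balances the two parts: density times radius inside and mass over
    radius outside are both of order \<open>1 / cosh t\<close>.\<close>
  let ?r = "cosh t"
  define q where "q y = ennreal (k y) * indicator (ball 0 ?r) y" for y
  have [measurable]: "ball (0 :: plane) ?r \<in> sets borel" by simp
  have q [measurable]: "q \<in> borel_measurable borel" unfolding q_def[abs_def] by measurable
  have r: "?r > 0" by (rule cosh_real_pos)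
  have 1: "(\<lambda>z. q (x - fst (traj a t z)) * ennreal (wt z)) \<in> borel_measurable lborel"
    using measurable_compose[OF measurable_position[OF a, of t], of "\<lambda>y. q (x - y)"] by simp
  have "(\<integral>\<^sup>+z. ennreal (k (x - fst (traj a t z))) * ennreal (wt z) \<partial>lborel) \<le>
      (\<integral>\<^sup>+z. q (x - fst (traj a t z)) * ennreal (wt z) + ennreal (1 / ?r) * ennreal (wt z) \<partial>lborel)"
  proof (rule nn_integral_mono)
    fix z
    let ?y = "x - fst (traj a t z)"
    show "ennreal (k ?y) * ennreal (wt z) \<le> q ?y * ennreal (wt z) + ennreal (1 / ?r) * ennreal (wt z)"
    proof (cases "norm ?y < ?r")
      case False
      then have y: "norm ?y > 0" "?r \<le> norm ?y" using r by auto
      have "k ?y \<le> 1 / norm ?y" using k[of ?y] y by (simp add: field_simps)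
      also have "\<dots> \<le> 1 / ?r" using y r by (simp add: frac_le)
      finally have "ennreal (k ?y) * ennreal (wt z) \<le> ennreal (1 / ?r) * ennreal (wt z)"
        by (intro mult_right_mono ennreal_leI) auto
      then show ?thesis by (simp add: add_increasing)
    qed (simp add: q_def)
  qed
  also have "\<dots> = (\<integral>\<^sup>+z. q (x - fst (traj a t z)) * ennreal (wt z) \<partial>lborel) + ennreal (1 / ?r) * (\<integral>\<^sup>+z. ennreal (wt z) \<partial>lborel)"
    by (subst nn_integral_add[OF 1]) (auto simp: nn_integral_cmult)
  also have "\<dots> \<le> ennreal (\<epsilon>\<^sup>2 * density_bound t) * (\<integral>\<^sup>+y. q (x - y) \<partial>lborel) + ennreal (1 / ?r) * ennreal (\<epsilon>\<^sup>2)"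
    by (intro add_mono mult_left_mono mass_wt nn_integral_position_le[OF a t, where q = "\<lambda>y. q (x - y)", OF _ _ wt_le]) auto
  also have "(\<integral>\<^sup>+y. q (x - y) \<partial>lborel) = (\<integral>\<^sup>+y. q y \<partial>lborel)"
    by (rule mpres_nn_integral[OF mpres_uminus_plane q])
  also have "ennreal (\<epsilon>\<^sup>2 * density_bound t) * (\<integral>\<^sup>+y. q y \<partial>lborel) + ennreal (1 / ?r) * ennreal (\<epsilon>\<^sup>2) \<le>
      ennreal (\<epsilon>\<^sup>2 * density_bound t) * ennreal (4 * pi * ?r) + ennreal (1 / ?r) * ennreal (\<epsilon>\<^sup>2)"
    unfolding q_def by (intro add_right_mono mult_left_mono nn_integral_inverse_norm_ball[OF k r]) auto
  also have "\<dots> = ennreal (\<epsilon>\<^sup>2 * density_bound t * (4 * pi * ?r) + 1 / ?r * \<epsilon>\<^sup>2)"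
    using r density_bound_pos[of t]
    by (simp only: ennreal_mult''[symmetric] ennreal_plus[symmetric] zero_le_power2 mult_nonneg_nonneg
        less_imp_le pi_gt_zero zero_le_numeral zero_le_divide_1_iff)
  also have "\<epsilon>\<^sup>2 * density_bound t * (4 * pi * ?r) + 1 / ?r * \<epsilon>\<^sup>2 = singular_const * \<epsilon>\<^sup>2 / cosh t"
    using r by (simp add: density_bound_def singular_const_def field_simps power2_eq_square)
  finally show ?thesis .
qed

lemma nn_integral_near_kernel:
  assumes a: "small_field a" and t: "t \<ge> 0" and d: "d > 0"
  shows "(\<integral>\<^sup>+z. ennreal (norm (coulomb_near d (x - fst (traj a t z)))) * ennreal (wt z) \<partial>lborel)
    \<le> ennreal (\<epsilon>\<^sup>2 * density_bound t * (12 * pi * d))"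
proof -
  have "(\<integral>\<^sup>+z. ennreal (norm (coulomb_near d (x - fst (traj a t z)))) * ennreal (wt z) \<partial>lborel)
      \<le> ennreal (\<epsilon>\<^sup>2 * density_bound t) * (\<integral>\<^sup>+y. ennreal (norm (coulomb_near d (x - y))) \<partial>lborel)"
    by (rule nn_integral_position_le[OF a t, where q = "\<lambda>y. ennreal (norm (coulomb_near d (x - y)))", OF _ _ wt_le]) auto
  also have "(\<integral>\<^sup>+y. ennreal (norm (coulomb_near d (x - y))) \<partial>lborel) = (\<integral>\<^sup>+y. ennreal (norm (coulomb_near d y)) \<partial>lborel)"
    by (rule mpres_nn_integral[OF mpres_uminus_plane, of "\<lambda>y. ennreal (norm (coulomb_near d y))"]) measurable
  also have "ennreal (\<epsilon>\<^sup>2 * density_bound t) * \<dots> \<le> ennreal (\<epsilon>\<^sup>2 * density_bound t) * ennreal (12 * pi * d)"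
    by (intro mult_left_mono nn_integral_coulomb_near d) auto
  also have "\<dots> = ennreal (\<epsilon>\<^sup>2 * density_bound t * (12 * pi * d))"
    using density_bound_pos[of t] by (intro ennreal_mult[symmetric]) (use d in auto)
  finally show ?thesis .
qed

section \<open>Fields of transported data, integrated along trajectories\<close>

definition lagrangian :: "(real \<Rightarrow> plane \<Rightarrow> plane) \<Rightarrow> (plane \<Rightarrow> plane) \<Rightarrow> real \<Rightarrow> plane \<Rightarrow> plane" where
  "lagrangian a k t x = (\<integral>z. (\<mu>0 z)\<^sup>2 *\<^sub>R k (x - fst (traj a t z)) \<partial>lborel)"

lemma measurable_lagrangian_integrand:
  fixes k :: "plane \<Rightarrow> plane"
  assumes "small_field a" and [measurable]: "k \<in> borel_measurable borel"
  shows "(\<lambda>z. (\<mu>0 z)\<^sup>2 *\<^sub>R k (x - fst (traj a t z))) \<in> borel_measurable borel"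
proof -
  have "(\<lambda>y. k (x - y)) \<in> borel_measurable borel" by measurable
  from measurable_compose[OF measurable_position[OF assms(1)] this]
  have "(\<lambda>z. k (x - fst (traj a t z))) \<in> borel_measurable borel" .
  then show ?thesis by (rule borel_measurable_scaleR[rotated]) measurable
qed

lemma kernel_integral_mu:
  assumes a: "small_field a" and t: "t \<ge> 0" and k: "k \<in> borel_measurable borel"
  shows "kernel_integral k (mu a t) x = lagrangian a k t x"
  using mpres_integral[OF mpres_orig[OF a t] measurable_lagrangian_integrand[OF a k, where x = x and t = t]]
  by (simp add: kernel_integral_def lagrangian_def mu_def traj_orig[OF a])

lemma integrable_kernel_mu:
  fixes k :: "plane \<Rightarrow> plane"
  assumes a: "small_field a" and t: "t \<ge> 0" and k: "k \<in> borel_measurable borel"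
    and i: "integrable lborel (\<lambda>z. (\<mu>0 z)\<^sup>2 *\<^sub>R k (x - fst (traj a t z)))"
  shows "integrable lborel (\<lambda>z. (mu a t z)\<^sup>2 *\<^sub>R k (x - fst z))"
  using mpres_integrable[OF mpres_orig[OF a t] measurable_lagrangian_integrand[OF a k, where x = x and t = t]] i
  by (simp add: mu_def traj_orig[OF a])

lemma norm_lagrangian_integrand:
  "ennreal (norm ((\<mu>0 z)\<^sup>2 *\<^sub>R u)) \<le> ennreal (norm u) * ennreal (wt z)"
  using mult_left_mono[OF sq_le_wt[of z], of "norm u"] by (simp add: mult.commute ennreal_leI flip: ennreal_mult')

lemma lagrangian_bound:
  assumes a: "small_field a" and k: "k \<in> borel_measurable borel"
    and B: "(\<integral>\<^sup>+z. ennreal (norm (k (x - fst (traj a t z)))) * ennreal (wt z) \<partial>lborel) \<le> ennreal B" and B0: "B \<ge> 0"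
  shows "integrable lborel (\<lambda>z. (\<mu>0 z)\<^sup>2 *\<^sub>R k (x - fst (traj a t z)))" and "norm (lagrangian a k t x) \<le> B"
proof -
  have le: "(\<integral>\<^sup>+z. norm ((\<mu>0 z)\<^sup>2 *\<^sub>R k (x - fst (traj a t z))) \<partial>lborel) \<le> ennreal B"
    by (rule order_trans[OF nn_integral_mono B]) (rule norm_lagrangian_integrand)
  show i: "integrable lborel (\<lambda>z. (\<mu>0 z)\<^sup>2 *\<^sub>R k (x - fst (traj a t z)))"
    using le measurable_lagrangian_integrand[OF a k] by (intro integrableI_bounded) (auto intro: le_less_trans)
  have "ennreal (norm (lagrangian a k t x)) \<le> ennreal B"
    unfolding lagrangian_def by (rule order_trans[OF integral_norm_bound_ennreal[OF i] le])
  then show "norm (lagrangian a k t x) \<le> B" using B0 by simp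
qed

lemma lagrangian_singular:
  assumes a: "small_field a" and t: "t \<ge> 0" and k: "k \<in> borel_measurable borel" "\<And>z. norm (k z) * norm z \<le> 1"
  shows "integrable lborel (\<lambda>z. (\<mu>0 z)\<^sup>2 *\<^sub>R k (x - fst (traj a t z)))"
    and "norm (lagrangian a k t x) \<le> singular_const * \<epsilon>\<^sup>2 / cosh t"
  by (rule lagrangian_bound[OF a k(1)],
      rule nn_integral_singular_kernel[OF a t, of "\<lambda>z. norm (k z)", OF measurable_compose[OF k(1) borel_measurable_norm] k(2)],
      use singular_const_pos in simp)+

lemma lagrangian_near:
  assumes a: "small_field a" and t: "t \<ge> 0" and d: "d > 0"
  shows "integrable lborel (\<lambda>z. (\<mu>0 z)\<^sup>2 *\<^sub>R coulomb_near d (x - fst (traj a t z)))"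
    and "norm (lagrangian a (coulomb_near d) t x) \<le> \<epsilon>\<^sup>2 * density_bound t * (12 * pi * d)"
  by (rule lagrangian_bound[OF a measurable_coulomb_near nn_integral_near_kernel[OF a t d]],
      use density_bound_pos[of t] d in simp)+

lemma coulomb_split: "coulomb z = coulomb_reg d z + coulomb_near d z"
  by (simp add: coulomb_near_def)

lemma lagrangian_split:
  assumes a: "small_field a" and t: "t \<ge> 0" and d: "d > 0"
  shows "lagrangian a coulomb t x = lagrangian a (coulomb_reg d) t x + lagrangian a (coulomb_near d) t x"
  unfolding lagrangian_def coulomb_split[of _ d] scaleR_add_right
  by (intro Bochner_Integration.integral_add lagrangian_singular[OF a t] lagrangian_near[OF a t d] norm_coulomb_reg d) auto

lemma nn_integral_bessel_kernel:
  assumes a: "small_field a" and t: "t \<ge> 0"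
  shows "(\<integral>\<^sup>+z. ennreal (1 / sqrt ((norm (x - fst (traj a t z)))\<^sup>2 + d\<^sup>2)) * ennreal (wt z) \<partial>lborel)
    \<le> ennreal (singular_const * \<epsilon>\<^sup>2 / cosh t)"
proof (rule nn_integral_singular_kernel[OF a t, of "\<lambda>z. 1 / sqrt ((norm z)\<^sup>2 + d\<^sup>2)"])
  show "1 / sqrt ((norm z)\<^sup>2 + d\<^sup>2) * norm z \<le> 1" for z :: plane
  proof (cases "z = 0")
    case False
    then have "0 < sqrt ((norm z)\<^sup>2 + d\<^sup>2)" by (simp add: add_pos_nonneg)
    moreover have "norm z \<le> sqrt ((norm z)\<^sup>2 + d\<^sup>2)" by (rule real_le_rsqrt) simp
    ultimately show ?thesis by (simp add: divide_le_eq)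
  qed simp
qed measurable

text \<open>The Lipschitz bound of the kernel is singular only like \<open>1 / norm\<close>, and
  \<open>wt\<close> contains the factor \<open>(bracket (snd z))\<^sup>2\<close> allowed for the
  displacement. The map \<open>Y\<close> stands for translated positions, for positions in another
  field, or for asymptotic positions.\<close>

lemma regular_field_diff:
  fixes Y :: "phase \<Rightarrow> plane"
  assumes a: "small_field a" and t: "t \<ge> 0" and d: "d > 0"
    and Y[measurable]: "Y \<in> borel_measurable borel" and \<delta>: "\<delta> \<ge> 0"
    and le: "\<And>z. norm (Y z - (x - fst (traj a t z))) \<le> \<delta> * (bracket (snd z))\<^sup>2"
  shows "norm ((\<integral>z. (\<mu>0 z)\<^sup>2 *\<^sub>R coulomb_reg d (Y z) \<partial>lborel) - lagrangian a (coulomb_reg d) t x)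
    \<le> \<delta> / d * (singular_const * \<epsilon>\<^sup>2 / cosh t)"
proof -
  let ?P = "\<lambda>z. x - fst (traj a t z)"
  let ?R = "\<lambda>z. 1 / sqrt ((norm (?P z))\<^sup>2 + d\<^sup>2)"
  have iY: "integrable lborel (\<lambda>z. (\<mu>0 z)\<^sup>2 *\<^sub>R coulomb_reg d (Y z))"
    by (rule Bochner_Integration.integrable_bound[of _ "\<lambda>z. (\<mu>0 z)\<^sup>2 * (1 / d)"])
       (use integrable_sq norm_coulomb_reg(2)[OF d] in \<open>auto intro!: AE_I2 mult_left_mono integrable_mult_left simp: abs_mult abs_of_pos[OF d] simp del: times_divide_eq_right\<close>)
  have iP: "integrable lborel (\<lambda>z. (\<mu>0 z)\<^sup>2 *\<^sub>R coulomb_reg d (?P z))"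
    by (intro lagrangian_singular[OF a t] norm_coulomb_reg d) auto
  have "ennreal (norm (\<integral>z. (\<mu>0 z)\<^sup>2 *\<^sub>R coulomb_reg d (Y z) - (\<mu>0 z)\<^sup>2 *\<^sub>R coulomb_reg d (?P z) \<partial>lborel))
      \<le> (\<integral>\<^sup>+z. norm ((\<mu>0 z)\<^sup>2 *\<^sub>R coulomb_reg d (Y z) - (\<mu>0 z)\<^sup>2 *\<^sub>R coulomb_reg d (?P z)) \<partial>lborel)"
    by (intro integral_norm_bound_ennreal Bochner_Integration.integrable_diff iY iP)
  also have "\<dots> \<le> (\<integral>\<^sup>+z. ennreal (\<delta> / d) * (ennreal (?R z) * ennreal (wt z)) \<partial>lborel)"
  proof (rule nn_integral_mono)
    fix z
    have "norm (coulomb_reg d (Y z) - coulomb_reg d (?P z)) \<le> norm (Y z - ?P z) / (d * sqrt ((norm (?P z))\<^sup>2 + d\<^sup>2))"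
      by (rule coulomb_reg_lipschitz[OF d])
    also have "\<dots> \<le> \<delta> * (bracket (snd z))\<^sup>2 / (d * sqrt ((norm (?P z))\<^sup>2 + d\<^sup>2))"
      using le[of z] d by (intro divide_right_mono) auto
    finally have "(\<mu>0 z)\<^sup>2 * norm (coulomb_reg d (Y z) - coulomb_reg d (?P z)) \<le> (\<mu>0 z)\<^sup>2 * (\<delta> * (bracket (snd z))\<^sup>2 / (d * sqrt ((norm (?P z))\<^sup>2 + d\<^sup>2)))"
      by (rule mult_left_mono) simp
    also have "\<dots> = \<delta> / d * (?R z * wt z)" by (simp add: wt_def power_mult_distrib)
    finally have "norm ((\<mu>0 z)\<^sup>2 *\<^sub>R coulomb_reg d (Y z) - (\<mu>0 z)\<^sup>2 *\<^sub>R coulomb_reg d (?P z)) \<le> \<delta> / d * (?R z * wt z)"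
      by (simp flip: scaleR_diff_right)
    moreover have "0 \<le> \<delta> / d" "0 \<le> ?R z" using d \<delta> by simp_all
    ultimately show "ennreal (norm ((\<mu>0 z)\<^sup>2 *\<^sub>R coulomb_reg d (Y z) - (\<mu>0 z)\<^sup>2 *\<^sub>R coulomb_reg d (?P z)))
        \<le> ennreal (\<delta> / d) * (ennreal (?R z) * ennreal (wt z))"
      by (metis ennreal_leI ennreal_mult')
  qed
  also have "\<dots> = ennreal (\<delta> / d) * (\<integral>\<^sup>+z. ennreal (?R z) * ennreal (wt z) \<partial>lborel)"
  proof (rule nn_integral_cmult)
    have "(\<lambda>y. ennreal (1 / sqrt ((norm (x - y))\<^sup>2 + d\<^sup>2))) \<in> borel_measurable borel" by measurable
    from measurable_compose[OF measurable_position[OF a] this]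
    show "(\<lambda>z. ennreal (?R z) * ennreal (wt z)) \<in> borel_measurable lborel" by measurable
  qed
  also have "\<dots> \<le> ennreal (\<delta> / d) * ennreal (singular_const * \<epsilon>\<^sup>2 / cosh t)"
    by (intro mult_left_mono nn_integral_bessel_kernel[OF a t]) auto
  also have "\<dots> = ennreal (\<delta> / d * (singular_const * \<epsilon>\<^sup>2 / cosh t))"
    using singular_const_pos by (intro ennreal_mult[symmetric]) (use d \<delta> in auto)
  finally have "norm (\<integral>z. (\<mu>0 z)\<^sup>2 *\<^sub>R coulomb_reg d (Y z) - (\<mu>0 z)\<^sup>2 *\<^sub>R coulomb_reg d (?P z) \<partial>lborel)
      \<le> \<delta> / d * (singular_const * \<epsilon>\<^sup>2 / cosh t)"
    using d \<delta> singular_const_pos by (subst (asm) ennreal_le_iff) auto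
  then show ?thesis
    using Bochner_Integration.integral_diff[OF iY iP] by (simp add: lagrangian_def)
qed

lemma abs_mu_le: "\<bar>mu a t z\<bar> \<le> \<epsilon> * (1 / bracket (snd (orig a t z)) ^ 3)"
  using decay[of "orig a t z"] by (simp add: mu_def)

lemma measurable_mu [measurable]: "small_field a \<Longrightarrow> mu a t \<in> borel_measurable borel"
  unfolding mu_def[abs_def] using measurable_compose[OF measurable_orig measurable_mu0] by simp

lemma measurable_velocity:
  assumes "small_field a"
  shows "(\<lambda>v. ennreal (1 / bracket (snd (orig a t (x, v))) ^ 3)) \<in> borel_measurable borel"
proof -
  have "(\<lambda>v. (x, v)) \<in> borel_measurable borel" by (intro borel_measurable_continuous_onI continuous_intros)
  from measurable_compose[OF measurable_compose[OF this measurable_orig[OF assms]] measurable_snd_borel]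
  have "(\<lambda>v. snd (orig a t (x, v))) \<in> borel_measurable borel" .
  moreover have "(\<lambda>u :: plane. ennreal (1 / bracket u ^ 3)) \<in> borel_measurable borel" by measurable
  ultimately show ?thesis by (rule measurable_compose)
qed

text \<open>In the factorised difference of squares one factor is uniformly small and the other
  keeps the decay that makes it integrable in velocity. The base points \<open>x\<close> and
  \<open>y\<close> differ when a density is compared with its translate.\<close>

lemma nn_integral_square_diff:
  assumes a: "small_field a" and b: "small_field b" and t: "t \<ge> 0" and c: "c \<ge> 0"
    and m: "(\<lambda>v. \<bar>f v\<bar>) \<in> borel_measurable borel" "(\<lambda>v. \<bar>g v\<bar>) \<in> borel_measurable borel"
    and f: "\<And>v. \<bar>f v\<bar> \<le> A * (1 / bracket (snd (orig a t (x, v))) ^ 3)"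
    and g: "\<And>v. \<bar>g v\<bar> \<le> A * (1 / bracket (snd (orig b t (y, v))) ^ 3)" and A: "A \<ge> 0"
    and diff: "\<And>v. \<bar>f v - g v\<bar> \<le> c"
  shows "(\<integral>\<^sup>+v. ennreal \<bar>(f v)\<^sup>2 - (g v)\<^sup>2\<bar> \<partial>lborel) \<le> ennreal (2 * c * A * density_bound t)"
proof -
  let ?F = "\<lambda>v. 1 / bracket (snd (orig a t (x, v))) ^ 3" and ?G = "\<lambda>v. 1 / bracket (snd (orig b t (y, v))) ^ 3"
  have mF: "(\<lambda>v. ennreal (?F v)) \<in> borel_measurable lborel" and mG: "(\<lambda>v. ennreal (?G v)) \<in> borel_measurable lborel"
    using measurable_velocity[OF a] measurable_velocity[OF b] by simp_all
  have "(\<integral>\<^sup>+v. ennreal \<bar>(f v)\<^sup>2 - (g v)\<^sup>2\<bar> \<partial>lborel) \<le> (\<integral>\<^sup>+v. ennreal (c * A) * (ennreal (?F v) + ennreal (?G v)) \<partial>lborel)"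
  proof (rule nn_integral_mono)
    fix v
    have pos: "?F v \<ge> 0" "?G v \<ge> 0" using less_imp_le[OF bracket_pos] by auto
    have "\<bar>(f v)\<^sup>2 - (g v)\<^sup>2\<bar> = \<bar>f v - g v\<bar> * \<bar>f v + g v\<bar>"
      by (simp add: power2_eq_square square_diff_square_factored abs_mult mult.commute)
    also have "\<dots> \<le> c * (A * ?F v + A * ?G v)"
      using f[of v] g[of v] c by (intro mult_mono diff) auto
    also have "\<dots> = c * A * (?F v + ?G v)" by (simp add: algebra_simps)
    finally have "\<bar>(f v)\<^sup>2 - (g v)\<^sup>2\<bar> \<le> c * A * (?F v + ?G v)" .
    then show "ennreal \<bar>(f v)\<^sup>2 - (g v)\<^sup>2\<bar> \<le> ennreal (c * A) * (ennreal (?F v) + ennreal (?G v))"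
      unfolding ennreal_plus[OF pos, symmetric] using c A
      by (subst ennreal_mult'[symmetric]) (auto intro: ennreal_leI)
  qed
  also have "\<dots> = ennreal (c * A) * ((\<integral>\<^sup>+v. ennreal (?F v) \<partial>lborel) + (\<integral>\<^sup>+v. ennreal (?G v) \<partial>lborel))"
    by (simp only: nn_integral_cmult[OF borel_measurable_add[OF mF mG]] nn_integral_add[OF mF mG])
  also have "\<dots> \<le> ennreal (c * A) * (ennreal (density_bound t) + ennreal (density_bound t))"
    by (intro mult_left_mono add_mono nn_integral_velocity a b t) auto
  also have "\<dots> = ennreal (2 * c * A * density_bound t)"
    using c A density_bound_pos[of t] by (simp flip: ennreal_plus ennreal_mult' add: algebra_simps)
  finally show ?thesis .
qed

text \<open>The gradient of the near kernel is of size \<open>1 / |z|^2\<close> at 0 and not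
  integrable, so the translation is moved onto the density, whose Lipschitz constant is that of
  \<open>\<mu>0\<close> times \<open>8 * exp t\<close>.\<close>

lemma near_field_translation:
  assumes a: "small_field a" and t: "t \<ge> 0" and d: "d > 0"
  shows "norm (lagrangian a (coulomb_near d) t x - lagrangian a (coulomb_near d) t y)
    \<le> 12 * pi * d * (16 * exp t * \<epsilon>\<^sup>2 * density_bound t * norm (x - y))"
proof -
  note [measurable] = measurable_mu[OF a]
  let ?c = "8 * exp t * \<epsilon> * norm (x - y)"
  define f where "f z = (mu a t z)\<^sup>2" for z
  define g where "g z = f (z + (y - x, 0))" for z
  have [measurable]: "f \<in> borel_measurable borel" unfolding f_def[abs_def] by measurable
  then have [measurable]: "g \<in> borel_measurable borel" unfolding g_def[abs_def] by measurable
  have int: "integrable lborel (\<lambda>z. f z *\<^sub>R coulomb_near d (u - fst z))" for u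
    unfolding f_def by (intro integrable_kernel_mu[OF a t] lagrangian_near[OF a t d]) auto
  have f: "(\<integral>z. f z *\<^sub>R coulomb_near d (u - fst z) \<partial>lborel) = lagrangian a (coulomb_near d) t u" for u
    using kernel_integral_mu[OF a t measurable_coulomb_near, of d u] by (simp add: kernel_integral_def f_def)
  have mY: "(\<lambda>z. f z *\<^sub>R coulomb_near d (y - fst z)) \<in> borel_measurable borel"
    using int[of y] by (simp add: borel_measurable_integrable)
  have eq: "f (z + (y - x, 0)) *\<^sub>R coulomb_near d (y - fst (z + (y - x, 0))) = g z *\<^sub>R coulomb_near d (x - fst z)" for z
    by (simp add: g_def)
  have g: "(\<integral>z. g z *\<^sub>R coulomb_near d (x - fst z) \<partial>lborel) = lagrangian a (coulomb_near d) t y"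
    using mpres_integral[OF mpres_translation mY, of "(y - x, 0)"] unfolding eq f by simp
  have gi: "integrable lborel (\<lambda>z. g z *\<^sub>R coulomb_near d (x - fst z))"
    using mpres_integrable[OF mpres_translation mY, of "(y - x, 0)"] int[of y] unfolding eq by simp
  have "norm ((\<integral>z. f z *\<^sub>R coulomb_near d (x - fst z) \<partial>lborel) - (\<integral>z. g z *\<^sub>R coulomb_near d (x - fst z) \<partial>lborel))
      \<le> 12 * pi * d * (2 * ?c * \<epsilon> * density_bound t)"
  proof (rule near_field_diff[OF _ _ int gi d])
    fix u
    have "(\<integral>\<^sup>+v. ennreal \<bar>(mu a t (u, v))\<^sup>2 - (mu a t (u + (y - x), v))\<^sup>2\<bar> \<partial>lborel) \<le> ennreal (2 * ?c * \<epsilon> * density_bound t)"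
    proof (rule nn_integral_square_diff[OF a a t _ _ _ abs_mu_le abs_mu_le])
      fix v
      have "\<bar>mu a t (u, v) - mu a t (u + (y - x), v)\<bar> \<le> \<epsilon> * norm (orig a t (u, v) - orig a t (u + (y - x), v))"
        unfolding mu_def by (rule lipschitz)
      also have "\<dots> \<le> \<epsilon> * (8 * exp t * norm ((u, v) - (u + (y - x), v)))"
        using eps by (intro mult_left_mono orig_lipschitz a t) auto
      also have "\<dots> = ?c" by (simp add: norm_Pair norm_minus_commute)
      finally show "\<bar>mu a t (u, v) - mu a t (u + (y - x), v)\<bar> \<le> ?c" .
    qed (use eps in auto)
    then show "(\<integral>\<^sup>+v. ennreal \<bar>f (u, v) - g (u, v)\<bar> \<partial>lborel) \<le> ennreal (2 * ?c * \<epsilon> * density_bound t)"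
      by (simp add: f_def g_def)
  qed (use eps density_bound_pos[of t] in auto)
  then show ?thesis unfolding f g by (simp add: algebra_simps power2_eq_square)
qed

lemma near_field_stability:
  assumes a: "small_field a" and b: "small_field b" and t: "t \<ge> 0" and d: "d > 0" and g0: "g \<ge> 0"
    and ab: "\<And>r x. 0 \<le> r \<Longrightarrow> r \<le> t \<Longrightarrow> norm (a r x - b r x) \<le> g"
  shows "norm (lagrangian a (coulomb_near d) t x - lagrangian b (coulomb_near d) t x)
    \<le> 12 * pi * d * (6 * exp t * g * \<epsilon>\<^sup>2 * density_bound t)"
proof -
  note [measurable] = measurable_mu[OF a] measurable_mu[OF b]
  let ?c = "3 * exp t * g * \<epsilon>"
  have int: "integrable lborel (\<lambda>z. (mu c t z)\<^sup>2 *\<^sub>R coulomb_near d (x - fst z))" if c: "small_field c" for c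
    by (intro integrable_kernel_mu[OF c t] lagrangian_near[OF c t d]) auto
  have "norm ((\<integral>z. (mu a t z)\<^sup>2 *\<^sub>R coulomb_near d (x - fst z) \<partial>lborel) - (\<integral>z. (mu b t z)\<^sup>2 *\<^sub>R coulomb_near d (x - fst z) \<partial>lborel))
      \<le> 12 * pi * d * (2 * ?c * \<epsilon> * density_bound t)"
  proof (rule near_field_diff[OF _ _ int[OF a] int[OF b] d])
    fix u
    show "(\<integral>\<^sup>+v. ennreal \<bar>(mu a t (u, v))\<^sup>2 - (mu b t (u, v))\<^sup>2\<bar> \<partial>lborel) \<le> ennreal (2 * ?c * \<epsilon> * density_bound t)"
    proof (rule nn_integral_square_diff[OF a b t _ _ _ abs_mu_le abs_mu_le])
      fix v
      have "\<bar>mu a t (u, v) - mu b t (u, v)\<bar> \<le> \<epsilon> * norm (orig a t (u, v) - orig b t (u, v))"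
        unfolding mu_def by (rule lipschitz)
      also have "\<dots> \<le> \<epsilon> * (3 * exp t * g)"
        using eps by (intro mult_left_mono orig_field_diff a b t ab) auto
      finally show "\<bar>mu a t (u, v) - mu b t (u, v)\<bar> \<le> ?c" by (simp add: algebra_simps)
    qed (use eps g0 in auto)
  qed (use eps g0 density_bound_pos[of t] in auto)
  then show ?thesis
    using kernel_integral_mu[OF a t measurable_coulomb_near, of d x] kernel_integral_mu[OF b t measurable_coulomb_near, of d x]
    by (simp add: kernel_integral_def algebra_simps power2_eq_square)
qed

definition fld :: "(real \<Rightarrow> plane \<Rightarrow> plane) \<Rightarrow> real \<Rightarrow> plane \<Rightarrow> plane" where
  "fld a t x = (1 / (2 * pi)) *\<^sub>R lagrangian a coulomb t x"

lemma efield_mu: "small_field a \<Longrightarrow> t \<ge> 0 \<Longrightarrow> efield (mu a t) x = fld a t x"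
  by (simp add: efield_eq fld_def kernel_integral_mu)

lemma field_defined_mu:
  assumes "small_field a" "t \<ge> 0"
  shows "field_defined (mu a t)"
  unfolding field_defined_def field_integrand_eq[abs_def]
  by (intro allI integrable_kernel_mu lagrangian_singular assms norm_coulomb measurable_coulomb)

lemma continuous_lagrangian_reg:
  assumes a: "small_field a" and d: "d > 0"
  shows "continuous_on UNIV (\<lambda>(t, x). lagrangian a (coulomb_reg d) t x)"
  unfolding lagrangian_def case_prod_unfold
proof (rule continuous_on_integral_dominated[where w = "\<lambda>z. (\<mu>0 z)\<^sup>2 * (1 / d)"])
  show "integrable lborel (\<lambda>z. (\<mu>0 z)\<^sup>2 * (1 / d))"
    by (intro integrable_mult_left integrable_sq)
  show "continuous_on UNIV (\<lambda>p. (\<mu>0 z)\<^sup>2 *\<^sub>R coulomb_reg d (snd p - fst (traj a (fst p) z)))" for z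
    by (intro continuous_intros continuous_on_compose2[OF continuous_on_coulomb_reg[OF d, of UNIV]]
        continuous_on_compose_pair[OF continuous_traj[OF a]]) auto
  show "(\<lambda>z. (\<mu>0 z)\<^sup>2 *\<^sub>R coulomb_reg d (snd p - fst (traj a (fst p) z))) \<in> borel_measurable lborel" for p
    using measurable_lagrangian_integrand[OF a measurable_coulomb_reg] by simp
  show "norm ((\<mu>0 z)\<^sup>2 *\<^sub>R coulomb_reg d (snd p - fst (traj a (fst p) z))) \<le> (\<mu>0 z)\<^sup>2 * (1 / d)" for p z
    using norm_coulomb_reg(2)[OF d] by (auto intro: mult_left_mono simp del: times_divide_eq_right)
qed

lemma density_bound_le: "density_bound t \<le> 256 * pi"
proof -
  have "1 \<le> (cosh t)\<^sup>2" using one_le_power[OF cosh_real_ge_1] .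
  then have "256 * pi / (cosh t)\<^sup>2 \<le> 256 * pi / 1" by (intro divide_left_mono) auto
  then show ?thesis by (simp add: density_bound_def)
qed

lemma inverse_Suc_pos: "0 < 1 / real (Suc n)"
  by simp

text \<open>Regularised fields are continuous by dominated convergence, and the remainder is at most
  a constant times \<open>d\<close> uniformly in time and space. The absolute value extends the
  field evenly to negative times, as the ODE theory requires.\<close>

lemma continuous_fld:
  assumes a: "small_field a"
  shows "continuous_on UNIV (\<lambda>(t, x). fld a \<bar>t\<bar> x)"
proof (rule uniform_limit_theorem[where F = sequentially
      and f = "\<lambda>n (t, x). (1 / (2 * pi)) *\<^sub>R lagrangian a (coulomb_reg (1 / real (Suc n))) \<bar>t\<bar> x"])
  show "\<forall>\<^sub>F n in sequentially. continuous_on UNIV (\<lambda>(t, x). (1 / (2 * pi)) *\<^sub>R lagrangian a (coulomb_reg (1 / real (Suc n))) \<bar>t\<bar> x)"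
    unfolding case_prod_unfold
    by (intro always_eventually allI continuous_intros continuous_on_compose_pair[OF continuous_lagrangian_reg[OF a inverse_Suc_pos]])
  show "uniform_limit UNIV (\<lambda>n (t, x). (1 / (2 * pi)) *\<^sub>R lagrangian a (coulomb_reg (1 / real (Suc n))) \<bar>t\<bar> x)
     (\<lambda>(t, x). fld a \<bar>t\<bar> x) sequentially"
  proof (rule uniform_limitI)
    fix e :: real assume e: "e > 0"
    let ?C = "\<epsilon>\<^sup>2 * (256 * pi) * (12 * pi)"
    have "(\<lambda>n. ?C * (1 / real (Suc n))) \<longlonglongrightarrow> ?C * 0"
      by (intro tendsto_intros LIMSEQ_Suc[OF lim_1_over_n])
    then have "\<forall>\<^sub>F n in sequentially. ?C * (1 / real (Suc n)) < e"
      using e by (intro order_tendstoD) auto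
    then show "\<forall>\<^sub>F n in sequentially. \<forall>p\<in>UNIV. dist (case p of (t, x) \<Rightarrow> (1 / (2 * pi)) *\<^sub>R lagrangian a (coulomb_reg (1 / real (Suc n))) \<bar>t\<bar> x)
        (case p of (t, x) \<Rightarrow> fld a \<bar>t\<bar> x) < e"
    proof eventually_elim
      case (elim n)
      show ?case
      proof clarify
        fix t :: real and x
        let ?d = "1 / real (Suc n)"
        have "dist ((1 / (2 * pi)) *\<^sub>R lagrangian a (coulomb_reg ?d) \<bar>t\<bar> x) (fld a \<bar>t\<bar> x)
            = 1 / (2 * pi) * norm (lagrangian a (coulomb_near ?d) \<bar>t\<bar> x)"
          unfolding fld_def lagrangian_split[OF a abs_ge_zero inverse_Suc_pos, of t x n] scaleR_add_right dist_norm
          by simp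
        also have "\<dots> \<le> 1 * norm (lagrangian a (coulomb_near ?d) \<bar>t\<bar> x)"
          using pi_gt3 by (intro mult_right_mono) auto
        also have "\<dots> \<le> \<epsilon>\<^sup>2 * density_bound \<bar>t\<bar> * (12 * pi * ?d)"
          using lagrangian_near(2)[OF a abs_ge_zero inverse_Suc_pos] by simp
        also have "\<dots> \<le> \<epsilon>\<^sup>2 * (256 * pi) * (12 * pi * ?d)"
          using density_bound_le by (intro mult_left_mono mult_right_mono) auto
        also have "\<dots> < e" using elim by (simp add: algebra_simps)
        finally show "dist ((1 / (2 * pi)) *\<^sub>R lagrangian a (coulomb_reg ?d) \<bar>t\<bar> x) (fld a \<bar>t\<bar> x) < e" .
      qed
    qed
  qed
qed auto

lemma exp_density_bound: "t \<ge> 0 \<Longrightarrow> exp t * density_bound t \<le> 512 * pi / cosh t"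
proof -
  have c: "cosh t > 0" by (rule cosh_real_pos)
  have "exp t * density_bound t \<le> (2 * cosh t) * density_bound t"
    using cosh_bounds(1)[of t] density_bound_pos[of t] by (intro mult_right_mono) auto
  also have "\<dots> = 512 * pi / cosh t" using c by (simp add: density_bound_def power2_eq_square)
  finally show ?thesis .
qed

end

section \<open>The self-consistent field as a fixed point\<close>

locale small_data = transported_data +
  assumes eps_small: "36 * (4 * singular_const + 98304 * pi\<^sup>2) * \<epsilon>\<^sup>2 \<le> 1"
begin

text \<open>The field estimates end with a constant over \<open>cosh t\<close>, and
  \<open>eps_small\<close> collects these constants: \<open>98304 = 192 * 512\<close> from
  translating the near field, \<open>4 * singular_const\<close> from the far field when two fields
  are compared, and 36 from the definition of small fields.\<close>

lemma scaled_small: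
  assumes C: "0 \<le> C" "C \<le> (4 * singular_const + 98304 * pi\<^sup>2) * \<epsilon>\<^sup>2"
  shows "1 / (2 * pi) * (C / cosh t) \<le> exp (- t) / 36"
proof -
  have "C \<le> 1 / 36" using C eps_small by linarith
  moreover have "1 / cosh t \<le> 2 * exp (- t)"
    using cosh_bounds(1)[of t] cosh_real_pos[of t] by (simp add: exp_minus field_simps)
  ultimately have "C * (1 / cosh t) \<le> 1 / 36 * (2 * exp (- t))"
    using C by (intro mult_mono) auto
  then have "1 / (2 * pi) * (C / cosh t) \<le> 1 / (2 * pi) * (1 / 36 * (2 * exp (- t)))"
    by (intro mult_left_mono) auto
  also have "\<dots> = (1 / pi) * (exp (- t) / 36)" by simp
  also have "\<dots> \<le> 1 * (exp (- t) / 36)" using pi_gt3 by (intro mult_right_mono) auto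
  finally show ?thesis by simp
qed

lemma fld_bound:
  assumes a: "small_field a" and t: "t \<ge> 0"
  shows "norm (fld a t x) \<le> exp (- t) / 36"
proof -
  have "norm (fld a t x) = 1 / (2 * pi) * norm (lagrangian a coulomb t x)" by (simp add: fld_def)
  also have "\<dots> \<le> 1 / (2 * pi) * (singular_const * \<epsilon>\<^sup>2 / cosh t)"
    by (intro mult_left_mono lagrangian_singular[OF a t] norm_coulomb) auto
  also have "\<dots> \<le> exp (- t) / 36"
    using singular_const_pos by (intro scaled_small mult_right_mono) auto
  finally show ?thesis .
qed

lemma reg_near_diff:
  assumes a: "small_field a" and b: "small_field b" and t: "t \<ge> 0"
    and reg: "norm (lagrangian a (coulomb_reg 1) t x - lagrangian b (coulomb_reg 1) t y) \<le> P"
    and near: "norm (lagrangian a (coulomb_near 1) t x - lagrangian b (coulomb_near 1) t y) \<le> Q"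
  shows "norm (fld a t x - fld b t y) \<le> 1 / (2 * pi) * (P + Q)"
proof -
  have "fld a t x - fld b t y = (1 / (2 * pi)) *\<^sub>R
      ((lagrangian a (coulomb_reg 1) t x - lagrangian b (coulomb_reg 1) t y) +
       (lagrangian a (coulomb_near 1) t x - lagrangian b (coulomb_near 1) t y))"
    unfolding fld_def lagrangian_split[OF a t zero_less_one] lagrangian_split[OF b t zero_less_one]
    by (simp add: algebra_simps)
  then have "norm (fld a t x - fld b t y) = 1 / (2 * pi) * norm ((lagrangian a (coulomb_reg 1) t x - lagrangian b (coulomb_reg 1) t y) +
       (lagrangian a (coulomb_near 1) t x - lagrangian b (coulomb_near 1) t y))" by simp
  also have "\<dots> \<le> 1 / (2 * pi) * (P + Q)"
    using norm_triangle_mono[OF reg near] by (intro mult_left_mono) auto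
  finally show ?thesis .
qed

lemma fld_lipschitz:
  assumes a: "small_field a" and t: "t \<ge> 0"
  shows "norm (fld a t x - fld a t y) \<le> exp (- t) / 36 * norm (x - y)"
proof -
  let ?n = "norm (x - y)"
  have "norm (fld a t x - fld a t y) \<le> 1 / (2 * pi) * (?n * (singular_const * \<epsilon>\<^sup>2 / cosh t) + 98304 * pi\<^sup>2 * \<epsilon>\<^sup>2 * ?n / cosh t)"
  proof (rule reg_near_diff[OF a a t])
    have m: "(\<lambda>z. x - fst (traj a t z)) \<in> borel_measurable borel"
      using measurable_position[OF a] by measurable
    have "norm ((\<integral>z. (\<mu>0 z)\<^sup>2 *\<^sub>R coulomb_reg 1 (x - fst (traj a t z)) \<partial>lborel) - lagrangian a (coulomb_reg 1) t y)
        \<le> ?n / 1 * (singular_const * \<epsilon>\<^sup>2 / cosh t)"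
    proof (rule regular_field_diff[OF a t _ m])
      fix z show "norm (x - fst (traj a t z) - (y - fst (traj a t z))) \<le> ?n * (bracket (snd z))\<^sup>2"
        using mult_left_mono[OF one_le_power[OF bracket_ge_1[of "snd z"], of 2], of ?n] by simp
    qed auto
    then show "norm (lagrangian a (coulomb_reg 1) t x - lagrangian a (coulomb_reg 1) t y) \<le> ?n * (singular_const * \<epsilon>\<^sup>2 / cosh t)"
      by (simp add: lagrangian_def)
    have "norm (lagrangian a (coulomb_near 1) t x - lagrangian a (coulomb_near 1) t y)
        \<le> 12 * pi * 1 * (16 * exp t * \<epsilon>\<^sup>2 * density_bound t * ?n)"
      by (rule near_field_translation[OF a t]) simp
    also have "\<dots> = 192 * pi * \<epsilon>\<^sup>2 * ?n * (exp t * density_bound t)" by simp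
    also have "\<dots> \<le> 192 * pi * \<epsilon>\<^sup>2 * ?n * (512 * pi / cosh t)"
      by (intro mult_left_mono exp_density_bound t) auto
    finally show "norm (lagrangian a (coulomb_near 1) t x - lagrangian a (coulomb_near 1) t y) \<le> 98304 * pi\<^sup>2 * \<epsilon>\<^sup>2 * ?n / cosh t"
      by (simp add: power2_eq_square algebra_simps)
  qed
  also have "\<dots> = 1 / (2 * pi) * ((singular_const * \<epsilon>\<^sup>2 + 98304 * pi\<^sup>2 * \<epsilon>\<^sup>2) / cosh t) * ?n"
    by (simp add: algebra_simps add_divide_distrib)
  also have "\<dots> \<le> exp (- t) / 36 * ?n"
    using singular_const_pos by (intro mult_right_mono scaled_small) (auto simp: algebra_simps)
  finally show ?thesis .
qed

text \<open>Trajectories in the two fields may separate like \<open>exp t\<close>, but the decay of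
  the density cancels this growth, so the contraction holds in the sup norm over all times at
  once.\<close>

lemma fld_stability:
  assumes a: "small_field a" and b: "small_field b" and t: "t \<ge> 0" and g: "g \<ge> 0"
    and ab: "\<And>r x. 0 \<le> r \<Longrightarrow> r \<le> t \<Longrightarrow> norm (a r x - b r x) \<le> g"
  shows "norm (fld a t x - fld b t x) \<le> g / 2"
proof -
  have ec: "exp t / cosh t \<le> 2" using cosh_bounds(1)[of t] cosh_real_pos[of t] by (simp add: field_simps)
  have "norm (fld a t x - fld b t x) \<le> 1 / (2 * pi) * (4 * singular_const * \<epsilon>\<^sup>2 * g + 98304 * pi\<^sup>2 * \<epsilon>\<^sup>2 * g)"
  proof (rule reg_near_diff[OF a b t])
    have m: "(\<lambda>z. x - fst (traj a t z)) \<in> borel_measurable borel"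
      using measurable_position[OF a] by measurable
    have "norm ((\<integral>z. (\<mu>0 z)\<^sup>2 *\<^sub>R coulomb_reg 1 (x - fst (traj a t z)) \<partial>lborel) - lagrangian b (coulomb_reg 1) t x)
        \<le> (2 * g * exp t) / 1 * (singular_const * \<epsilon>\<^sup>2 / cosh t)"
    proof (rule regular_field_diff[OF b t _ m])
      fix z
      have "norm (x - fst (traj a t z) - (x - fst (traj b t z))) \<le> 2 * g * exp t"
        using traj_field_diff[OF a b t ab, of z] by (simp add: norm_minus_commute)
      also have "\<dots> \<le> 2 * g * exp t * (bracket (snd z))\<^sup>2"
        using mult_left_mono[OF one_le_power[OF bracket_ge_1[of "snd z"], of 2], of "2 * g * exp t"] g by simp
      finally show "norm (x - fst (traj a t z) - (x - fst (traj b t z))) \<le> 2 * g * exp t * (bracket (snd z))\<^sup>2" .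
    qed (use g in auto)
    also have "\<dots> = 2 * g * (singular_const * \<epsilon>\<^sup>2) * (exp t / cosh t)" by simp
    also have "\<dots> \<le> 2 * g * (singular_const * \<epsilon>\<^sup>2) * 2"
      using g singular_const_pos by (intro mult_left_mono ec) auto
    finally show "norm (lagrangian a (coulomb_reg 1) t x - lagrangian b (coulomb_reg 1) t x) \<le> 4 * singular_const * \<epsilon>\<^sup>2 * g"
      by (simp add: lagrangian_def algebra_simps)
    have "norm (lagrangian a (coulomb_near 1) t x - lagrangian b (coulomb_near 1) t x)
        \<le> 12 * pi * 1 * (6 * exp t * g * \<epsilon>\<^sup>2 * density_bound t)"
      by (rule near_field_stability[OF a b t _ g ab]) auto
    also have "\<dots> = 72 * pi * \<epsilon>\<^sup>2 * g * (exp t * density_bound t)" by simp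
    also have "\<dots> \<le> 72 * pi * \<epsilon>\<^sup>2 * g * (512 * pi / 1)"
    proof (intro mult_left_mono)
      have "512 * pi / cosh t \<le> 512 * pi / 1" using cosh_real_ge_1[of t] by (intro divide_left_mono) auto
      then show "exp t * density_bound t \<le> 512 * pi / 1" using exp_density_bound[OF t] by linarith
    qed (use g in auto)
    also have "\<dots> \<le> 98304 * pi\<^sup>2 * \<epsilon>\<^sup>2 * g"
      using g eps by (simp add: power2_eq_square)
    finally show "norm (lagrangian a (coulomb_near 1) t x - lagrangian b (coulomb_near 1) t x) \<le> 98304 * pi\<^sup>2 * \<epsilon>\<^sup>2 * g" .
  qed
  also have "\<dots> = 1 / (2 * pi) * (((4 * singular_const + 98304 * pi\<^sup>2) * \<epsilon>\<^sup>2) * g)" by (simp add: algebra_simps)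
  also have "\<dots> \<le> 1 / 2 * (1 * g)"
  proof (intro mult_mono)
    show "(4 * singular_const + 98304 * pi\<^sup>2) * \<epsilon>\<^sup>2 \<le> 1"
      using eps_small unfolding mult.assoc by linarith
    show "1 / (2 * pi) \<le> 1 / 2" using pi_gt3 by (simp add: divide_simps)
  qed (use g singular_const_pos in auto)
  finally show ?thesis by simp
qed

lemma small_field_fld:
  assumes a: "small_field a"
  shows "small_field (\<lambda>t. fld a \<bar>t\<bar>)"
  unfolding small_field_def using continuous_fld[OF a] fld_bound[OF a] fld_lipschitz[OF a] by auto

lemma small_field_limit:
  assumes a: "\<And>n. small_field (a n)" and lim: "\<And>t x. (\<lambda>n. a n t x) \<longlonglongrightarrow> b t x"
    and b: "continuous_on UNIV (\<lambda>(t, x). b t x)"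
  shows "small_field b"
  unfolding small_field_def
proof (intro conjI allI b)
  fix t x y
  show "norm (b t x) \<le> exp (- \<bar>t\<bar>) / 36"
    by (rule LIMSEQ_le_const2[OF tendsto_norm[OF lim]]) (use a in \<open>auto simp: small_field_def\<close>)
  show "norm (b t x - b t y) \<le> exp (- \<bar>t\<bar>) / 36 * norm (x - y)"
    by (rule LIMSEQ_le_const2[OF tendsto_norm[OF tendsto_diff[OF lim lim]]]) (use a in \<open>auto simp: small_field_def\<close>)
qed

text \<open>The inequalities defining small fields survive pointwise limits and continuity survives
  uniform ones, so these fields form a closed set of bounded continuous functions, which
  \<open>fld\<close> maps into itself and contracts by 1/2.\<close>

lemma fixed_point_field:
  obtains a where "small_field a" "\<And>t x. a t x = fld a \<bar>t\<bar> x"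
proof -
  define S where "S = {f :: (real \<times> plane) \<Rightarrow>\<^sub>C plane. small_field (\<lambda>t x. f (t, x))}"
  define T where "T f = Bcontfun (\<lambda>(t, x). fld (\<lambda>t x. apply_bcontfun f (t, x)) \<bar>t\<bar> x)" for f
  have Tapp: "apply_bcontfun (T f) (t, x) = fld (\<lambda>t x. f (t, x)) \<bar>t\<bar> x" if f: "f \<in> S" for f t x
  proof -
    have s: "small_field (\<lambda>t x. f (t, x))" using f by (simp add: S_def)
    have "(\<lambda>(t, x). fld (\<lambda>t x. apply_bcontfun f (t, x)) \<bar>t\<bar> x) \<in> bcontfun"
    proof (rule bcontfun_normI[OF continuous_fld[OF s], of 1])
      show "norm (case p of (t, x) \<Rightarrow> fld (\<lambda>t x. f (t, x)) \<bar>t\<bar> x) \<le> 1" for p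
      proof (cases p)
        case (Pair t x)
        have "exp (- \<bar>t\<bar>) \<le> 1" by simp
        then show ?thesis unfolding Pair prod.case using fld_bound[OF s abs_ge_zero, of t x] by linarith
      qed
    qed
    then show ?thesis by (simp add: T_def Bcontfun_inverse)
  qed
  have "\<exists>!f\<in>S. T f = f"
  proof (rule Banach_fix)
    show "complete S"
      unfolding complete_eq_closed closed_sequential_limits
    proof (intro allI impI, elim conjE)
      fix F f assume F: "\<forall>n. F n \<in> S" "F \<longlonglongrightarrow> f"
      have "small_field (\<lambda>t x. f (t, x))"
      proof (rule small_field_limit[of "\<lambda>n t x. F n (t, x)"])
        show "(\<lambda>n. F n (t, x)) \<longlonglongrightarrow> f (t, x)" for t x
          by (rule metric_tendsto_imp_tendsto[OF F(2)]) (simp add: dist_bounded)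
      qed (use F in \<open>auto simp: S_def\<close>)
      then show "f \<in> S" by (simp add: S_def)
    qed
    have "0 \<in> S" by (auto simp: S_def small_field_def)
    then show "S \<noteq> {}" by blast
    show "T ` S \<subseteq> S"
    proof clarify
      fix f assume f: "f \<in> S"
      then have "small_field (\<lambda>t. fld (\<lambda>t x. f (t, x)) \<bar>t\<bar>)"
        by (intro small_field_fld) (simp add: S_def)
      then show "T f \<in> S" using Tapp[OF f] by (simp add: S_def)
    qed
    fix f g assume fg: "f \<in> S" "g \<in> S"
    show "dist (T f) (T g) \<le> 1 / 2 * dist f g"
    proof (rule dist_bound)
      fix p :: "real \<times> plane"
      obtain t x where p: "p = (t, x)" by (cases p)
      have "norm (fld (\<lambda>t x. f (t, x)) \<bar>t\<bar> x - fld (\<lambda>t x. g (t, x)) \<bar>t\<bar> x) \<le> dist f g / 2"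
        by (rule fld_stability) (use fg dist_bounded[of f _ g] in \<open>auto simp: S_def dist_norm\<close>)
      then show "dist (apply_bcontfun (T f) p) (apply_bcontfun (T g) p) \<le> 1 / 2 * dist f g"
        by (simp add: p Tapp fg dist_norm)
    qed
  qed auto
  then obtain f where f: "f \<in> S" "T f = f" by blast
  show thesis
  proof (rule that[of "\<lambda>t x. f (t, x)"])
    show "small_field (\<lambda>t x. f (t, x))" using f(1) unfolding S_def by (rule CollectD)
    show "f (t, x) = fld (\<lambda>t x. f (t, x)) \<bar>t\<bar> x" for t x
      using Tapp[OF f(1), of t x] unfolding f(2) .
  qed
qed

end

section \<open>Regularity of the self-consistent field\<close>

lemma norm_derivative_le_lipschitz:
  fixes f :: "'a::real_normed_vector \<Rightarrow> 'b::real_normed_vector" and D :: "'a \<Rightarrow>\<^sub>L 'b"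
  assumes D: "(f has_derivative blinfun_apply D) (at x)" and lip: "\<And>y. norm (f y - f x) \<le> c * norm (y - x)" and c: "c \<ge> 0"
  shows "norm D \<le> c"
proof (rule norm_blinfun_bound[OF c])
  fix h
  show "norm (D h) \<le> c * norm h"
  proof (cases "h = 0")
    case False
    have "norm (D h) \<le> c * norm h + e" if e: "e > 0" for e
    proof -
      from D have "\<forall>e>0. \<exists>d>0. \<forall>y. norm (y - x) < d \<longrightarrow> norm (f y - f x - D (y - x)) \<le> e * norm (y - x)"
        unfolding has_derivative_at_alt by blast
      then obtain d where d: "d > 0" "\<And>y. norm (y - x) < d \<Longrightarrow> norm (f y - f x - D (y - x)) \<le> e / norm h * norm (y - x)"
        using e False by (metis divide_pos_pos zero_less_norm_iff)
      define s where "s = d / (2 * norm h)"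
      have s: "s > 0" "norm (s *\<^sub>R h) < d" using d False by (auto simp: s_def)
      have "norm (f (x + s *\<^sub>R h) - f x - D (s *\<^sub>R h)) \<le> e / norm h * norm (s *\<^sub>R h)"
        using d(2)[of "x + s *\<^sub>R h"] s by simp
      moreover have "norm (D (s *\<^sub>R h)) \<le> norm (f (x + s *\<^sub>R h) - f x) + norm (f (x + s *\<^sub>R h) - f x - D (s *\<^sub>R h))"
        using norm_triangle_ineq4[of "f (x + s *\<^sub>R h) - f x" "f (x + s *\<^sub>R h) - f x - D (s *\<^sub>R h)"] by simp
      ultimately have "norm (D (s *\<^sub>R h)) \<le> c * norm (s *\<^sub>R h) + e / norm h * norm (s *\<^sub>R h)"
        using lip[of "x + s *\<^sub>R h"] by simp
      then have "s * norm (D h) \<le> s * (c * norm h + e)"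
        using s False by (simp add: blinfun.scaleR_right algebra_simps)
      then show ?thesis using s by simp
    qed
    then show ?thesis by (rule field_le_epsilon)
  qed simp
qed

text \<open>The Lipschitz seminorm controls derivatives: if \<open>F n\<close> and
  \<open>F m\<close> are close to \<open>f\<close> in it, their derivatives are uniformly close, and
  the Cauchy limit is the derivative of \<open>f\<close>. This suits the field, where the omitted
  near part has a small Lipschitz constant but no derivative known in advance.\<close>

lemma C1_limit:
  fixes f :: "'p::topological_space \<Rightarrow> 'a::real_normed_vector \<Rightarrow> 'b::banach"
  assumes der: "\<And>n p x. (F n p has_derivative blinfun_apply (DF n p x)) (at x)"
    and cont: "\<And>n. continuous_on UNIV (\<lambda>(p, x). DF n p x)"
    and lip: "\<And>n p x y. norm ((f p x - F n p x) - (f p y - F n p y)) \<le> d n * norm (x - y)"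
    and d: "d \<longlonglongrightarrow> 0" and d0: "\<And>n. d n \<ge> 0"
  obtains D where "continuous_on UNIV (\<lambda>(p, x). D p x)" "\<And>p x. (f p has_derivative blinfun_apply (D p x)) (at x)"
proof -
  have diff: "norm (DF n p x - DF m p x) \<le> d n + d m" for n m p x
  proof (rule norm_derivative_le_lipschitz)
    show "((\<lambda>x. F n p x - F m p x) has_derivative blinfun_apply (DF n p x - DF m p x)) (at x)"
      using has_derivative_diff[OF der der] by (simp add: blinfun.diff_left[abs_def])
    fix y
    have "(F n p y - F m p y) - (F n p x - F m p x) = ((f p y - F m p y) - (f p x - F m p x)) - ((f p y - F n p y) - (f p x - F n p x))"
      by simp
    then have "norm ((F n p y - F m p y) - (F n p x - F m p x)) \<le> norm ((f p y - F m p y) - (f p x - F m p x)) + norm ((f p y - F n p y) - (f p x - F n p x))"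
      by (metis norm_triangle_ineq4)
    also have "\<dots> \<le> d m * norm (y - x) + d n * norm (y - x)" by (intro add_mono lip)
    finally show "norm ((F n p y - F m p y) - (F n p x - F m p x)) \<le> (d n + d m) * norm (y - x)"
      by (simp add: algebra_simps)
  qed (simp add: d0)
  have "uniformly_Cauchy_on UNIV (\<lambda>n (p, x). DF n p x)"
  proof (rule uniformly_Cauchy_onI)
    fix e :: real assume "e > 0"
    then obtain N where N: "\<And>n. n \<ge> N \<Longrightarrow> d n < e / 2"
      using order_tendstoD(2)[OF d, of "e / 2"] by (auto simp: eventually_sequentially)
    show "\<exists>M. \<forall>x\<in>UNIV. \<forall>m\<ge>M. \<forall>n\<ge>M. dist (case x of (p, x) \<Rightarrow> DF m p x) (case x of (p, x) \<Rightarrow> DF n p x) < e"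
    proof (intro exI[of _ N] ballI allI impI)
      fix q :: "'p \<times> 'a" and m n assume mn: "m \<ge> N" "n \<ge> N"
      obtain p x where q: "q = (p, x)" by (cases q)
      show "dist (case q of (p, x) \<Rightarrow> DF m p x) (case q of (p, x) \<Rightarrow> DF n p x) < e"
        using diff[of m p x n] N[OF mn(1)] N[OF mn(2)] by (simp add: q dist_norm)
    qed
  qed
  then have "uniformly_convergent_on UNIV (\<lambda>n (p, x). DF n p x)" by (rule Cauchy_uniformly_convergent)
  then obtain D0 where D0: "uniform_limit UNIV (\<lambda>n (p, x). DF n p x) D0 sequentially"
    unfolding uniformly_convergent_on_def by blast
  define D where "D p x = D0 (p, x)" for p x
  have D0D: "(\<lambda>(p, x). D p x) = D0" by (auto simp: D_def)
  show thesis
  proof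
    show "continuous_on UNIV (\<lambda>(p, x). D p x)"
      unfolding D0D using cont by (intro uniform_limit_theorem[OF _ D0]) auto
    fix p x
    show "(f p has_derivative blinfun_apply (D p x)) (at x)"
      unfolding has_derivative_at_alt
    proof (intro conjI allI impI blinfun.bounded_linear_right)
      fix e :: real assume e: "e > 0"
      have "\<forall>\<^sub>F n in sequentially. dist (DF n p x) (D p x) < e / 3"
        using uniform_limitD[OF D0, of "e / 3"] e by (auto simp: D_def elim!: eventually_mono)
      moreover have "\<forall>\<^sub>F n in sequentially. d n < e / 3"
        using order_tendstoD(2)[OF d, of "e / 3"] e by simp
      ultimately have "\<forall>\<^sub>F n in sequentially. dist (DF n p x) (D p x) < e / 3 \<and> d n < e / 3"
        by (rule eventually_conj)
      then obtain n where n: "dist (DF n p x) (D p x) < e / 3" "d n < e / 3"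
        by (auto simp: eventually_sequentially)
      from der[of n p x] have "\<forall>e>0. \<exists>\<delta>>0. \<forall>y. norm (y - x) < \<delta> \<longrightarrow> norm (F n p y - F n p x - DF n p x (y - x)) \<le> e * norm (y - x)"
        unfolding has_derivative_at_alt by blast
      then obtain \<delta> where \<delta>: "\<delta> > 0" "\<And>y. norm (y - x) < \<delta> \<Longrightarrow> norm (F n p y - F n p x - DF n p x (y - x)) \<le> e / 3 * norm (y - x)"
        using e by (meson divide_pos_pos zero_less_numeral)
      show "\<exists>\<delta>>0. \<forall>y. norm (y - x) < \<delta> \<longrightarrow> norm (f p y - f p x - D p x (y - x)) \<le> e * norm (y - x)"
      proof (intro exI conjI allI impI)
        fix y assume y: "norm (y - x) < \<delta>"
        have "f p y - f p x - D p x (y - x) = ((f p y - F n p y) - (f p x - F n p x)) +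
            ((F n p y - F n p x - DF n p x (y - x)) + (DF n p x - D p x) (y - x))"
          by (simp add: blinfun.diff_left)
        then have "norm (f p y - f p x - D p x (y - x)) \<le> norm ((f p y - F n p y) - (f p x - F n p x)) +
            (norm (F n p y - F n p x - DF n p x (y - x)) + norm ((DF n p x - D p x) (y - x)))"
          by (simp only:) (rule order_trans[OF norm_triangle_ineq add_left_mono[OF norm_triangle_ineq]])
        also have "\<dots> \<le> e / 3 * norm (y - x) + (e / 3 * norm (y - x) + e / 3 * norm (y - x))"
        proof (intro add_mono \<delta>(2) y)
          show "norm ((f p y - F n p y) - (f p x - F n p x)) \<le> e / 3 * norm (y - x)"
            by (rule order_trans[OF lip mult_right_mono[OF less_imp_le[OF n(2)] norm_ge_zero]])
          show "norm ((DF n p x - D p x) (y - x)) \<le> e / 3 * norm (y - x)"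
            using n(1) by (intro order_trans[OF norm_blinfun] mult_right_mono) (auto simp: dist_norm)
        qed
        finally show "norm (f p y - f p x - D p x (y - x)) \<le> e * norm (y - x)" by simp
      qed (rule \<delta>(1))
    qed
  qed
qed

text \<open>Caratheodory's criterion: a slope that is continuous at the base point is the derivative
  there.\<close>

lemma has_derivative_of_slope:
  fixes M :: "'a::real_normed_vector \<Rightarrow> 'a \<Rightarrow>\<^sub>L 'b::real_normed_vector"
  assumes M: "\<And>y. f y - f x = M y (y - x)" and lim: "(M \<longlongrightarrow> M x) (at x)"
  shows "(f has_derivative blinfun_apply (M x)) (at x)"
  unfolding has_derivative_iff_norm
proof (intro conjI blinfun.bounded_linear_right)
  have "((\<lambda>y. norm (M y - M x)) \<longlongrightarrow> 0) (at x)"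
    using lim by (simp add: tendsto_norm_zero LIM_zero)
  then show "((\<lambda>y. norm (f y - f x - M x (y - x)) / norm (y - x)) \<longlongrightarrow> 0) (at x)"
  proof (rule Lim_null_comparison[rotated], intro always_eventually allI)
    fix y
    have "norm (f y - f x - M x (y - x)) \<le> norm (M y - M x) * norm (y - x)"
      unfolding M using norm_blinfun[of "M y - M x" "y - x"] by (simp add: blinfun.diff_left)
    then show "norm (norm (f y - f x - M x (y - x)) / norm (y - x)) \<le> norm (M y - M x)"
      by (simp add: divide_le_eq)
  qed
qed

text \<open>An exact difference quotient of the regularised kernel, linear in \<open>h\<close> and
  continuous in both points; on the diagonal it is the derivative. With \<open>p\<close> and
  \<open>q\<close> the two denominators it comes from
  \<open>1 / q - 1 / p = (p - q) / (p * q)\<close> and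
  \<open>p - q = (u + w) \<bullet> (u - w)\<close>.\<close>

definition coulomb_slope :: "real \<Rightarrow> plane \<Rightarrow> plane \<Rightarrow> plane \<Rightarrow> plane" where
  "coulomb_slope d u w h = (1 / ((norm u)\<^sup>2 + d\<^sup>2)) *\<^sub>R h
     - (((u + w) \<bullet> h) / (((norm u)\<^sup>2 + d\<^sup>2) * ((norm w)\<^sup>2 + d\<^sup>2))) *\<^sub>R w"

lemma coulomb_slope:
  assumes d: "d > 0"
  shows "coulomb_reg d u - coulomb_reg d w = coulomb_slope d u w (u - w)"
proof -
  define p q where "p = (norm u)\<^sup>2 + d\<^sup>2" and "q = (norm w)\<^sup>2 + d\<^sup>2"
  have pq: "p > 0" "q > 0" using d by (auto simp: p_def q_def add_nonneg_pos)
  have "(u + w) \<bullet> (u - w) = p - q"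
    by (simp add: p_def q_def power2_norm_eq_inner inner_add inner_diff inner_commute)
  then have "coulomb_slope d u w (u - w) = (1 / p) *\<^sub>R (u - w) - ((p - q) / (p * q)) *\<^sub>R w"
    by (simp add: coulomb_slope_def flip: p_def q_def)
  also have "(p - q) / (p * q) = 1 / q - 1 / p" using pq by (simp add: field_simps)
  also have "(1 / p) *\<^sub>R (u - w) - (1 / q - 1 / p) *\<^sub>R w = (1 / p) *\<^sub>R u - (1 / q) *\<^sub>R w"
    by (simp add: algebra_simps)
  finally show ?thesis by (simp add: coulomb_reg_def divide_inverse flip: p_def q_def)
qed

lemma norm_coulomb_slope:
  assumes d: "d > 0"
  shows "norm (coulomb_slope d u w h) \<le> 3 / d\<^sup>2 * norm h"
proof -
  define p q where "p = (norm u)\<^sup>2 + d\<^sup>2" and "q = (norm w)\<^sup>2 + d\<^sup>2"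
  have pq: "p > 0" "q > 0" "d\<^sup>2 \<le> p" "d\<^sup>2 \<le> q" "(norm w)\<^sup>2 \<le> q" using d by (auto simp: p_def q_def add_nonneg_pos)
  have np: "norm u / p \<le> 1 / d" "norm w / q \<le> 1 / d"
    using norm_coulomb_reg(2)[OF d, of u] norm_coulomb_reg(2)[OF d, of w] pq
    by (simp_all add: coulomb_reg_def abs_of_pos divide_inverse mult.commute flip: p_def q_def)
  have "norm (coulomb_slope d u w h) \<le> 1 / p * norm h + \<bar>(u + w) \<bullet> h\<bar> / (p * q) * norm w"
    unfolding coulomb_slope_def p_def[symmetric] q_def[symmetric] using pq
    by (intro order_trans[OF norm_triangle_ineq4]) (simp add: abs_mult)
  also have "\<dots> \<le> 1 / p * norm h + ((norm u + norm w) * norm h) / (p * q) * norm w"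
  proof (intro add_left_mono mult_right_mono divide_right_mono)
    show "\<bar>(u + w) \<bullet> h\<bar> \<le> (norm u + norm w) * norm h"
      using Cauchy_Schwarz_ineq2[of "u + w" h] mult_right_mono[OF norm_triangle_ineq[of u w], of "norm h"] by simp
  qed (use pq in auto)
  also have "\<dots> = (1 / p + (norm u / p) * (norm w / q) + ((norm w)\<^sup>2 / q) * (1 / p)) * norm h"
    using pq by (simp add: field_simps power2_eq_square)
  also have "\<dots> \<le> (1 / d\<^sup>2 + (1 / d) * (1 / d) + 1 * (1 / d\<^sup>2)) * norm h"
    using np pq d by (intro mult_right_mono add_mono mult_mono) (auto simp: frac_le)
  also have "\<dots> = 3 / d\<^sup>2 * norm h" using d by (simp add: power2_eq_square field_simps)
  finally show ?thesis .
qed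

lemma linear_coulomb_slope: "coulomb_slope d u w h = (\<Sum>j\<in>Basis. (h \<bullet> j) *\<^sub>R coulomb_slope d u w j)"
proof -
  have "bounded_linear (coulomb_slope d u w)"
    unfolding coulomb_slope_def divide_inverse
    by (intro bounded_linear_sub bounded_linear_const_scaleR bounded_linear_ident bounded_linear_scaleR_const
        bounded_linear_mult_const bounded_linear_inner_right)
  then show ?thesis
    using linear_sum[of "coulomb_slope d u w" "\<lambda>j. (h \<bullet> j) *\<^sub>R j" Basis]
    by (simp add: euclidean_representation bounded_linear.linear linear_simps)
qed

lemma continuous_on_coulomb_slope:
  assumes d: "d > 0" and "continuous_on S f" "continuous_on S g"
  shows "continuous_on S (\<lambda>x. coulomb_slope d (f x) (g x) h)"
proof -
  have "(norm z)\<^sup>2 + d\<^sup>2 \<noteq> 0" for z :: plane using d by (metis add_nonneg_pos less_irrefl zero_le_power2 zero_less_power)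
  then show ?thesis unfolding coulomb_slope_def using assms by (intro continuous_intros) auto
qed

section \<open>Derivatives of the regularised fields\<close>

context transported_data begin

text \<open>The operator is assembled column by column, so that only plane-valued functions have to
  be integrated.\<close>

definition slope_integral :: "(real \<Rightarrow> plane \<Rightarrow> plane) \<Rightarrow> real \<Rightarrow> real \<Rightarrow> plane \<Rightarrow> plane \<Rightarrow> plane \<Rightarrow>\<^sub>L plane" where
  "slope_integral a d t x y = (\<Sum>j\<in>Basis. blinfun_scaleR_left
     (\<integral>z. (\<mu>0 z)\<^sup>2 *\<^sub>R coulomb_slope d (x - fst (traj a t z)) (y - fst (traj a t z)) j \<partial>lborel) o\<^sub>L blinfun_inner_left j)"

lemma slope_integrand_bound:
  assumes "d > 0"
  shows "norm ((\<mu>0 z)\<^sup>2 *\<^sub>R coulomb_slope d u w h) \<le> (\<mu>0 z)\<^sup>2 * (3 / d\<^sup>2 * norm h)"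
  using mult_left_mono[OF norm_coulomb_slope[OF assms, of u w h], of "(\<mu>0 z)\<^sup>2"] by simp

lemma measurable_slope_integrand:
  assumes a: "small_field a" and d: "d > 0"
  shows "(\<lambda>z. (\<mu>0 z)\<^sup>2 *\<^sub>R coulomb_slope d (x - fst (traj a t z)) (y - fst (traj a t z)) h) \<in> borel_measurable lborel"
proof -
  have "continuous_on UNIV (\<lambda>z. (\<mu>0 z)\<^sup>2 *\<^sub>R coulomb_slope d (x - fst (traj a t z)) (y - fst (traj a t z)) h)"
    by (intro continuous_intros continuous_on_coulomb_slope d cont continuous_on_compose_pair[OF continuous_traj[OF a]])
  then show ?thesis by (simp add: borel_measurable_continuous_onI)
qed

lemma integrable_slope_integrand:
  assumes a: "small_field a" and d: "d > 0"
  shows "integrable lborel (\<lambda>z. (\<mu>0 z)\<^sup>2 *\<^sub>R coulomb_slope d (x - fst (traj a t z)) (y - fst (traj a t z)) h)"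
  by (rule Bochner_Integration.integrable_bound[OF integrable_mult_left[OF integrable_sq, of "3 / d\<^sup>2 * norm h"]
        measurable_slope_integrand[OF a d]])
     (use slope_integrand_bound[OF d] in \<open>auto intro!: AE_I2 order_trans[OF _ abs_ge_self]\<close>)

lemma lagrangian_reg_diff:
  assumes a: "small_field a" and d: "d > 0"
  shows "lagrangian a (coulomb_reg d) t x - lagrangian a (coulomb_reg d) t y = slope_integral a d t x y (x - y)"
proof -
  let ?s = "\<lambda>h z. (\<mu>0 z)\<^sup>2 *\<^sub>R coulomb_slope d (x - fst (traj a t z)) (y - fst (traj a t z)) h"
  have int: "integrable lborel (\<lambda>z. (\<mu>0 z)\<^sup>2 *\<^sub>R coulomb_reg d (u - fst (traj a t z)))" for u
    by (rule Bochner_Integration.integrable_bound[OF integrable_mult_left[OF integrable_sq, of "1 / d"]])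
       (use measurable_lagrangian_integrand[OF a measurable_coulomb_reg] norm_coulomb_reg(2)[OF d]
        in \<open>auto intro!: AE_I2 order_trans[OF _ abs_ge_self] mult_left_mono simp del: times_divide_eq_right\<close>)
  have "lagrangian a (coulomb_reg d) t x - lagrangian a (coulomb_reg d) t y = (\<integral>z. ?s (x - y) z \<partial>lborel)"
    unfolding lagrangian_def Bochner_Integration.integral_diff[OF int int, symmetric] scaleR_diff_right[symmetric]
    by (simp add: coulomb_slope[OF d])
  also have "\<dots> = (\<integral>z. (\<Sum>j\<in>Basis. ((x - y) \<bullet> j) *\<^sub>R ?s j z) \<partial>lborel)"
    by (subst linear_coulomb_slope) (simp add: scaleR_sum_right scaleR_left_commute mult.commute)
  also have "\<dots> = (\<Sum>j\<in>Basis. ((x - y) \<bullet> j) *\<^sub>R (\<integral>z. ?s j z \<partial>lborel))"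
  proof -
    have i: "integrable lborel (\<lambda>z. ((x - y) \<bullet> j) *\<^sub>R ?s j z)" for j
      by (intro integrable_scaleR_right integrable_slope_integrand[OF a d])
    show ?thesis
      unfolding Bochner_Integration.integral_sum[OF i]
      by (intro sum.cong refl Bochner_Integration.integral_scaleR_right integrable_slope_integrand[OF a d])
  qed
  finally show ?thesis by (simp add: slope_integral_def blinfun.sum_left)
qed

lemma continuous_slope_integral:
  assumes a: "small_field a" and d: "d > 0"
  shows "continuous_on UNIV (\<lambda>(t, x, y). slope_integral a d t x y)"
proof -
  have "continuous_on UNIV (\<lambda>p. \<integral>z. (\<mu>0 z)\<^sup>2 *\<^sub>R coulomb_slope d (fst (snd p) - fst (traj a (fst p) z)) (snd (snd p) - fst (traj a (fst p) z)) j \<partial>lborel)" for j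
  proof (rule continuous_on_integral_dominated[where w = "\<lambda>z. (\<mu>0 z)\<^sup>2 * (3 / d\<^sup>2 * norm j)"])
    show "integrable lborel (\<lambda>z. (\<mu>0 z)\<^sup>2 * (3 / d\<^sup>2 * norm j))"
      by (intro integrable_mult_left integrable_sq)
    show "continuous_on UNIV (\<lambda>p. (\<mu>0 z)\<^sup>2 *\<^sub>R coulomb_slope d (fst (snd p) - fst (traj a (fst p) z)) (snd (snd p) - fst (traj a (fst p) z)) j)" for z
      by (intro continuous_intros continuous_on_coulomb_slope d continuous_on_compose_pair[OF continuous_traj[OF a]])
  qed (rule measurable_slope_integrand[OF a d], rule slope_integrand_bound[OF d])
  then show ?thesis
    unfolding slope_integral_def case_prod_unfold
    by (intro continuous_intros bounded_bilinear.continuous_on[OF bounded_bilinear_blinfun_compose]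
        bounded_linear.continuous_on[OF bounded_linear_blinfun_scaleR_left])
qed

lemma lagrangian_reg_derivative:
  assumes a: "small_field a" and d: "d > 0"
  shows "(lagrangian a (coulomb_reg d) t has_derivative blinfun_apply (slope_integral a d t x x)) (at x)"
proof (rule has_derivative_of_slope[where M = "\<lambda>y. slope_integral a d t y x", OF lagrangian_reg_diff[OF a d]])
  have "continuous_on UNIV (\<lambda>y. slope_integral a d t y x)"
    by (intro continuous_on_compose_triple[OF continuous_slope_integral[OF a d]] continuous_intros)
  then show "((\<lambda>y. slope_integral a d t y x) \<longlongrightarrow> slope_integral a d t x x) (at x)"
    by (simp add: continuous_on_def)
qed

end

lemma differentiable_grad:
  fixes f :: "'a::euclidean_space \<Rightarrow> real"
  assumes "f differentiable (at z)"
  shows "(f has_derivative (\<lambda>h. h \<bullet> grad f z)) (at z)"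
proof -
  from assms obtain D where D: "(f has_derivative D) (at z)" by (auto simp: differentiable_def)
  interpret bounded_linear D using D by (rule has_derivative_bounded_linear)
  define c where "c = (\<Sum>i\<in>Basis. D i *\<^sub>R i)"
  have "D h = h \<bullet> c" for h
  proof -
    have "D h = D (\<Sum>i\<in>Basis. (h \<bullet> i) *\<^sub>R i)" by (simp add: euclidean_representation)
    then show ?thesis by (simp add: c_def sum scaleR inner_sum_right mult.commute)
  qed
  then have "D = (\<lambda>h. h \<bullet> c)" by (rule ext)
  then have g: "GDERIV f z :> c"
    using D unfolding gderiv_def by (simp only:)
  have "D' = c" if "GDERIV f z :> D'" for D'
  proof -
    have "(\<lambda>h. h \<bullet> D') = (\<lambda>h. h \<bullet> c)"
      using that g unfolding gderiv_def by (rule has_derivative_unique)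
    from fun_cong[OF this] have "\<forall>h. h \<bullet> D' = h \<bullet> c" by blast
    then show ?thesis by (rule vector_eq_ldot[THEN iffD1])
  qed
  with g have "grad f z = c"
    unfolding grad_def by (rule the_equality[where P = "\<lambda>D. GDERIV f z :> D"])
  then show ?thesis using g by (simp add: gderiv_def)
qed

section \<open>Derivatives of trajectories in time and of the force in space\<close>

context coupling begin

lemma lin_deriv:
  "((\<lambda>t. lin t (y t)) has_vector_derivative (snd (lin t (y t)), fst (lin t (y t))) + lin t y') (at t)"
  if "(y has_vector_derivative y') (at t)"
proof -
  have f: "((\<lambda>t. fst (y t)) has_vector_derivative fst y') (at t)" and s: "((\<lambda>t. snd (y t)) has_vector_derivative snd y') (at t)"
    using that bounded_linear.has_vector_derivative[OF bounded_linear_fst] bounded_linear.has_vector_derivative[OF bounded_linear_snd]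
    by blast+
  have ch: "(cosh has_real_derivative sinh t) (at t)" and sh: "(sinh has_real_derivative cosh t) (at t)"
    by (auto intro!: derivative_eq_intros)
  have 1: "((\<lambda>t. cosh t *\<^sub>R fst (y t) + sinh t *\<^sub>R snd (y t)) has_vector_derivative
      (cosh t *\<^sub>R fst y' + sinh t *\<^sub>R fst (y t)) + (sinh t *\<^sub>R snd y' + cosh t *\<^sub>R snd (y t))) (at t)"
    by (intro has_vector_derivative_add has_vector_derivative_scaleR ch sh f s)
  have 2: "((\<lambda>t. sinh t *\<^sub>R fst (y t) + cosh t *\<^sub>R snd (y t)) has_vector_derivative
      (sinh t *\<^sub>R fst y' + cosh t *\<^sub>R fst (y t)) + (cosh t *\<^sub>R snd y' + sinh t *\<^sub>R snd (y t))) (at t)"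
    by (intro has_vector_derivative_add has_vector_derivative_scaleR ch sh f s)
  show ?thesis
    unfolding lin_def by (rule has_vector_derivative_eq_rhs[OF has_vector_derivative_Pair[OF 1 2]]) (simp add: algebra_simps)
qed

definition speed :: "(real \<Rightarrow> plane \<Rightarrow> plane) \<Rightarrow> real \<Rightarrow> phase \<Rightarrow> phase" where
  "speed a t z = (snd z, fst z + lam *\<^sub>R a t (fst z))"

lemma lin_flow_deriv:
  assumes "small_field a"
  shows "((\<lambda>t. lin t (flow lam a s w t)) has_vector_derivative speed a t (lin t (flow lam a s w t))) (at t)"
  using lin_deriv[OF flow_deriv[OF assms]] by (rule has_vector_derivative_eq_rhs) (simp add: force_lin speed_def)

lemma continuous_speed:
  assumes "continuous_on UNIV (\<lambda>(t, x). a t x)"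
  shows "continuous_on UNIV (\<lambda>(t, z). speed a t z)"
  unfolding speed_def case_prod_unfold by (intro continuous_intros continuous_on_compose_pair[OF assms])

text \<open>A particle placed at \<open>z\<close> at time \<open>s\<close> moves until
  \<open>t\<close> by about \<open>t - s\<close> times its speed, hence the negative sign. The time
  derivative of the density at a fixed point is reduced to this one, as the density is constant
  along trajectories.\<close>

lemma start_time_deriv:
  assumes a: "small_field a"
  shows "((\<lambda>s. lin t (flow lam a s (lin (- s) z) t)) has_vector_derivative - speed a t z) (at t)"
proof -
  define Z where "Z s r = lin r (flow lam a s (lin (- s) z) r)" for s r
  have dZ: "(Z s has_vector_derivative speed a r (Z s r)) (at r)" for s r
    unfolding Z_def by (rule lin_flow_deriv[OF a])
  have Zs: "Z s s = z" for s by (simp add: Z_def flow_init[OF a])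
  have sc: "continuous_on UNIV (\<lambda>(t, z). speed a t z)"
    using a by (intro continuous_speed) (simp add: small_field_def)
  have "continuous_on UNIV (\<lambda>p. speed a (snd p) (Z (fst p) (snd p)))"
    unfolding Z_def
    by (intro continuous_on_compose_pair[OF sc] continuous_intros continuous_on_compose_triple[OF continuous_flow[OF a]])
  then have lim: "((\<lambda>p. speed a (snd p) (Z (fst p) (snd p))) \<longlongrightarrow> speed a t z) (at (t, t))"
    unfolding continuous_on_def by (auto dest!: spec[of _ t] simp: Zs)
  show ?thesis
    unfolding Z_def[symmetric] has_vector_derivative_def has_derivative_at_alt
  proof (intro conjI allI impI)
    show "bounded_linear (\<lambda>x. x *\<^sub>R - speed a t z)" by (rule bounded_linear_scaleR_left)
    fix e :: real assume e: "e > 0"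
    obtain d where d: "d > 0" "\<And>p. p \<noteq> (t, t) \<Longrightarrow> dist p (t, t) < d \<Longrightarrow> dist (speed a (snd p) (Z (fst p) (snd p))) (speed a t z) < e"
      using tendstoD[OF lim e] unfolding eventually_at by auto
    have near: "norm (speed a r (Z s r) - speed a t z) \<le> e" if "\<bar>s - t\<bar> < d / 2" "\<bar>r - t\<bar> < d / 2" for s r
    proof (cases "(s, r) = (t, t)")
      case True
      then show ?thesis using e by (simp add: Zs)
    next
      case False
      have "dist (s, r) (t, t) \<le> \<bar>s - t\<bar> + \<bar>r - t\<bar>"
        using norm_Pair_le[of "s - t" "r - t"] by (simp add: dist_norm)
      then show ?thesis using d(2)[OF False] that by (simp add: dist_norm)
    qed
    show "\<exists>d>0. \<forall>y. norm (y - t) < d \<longrightarrow> norm (Z y t - Z t t - (y - t) *\<^sub>R - speed a t z) \<le> e * norm (y - t)"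
    proof (intro exI conjI allI impI)
      show "d / 2 > 0" using d by simp
      fix s assume s: "norm (s - t) < d / 2"
      let ?g = "\<lambda>r. Z s r - r *\<^sub>R speed a t z"
      have dg: "(?g has_vector_derivative speed a r (Z s r) - speed a t z) (at r)" for r
        by (auto intro!: derivative_eq_intros dZ)
      have le: "((\<lambda>r. e * r) has_real_derivative e) (at r)" for r by (auto intro!: derivative_eq_intros)
      have "norm (?g t - ?g s) \<le> e * \<bar>s - t\<bar>"
      proof (cases "s \<le> t")
        case True
        have "norm (?g t - ?g s) \<le> e * t - e * s"
          by (rule norm_increment_le[OF True dg le]) (use s near in auto)
        then show ?thesis using True by (simp add: algebra_simps)
      next
        case False
        then have "t \<le> s" by simp
        then have "norm (?g s - ?g t) \<le> e * s - e * t"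
          by (rule norm_increment_le[OF _ dg le]) (use s near in auto)
        then show ?thesis using False by (simp add: norm_minus_commute algebra_simps)
      qed
      then show "norm (Z s t - Z t t - (s - t) *\<^sub>R - speed a t z) \<le> e * norm (s - t)"
        by (simp add: Zs algebra_simps)
    qed
  qed
qed

lemma force_derivative:
  fixes Da :: "real \<Rightarrow> plane \<Rightarrow> plane \<Rightarrow>\<^sub>L plane"
  assumes Da: "\<And>t x. (a t has_derivative blinfun_apply (Da t x)) (at x)" and c: "continuous_on UNIV (\<lambda>(t, x). Da t x)"
  obtains Df where "continuous_on UNIV (\<lambda>(t, w). Df t w)"
    "\<And>t w. (force lam a t has_derivative blinfun_apply (Df t w)) (at w)"
proof -
  define inl inr :: "plane \<Rightarrow>\<^sub>L phase" where "inl = Blinfun (\<lambda>u. (u, 0))" and "inr = Blinfun (\<lambda>u. (0, u))"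
  have inl: "blinfun_apply inl u = (u, 0)" and inr: "blinfun_apply inr u = (0, u)" for u
  proof -
    have "bounded_linear (\<lambda>u :: plane. (u, 0 :: plane))" "bounded_linear (\<lambda>u :: plane. (0 :: plane, u))"
      by (intro bounded_linear_Pair bounded_linear_ident bounded_linear_zero)+
    then show "blinfun_apply inl u = (u, 0)" "blinfun_apply inr u = (0, u)"
      by (simp_all add: inl_def inr_def bounded_linear_Blinfun_apply)
  qed
  define Q where "Q t = cosh t *\<^sub>R fst_blinfun + sinh t *\<^sub>R (snd_blinfun :: phase \<Rightarrow>\<^sub>L plane)" for t :: real
  define P where "P t = (- sinh t * lam) *\<^sub>R inl + (cosh t * lam) *\<^sub>R inr" for t
  define Df where "Df t w = P t o\<^sub>L Da t (fst (lin t w)) o\<^sub>L Q t" for t w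
  have Q: "blinfun_apply (Q t) w = fst (lin t w)" for t w
    by (simp add: Q_def lin_def blinfun.add_left blinfun.scaleR_left)
  have P: "blinfun_apply (P t) u = (- sinh t *\<^sub>R (lam *\<^sub>R u), cosh t *\<^sub>R (lam *\<^sub>R u))" for t u
    by (simp add: P_def blinfun.add_left blinfun.diff_left blinfun.scaleR_left inl inr)
  have eq: "force lam a t = (\<lambda>w. blinfun_apply (P t) (a t (blinfun_apply (Q t) w)))" for t
    by (simp add: fun_eq_iff force_def Let_def P Q)
  show thesis
  proof
    show "continuous_on UNIV (\<lambda>(t, w). Df t w)"
      unfolding Df_def P_def Q_def case_prod_unfold
      by (intro bounded_bilinear.continuous_on[OF bounded_bilinear_blinfun_compose] continuous_intros
          continuous_on_compose_pair[OF c])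
    show "(force lam a t has_derivative blinfun_apply (Df t w)) (at w)" for t w
    proof -
      have "((\<lambda>w. a t (Q t w)) has_derivative (\<lambda>h. Da t (Q t w) (Q t h))) (at w)"
        by (rule has_derivative_compose[OF bounded_linear_imp_has_derivative[OF blinfun.bounded_linear_right] Da])
      then have "((\<lambda>w. P t (a t (Q t w))) has_derivative (\<lambda>h. P t (Da t (Q t w) (Q t h)))) (at w)"
        by (rule bounded_linear.has_derivative[OF blinfun.bounded_linear_right])
      moreover have "blinfun_apply (Df t w) = (\<lambda>h. P t (Da t (Q t w) (Q t h)))"
        by (simp add: fun_eq_iff Df_def Q)
      ultimately show ?thesis by (simp add: eq)
    qed
  qed
qed

end

section \<open>The transported density as a classical solution\<close>

locale vlasov_field = small_data +
  fixes a :: "real \<Rightarrow> plane \<Rightarrow> plane"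
  assumes a: "small_field a" and fixed: "a t x = fld a \<bar>t\<bar> x" and C1: "C1_fun \<mu>0"
begin

text \<open>Regularised fields are \<open>C^1\<close>, and what they omit is the near field, whose
  Lipschitz constant is at most \<open>d\<close> because the smallness of \<open>\<epsilon>\<close>
  absorbs the factor in front.\<close>

lemma field_C1:
  obtains Da :: "real \<Rightarrow> plane \<Rightarrow> plane \<Rightarrow>\<^sub>L plane" where
    "continuous_on UNIV (\<lambda>(t, x). Da t x)" "\<And>t x. (a t has_derivative blinfun_apply (Da t x)) (at x)"
proof -
  let ?d = "\<lambda>n. 1 / real (Suc n)" and ?c = "1 / (2 * pi)"
  have lip: "norm ((a t x - ?c *\<^sub>R lagrangian a (coulomb_reg (?d n)) \<bar>t\<bar> x) - (a t y - ?c *\<^sub>R lagrangian a (coulomb_reg (?d n)) \<bar>t\<bar> y)) \<le> ?d n * norm (x - y)"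
    for n t x y
  proof -
    have e: "a t u - ?c *\<^sub>R lagrangian a (coulomb_reg (?d n)) \<bar>t\<bar> u = ?c *\<^sub>R lagrangian a (coulomb_near (?d n)) \<bar>t\<bar> u" for u
      unfolding fixed[of t u] fld_def lagrangian_split[OF a abs_ge_zero inverse_Suc_pos, of t u n] scaleR_add_right by simp
    have "norm (lagrangian a (coulomb_near (?d n)) \<bar>t\<bar> x - lagrangian a (coulomb_near (?d n)) \<bar>t\<bar> y)
        \<le> 12 * pi * ?d n * (16 * exp \<bar>t\<bar> * \<epsilon>\<^sup>2 * density_bound \<bar>t\<bar> * norm (x - y))"
      by (rule near_field_translation[OF a abs_ge_zero inverse_Suc_pos])
    also have "\<dots> = 192 * pi * \<epsilon>\<^sup>2 * (exp \<bar>t\<bar> * density_bound \<bar>t\<bar>) * (?d n * norm (x - y))" by simp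
    also have "\<dots> \<le> 192 * pi * \<epsilon>\<^sup>2 * (512 * pi / 1) * (?d n * norm (x - y))"
    proof (intro mult_left_mono mult_right_mono)
      have "512 * pi / cosh \<bar>t\<bar> \<le> 512 * pi / 1" using cosh_real_ge_1[of "\<bar>t\<bar>"] by (intro divide_left_mono) auto
      then show "exp \<bar>t\<bar> * density_bound \<bar>t\<bar> \<le> 512 * pi / 1" using exp_density_bound[OF abs_ge_zero, of t] by linarith
    qed auto
    also have "\<dots> = (98304 * pi\<^sup>2 * \<epsilon>\<^sup>2) * (?d n * norm (x - y))" by (simp add: power2_eq_square)
    also have "\<dots> \<le> 1 * (?d n * norm (x - y))"
    proof (rule mult_right_mono)
      have "0 \<le> singular_const * \<epsilon>\<^sup>2" "0 \<le> 98304 * pi\<^sup>2 * \<epsilon>\<^sup>2" using singular_const_pos by auto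
      then show "98304 * pi\<^sup>2 * \<epsilon>\<^sup>2 \<le> 1" using eps_small by (simp add: algebra_simps)
    qed auto
    finally have *: "norm (lagrangian a (coulomb_near (?d n)) \<bar>t\<bar> x - lagrangian a (coulomb_near (?d n)) \<bar>t\<bar> y) \<le> ?d n * norm (x - y)" by simp
    have "norm (?c *\<^sub>R lagrangian a (coulomb_near (?d n)) \<bar>t\<bar> x - ?c *\<^sub>R lagrangian a (coulomb_near (?d n)) \<bar>t\<bar> y) =
        ?c * norm (lagrangian a (coulomb_near (?d n)) \<bar>t\<bar> x - lagrangian a (coulomb_near (?d n)) \<bar>t\<bar> y)"
      by (simp flip: scaleR_diff_right)
    also have "\<dots> \<le> 1 * norm (lagrangian a (coulomb_near (?d n)) \<bar>t\<bar> x - lagrangian a (coulomb_near (?d n)) \<bar>t\<bar> y)"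
      using pi_gt3 by (intro mult_right_mono) (auto simp: divide_simps)
    finally show ?thesis unfolding e using * by simp
  qed
  show thesis
  proof (rule C1_limit[of "\<lambda>n t x. ?c *\<^sub>R lagrangian a (coulomb_reg (?d n)) \<bar>t\<bar> x"
        "\<lambda>n t x. ?c *\<^sub>R slope_integral a (?d n) \<bar>t\<bar> x x" a ?d])
    show "((\<lambda>x. ?c *\<^sub>R lagrangian a (coulomb_reg (?d n)) \<bar>t\<bar> x) has_derivative blinfun_apply (?c *\<^sub>R slope_integral a (?d n) \<bar>t\<bar> x x)) (at x)" for n t x
      using has_derivative_scaleR_right[OF lagrangian_reg_derivative[OF a inverse_Suc_pos]]
      by (simp add: blinfun.scaleR_left[abs_def])
    show "continuous_on UNIV (\<lambda>(t, x). ?c *\<^sub>R slope_integral a (?d n) \<bar>t\<bar> x x)" for n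
      unfolding case_prod_unfold
      by (intro continuous_intros continuous_on_compose_triple[OF continuous_slope_integral[OF a inverse_Suc_pos]])
    show "?d \<longlonglongrightarrow> 0" by (rule LIMSEQ_Suc[OF lim_1_over_n])
  qed (use lip that in auto)
qed

lemma mu0_derivative: "(\<mu>0 has_derivative (\<lambda>h. h \<bullet> grad \<mu>0 z)) (at z)"
  using C1 unfolding C1_fun_def by (intro differentiable_grad) blast

lemma continuous_grad: "continuous_on UNIV (grad \<mu>0)"
  using C1 by (simp add: C1_fun_def)

lemma mu_C1:
  obtains G :: "real \<Rightarrow> phase \<Rightarrow> phase \<Rightarrow> real" where
    "\<And>h. continuous_on UNIV (\<lambda>(t, z). G t z h)" "\<And>t z. (mu a t has_derivative G t z) (at z)"
proof -
  obtain Da where Da: "continuous_on UNIV (\<lambda>(t, x). Da t x)" "\<And>t x. (a t has_derivative blinfun_apply (Da t x)) (at x)"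
    by (rule field_C1) (rule that; assumption)
  obtain Df where Df: "continuous_on UNIV (\<lambda>(t, w). Df t w)" "\<And>t w. (force lam a t has_derivative blinfun_apply (Df t w)) (at w)"
    by (rule force_derivative[OF Da(2,1)]) (rule that; assumption)
  have bd: "norm (Df t w) \<le> exp \<bar>t\<bar>" for t w
    by (rule norm_derivative_le_lipschitz[OF Df(2) force_lipschitz[OF a]]) simp
  obtain J where J: "continuous_on UNIV (\<lambda>(s, t, u). J s t u)"
    "\<And>s t u. ((\<lambda>u. flow lam a s u t) has_derivative blinfun_apply (J s t u)) (at u)"
    by (rule ode_flow_has_derivative[OF Df(2,1) _ bd flow_init[OF a] flow_deriv[OF a] continuous_flow[OF a]])
       (auto intro!: continuous_intros)
  define G where "G t z h = J t 0 (lin (- t) z) (lin (- t) h) \<bullet> grad \<mu>0 (orig a t z)" for t z h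
  show thesis
  proof
    show "continuous_on UNIV (\<lambda>(t, z). G t z h)" for h
      unfolding G_def case_prod_unfold
      by (intro continuous_intros continuous_on_compose_triple[OF J(1)]
          continuous_on_compose2[OF continuous_grad] continuous_on_compose_pair[OF continuous_orig[OF a]]) auto
    show "(mu a t has_derivative G t z) (at z)" for t z
    proof -
      have "(orig a t has_derivative (\<lambda>h. J t 0 (lin (- t) z) (lin (- t) h))) (at z)"
        unfolding orig_def[abs_def]
        by (rule has_derivative_compose[OF bounded_linear_imp_has_derivative[OF bounded_linear_lin] J(2)])
      from has_derivative_compose[OF this mu0_derivative] show ?thesis
        by (simp add: mu_def[abs_def] G_def[abs_def])
    qed
  qed
qed

lemma mu_global_solution: "global_solution lam \<mu>0 (mu a)"
proof -
  obtain G where G: "\<And>h. continuous_on UNIV (\<lambda>(t, z). G t z h)" "\<And>t z. (mu a t has_derivative G t z) (at z)"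
    by (rule mu_C1) (rule that; assumption)
  have lin: "bounded_linear (G t z)" for t z by (rule has_derivative_bounded_linear[OF G(2)])
  have Gc: "continuous_on S (\<lambda>p. G (fst p) (snd p) h)" for S h
    using continuous_on_subset[OF G(1)] by (simp add: case_prod_unfold)
  have efld: "efield (mu a t) x = a t x" if "t \<ge> 0" for t x
    using efield_mu[OF a that] fixed[of t x] that by simp
  have acont: "continuous_on UNIV (\<lambda>(t, x). a t x)" using a by (simp add: small_field_def)
  define dx where "dx p = (\<Sum>i\<in>Basis. G (fst p) (snd p) (i, 0) *\<^sub>R i)" for p :: "real \<times> phase"
  define dv where "dv p = (\<Sum>i\<in>Basis. G (fst p) (snd p) (0, i) *\<^sub>R i)" for p :: "real \<times> phase"
  define dt where "dt p = - (snd (snd p) \<bullet> dx p + fst (snd p) \<bullet> dv p + lam * (a (fst p) (fst (snd p)) \<bullet> dv p))" for p :: "real \<times> phase"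
  have Gx: "G t z (h, 0) = h \<bullet> dx (t, z)" and Gv: "G t z (0, h) = h \<bullet> dv (t, z)" for t z h
  proof -
    interpret bounded_linear "G t z" by (rule lin)
    interpret l: bounded_linear "\<lambda>h. G t z (h, 0)"
      by (rule bounded_linear_compose[OF bounded_linear_axioms])
         (intro bounded_linear_Pair bounded_linear_ident bounded_linear_zero)
    interpret r: bounded_linear "\<lambda>h. G t z (0, h)"
      by (rule bounded_linear_compose[OF bounded_linear_axioms])
         (intro bounded_linear_Pair bounded_linear_ident bounded_linear_zero)
    have "G t z (h, 0) = G t z (\<Sum>i\<in>Basis. (h \<bullet> i) *\<^sub>R i, 0)" "G t z (0, h) = G t z (0, \<Sum>i\<in>Basis. (h \<bullet> i) *\<^sub>R i)"
      by (simp_all add: euclidean_representation)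
    then show "G t z (h, 0) = h \<bullet> dx (t, z)" "G t z (0, h) = h \<bullet> dv (t, z)"
      unfolding l.sum r.sum by (simp_all add: l.scaleR r.scaleR dx_def dv_def inner_sum_right mult.commute)
  qed
  have dxc: "continuous_on S dx" and dvc: "continuous_on S dv" for S
    unfolding dx_def dv_def by (intro continuous_intros Gc)+
  have dtc: "continuous_on S dt" for S
    unfolding dt_def by (intro continuous_intros dxc dvc continuous_on_compose_pair[OF acont])
  have time: "((\<lambda>s. mu a s z) has_real_derivative dt (t, z)) (at t)" for t z
  proof -
    \<comment> \<open>Constancy along trajectories moves the dependence on \<open>s\<close> from the
      density into the starting time of a trajectory, so the spatial derivative at the one time
      \<open>t\<close> suffices.\<close>
    have "mu a s z = mu a t (lin t (flow lam a s (lin (- s) z) t))" for s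
      by (simp add: mu_def orig_def flow_flow[OF a])
    moreover have "((\<lambda>s. mu a t (lin t (flow lam a s (lin (- s) z) t))) has_derivative (\<lambda>h. G t z (h *\<^sub>R - speed a t z))) (at t)"
    proof -
      have 1: "((\<lambda>s. lin t (flow lam a s (lin (- s) z) t)) has_derivative (\<lambda>h. h *\<^sub>R - speed a t z)) (at t)"
        using start_time_deriv[OF a] unfolding has_vector_derivative_def .
      have 2: "(mu a t has_derivative G t z) (at (lin t (flow lam a t (lin (- t) z) t)))"
        using G(2) by (simp add: flow_init[OF a])
      show ?thesis by (rule has_derivative_compose[OF 1 2])
    qed
    moreover have "G t z (h *\<^sub>R - speed a t z) = h * dt (t, z)" for h
    proof -
      interpret bounded_linear "G t z" by (rule lin)
      have "G t z (speed a t z) = G t z ((snd z, 0) + (0, fst z + lam *\<^sub>R a t (fst z)))" by (simp add: speed_def)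
      also have "\<dots> = - dt (t, z)" unfolding add Gx Gv by (simp add: dt_def inner_add_left algebra_simps)
      finally show ?thesis by (simp add: linear_simps[OF lin])
    qed
    ultimately have "((\<lambda>s. mu a s z) has_derivative (\<lambda>h. h * dt (t, z))) (at t)" by simp
    moreover have "(\<lambda>h. h * dt (t, z)) = (*) (dt (t, z))" by (simp add: fun_eq_iff)
    ultimately show ?thesis unfolding has_field_derivative_def by (simp only:)
  qed
  show ?thesis
    unfolding global_solution_def
  proof (intro conjI allI impI;
      (rule exI[of _ dt], rule exI[of _ dx], rule exI[of _ dv], intro conjI allI impI dtc dxc dvc)?)
    show "mu a 0 = \<mu>0" by (simp add: mu_def fun_eq_iff a)
    fix t :: real assume t: "t \<ge> 0"
    show "field_defined (mu a t)" by (rule field_defined_mu[OF a t])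
    have [measurable]: "mu a t \<in> borel_measurable borel" by (rule measurable_mu[OF a])
    have "(\<integral>\<^sup>+z. ennreal ((mu a t z)\<^sup>2) \<partial>lborel) = (\<integral>\<^sup>+z. ennreal ((\<mu>0 z)\<^sup>2) \<partial>lborel)"
      unfolding mu_def by (rule mpres_nn_integral[OF mpres_orig[OF a t], of "\<lambda>z. ennreal ((\<mu>0 z)\<^sup>2)"]) measurable
    also have "\<dots> < \<infinity>" using integrable_sq by (simp add: integrable_iff_bounded)
    finally show "in_L2 (mu a t)" by (simp add: in_L2_def L2_norm_def Let_def)
    show "GDERIV (\<lambda>y. mu a t (y, v)) x :> dx (t, x, v)" for x v
    proof -
      have "((\<lambda>y. mu a t (y, v)) has_derivative (\<lambda>h. G t (x, v) (h, 0))) (at x)"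
        by (rule has_derivative_compose[OF _ G(2)]) (auto intro!: derivative_eq_intros)
      then show ?thesis by (simp add: gderiv_def Gx)
    qed
    show "GDERIV (\<lambda>w. mu a t (x, w)) v :> dv (t, x, v)" for x v
    proof -
      have "((\<lambda>w. mu a t (x, w)) has_derivative (\<lambda>h. G t (x, v) (0, h))) (at v)"
        by (rule has_derivative_compose[OF _ G(2)]) (auto intro!: derivative_eq_intros)
      then show ?thesis by (simp add: gderiv_def Gv)
    qed
    show "((\<lambda>s. mu a s (x, v)) has_real_derivative dt (t, x, v)) (at t within {0..})" for x v
      by (rule has_field_derivative_at_within[OF time])
    show "dt (t, x, v) + v \<bullet> dx (t, x, v) + x \<bullet> dv (t, x, v) + lam * (efield (mu a t) x \<bullet> dv (t, x, v)) = 0" for x v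
      by (simp add: dt_def efld[OF t])
  next
    have "continuous_on ({0..} \<times> UNIV) (\<lambda>(t, x). a t x)" by (rule continuous_on_subset[OF acont]) simp
    then show "continuous_on ({0..} \<times> UNIV) (\<lambda>(t, x). efield (mu a t) x)"
      by (rule continuous_on_eq) (auto simp: efld)
    fix T :: real
    show "bounded ((\<lambda>(t, x). efield (mu a t) x) ` ({0..T} \<times> UNIV))"
      unfolding bounded_iff
    proof (intro exI[of _ 1] ballI, clarify)
      fix t :: real and x :: plane assume "t \<in> {0..T}"
      then have "efield (mu a t) x = a t x" by (simp add: efld)
      moreover have "norm (a t x) \<le> exp (- \<bar>t\<bar>) / 36" using a unfolding small_field_def by blast
      ultimately have "norm (efield (mu a t) x) \<le> exp (- \<bar>t\<bar>) / 36" by simp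
      also have "\<dots> \<le> 1"
      proof -
        have "exp (- \<bar>t\<bar>) \<le> 1" by simp
        then show ?thesis by linarith
      qed
      finally show "norm (efield (mu a t) x) \<le> 1" .
    qed
  qed
qed

end

section \<open>Uniqueness\<close>

locale competitor = vlasov_field +
  fixes \<nu> :: "real \<Rightarrow> phase \<Rightarrow> real"
  assumes sol: "global_solution lam \<mu>0 \<nu>"
begin

definition F :: "real \<Rightarrow> plane \<Rightarrow> plane" where "F t x = efield (\<nu> t) x"

lemma nu_0: "\<nu> 0 = \<mu>0"
  and nu_L2: "t \<ge> 0 \<Longrightarrow> in_L2 (\<nu> t)"
  and nu_field: "t \<ge> 0 \<Longrightarrow> field_defined (\<nu> t)"
  and continuous_F: "continuous_on ({0..} \<times> UNIV) (\<lambda>(t, x). F t x)"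
  and bounded_F: "T \<ge> 0 \<Longrightarrow> bounded ((\<lambda>(t, x). F t x) ` ({0..T} \<times> UNIV))"
  using sol unfolding global_solution_def F_def by blast+

lemma F_bound:
  assumes "T \<ge> 0"
  obtains M where "M > 0" "\<And>t x. 0 \<le> t \<Longrightarrow> t \<le> T \<Longrightarrow> norm (F t x) \<le> M"
proof -
  obtain M where M: "M > 0" "\<forall>y\<in>(\<lambda>(t, x). F t x) ` ({0..T} \<times> UNIV). norm y \<le> M"
    using bounded_F[OF assms] unfolding bounded_pos by blast
  have "norm (F t x) \<le> M" if "0 \<le> t" "t \<le> T" for t x
    using that by (intro M(2)[rule_format]) (auto intro!: image_eqI[of _ _ "(t, x)"])
  with M(1) that show thesis by blast
qed

lemma measurable_F: "t \<ge> 0 \<Longrightarrow> F t \<in> borel_measurable borel"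
proof -
  assume t: "t \<ge> 0"
  have "continuous_on UNIV (\<lambda>x. (\<lambda>(t, x). F t x) (t, x))"
    by (rule continuous_on_compose2[OF continuous_F]) (use t in \<open>auto intro!: continuous_intros\<close>)
  then show ?thesis by (simp add: borel_measurable_continuous_onI)
qed

text \<open>Continuous partial derivatives combine to a joint derivative, one-sided in time at 0.
  With the equation substituted for the time derivative, the rate of change of \<open>\<nu>\<close>
  along a curve is the gradient times the difference between the velocity of the curve and
  \<open>speed F\<close>.\<close>

lemma total_derivative:
  obtains D :: "real \<times> phase \<Rightarrow> phase" where
    "continuous_on ({0..} \<times> UNIV) D"
    "\<And>t z. t \<ge> 0 \<Longrightarrow> ((\<lambda>(t, z). \<nu> t z) has_derivative
       (\<lambda>(h, k). k \<bullet> D (t, z) - h * (speed F t z \<bullet> D (t, z)))) (at (t, z) within {0..} \<times> UNIV)"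
proof -
  obtain dt dx dv where c: "continuous_on ({0..} \<times> UNIV) (dt :: real \<times> phase \<Rightarrow> real)"
      "continuous_on ({0..} \<times> UNIV) (dx :: real \<times> phase \<Rightarrow> plane)"
      "continuous_on ({0..} \<times> UNIV) (dv :: real \<times> phase \<Rightarrow> plane)"
    and der: "\<And>t x v. t \<ge> 0 \<Longrightarrow> ((\<lambda>s. \<nu> s (x, v)) has_real_derivative dt (t, x, v)) (at t within {0..})"
      "\<And>t x v. t \<ge> 0 \<Longrightarrow> GDERIV (\<lambda>y. \<nu> t (y, v)) x :> dx (t, x, v)"
      "\<And>t x v. t \<ge> 0 \<Longrightarrow> GDERIV (\<lambda>w. \<nu> t (x, w)) v :> dv (t, x, v)"
    and eq: "\<And>t x v. t \<ge> 0 \<Longrightarrow> dt (t, x, v) + v \<bullet> dx (t, x, v) + x \<bullet> dv (t, x, v)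
             + lam * (F t x \<bullet> dv (t, x, v)) = 0"
    using sol unfolding global_solution_def F_def by blast
  define D where "D p = (dx p, dv p)" for p
  have Dc: "continuous_on ({0..} \<times> UNIV) D" unfolding D_def by (intro continuous_intros c)
  have space: "(\<nu> t has_derivative (\<lambda>k. k \<bullet> D (t, z))) (at z)" if t: "t \<ge> 0" for t z
  proof -
    obtain x v where z: "z = (x, v)" by (cases z)
    have "continuous_on UNIV (\<lambda>p. dv (t, p))"
      by (rule continuous_on_compose2[OF c(3)]) (use t in \<open>auto intro!: continuous_intros\<close>)
    then have "continuous_on UNIV (\<lambda>p. blinfun_inner_left (dv (t, p)))"
      by (rule bounded_linear.continuous_on[OF bounded_linear_blinfun_inner_left])
    then have cont: "continuous (at (x, v) within UNIV \<times> UNIV) (\<lambda>(x, v). blinfun_inner_left (dv (t, x, v)))"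
      by (simp add: continuous_on_eq_continuous_within case_prod_unfold)
    have "((\<lambda>(x, v). \<nu> t (x, v)) has_derivative (\<lambda>(tx, ty). tx \<bullet> dx (t, x, v) + blinfun_inner_left (dv (t, x, v)) ty)) (at (x, v) within UNIV \<times> UNIV)"
      by (rule has_derivative_partialsI[OF _ _ cont]) (use der(2,3)[OF t] in \<open>auto simp: gderiv_def blinfun_inner_left.rep_eq\<close>)
    then show ?thesis
      by (simp add: z D_def case_prod_unfold inner_prod_def blinfun_inner_left.rep_eq)
  qed
  show thesis
  proof (rule that[OF Dc])
    fix t :: real and z :: phase assume t: "t \<ge> 0"
    obtain x v where z: "z = (x, v)" by (cases z)
    have "continuous_on ({0..} \<times> UNIV) (\<lambda>p. blinfun_inner_left (D p))"
      by (rule bounded_linear.continuous_on[OF bounded_linear_blinfun_inner_left Dc])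
    then have cont: "continuous (at (t, z) within {0..} \<times> UNIV) (\<lambda>(t, z). blinfun_inner_left (D (t, z)))"
      using t unfolding continuous_on_eq_continuous_within by (auto simp: case_prod_unfold simp del: split_paired_All)
    have "((\<lambda>(t, z). \<nu> t z) has_derivative (\<lambda>(h, k). h * dt (t, z) + blinfun_inner_left (D (t, z)) k)) (at (t, z) within {0..} \<times> UNIV)"
    proof (rule has_derivative_partialsI[OF _ _ cont])
      have "(*) (dt (t, z)) = (\<lambda>h. h * dt (t, z))" by (simp add: fun_eq_iff)
      then show "((\<lambda>s. \<nu> s z) has_derivative (\<lambda>h. h * dt (t, z))) (at t within {0..})"
        using der(1)[OF t, of x v] by (simp add: z has_field_derivative_def)
    qed (use space in \<open>auto simp: blinfun_inner_left.rep_eq\<close>)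
    moreover have "dt (t, z) = - (speed F t z \<bullet> D (t, z))"
      using eq[OF t, of x v] by (simp add: z speed_def D_def inner_add_left)
    ultimately show "((\<lambda>(t, z). \<nu> t z) has_derivative
       (\<lambda>(h, k). k \<bullet> D (t, z) - h * (speed F t z \<bullet> D (t, z)))) (at (t, z) within {0..} \<times> UNIV)"
      by (simp add: case_prod_unfold blinfun_inner_left.rep_eq)
  qed
qed

lemma measurable_nu [measurable]: "t \<ge> 0 \<Longrightarrow> \<nu> t \<in> borel_measurable borel"
  using nu_L2 by (simp add: in_L2_def)

lemma force_F_bound:
  assumes "0 \<le> r" "r \<le> T" "norm (F r (fst (lin r w))) \<le> M"
  shows "norm (force lam F r w) \<le> exp T * M"
proof -
  have "norm (force lam F r w) \<le> exp \<bar>r\<bar> * norm (F r (fst (lin r w)))" by (rule norm_force)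
  also have "\<dots> \<le> exp T * M" using assms by (intro mult_mono) auto
  finally show ?thesis .
qed

text \<open>On each step the polygon moves with the force frozen at its start, which differs little
  from the current force by uniform continuity on the compact set that polygons can reach. So
  \<open>\<nu>\<close> changes by \<open>o(h)\<close> per step and by \<open>o(1)\<close> in
  total.\<close>

lemma nu_euler:
  assumes t: "t \<ge> 0" and \<eta>: "\<eta> > 0"
  shows "\<forall>\<^sub>F n in sequentially. \<forall>w. norm w \<le> R \<longrightarrow>
     \<bar>\<nu> t (lin t (euler F (t / n) n w)) - \<mu>0 w\<bar> \<le> \<eta>"
proof (rule total_derivative)
  fix D :: "real \<times> phase \<Rightarrow> phase"
  assume Dc: "continuous_on ({0..} \<times> UNIV) D"
    and D: "\<And>t z. t \<ge> 0 \<Longrightarrow> ((\<lambda>(t, z). \<nu> t z) has_derivative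
       (\<lambda>(h, k). k \<bullet> D (t, z) - h * (speed F t z \<bullet> D (t, z)))) (at (t, z) within {0..} \<times> UNIV)"
  obtain M where M: "M > 0" "\<And>r x. 0 \<le> r \<Longrightarrow> r \<le> t \<Longrightarrow> norm (F r x) \<le> M"
    using F_bound[OF t] by blast
  define B where "B = exp t * M"
  have B: "B > 0" "\<And>r w. 0 \<le> r \<Longrightarrow> r \<le> t \<Longrightarrow> norm (force lam F r w) \<le> B"
    using M by (auto simp: B_def intro!: force_F_bound)
  \<comment> \<open>\<open>R1\<close> bounds the polygons in profile coordinates and
    \<open>R2\<close> their physical images, where \<open>K\<close> will bound the gradient.\<close>
  define R1 where "R1 = \<bar>R\<bar> + t * B"
  define R2 where "R2 = 2 * exp t * R1"
  have "compact (D ` ({0..t} \<times> cball 0 R2))"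
    by (intro compact_continuous_image continuous_on_subset[OF Dc] compact_Times) auto
  then obtain K where K: "K > 0" "\<And>p. p \<in> {0..t} \<times> cball 0 R2 \<Longrightarrow> norm (D p) \<le> K"
    using bounded_pos[of "D ` ({0..t} \<times> cball 0 R2)"] by (auto dest!: compact_imp_bounded)
  define \<omega> where "\<omega> = \<eta> / (2 * exp t * K * (t + 1))"
  have \<omega>: "\<omega> > 0" using \<eta> K t by (simp add: \<omega>_def)
  have fc: "continuous_on ({0..t} \<times> cball 0 R1) (\<lambda>(r, w). force lam F r w)"
  proof -
    have "continuous_on ({0..t} \<times> cball 0 R1) (\<lambda>p. (\<lambda>(t, x). F t x) (fst p, fst (lin (fst p) (snd p))))"
      by (rule continuous_on_compose2[OF continuous_F]) (auto intro!: continuous_intros)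
    then show ?thesis unfolding force_def Let_def case_prod_unfold by (intro continuous_intros) auto
  qed
  then have "uniformly_continuous_on ({0..t} \<times> cball 0 R1) (\<lambda>(r, w). force lam F r w)"
    by (intro compact_uniformly_continuous compact_Times) auto
  then obtain \<delta> where \<delta>: "\<delta> > 0" "\<And>p q. p \<in> {0..t} \<times> cball 0 R1 \<Longrightarrow> q \<in> {0..t} \<times> cball 0 R1 \<Longrightarrow>
      dist q p < \<delta> \<Longrightarrow> dist ((\<lambda>(r, w). force lam F r w) q) ((\<lambda>(r, w). force lam F r w) p) < \<omega>"
    using \<omega> unfolding uniformly_continuous_on_def by meson
  have main: "\<bar>\<nu> t (lin t (euler F (t / n) n w)) - \<mu>0 w\<bar> \<le> \<eta>"
    if n: "t / real n < \<delta> / (1 + B)" "n > 0" and w: "norm w \<le> R" for n w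
  proof -
    define h where "h = t / n"
    have h: "h \<ge> 0" "h * (1 + B) < \<delta>" "real n * h = t"
      using n t B(1) by (auto simp: h_def field_simps)
    define C where "C = 2 * exp t * \<omega> * K"
    let ?w = "\<lambda>k. euler F h k w"
    have wk: "norm (?w k + s *\<^sub>R force lam F (k * h) (?w k)) \<le> R1" if k: "k < n" and s: "0 \<le> s" "s \<le> h" for k s
    proof -
      have kh: "real k * h + h \<le> t"
        using k h mult_right_mono[of "real (Suc k)" "real n" h] by (simp add: algebra_simps)
      have b: "norm (force lam F (real j * h) u) \<le> B" if "j < n" for j u
      proof (rule B(2))
        show "real j * h \<le> t" using that h mult_right_mono[of "real j" "real n" h] by simp
      qed (use h in simp)
      have "norm (?w k - w) \<le> real k * h * B"
        by (rule norm_euler_diff[OF h(1) b]) (use k in auto)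
      moreover have "norm (s *\<^sub>R force lam F (k * h) (?w k)) \<le> h * B"
        using b[OF k] s B(1) by (simp add: mult_mono)
      moreover have "(real k * h + h) * B \<le> t * B" using kh B by (intro mult_right_mono) auto
      moreover have "norm (?w k + s *\<^sub>R force lam F (k * h) (?w k)) \<le> norm w + norm (?w k - w) + norm (s *\<^sub>R force lam F (k * h) (?w k))"
        using norm_triangle_ineq[of "?w k" "s *\<^sub>R force lam F (k * h) (?w k)"] norm_triangle_sub[of "?w k" w] by simp
      ultimately show ?thesis using w by (simp add: R1_def algebra_simps)
    qed
    have "\<bar>\<nu> (k * h) (lin (k * h) (?w k)) - \<mu>0 w\<bar> \<le> k * h * C" if "k \<le> n" for k
      using that
    proof (induction k)
      case 0
      then show ?case by (simp add: nu_0)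
    next
      case (Suc k)
      let ?r = "real k * h" and ?z = "?w k" and ?b = "force lam F (real k * h) (?w k)"
      have kn: "k < n" using Suc by simp
      have r: "0 \<le> ?r" "?r + h \<le> t"
        using kn h mult_right_mono[of "real (Suc k)" "real n" h] by (auto simp: algebra_simps)
      define c where "c s = lin (?r + s) (?z + s *\<^sub>R ?b)" for s
      define g where "g s = \<nu> (?r + s) (c s)" for s
      define g' where "g' s = lin (?r + s) (?b - force lam F (?r + s) (?z + s *\<^sub>R ?b)) \<bullet> D (?r + s, c s)" for s
      have dc: "(c has_vector_derivative (snd (c s), fst (c s)) + lin (?r + s) ?b) (at s)" for s
      proof -
        have "((\<lambda>u. ?z + (u - ?r) *\<^sub>R ?b) has_vector_derivative ?b) (at (?r + s))"
          by (auto intro!: derivative_eq_intros)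
        note l = lin_deriv[OF this]
        have "((\<lambda>s. ?r + s) has_real_derivative 1) (at s)" by (auto intro!: derivative_eq_intros)
        from vector_diff_chain_at[OF this[unfolded has_real_derivative_iff_has_vector_derivative] l]
        show ?thesis by (simp add: o_def c_def[abs_def])
      qed
      have dg: "((\<lambda>s. g s) has_derivative (\<lambda>h. h *\<^sub>R g' s)) (at s within {0..h})" if s: "0 \<le> s" for s
      proof -
        have 1: "((\<lambda>s. (?r + s, c s)) has_derivative (\<lambda>u. (u, u *\<^sub>R ((snd (c s), fst (c s)) + lin (?r + s) ?b)))) (at s within {0..h})"
          by (intro has_derivative_Pair has_derivative_at_withinI[OF dc[unfolded has_vector_derivative_def]])
             (auto intro!: derivative_eq_intros)
        have "(\<lambda>s. (?r + s, c s)) ` {0..h} \<subseteq> {0..} \<times> UNIV" using r by auto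
        from has_derivative_in_compose[OF 1 has_derivative_subset[OF D[of "?r + s" "c s"] this]]
        have "((\<lambda>s. \<nu> (?r + s) (c s)) has_derivative (\<lambda>u. (u *\<^sub>R ((snd (c s), fst (c s)) + lin (?r + s) ?b)) \<bullet> D (?r + s, c s)
            - u * (speed F (?r + s) (c s) \<bullet> D (?r + s, c s)))) (at s within {0..h})"
          using r s by simp
        moreover have "(u *\<^sub>R ((snd (c s), fst (c s)) + lin (?r + s) ?b)) \<bullet> D (?r + s, c s) - u * (speed F (?r + s) (c s) \<bullet> D (?r + s, c s)) = u *\<^sub>R g' s" for u
        proof -
          have "speed F (?r + s) (c s) = (snd (c s), fst (c s)) + lin (?r + s) (force lam F (?r + s) (?z + s *\<^sub>R ?b))"
            by (simp add: force_lin speed_def c_def)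
          moreover have "(u *\<^sub>R (q + l)) \<bullet> p - u * ((q + l') \<bullet> p) = u *\<^sub>R ((l - l') \<bullet> p)" for q l l' p :: phase
            by (simp add: inner_add_left inner_diff_left algebra_simps)
          ultimately show ?thesis unfolding g'_def lin_diff by (simp only:)
        qed
        ultimately show ?thesis by (simp add: g_def)
      qed
      have "norm (g h - g 0) \<le> C * norm (h - 0)"
      proof (rule differentiable_bound[where S = "{0..h}" and f' = "\<lambda>s h. h *\<^sub>R g' s"])
        fix s assume s: "s \<in> {0..h}"
        show "(g has_derivative (\<lambda>u. u *\<^sub>R g' s)) (at s within {0..h})" using dg s by auto
        have in1: "(?r + s, ?z + s *\<^sub>R ?b) \<in> {0..t} \<times> cball 0 R1" "(?r, ?z) \<in> {0..t} \<times> cball 0 R1"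
          using wk[OF kn, of s] wk[OF kn, of 0] s r by auto
        have "dist (?r, ?z) (?r + s, ?z + s *\<^sub>R ?b) \<le> s + s * B"
          using norm_Pair_le[of s "s *\<^sub>R ?b"] s mult_left_mono[OF B(2)[of ?r ?z], of s] r h
          by (simp add: dist_norm norm_minus_commute norm_Pair)
        also have "\<dots> = s * (1 + B)" by (simp add: algebra_simps)
        also have "\<dots> \<le> h * (1 + B)" using s B by (intro mult_right_mono) auto
        also have "\<dots> < \<delta>" by (rule h(2))
        finally have "norm (?b - force lam F (?r + s) (?z + s *\<^sub>R ?b)) < \<omega>"
          using \<delta>(2)[OF in1] by (simp add: dist_norm)
        moreover have "exp \<bar>?r + s\<bar> \<le> exp t" using s r by auto
        ultimately have l: "norm (lin (?r + s) (?b - force lam F (?r + s) (?z + s *\<^sub>R ?b))) \<le> 2 * exp t * \<omega>"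
          by (intro order_trans[OF norm_lin_le] mult_mono) auto
        have "norm (c s) \<le> 2 * exp \<bar>?r + s\<bar> * norm (?z + s *\<^sub>R ?b)"
          unfolding c_def by (rule norm_lin_le)
        also have "\<dots> \<le> 2 * exp t * R1"
          using \<open>exp \<bar>?r + s\<bar> \<le> exp t\<close> wk[OF kn, of s] s by (intro mult_mono) auto
        finally have "norm (D (?r + s, c s)) \<le> K"
          using s r by (intro K(2)) (auto simp: R2_def)
        then have "\<bar>g' s\<bar> \<le> C"
          using Cauchy_Schwarz_ineq2[of "lin (?r + s) (?b - force lam F (?r + s) (?z + s *\<^sub>R ?b))" "D (?r + s, c s)"]
            mult_mono[OF l, of "norm (D (?r + s, c s))" K] \<omega> by (simp add: C_def g'_def)
        then show "onorm (\<lambda>u. u *\<^sub>R g' s) \<le> C"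
          by (intro onorm_bound) (auto simp: C_def abs_mult mult.commute[of _ "\<bar>g' s\<bar>"] intro!: mult_right_mono mult_nonneg_nonneg less_imp_le[OF \<omega>] less_imp_le[OF K(1)])
      qed (use h in auto)
      moreover have "g h = \<nu> (Suc k * h) (lin (Suc k * h) (?w (Suc k)))" "g 0 = \<nu> ?r (lin ?r ?z)"
        by (simp_all add: g_def c_def algebra_simps)
      ultimately have "\<bar>\<nu> (Suc k * h) (lin (Suc k * h) (?w (Suc k))) - \<nu> ?r (lin ?r ?z)\<bar> \<le> C * h"
        using h by simp
      moreover have "\<bar>\<nu> ?r (lin ?r ?z) - \<mu>0 w\<bar> \<le> ?r * C" using Suc by simp
      moreover have "real (Suc k) * h * C = ?r * C + C * h" by (simp add: algebra_simps)
      ultimately show ?case by linarith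
    qed
    from this[of n] have "\<bar>\<nu> t (lin t (?w n)) - \<mu>0 w\<bar> \<le> t * C" by (simp add: h)
    also have "t * C = \<eta> * (t / (t + 1))"
    proof -
      have "C = \<eta> / (t + 1)" using K(1) t by (simp add: C_def \<omega>_def)
      then show ?thesis by simp
    qed
    also have "\<dots> \<le> \<eta> * 1" using t \<eta> by (intro mult_left_mono) auto
    finally show ?thesis by (simp add: h_def)
  qed
  have "(\<lambda>n. t / real n) \<longlonglongrightarrow> 0" by (rule lim_const_over_n)
  moreover have "0 < \<delta> / (1 + B)" using \<delta>(1) B(1) by simp
  ultimately have "\<forall>\<^sub>F n in sequentially. t / real n < \<delta> / (1 + B)"
    by (rule order_tendstoD(2))
  then show ?thesis using eventually_gt_at_top[of 0]
    by eventually_elim (use main in blast)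
qed

text \<open>The field of a competing solution is merely continuous, so its characteristics need not be
  unique; Euler polygons take their place.\<close>

definition fwd :: "real \<Rightarrow> nat \<Rightarrow> phase \<Rightarrow> phase" where "fwd t n = euler F (t / real (Suc n)) (Suc n)"
definition bwd :: "real \<Rightarrow> nat \<Rightarrow> phase \<Rightarrow> phase" where "bwd t n = euler_back F (t / real (Suc n)) (Suc n)"

lemma fwd_bwd: "fwd t n (bwd t n w) = w" and bwd_fwd: "bwd t n (fwd t n w) = w"
  unfolding fwd_def bwd_def by (rule euler_euler_back euler_back_euler)+

lemma mpres_fwd: "t \<ge> 0 \<Longrightarrow> mpres (fwd t n)" and mpres_bwd: "t \<ge> 0 \<Longrightarrow> mpres (bwd t n)"
  unfolding fwd_def bwd_def by (intro mpres_euler mpres_euler_back measurable_F; simp)+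

lemma displacement_bound:
  assumes t: "t \<ge> 0"
  obtains B where "B > 0" "\<And>n w. norm (fwd t n w - w) \<le> B" "\<And>n w. norm (bwd t n w - w) \<le> B"
proof -
  obtain M where M: "M > 0" "\<And>r x. 0 \<le> r \<Longrightarrow> r \<le> t \<Longrightarrow> norm (F r x) \<le> M"
    using F_bound[OF t] by blast
  have b: "norm (force lam F (real k * (t / real (Suc n))) w) \<le> exp t * M" if "k < Suc n" for k n w
  proof (rule force_F_bound)
    show "real k * (t / real (Suc n)) \<le> t"
      using that t mult_right_mono[of "real k" "real (Suc n)" "t / real (Suc n)"] by simp
    then show "norm (F (real k * (t / real (Suc n))) x) \<le> M" for x using M(2) t by simp
  qed (use t in simp)
  have h: "0 \<le> t / real (Suc n)" for n using t by simp
  have "norm (fwd t n w - w) \<le> real (Suc n) * (t / real (Suc n)) * (exp t * M)" for n w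
    unfolding fwd_def by (rule norm_euler_diff[OF h b]) auto
  moreover have "norm (bwd t n w - w) \<le> real (Suc n) * (t / real (Suc n)) * (exp t * M)" for n w
    unfolding bwd_def by (rule norm_euler_back_diff[OF h b])
  moreover have "real (Suc n) * (t / real (Suc n)) * (exp t * M) \<le> t * (exp t * M) + 1" for n by simp
  ultimately have "norm (fwd t n w - w) \<le> t * (exp t * M) + 1" "norm (bwd t n w - w) \<le> t * (exp t * M) + 1" for n w
    by (meson order_trans)+
  moreover have "t * (exp t * M) + 1 > 0" using t M by (simp add: add_nonneg_pos)
  ultimately show thesis using that by blast
qed

text \<open>The second limit follows from the first at the moving points \<open>bwd t n w\<close>:
  these stay in a fixed ball, on which the first convergence is uniform, and \<open>fwd\<close>
  returns them to \<open>w\<close>.\<close>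

lemma nu_fwd_limit:
  assumes t: "t \<ge> 0"
  shows "(\<lambda>n. \<nu> t (lin t (fwd t n w))) \<longlonglongrightarrow> \<mu>0 w" and "(\<lambda>n. \<mu>0 (bwd t n w)) \<longlonglongrightarrow> \<nu> t (lin t w)"
proof -
  obtain B where B: "B > 0" "\<And>n w. norm (bwd t n w - w) \<le> B"
    by (rule displacement_bound[OF t]) (rule that; assumption)
  have ev: "\<forall>\<^sub>F n in sequentially. \<forall>w. norm w \<le> R \<longrightarrow> \<bar>\<nu> t (lin t (fwd t n w)) - \<mu>0 w\<bar> \<le> \<eta>" if "\<eta> > 0" for R \<eta>
    using eventually_sequentially_Suc[THEN iffD2, OF nu_euler[OF t that, of R]] unfolding fwd_def .
  show "(\<lambda>n. \<nu> t (lin t (fwd t n w))) \<longlonglongrightarrow> \<mu>0 w"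
  proof (rule tendstoI)
    fix e :: real assume e: "e > 0"
    then have "\<forall>\<^sub>F n in sequentially. \<forall>u. norm u \<le> norm w \<longrightarrow> \<bar>\<nu> t (lin t (fwd t n u)) - \<mu>0 u\<bar> \<le> e / 2"
      by (intro ev) simp
    then show "\<forall>\<^sub>F n in sequentially. dist (\<nu> t (lin t (fwd t n w))) (\<mu>0 w) < e"
    proof eventually_elim
      case (elim n)
      then have "\<bar>\<nu> t (lin t (fwd t n w)) - \<mu>0 w\<bar> \<le> e / 2" by blast
      then show ?case using e by (simp add: dist_real_def)
    qed
  qed
  show "(\<lambda>n. \<mu>0 (bwd t n w)) \<longlonglongrightarrow> \<nu> t (lin t w)"
  proof (rule tendstoI)
    fix e :: real assume e: "e > 0"
    then have "\<forall>\<^sub>F n in sequentially. \<forall>u. norm u \<le> norm w + B \<longrightarrow> \<bar>\<nu> t (lin t (fwd t n u)) - \<mu>0 u\<bar> \<le> e / 2"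
      by (intro ev) simp
    then show "\<forall>\<^sub>F n in sequentially. dist (\<mu>0 (bwd t n w)) (\<nu> t (lin t w)) < e"
    proof eventually_elim
      case (elim n)
      have "norm (bwd t n w) \<le> norm w + B"
        using norm_triangle_sub[of "bwd t n w" w] B(2)[of n w] by linarith
      then have "\<bar>\<nu> t (lin t (fwd t n (bwd t n w))) - \<mu>0 (bwd t n w)\<bar> \<le> e / 2" using elim by blast
      then show ?case using e by (simp add: dist_real_def fwd_bwd abs_minus_commute)
    qed
  qed
qed

text \<open>The limiting distance in the Euler estimate. It is proportional to \<open>N\<close>, and
  its factor \<open>1 / (\<Lambda> - exp t)\<close> is what makes the comparison of fields
  contract.\<close>

definition gap :: "real \<Rightarrow> real \<Rightarrow> real \<Rightarrow> real" where
  "gap N \<Lambda> t = exp t * N / (\<Lambda> - exp t) * exp (\<Lambda> * t)"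

lemma gap_nonneg: "N \<ge> 0 \<Longrightarrow> \<Lambda> > exp t \<Longrightarrow> gap N \<Lambda> t \<ge> 0"
  by (simp add: gap_def)

lemma fwd_near_flow:
  assumes t: "t \<ge> 0" and N: "N \<ge> 0" and \<Lambda>: "\<Lambda> > exp t" and \<eta>: "\<eta> > 0"
    and close: "\<And>r x. 0 \<le> r \<Longrightarrow> r \<le> t \<Longrightarrow> norm (F r x - a r x) \<le> N * exp (\<Lambda> * r)"
  shows "\<forall>\<^sub>F n in sequentially. \<forall>w. norm w \<le> R \<longrightarrow> norm (fwd t n w - flow lam a 0 w t) \<le> gap N \<Lambda> t + \<eta>"
  using eventually_sequentially_Suc[THEN iffD2, OF euler_near_flow[OF a t \<Lambda> N \<eta> close, of R]]
  unfolding fwd_def gap_def by simp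

lemma bwd_near_flow:
  assumes t: "t \<ge> 0" and N: "N \<ge> 0" and \<Lambda>: "\<Lambda> > exp t" and \<eta>: "\<eta> > 0"
    and close: "\<And>r x. 0 \<le> r \<Longrightarrow> r \<le> t \<Longrightarrow> norm (F r x - a r x) \<le> N * exp (\<Lambda> * r)"
  shows "\<forall>\<^sub>F n in sequentially. norm (bwd t n w - flow lam a t w 0) \<le> 16 * exp (2 * t) * (gap N \<Lambda> t + \<eta>)"
proof -
  obtain B where B: "B > 0" "\<And>n w. norm (bwd t n w - w) \<le> B"
    by (rule displacement_bound[OF t]) (rule that; assumption)
  have "\<forall>\<^sub>F n in sequentially. \<forall>u. norm u \<le> norm w + B \<longrightarrow> norm (fwd t n u - flow lam a 0 u t) \<le> gap N \<Lambda> t + \<eta>"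
    by (rule fwd_near_flow[OF t N \<Lambda> \<eta> close])
  then show ?thesis
  proof eventually_elim
    case (elim n)
    have "norm (bwd t n w) \<le> norm w + B"
      using norm_triangle_sub[of "bwd t n w" w] B(2)[of n w] by linarith
    then have "norm (fwd t n (bwd t n w) - flow lam a 0 (bwd t n w) t) \<le> gap N \<Lambda> t + \<eta>" using elim by blast
    then have "norm (flow lam a 0 (bwd t n w) t - w) \<le> gap N \<Lambda> t + \<eta>" by (simp add: fwd_bwd norm_minus_commute)
    then have "16 * exp (2 * t) * norm (flow lam a 0 (bwd t n w) t - w) \<le> 16 * exp (2 * t) * (gap N \<Lambda> t + \<eta>)"
      by (rule mult_left_mono) simp
    from order_trans[OF flow_back_lipschitz[OF a t] this] show ?case
      by (simp add: flow_flow[OF a] flow_init[OF a])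
  qed
qed

text \<open>The competitor is accessible only as a limit of \<open>\<mu>0\<close> along backward
  polygons, so the Lipschitz bound of \<open>\<mu>0\<close> is applied before the limit and
  \<open>\<eta>\<close> absorbs the error of the scheme.\<close>

lemma nu_mu_diff:
  assumes t: "t \<ge> 0" and N: "N \<ge> 0" and \<Lambda>: "\<Lambda> > exp t"
    and close: "\<And>r x. 0 \<le> r \<Longrightarrow> r \<le> t \<Longrightarrow> norm (F r x - a r x) \<le> N * exp (\<Lambda> * r)"
  shows "\<bar>\<nu> t z - mu a t z\<bar> \<le> 16 * exp (2 * t) * \<epsilon> * gap N \<Lambda> t"
proof (rule field_le_epsilon)
  fix e :: real assume e: "e > 0"
  define \<eta> where "\<eta> = e / (16 * exp (2 * t) * \<epsilon>)"
  have \<eta>: "\<eta> > 0" using e eps by (simp add: \<eta>_def)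
  let ?w = "lin (- t) z"
  have lim: "(\<lambda>n. \<bar>\<mu>0 (bwd t n ?w) - mu a t z\<bar>) \<longlonglongrightarrow> \<bar>\<nu> t z - mu a t z\<bar>"
    using nu_fwd_limit(2)[OF t, of ?w] by (intro tendsto_intros) simp
  have "\<forall>\<^sub>F n in sequentially. norm (bwd t n ?w - flow lam a t ?w 0) \<le> 16 * exp (2 * t) * (gap N \<Lambda> t + \<eta>)"
    by (rule bwd_near_flow[OF t N \<Lambda> \<eta> close])
  then have "\<forall>\<^sub>F n in sequentially. \<bar>\<mu>0 (bwd t n ?w) - mu a t z\<bar> \<le> 16 * exp (2 * t) * \<epsilon> * gap N \<Lambda> t + e"
  proof eventually_elim
    case (elim n)
    have "\<bar>\<mu>0 (bwd t n ?w) - mu a t z\<bar> \<le> \<epsilon> * norm (bwd t n ?w - flow lam a t ?w 0)"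
      unfolding mu_def orig_def by (rule lipschitz)
    also have "\<dots> \<le> \<epsilon> * (16 * exp (2 * t) * (gap N \<Lambda> t + \<eta>))"
      using elim eps by (intro mult_left_mono) auto
    also have "\<dots> = 16 * exp (2 * t) * \<epsilon> * gap N \<Lambda> t + e"
      using eps by (simp add: \<eta>_def field_simps)
    finally show ?case .
  qed
  then show "\<bar>\<nu> t z - mu a t z\<bar> \<le> 16 * exp (2 * t) * \<epsilon> * gap N \<Lambda> t + e"
    by (rule tendsto_upperbound[OF lim]) simp
qed

text \<open>Backward polygons and the backward flow of \<open>a\<close> end at bounded distance, so
  by Peetre's inequality the weights at the two end points are comparable. The competitor inherits a
  decay measured at \<open>orig a t z\<close>, where velocity integrals are under control.\<close>

lemma nu_decay:
  assumes t: "t \<ge> 0" and N: "N \<ge> 0" and \<Lambda>: "\<Lambda> > exp t"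
    and close: "\<And>r x. 0 \<le> r \<Longrightarrow> r \<le> t \<Longrightarrow> norm (F r x - a r x) \<le> N * exp (\<Lambda> * r)"
  shows "\<bar>\<nu> t z\<bar> \<le> (1 + 16 * exp (2 * t) * (gap N \<Lambda> t + 1)) ^ 3 * \<epsilon> * (1 / bracket (snd (orig a t z)) ^ 3)"
proof -
  let ?w = "lin (- t) z" and ?A = "1 + 16 * exp (2 * t) * (gap N \<Lambda> t + 1)"
  have A: "?A \<ge> 1" using gap_nonneg[OF N \<Lambda>] by simp
  have lim: "(\<lambda>n. \<bar>\<mu>0 (bwd t n ?w)\<bar>) \<longlonglongrightarrow> \<bar>\<nu> t z\<bar>"
    using nu_fwd_limit(2)[OF t, of ?w] by (intro tendsto_intros) simp
  have "\<forall>\<^sub>F n in sequentially. norm (bwd t n ?w - flow lam a t ?w 0) \<le> 16 * exp (2 * t) * (gap N \<Lambda> t + 1)"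
    by (rule bwd_near_flow[OF t N \<Lambda> zero_less_one close])
  then have "\<forall>\<^sub>F n in sequentially. \<bar>\<mu>0 (bwd t n ?w)\<bar> \<le> ?A ^ 3 * \<epsilon> * (1 / bracket (snd (orig a t z)) ^ 3)"
  proof eventually_elim
    case (elim n)
    let ?u = "snd (orig a t z)" and ?v = "snd (bwd t n ?w)"
    have "norm (?u - ?v) \<le> norm (orig a t z - bwd t n ?w)"
      using norm_snd_le'[of "orig a t z - bwd t n ?w"] by simp
    also have "\<dots> \<le> 16 * exp (2 * t) * (gap N \<Lambda> t + 1)" using elim by (simp add: orig_def norm_minus_commute)
    finally have "bracket ?u \<le> ?A * bracket ?v"
      using bracket_peetre[of ?u ?v] bracket_pos[of ?v]
      by (smt (verit) mult_right_mono)
    then have "bracket ?u ^ 3 \<le> ?A ^ 3 * bracket ?v ^ 3"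
      using bracket_pos[of ?u] by (simp add: power_mono less_imp_le flip: power_mult_distrib)
    then have "\<epsilon> / bracket ?v ^ 3 \<le> ?A ^ 3 * \<epsilon> * (1 / bracket ?u ^ 3)"
      using eps bracket_pos[of ?u] bracket_pos[of ?v] by (simp add: field_simps)
    then show ?case using decay[of "bwd t n ?w"] by simp
  qed
  then show ?thesis by (rule tendsto_upperbound[OF lim]) simp
qed

lemma integrable_nu_sq: "t \<ge> 0 \<Longrightarrow> integrable lborel (\<lambda>z. (\<nu> t z)\<^sup>2)"
proof -
  assume t: "t \<ge> 0"
  note [measurable] = measurable_nu[OF t]
  have "(\<integral>\<^sup>+z. ennreal ((\<nu> t z)\<^sup>2) \<partial>lborel) < \<infinity>"
    using nu_L2[OF t] by (auto simp: in_L2_def L2_norm_def Let_def split: if_splits)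
  then show ?thesis by (intro integrableI_bounded) auto
qed

lemma integrable_bounded_kernel:
  fixes f :: "phase \<Rightarrow> real" and k :: "phase \<Rightarrow> plane"
  assumes f: "integrable lborel (\<lambda>z. (f z)\<^sup>2)" and [measurable]: "f \<in> borel_measurable borel" "k \<in> borel_measurable borel"
    and k: "\<And>z. norm (k z) \<le> C"
  shows "integrable lborel (\<lambda>z. (f z)\<^sup>2 *\<^sub>R k z)"
  by (rule Bochner_Integration.integrable_bound[OF integrable_mult_left[OF f, of C]])
     (use k in \<open>auto intro!: AE_I2 order_trans[OF _ abs_ge_self] mult_left_mono\<close>)

text \<open>The regularised kernel is bounded and Lipschitz. Boundedness lets \<open>L^1\<close>
  convergence of the transported densities identify the far field of \<open>\<nu>\<close> with a
  limit of integrals along polygons; the Lipschitz bound compares these with integrals along the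
  flow of \<open>a\<close>.\<close>

lemma far_field_nu:
  assumes t: "t \<ge> 0" and N: "N \<ge> 0" and \<Lambda>: "\<Lambda> > exp t"
    and close: "\<And>r x. 0 \<le> r \<Longrightarrow> r \<le> t \<Longrightarrow> norm (F r x - a r x) \<le> N * exp (\<Lambda> * r)"
  shows "norm (kernel_integral (coulomb_reg 1) (\<nu> t) x - lagrangian a (coulomb_reg 1) t x) \<le> 2 * exp t * gap N \<Lambda> t * \<epsilon>\<^sup>2"
proof -
  note [measurable] = measurable_nu[OF t] mpres_measurable[OF mpres_lin] mpres_measurable[OF mpres_fwd[OF t]]
    mpres_measurable[OF mpres_bwd[OF t]] mpres_measurable[OF mpres_flow(1)[OF a t]]
  obtain B where B: "B > 0" "\<And>n w. norm (fwd t n w - w) \<le> B"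
    by (rule displacement_bound[OF t]) (rule that; assumption)
  define k where "k w = coulomb_reg 1 (x - fst (lin t w))" for w
  have k_meas[measurable]: "k \<in> borel_measurable borel"
    unfolding k_def
    by (intro borel_measurable_continuous_onI continuous_on_compose2[OF continuous_on_coulomb_reg[OF zero_less_one]] continuous_intros) auto
  have k1: "norm (k w) \<le> 1" for w using norm_coulomb_reg(2)[of 1] by (simp add: k_def)
  have klip: "norm (k w - k u) \<le> 2 * exp t * norm (w - u)" for w u
  proof -
    have "norm (k w - k u) \<le> norm (fst (lin t u) - fst (lin t w)) / (1 * sqrt ((norm (x - fst (lin t u)))\<^sup>2 + 1\<^sup>2))"
      using coulomb_reg_lipschitz[of 1 "x - fst (lin t w)" "x - fst (lin t u)"] by (simp add: k_def)
    also have "\<dots> \<le> norm (fst (lin t u) - fst (lin t w)) / 1"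
      by (intro divide_left_mono) (auto intro: add_nonneg_pos)
    also have "\<dots> = norm (fst (lin t (w - u)))" by (simp add: lin_diff norm_minus_commute)
    also have "\<dots> \<le> 2 * exp t * norm (w - u)"
      using norm_fst_le'[of "lin t (w - u)"] norm_lin_le[of t "w - u"] t by simp
    finally show ?thesis .
  qed
  define g where "g w = \<nu> t (lin t w)" for w
  have [measurable]: "g \<in> borel_measurable borel" unfolding g_def by measurable
  define I where "I n = (\<integral>w. (\<mu>0 w)\<^sup>2 *\<^sub>R k (fwd t n w) \<partial>lborel)" for n
  define L where "L = (\<integral>w. (\<mu>0 w)\<^sup>2 *\<^sub>R k (flow lam a 0 w t) \<partial>lborel)"
  have Leq: "lagrangian a (coulomb_reg 1) t x = L"
    by (simp add: L_def lagrangian_def k_def traj_def)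
  have nueq: "kernel_integral (coulomb_reg 1) (\<nu> t) x = (\<integral>w. (g w)\<^sup>2 *\<^sub>R k w \<partial>lborel)"
    unfolding kernel_integral_def g_def k_def
    by (rule mpres_integral[OF mpres_lin, symmetric, of "\<lambda>z. (\<nu> t z)\<^sup>2 *\<^sub>R coulomb_reg 1 (x - fst z)"]) measurable
  have fin: "(\<integral>\<^sup>+z. ennreal ((\<mu>0 z)\<^sup>2) \<partial>lborel) < \<infinity>"
    using integrable_sq by (simp add: integrable_iff_bounded)
  note L1 = tendsto_L1_transport[OF mpres_fwd[OF t] mpres_bwd[OF t] measurable_mu0 \<open>g \<in> borel_measurable borel\<close> fin,
      unfolded g_def, OF nu_fwd_limit(2)[OF t] nu_fwd_limit(1)[OF t], folded g_def]
  have gi: "integrable lborel (\<lambda>w. (g w)\<^sup>2)"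
    using fin L1(1) by (intro integrableI_bounded) auto
  have bi: "integrable lborel (\<lambda>w. (\<mu>0 (bwd t n w))\<^sup>2)" for n
    using integrable_sq mpres_integrable[OF mpres_bwd[OF t], of "\<lambda>w. (\<mu>0 w)\<^sup>2"] by simp
  have Ieq: "I n = (\<integral>w. (\<mu>0 (bwd t n w))\<^sup>2 *\<^sub>R k w \<partial>lborel)" for n
    using mpres_integral[OF mpres_bwd[OF t, of n], of "\<lambda>w. (\<mu>0 w)\<^sup>2 *\<^sub>R k (fwd t n w)"] by (simp add: I_def fwd_bwd)
  have lim: "I \<longlonglongrightarrow> kernel_integral (coulomb_reg 1) (\<nu> t) x"
  proof (rule tendstoI)
    fix e :: real assume e: "e > 0"
    have "\<forall>\<^sub>F n in sequentially. (\<integral>\<^sup>+z. ennreal \<bar>(\<mu>0 (bwd t n z))\<^sup>2 - (g z)\<^sup>2\<bar> \<partial>lborel) < ennreal e"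
      using L1(2) e by (intro order_tendstoD) auto
    then show "\<forall>\<^sub>F n in sequentially. dist (I n) (kernel_integral (coulomb_reg 1) (\<nu> t) x) < e"
    proof eventually_elim
      case (elim n)
      have i1: "integrable lborel (\<lambda>w. (\<mu>0 (bwd t n w))\<^sup>2 *\<^sub>R k w)" and i2: "integrable lborel (\<lambda>w. (g w)\<^sup>2 *\<^sub>R k w)"
        by (rule integrable_bounded_kernel[OF bi _ _ k1] integrable_bounded_kernel[OF gi _ _ k1]; measurable)+
      have "ennreal (norm (\<integral>w. ((\<mu>0 (bwd t n w))\<^sup>2 - (g w)\<^sup>2) *\<^sub>R k w \<partial>lborel)) \<le> (\<integral>\<^sup>+w. norm (((\<mu>0 (bwd t n w))\<^sup>2 - (g w)\<^sup>2) *\<^sub>R k w) \<partial>lborel)"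
        using Bochner_Integration.integrable_diff[OF i1 i2]
        by (intro integral_norm_bound_ennreal) (simp add: scaleR_diff_left)
      also have "\<dots> \<le> (\<integral>\<^sup>+z. ennreal \<bar>(\<mu>0 (bwd t n z))\<^sup>2 - (g z)\<^sup>2\<bar> \<partial>lborel)"
        using k1 by (intro nn_integral_mono ennreal_leI) (simp add: mult_left_le)
      also note elim
      finally have "norm (\<integral>w. ((\<mu>0 (bwd t n w))\<^sup>2 - (g w)\<^sup>2) *\<^sub>R k w \<partial>lborel) < e"
        by (simp add: ennreal_less_iff)
      then show ?case
        unfolding dist_norm Ieq nueq Bochner_Integration.integral_diff[OF i1 i2, symmetric] scaleR_diff_left[symmetric] .
    qed
  qed
  define b where "b = gap N \<Lambda> t"
  have b0: "b \<ge> 0" using gap_nonneg[OF N \<Lambda>] by (simp add: b_def)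
  \<comment> \<open>The excess of the distance over its limiting bound \<open>b\<close>. It tends to
    0 only locally uniformly in \<open>w\<close>, but polygons and flow have bounded displacement,
    so dominated convergence applies.\<close>
  define u where "u n w = max 0 (norm (fwd t n w - flow lam a 0 w t) - b)" for n w
  have u_meas[measurable]: "u n \<in> borel_measurable borel" for n
    unfolding u_def by measurable
  have lim_u: "(\<lambda>n. u n w) \<longlonglongrightarrow> 0" for w
  proof (rule tendstoI)
    fix e :: real assume e: "e > 0"
    then have "\<forall>\<^sub>F n in sequentially. \<forall>v. norm v \<le> norm w \<longrightarrow> norm (fwd t n v - flow lam a 0 v t) \<le> gap N \<Lambda> t + e / 2"
      by (intro fwd_near_flow[OF t N \<Lambda> _ close]) auto
    then show "\<forall>\<^sub>F n in sequentially. dist (u n w) 0 < e"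
    proof eventually_elim
      case (elim n)
      then have "norm (fwd t n w - flow lam a 0 w t) \<le> b + e / 2" by (simp add: b_def del: split_paired_All)
      then show ?case using e by (simp add: u_def dist_real_def)
    qed
  qed
  have u_bd: "\<bar>u n w\<bar> \<le> B + (1 + t)" for n w
  proof -
    have "norm (uns (flow lam a 0 w t) - uns (flow lam a 0 w 0)) \<le> (exp (- 2 * 0) - exp (- 2 * t)) / 72"
      by (rule uns_increment[OF a _ t flow_deriv[OF a]]) simp
    also have "\<dots> \<le> 1"
    proof -
      have "(exp (- 2 * 0) - e) / 72 \<le> 1" if "e \<ge> 0" for e :: real using that by simp
      from this[OF exp_ge_zero] show ?thesis .
    qed
    finally have "norm (uns (flow lam a 0 w t - w)) \<le> 1" by (simp add: flow_init[OF a] uns_diff)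
    moreover have "norm (sta (flow lam a 0 w t) - sta (flow lam a 0 w 0)) \<le> (t - 0) / 36"
      by (rule sta_increment[OF a _ t flow_deriv[OF a]]) simp
    then have "norm (sta (flow lam a 0 w t - w)) \<le> t / 36" by (simp add: flow_init[OF a] sta_diff)
    ultimately have "norm (flow lam a 0 w t - w) \<le> 1 + t"
      using norm_le_uns_sta[of "flow lam a 0 w t - w"] t by linarith
    then have "norm (fwd t n w - flow lam a 0 w t) \<le> B + (1 + t)"
      using B(2)[of n w] norm_triangle_ineq4[of "fwd t n w - w" "flow lam a 0 w t - w"] by simp
    then show ?thesis using b0 B(1) t by (simp add: u_def)
  qed
  have lim_int: "(\<lambda>n. \<integral>w. (\<mu>0 w)\<^sup>2 * u n w \<partial>lborel) \<longlonglongrightarrow> (\<integral>w. 0 \<partial>(lborel :: phase measure))"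
  proof (rule integral_dominated_convergence[where w = "\<lambda>w. (\<mu>0 w)\<^sup>2 * (B + (1 + t))"])
    show "integrable lborel (\<lambda>w. (\<mu>0 w)\<^sup>2 * (B + (1 + t)))" by (intro integrable_mult_left integrable_sq)
    show "AE w in lborel. (\<lambda>n. (\<mu>0 w)\<^sup>2 * u n w) \<longlonglongrightarrow> 0"
    proof (rule AE_I2)
      fix w show "(\<lambda>n. (\<mu>0 w)\<^sup>2 * u n w) \<longlonglongrightarrow> 0"
        using tendsto_mult[OF tendsto_const[of "(\<mu>0 w)\<^sup>2"] lim_u[of w]] by simp
    qed
    show "AE w in lborel. norm ((\<mu>0 w)\<^sup>2 * u n w) \<le> (\<mu>0 w)\<^sup>2 * (B + (1 + t))" for n
      using u_bd by (intro AE_I2) (simp add: abs_mult mult_left_mono)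
  qed measurable
  have mass_le: "(\<integral>w. (\<mu>0 w)\<^sup>2 \<partial>lborel) \<le> \<epsilon>\<^sup>2"
  proof -
    have "ennreal (\<integral>w. (\<mu>0 w)\<^sup>2 \<partial>lborel) = (\<integral>\<^sup>+w. ennreal ((\<mu>0 w)\<^sup>2) \<partial>lborel)"
      by (rule nn_integral_eq_integral[symmetric, OF integrable_sq]) simp
    also have "\<dots> \<le> (\<integral>\<^sup>+w. ennreal (wt w) \<partial>lborel)"
      by (intro nn_integral_mono ennreal_leI sq_le_wt)
    also have "\<dots> \<le> ennreal (\<epsilon>\<^sup>2)" by (rule mass_wt)
    finally show ?thesis by simp
  qed
  have step: "norm (I n - L) \<le> 2 * exp t * b * (\<integral>w. (\<mu>0 w)\<^sup>2 \<partial>lborel) + 2 * exp t * (\<integral>w. (\<mu>0 w)\<^sup>2 * u n w \<partial>lborel)" for n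
  proof -
    have i1: "integrable lborel (\<lambda>w. (\<mu>0 w)\<^sup>2 *\<^sub>R k (fwd t n w))" and i2: "integrable lborel (\<lambda>w. (\<mu>0 w)\<^sup>2 *\<^sub>R k (flow lam a 0 w t))"
      by (rule integrable_bounded_kernel[OF integrable_sq _ _ k1]; measurable)+
    have iu: "integrable lborel (\<lambda>w. (\<mu>0 w)\<^sup>2 * u n w)"
      by (rule Bochner_Integration.integrable_bound[OF integrable_mult_left[OF integrable_sq, of "B + (1 + t)"]])
         (use u_bd in \<open>auto intro!: AE_I2 order_trans[OF _ abs_ge_self] mult_left_mono simp: abs_mult\<close>)
    have "norm (I n - L) \<le> (\<integral>w. norm ((\<mu>0 w)\<^sup>2 *\<^sub>R k (fwd t n w) - (\<mu>0 w)\<^sup>2 *\<^sub>R k (flow lam a 0 w t)) \<partial>lborel)"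
      unfolding I_def L_def Bochner_Integration.integral_diff[OF i1 i2, symmetric] by (rule integral_norm_bound)
    also have "\<dots> \<le> (\<integral>w. 2 * exp t * b * (\<mu>0 w)\<^sup>2 + 2 * exp t * ((\<mu>0 w)\<^sup>2 * u n w) \<partial>lborel)"
    proof (rule integral_mono)
      show "integrable lborel (\<lambda>w. norm ((\<mu>0 w)\<^sup>2 *\<^sub>R k (fwd t n w) - (\<mu>0 w)\<^sup>2 *\<^sub>R k (flow lam a 0 w t)))"
        by (intro integrable_norm Bochner_Integration.integrable_diff i1 i2)
      show "integrable lborel (\<lambda>w. 2 * exp t * b * (\<mu>0 w)\<^sup>2 + 2 * exp t * ((\<mu>0 w)\<^sup>2 * u n w))"
        by (intro Bochner_Integration.integrable_add integrable_mult_right integrable_sq iu)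
      fix w
      have "norm (k (fwd t n w) - k (flow lam a 0 w t)) \<le> 2 * exp t * (b + u n w)"
        by (rule order_trans[OF klip mult_left_mono]) (auto simp: u_def)
      from mult_left_mono[OF this, of "(\<mu>0 w)\<^sup>2"]
      show "norm ((\<mu>0 w)\<^sup>2 *\<^sub>R k (fwd t n w) - (\<mu>0 w)\<^sup>2 *\<^sub>R k (flow lam a 0 w t)) \<le> 2 * exp t * b * (\<mu>0 w)\<^sup>2 + 2 * exp t * ((\<mu>0 w)\<^sup>2 * u n w)"
        by (simp add: algebra_simps flip: scaleR_diff_right)
    qed
    also have "\<dots> = 2 * exp t * b * (\<integral>w. (\<mu>0 w)\<^sup>2 \<partial>lborel) + 2 * exp t * (\<integral>w. (\<mu>0 w)\<^sup>2 * u n w \<partial>lborel)"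
      using iu integrable_sq by simp
    finally show ?thesis .
  qed
  have "norm (kernel_integral (coulomb_reg 1) (\<nu> t) x - L) \<le> 2 * exp t * b * (\<integral>w. (\<mu>0 w)\<^sup>2 \<partial>lborel) + 2 * exp t * 0"
  proof (rule LIMSEQ_le)
    show "(\<lambda>n. norm (I n - L)) \<longlonglongrightarrow> norm (kernel_integral (coulomb_reg 1) (\<nu> t) x - L)"
      by (intro tendsto_intros lim)
    show "(\<lambda>n. 2 * exp t * b * (\<integral>w. (\<mu>0 w)\<^sup>2 \<partial>lborel) + 2 * exp t * (\<integral>w. (\<mu>0 w)\<^sup>2 * u n w \<partial>lborel))
        \<longlonglongrightarrow> 2 * exp t * b * (\<integral>w. (\<mu>0 w)\<^sup>2 \<partial>lborel) + 2 * exp t * 0"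
      using lim_int by (intro tendsto_intros) simp
  qed (use step in blast)
  also have "\<dots> \<le> 2 * exp t * b * \<epsilon>\<^sup>2"
    using mass_le b0 by (simp add: mult_left_mono)
  finally show ?thesis by (simp add: Leq b_def)
qed

lemma gap_le:
  assumes "t \<le> T" "N \<ge> 0" "\<Lambda> > exp T"
  shows "gap N \<Lambda> t \<le> exp T * N / (\<Lambda> - exp T) * exp (\<Lambda> * t)"
proof -
  have e: "exp t \<le> exp T" using assms by simp
  have "exp t * N / (\<Lambda> - exp t) \<le> exp T * N / (\<Lambda> - exp T)"
    using e assms by (intro frac_le mult_right_mono mult_nonneg_nonneg) auto
  then show ?thesis unfolding gap_def by (intro mult_right_mono) auto
qed

text \<open>The splitting at \<open>d = 1\<close> again. For the competitor, integrability against
  the full kernel is part of the notion of solution and integrability against the regularised one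
  follows from square integrability; the near part is their difference.\<close>

lemma field_F_diff:
  assumes t: "t \<ge> 0" and N: "N \<ge> 0" and \<Lambda>: "\<Lambda> > exp t"
    and close: "\<And>r x. 0 \<le> r \<Longrightarrow> r \<le> t \<Longrightarrow> norm (F r x - a r x) \<le> N * exp (\<Lambda> * r)"
    and A: "A \<ge> \<epsilon>" "\<And>z. \<bar>\<nu> t z\<bar> \<le> A * (1 / bracket (snd (orig a t z)) ^ 3)"
  shows "norm (F t x - a t x) \<le> (2 * exp t * \<epsilon>\<^sup>2 + 12 * pi * (2 * (16 * exp (2 * t) * \<epsilon>) * A * density_bound t)) * gap N \<Lambda> t"
proof -
  note [measurable] = measurable_nu[OF t] measurable_mu[OF a]
  have A0: "A \<ge> 0" using A(1) eps by linarith
  have g0: "gap N \<Lambda> t \<ge> 0" by (rule gap_nonneg[OF N \<Lambda>])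
  let ?c = "16 * exp (2 * t) * \<epsilon> * gap N \<Lambda> t"
  have c: "?c \<ge> 0" using g0 eps by simp
  have iN: "integrable lborel (\<lambda>z. (\<nu> t z)\<^sup>2 *\<^sub>R coulomb (x - fst z))"
    using nu_field[OF t] unfolding field_defined_def field_integrand_eq[abs_def] by blast
  have iR: "integrable lborel (\<lambda>z. (\<nu> t z)\<^sup>2 *\<^sub>R coulomb_reg 1 (x - fst z))"
  proof (rule integrable_bounded_kernel[OF integrable_nu_sq[OF t]])
    show "(\<lambda>z :: phase. coulomb_reg 1 (x - fst z)) \<in> borel_measurable borel"
      by (intro borel_measurable_continuous_onI continuous_on_compose2[OF continuous_on_coulomb_reg[OF zero_less_one]] continuous_intros) auto
    show "norm (coulomb_reg 1 (x - fst z)) \<le> 1" for z :: phase using norm_coulomb_reg(2)[of 1] by simp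
  qed measurable
  have n: "(\<nu> t z)\<^sup>2 *\<^sub>R coulomb_near 1 (x - fst z) = (\<nu> t z)\<^sup>2 *\<^sub>R coulomb (x - fst z) - (\<nu> t z)\<^sup>2 *\<^sub>R coulomb_reg 1 (x - fst z)" for z
    by (simp add: coulomb_near_def scaleR_diff_right)
  have iS: "integrable lborel (\<lambda>z. (\<nu> t z)\<^sup>2 *\<^sub>R coulomb_near 1 (x - fst z))"
    unfolding n by (intro Bochner_Integration.integrable_diff iN iR)
  have split: "kernel_integral coulomb (\<nu> t) x = kernel_integral (coulomb_reg 1) (\<nu> t) x + kernel_integral (coulomb_near 1) (\<nu> t) x"
    unfolding kernel_integral_def n Bochner_Integration.integral_diff[OF iN iR] by simp
  have im: "integrable lborel (\<lambda>z. (mu a t z)\<^sup>2 *\<^sub>R coulomb_near 1 (x - fst z))"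
    by (intro integrable_kernel_mu[OF a t] lagrangian_near[OF a t]) auto
  have near: "norm (kernel_integral (coulomb_near 1) (\<nu> t) x - lagrangian a (coulomb_near 1) t x)
      \<le> 12 * pi * 1 * (2 * ?c * A * density_bound t)"
    unfolding kernel_integral_mu[OF a t measurable_coulomb_near, symmetric] unfolding kernel_integral_def
  proof (rule near_field_diff[OF _ _ iS im zero_less_one])
    show "2 * ?c * A * density_bound t \<ge> 0" using c A0 density_bound_pos[of t] by simp
    show "(\<integral>\<^sup>+v. ennreal \<bar>(\<nu> t (y, v))\<^sup>2 - (mu a t (y, v))\<^sup>2\<bar> \<partial>lborel) \<le> ennreal (2 * ?c * A * density_bound t)" for y
    proof (rule nn_integral_square_diff[OF a a t c])
      show "(\<lambda>v. \<bar>\<nu> t (y, v)\<bar>) \<in> borel_measurable borel" "(\<lambda>v. \<bar>mu a t (y, v)\<bar>) \<in> borel_measurable borel"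
        by (simp_all add: borel_measurable_abs measurable_compose[OF _ measurable_nu[OF t]] measurable_compose[OF _ measurable_mu[OF a]])
      show "\<bar>\<nu> t (y, v)\<bar> \<le> A * (1 / bracket (snd (orig a t (y, v))) ^ 3)" for v by (rule A(2))
      show "\<bar>mu a t (y, v)\<bar> \<le> A * (1 / bracket (snd (orig a t (y, v))) ^ 3)" for v
        by (rule order_trans[OF abs_mu_le mult_right_mono[OF A(1)]]) (simp add: bracket_pos less_imp_le)
      show "\<bar>\<nu> t (y, v) - mu a t (y, v)\<bar> \<le> ?c" for v by (rule nu_mu_diff[OF t N \<Lambda> close])
    qed (use A0 in auto)
  qed measurable
  have "F t x - a t x = (1 / (2 * pi)) *\<^sub>R ((kernel_integral (coulomb_reg 1) (\<nu> t) x - lagrangian a (coulomb_reg 1) t x)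
      + (kernel_integral (coulomb_near 1) (\<nu> t) x - lagrangian a (coulomb_near 1) t x))"
    using t by (simp add: F_def efield_eq split fixed fld_def lagrangian_split[OF a t zero_less_one] scaleR_diff_right scaleR_add_right)
  then have "norm (F t x - a t x) \<le> 1 / (2 * pi) * (2 * exp t * gap N \<Lambda> t * \<epsilon>\<^sup>2 + 12 * pi * 1 * (2 * ?c * A * density_bound t))"
    using mult_left_mono[OF norm_triangle_le[OF add_mono[OF far_field_nu[OF t N \<Lambda> close, of x] near]], of "1 / (2 * pi)"]
    by (simp del: times_divide_eq_left)
  also have "\<dots> \<le> 1 * (2 * exp t * gap N \<Lambda> t * \<epsilon>\<^sup>2 + 12 * pi * 1 * (2 * ?c * A * density_bound t))"
  proof (intro mult_right_mono add_nonneg_nonneg)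
    show "1 / (2 * pi) \<le> 1" using pi_gt3 by simp
    show "0 \<le> 2 * exp t * gap N \<Lambda> t * \<epsilon>\<^sup>2" using g0 by simp
    show "0 \<le> 12 * pi * 1 * (2 * ?c * A * density_bound t)" by (rule order_trans[OF norm_ge_zero near])
  qed
  also have "\<dots> = (2 * exp t * \<epsilon>\<^sup>2 + 12 * pi * (2 * (16 * exp (2 * t) * \<epsilon>) * A * density_bound t)) * gap N \<Lambda> t"
    by (simp add: algebra_simps)
  finally show ?thesis .
qed

lemma F_eq:
  assumes T: "T \<ge> 0" and t: "0 \<le> t" "t \<le> T"
  shows "F t x = a t x"
proof -
  obtain M where M: "M > 0" "\<And>r x. 0 \<le> r \<Longrightarrow> r \<le> T \<Longrightarrow> norm (F r x) \<le> M"
    using F_bound[OF T] by blast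
  define N where "N = M + 1"
  \<comment> \<open>\<open>G\<close>, \<open>A\<close> and \<open>K\<close> must not depend on
    \<open>\<Lambda>\<close>, which is chosen last. So the decay constant \<open>A\<close> is drawn
    from the crude bound \<open>N\<close> with the rate \<open>exp T + 1\<close>, and only the
    iteration uses the large \<open>\<Lambda>\<close>.\<close>
  define G where "G = exp T * N * exp ((exp T + 1) * T)"
  define A where "A = (1 + 16 * exp (2 * T) * (G + 1)) ^ 3 * \<epsilon>"
  define K where "K = 2 * exp T * \<epsilon>\<^sup>2 + 12 * pi * (2 * (16 * exp (2 * T) * \<epsilon>) * A * (256 * pi))"
  \<comment> \<open>Makes \<open>K * exp T / (\<Lambda> - exp T)\<close> at most 1/2, so that every
    round of the induction halves the bound.\<close>
  define \<Lambda> where "\<Lambda> = exp T + 2 * K * exp T + 1"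
  have N: "N > 0" using M by (simp add: N_def)
  have G: "G > 0" using N by (simp add: G_def)
  have A: "A \<ge> \<epsilon>" unfolding A_def
    using eps G by (simp add: one_le_power)
  have K: "K > 0" using eps A by (simp add: K_def add_pos_nonneg)
  have \<Lambda>: "\<Lambda> > exp T" using K by (simp add: \<Lambda>_def add_pos_pos)
  have near0: "norm (F r x - a r x) \<le> N * exp (L * r)" if "0 \<le> r" "r \<le> T" "L \<ge> 0" for r x L
  proof -
    have "norm (a r x) \<le> exp (- \<bar>r\<bar>) / 36" using a by (simp add: small_field_def)
    also have "\<dots> \<le> 1" using exp_le_one_iff[of "- \<bar>r\<bar>"] by linarith
    finally have "norm (a r x) \<le> 1" .
    then have "norm (F r x - a r x) \<le> N" using M(2)[OF that(1,2), of x] norm_triangle_ineq4[of "F r x" "a r x"]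
      by (simp add: N_def)
    also have "\<dots> \<le> N * exp (L * r)" using N that by simp
    finally show ?thesis .
  qed
  have decay_A: "\<bar>\<nu> r z\<bar> \<le> A * (1 / bracket (snd (orig a r z)) ^ 3)" if r: "0 \<le> r" "r \<le> T" for r z
  proof -
    have L: "exp r < exp T + 1" using r by (smt (verit) exp_le_cancel_iff)
    have cl: "norm (F s x - a s x) \<le> N * exp ((exp T + 1) * s)" if "0 \<le> s" "s \<le> r" for s x
      using near0[of s "exp T + 1" x] that r by (simp add: add_nonneg_nonneg)
    have "gap N (exp T + 1) r \<le> exp T * N / (exp T + 1 - exp T) * exp ((exp T + 1) * r)"
      by (rule gap_le) (use r N in auto)
    also have "\<dots> \<le> exp T * N / (exp T + 1 - exp T) * exp ((exp T + 1) * T)"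
      using r N by (intro mult_left_mono) (auto intro!: mult_left_mono add_nonneg_nonneg)
    finally have g: "gap N (exp T + 1) r \<le> G" by (simp add: G_def)
    have "\<bar>\<nu> r z\<bar> \<le> (1 + 16 * exp (2 * r) * (gap N (exp T + 1) r + 1)) ^ 3 * \<epsilon> * (1 / bracket (snd (orig a r z)) ^ 3)"
      by (rule nu_decay[OF r(1) _ L cl]) (use N in auto)
    also have "\<dots> \<le> A * (1 / bracket (snd (orig a r z)) ^ 3)"
      unfolding A_def using g r gap_nonneg[OF less_imp_le[OF N] L] eps bracket_pos[of "snd (orig a r z)"]
      by (intro mult_right_mono power_mono add_mono mult_mono) auto
    finally show ?thesis .
  qed
  have bound: "norm (F r x - a r x) \<le> N / 2 ^ k * exp (\<Lambda> * r)" if "0 \<le> r" "r \<le> T" for k r x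
    using that
  proof (induction k arbitrary: r x)
    case 0
    then show ?case using near0[of r \<Lambda> x] K by (simp add: \<Lambda>_def add_nonneg_nonneg)
  next
    case (Suc k)
    have Nk: "N / 2 ^ k \<ge> 0" using N by simp
    have L: "\<Lambda> > exp r" using \<Lambda> Suc.prems by (smt (verit) exp_le_cancel_iff)
    have g0: "gap (N / 2 ^ k) \<Lambda> r \<ge> 0" by (rule gap_nonneg[OF Nk L])
    have "norm (F r x - a r x) \<le> (2 * exp r * \<epsilon>\<^sup>2 + 12 * pi * (2 * (16 * exp (2 * r) * \<epsilon>) * A * density_bound r)) * gap (N / 2 ^ k) \<Lambda> r"
      by (rule field_F_diff[OF Suc.prems(1) Nk L _ A decay_A]) (use Suc in auto)
    also have "\<dots> \<le> K * gap (N / 2 ^ k) \<Lambda> r"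
      unfolding K_def using Suc.prems g0 eps A density_bound_le[of r] density_bound_pos[of r]
      by (intro mult_right_mono add_mono mult_mono mult_left_mono) auto
    also have "\<dots> \<le> K * (exp T * (N / 2 ^ k) / (\<Lambda> - exp T) * exp (\<Lambda> * r))"
      using K by (intro mult_left_mono gap_le Suc.prems Nk \<Lambda>) auto
    also have "\<dots> = (K * exp T / (2 * K * exp T + 1)) * (N / 2 ^ k * exp (\<Lambda> * r))"
      by (simp add: \<Lambda>_def mult_ac)
    also have "\<dots> \<le> (1 / 2) * (N / 2 ^ k * exp (\<Lambda> * r))"
    proof (rule mult_right_mono)
      have "K * exp T > 0" using K by simp
      then show "K * exp T / (2 * K * exp T + 1) \<le> 1 / 2" by (simp add: divide_simps)
    qed (use N in simp)
    finally show ?case by simp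
  qed
  have "(\<lambda>k. N * exp (\<Lambda> * t) * inverse (2 ^ k)) \<longlonglongrightarrow> N * exp (\<Lambda> * t) * 0"
    by (intro tendsto_intros LIMSEQ_inverse_realpow_zero) simp
  moreover have "norm (F t x - a t x) \<le> N * exp (\<Lambda> * t) * inverse (2 ^ k)" for k
    using bound[OF t, of x k] by (simp add: divide_inverse mult_ac)
  ultimately have "norm (F t x - a t x) \<le> N * exp (\<Lambda> * t) * 0"
    by (intro tendsto_lowerbound[where F = sequentially]) (auto intro: always_eventually)
  then show ?thesis by simp
qed

lemma unique_solution: "t \<ge> 0 \<Longrightarrow> \<nu> t = mu a t"
proof
  fix z assume t: "t \<ge> 0"
  have "norm (F r x - a r x) \<le> 0 * exp ((exp t + 1) * r)" if "0 \<le> r" "r \<le> t" for r x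
    using F_eq[OF t that] by simp
  from nu_mu_diff[OF t _ _ this] show "\<nu> t z = mu a t z" by (simp add: gap_def)
qed

end

section \<open>Asymptotic behaviour\<close>

lemma power_exp_tendsto_0:
  fixes c :: real
  shows "((\<lambda>t. (t + c) ^ k * exp (- t)) \<longlongrightarrow> 0) at_top"
proof -
  have "filterlim (\<lambda>t. t + c) at_top at_top"
    using filterlim_tendsto_add_at_top[OF tendsto_const filterlim_ident, of c] by (simp add: add.commute)
  then have "((\<lambda>t. (t + c) ^ k / exp (t + c)) \<longlongrightarrow> 0) at_top"
    by (rule filterlim_compose[OF tendsto_power_div_exp_0])
  from tendsto_mult_right_zero[OF this, of "exp c"]
  show ?thesis by (simp add: exp_add exp_minus field_simps)
qed

text \<open>The limit runs along the integers while the bound holds at every real \<open>t\<close>,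
  since all late integers can be compared with \<open>t\<close>.\<close>

lemma lim_rate:
  fixes f :: "real \<Rightarrow> 'a::banach"
  assumes d: "\<And>s t. 0 \<le> s \<Longrightarrow> s \<le> t \<Longrightarrow> norm (f t - f s) \<le> r s" and r: "(r \<longlongrightarrow> 0) at_top" and t: "t \<ge> 0"
  shows "norm (lim (\<lambda>n. f (real n)) - f t) \<le> r t"
proof -
  have rn: "(\<lambda>n. r (real n)) \<longlonglongrightarrow> 0" by (rule filterlim_compose[OF r filterlim_real_sequentially])
  have "Cauchy (\<lambda>n. f (real n))"
  proof (rule CauchyI')
    fix e :: real assume "e > 0"
    from order_tendstoD(2)[OF rn this] obtain M where M: "\<And>n. n \<ge> M \<Longrightarrow> r (real n) < e"
      by (auto simp: eventually_sequentially)
    have "dist (f (real m)) (f (real n)) < e" if "m \<ge> M" "n > m" for m n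
      using le_less_trans[OF d M[OF that(1)], of "real n"] that by (simp add: dist_norm norm_minus_commute)
    then show "\<exists>M. \<forall>m\<ge>M. \<forall>n>m. dist (f (real m)) (f (real n)) < e" by blast
  qed
  then have lim: "(\<lambda>n. f (real n)) \<longlonglongrightarrow> lim (\<lambda>n. f (real n))"
    by (simp add: Cauchy_convergent_iff convergent_LIMSEQ_iff)
  have "\<forall>\<^sub>F n in sequentially. norm (f (real n) - f t) \<le> r t"
    using eventually_ge_at_top[of "nat \<lceil>t\<rceil>"]
  proof eventually_elim
    case (elim n)
    then have "t \<le> real n" by linarith
    then show ?case by (rule d[OF t])
  qed
  then show ?thesis
    by (intro tendsto_upperbound[OF tendsto_norm[OF tendsto_diff[OF lim tendsto_const]]]) simp_all
qed

lemma coulomb_scale: "c > 0 \<Longrightarrow> coulomb z = c *\<^sub>R coulomb (c *\<^sub>R z)"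
  by (simp add: coulomb_def power2_eq_square field_simps)

text \<open>\<open>coulomb\<close> is homogeneous of degree -1 and \<open>d\<close> scales like a
  length; this is used when positions are divided by \<open>cosh t\<close>.\<close>

lemma coulomb_near_scale:
  assumes c: "c > 0"
  shows "coulomb_near d z = c *\<^sub>R coulomb_near (c * d) (c *\<^sub>R z)"
proof -
  have "(norm (c *\<^sub>R z))\<^sup>2 + (c * d)\<^sup>2 = c\<^sup>2 * ((norm z)\<^sup>2 + d\<^sup>2)"
    by (simp add: power_mult_distrib distrib_left)
  then have "coulomb_reg d z = c *\<^sub>R coulomb_reg (c * d) (c *\<^sub>R z)"
    using c by (simp add: coulomb_reg_def power2_eq_square)
  then show ?thesis using coulomb_scale[OF c, of z] by (simp add: coulomb_near_def scaleR_diff_right)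
qed

lemma isCont_coulomb: "z \<noteq> 0 \<Longrightarrow> isCont coulomb z"
  unfolding coulomb_def[abs_def] by (intro continuous_intros) auto

lemma isCont_coulomb_reg: "d > 0 \<Longrightarrow> isCont (coulomb_reg d) z"
  using continuous_on_coulomb_reg[of d UNIV] by (simp add: continuous_on_eq_continuous_at)

section \<open>Limits of the unstable components and the limit field\<close>

context vlasov_field begin

definition asym :: "phase \<Rightarrow> plane" where
  "asym z = lim (\<lambda>n. uns (flow lam a 0 z (real n)))"

definition Einf :: "plane \<Rightarrow> plane" where
  "Einf y = (1 / (2 * pi)) *\<^sub>R (\<integral>z. (\<mu>0 z)\<^sup>2 *\<^sub>R coulomb (y - asym z) \<partial>lborel)"

lemma asym_rate:
  assumes t: "t \<ge> 0"
  shows "norm (asym z - uns (flow lam a 0 z t)) \<le> exp (- 2 * t) / 72"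
  unfolding asym_def
proof (rule lim_rate[OF _ _ t])
  show "norm (uns (flow lam a 0 z t) - uns (flow lam a 0 z s)) \<le> exp (- 2 * s) / 72" if "0 \<le> s" "s \<le> t" for s t
    by (rule order_trans[OF uns_increment[OF a that flow_deriv[OF a]]]) simp
  have "((\<lambda>t :: real. (t + 0) ^ 0 * exp (- t) * ((t + 0) ^ 0 * exp (- t)) / 72) \<longlongrightarrow> 0 * 0 / 72) at_top"
    by (intro tendsto_intros power_exp_tendsto_0) simp
  then show "((\<lambda>t :: real. exp (- 2 * t) / 72) \<longlongrightarrow> 0) at_top"
    by (simp flip: exp_add)
qed

lemma asym_limit: "(\<lambda>n. uns (flow lam a 0 z (real n))) \<longlonglongrightarrow> asym z"
proof (rule Lim_null_comparison[THEN LIM_zero_cancel])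
  show "\<forall>\<^sub>F n in sequentially. norm (uns (flow lam a 0 z (real n)) - asym z) \<le> (real n + 0) ^ 0 * exp (- real n)"
  proof (rule always_eventually, rule allI)
    fix n
    have "exp (- 2 * real n) / 72 \<le> exp (- real n)"
      using exp_le_cancel_iff[of "- 2 * real n" "- real n"] exp_ge_zero[of "- 2 * real n"] by linarith
    then show "norm (uns (flow lam a 0 z (real n)) - asym z) \<le> (real n + 0) ^ 0 * exp (- real n)"
      using order_trans[OF asym_rate] by (simp add: norm_minus_commute)
  qed
  show "(\<lambda>n. (real n + 0) ^ 0 * exp (- real n)) \<longlonglongrightarrow> 0"
    by (rule filterlim_compose[OF power_exp_tendsto_0 filterlim_real_sequentially])
qed

lemma measurable_asym [measurable]: "asym \<in> borel_measurable borel"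
proof (rule borel_measurable_LIMSEQ_metric[OF _ asym_limit])
  show "(\<lambda>z. uns (flow lam a 0 z (real n))) \<in> borel_measurable borel" for n
    unfolding uns_def
    by (intro borel_measurable_continuous_onI continuous_intros continuous_on_compose_triple[OF continuous_flow[OF a]])
qed

text \<open>Writing \<open>cosh t\<close> as the half sum of \<open>exp t\<close> and
  \<open>exp (- t)\<close> compares both components with \<open>asym z\<close>. The unstable error
  is \<open>exp t\<close> times \<open>O(exp (- 2 * t))\<close>. The stable error is
  \<open>exp (- t)\<close> times a drift \<open>O(t)\<close> plus the initial offset
  \<open>- 2 * snd z\<close>, which is the source of the velocity weight.\<close>

lemma asym_position:
  assumes t: "t \<ge> 0"
  shows "norm (fst (traj a t z) - cosh t *\<^sub>R asym z) \<le> (t + 2) * exp (- t) * (bracket (snd z))\<^sup>2"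
proof -
  let ?y = "flow lam a 0 z"
  have i: "norm (asym z - uns (?y 0)) \<le> exp (- 2 * 0) / 72" "norm (asym z - uns (?y t)) \<le> exp (- 2 * t) / 72"
    using t by (intro asym_rate; simp)+
  have s: "norm (sta (?y t) - sta (?y 0)) \<le> (t - 0) / 36"
    by (rule sta_increment[OF a _ t flow_deriv[OF a]]) simp
  have d: "sta (?y t) - asym z = (sta (?y t) - sta (?y 0)) - (asym z - uns (?y 0)) - 2 *\<^sub>R snd z"
    by (simp add: flow_init[OF a] sta_def uns_def scaleR_2)
  have S: "norm (sta (?y t) - asym z) \<le> t / 36 + 1 / 72 + 2 * norm (snd z)"
    unfolding d using norm_triangle_ineq4[of "(sta (?y t) - sta (?y 0)) - (asym z - uns (?y 0))" "2 *\<^sub>R snd z"]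
      norm_triangle_ineq4[of "sta (?y t) - sta (?y 0)" "asym z - uns (?y 0)"] i(1) s by simp
  have "fst (traj a t z) - cosh t *\<^sub>R asym z = (1 / 2) *\<^sub>R (exp t *\<^sub>R (uns (?y t) - asym z) + exp (- t) *\<^sub>R (sta (?y t) - asym z))"
    unfolding traj_def fst_lin_eq
    by (simp add: cosh_def algebra_simps add_divide_distrib)
  then have "norm (fst (traj a t z) - cosh t *\<^sub>R asym z) \<le> 1 / 2 * (exp t * norm (asym z - uns (?y t)) + exp (- t) * norm (sta (?y t) - asym z))"
    using norm_triangle_ineq[of "exp t *\<^sub>R (uns (?y t) - asym z)" "exp (- t) *\<^sub>R (sta (?y t) - asym z)"]
    by (simp add: norm_minus_commute[of "asym z"])
  also have "\<dots> \<le> 1 / 2 * (exp t * (exp (- 2 * t) / 72) + exp (- t) * (t / 36 + 1 / 72 + 2 * norm (snd z)))"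
    using i(2) S by (intro mult_left_mono add_mono) auto
  also have "\<dots> = exp (- t) * (1 / 2 * (1 / 72 + (t / 36 + 1 / 72 + 2 * norm (snd z))))"
    by (simp add: algebra_simps flip: exp_add)
  also have "\<dots> \<le> exp (- t) * ((t + 2) * (bracket (snd z))\<^sup>2)"
  proof (rule mult_left_mono)
    let ?b = "bracket (snd z)"
    have b: "1 \<le> ?b" "norm (snd z) \<le> ?b" by (rule bracket_ge_1 bracket_ge_norm)+
    have "?b * 1 \<le> ?b * ?b" using b by (intro mult_left_mono) auto
    then have b2: "?b \<le> ?b\<^sup>2" by (simp add: power2_eq_square)
    have "t * 1 \<le> t * ?b\<^sup>2" using b b2 t by (intro mult_left_mono) auto
    moreover have "1 / 2 * (1 / 72 + (t / 36 + 1 / 72 + 2 * n)) \<le> p + 2 * q"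
      if "t * 1 \<le> p" "1 \<le> b" "n \<le> b" "b \<le> q" for p q b n :: real
      using that t by simp
    ultimately show "1 / 2 * (1 / 72 + (t / 36 + 1 / 72 + 2 * norm (snd z))) \<le> (t + 2) * ?b\<^sup>2"
      using b b2 unfolding distrib_right by blast
  qed simp
  finally show ?thesis by (simp add: mult_ac)
qed

text \<open>For \<open>asym\<close> itself no expansion estimate is at hand. Its kernel integrals
  are approached by those at finite times, rescaled by \<open>cosh s\<close>, and Fatou's lemma
  carries over a bound uniform in \<open>s\<close>. Where \<open>y = asym z\<close> the kernel may
  jump, but its value 0 there makes the inequality trivial.\<close>

lemma asym_fatou:
  fixes k :: "plane \<Rightarrow> plane"
  assumes [measurable]: "k \<in> borel_measurable borel" and k0: "k 0 = 0" and k: "\<And>z. z \<noteq> 0 \<Longrightarrow> isCont k z"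
    and B: "\<And>s. s \<ge> 0 \<Longrightarrow> (\<integral>\<^sup>+z. ennreal (norm (k (y - fst (traj a s z) /\<^sub>R cosh s))) * ennreal (wt z) \<partial>lborel) \<le> ennreal B"
  shows "(\<integral>\<^sup>+z. ennreal (norm (k (y - asym z))) * ennreal (wt z) \<partial>lborel) \<le> ennreal B"
proof -
  note [measurable] = measurable_position[OF a]
  let ?f = "\<lambda>n z. ennreal (norm (k (y - fst (traj a (real n) z) /\<^sub>R cosh (real n)))) * ennreal (wt z)"
  have lim: "(\<lambda>n. fst (traj a (real n) z) /\<^sub>R cosh (real n)) \<longlonglongrightarrow> asym z" for z
  proof (rule Lim_null_comparison[THEN LIM_zero_cancel])
    show "\<forall>\<^sub>F n in sequentially. norm (fst (traj a (real n) z) /\<^sub>R cosh (real n) - asym z)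
        \<le> (real n + 2) ^ 1 * exp (- real n) * (bracket (snd z))\<^sup>2"
    proof (rule always_eventually, rule allI)
      fix n
      let ?c = "cosh (real n)"
      have c: "?c \<ge> 1" by (rule cosh_real_ge_1)
      have "fst (traj a (real n) z) /\<^sub>R ?c - asym z = inverse ?c *\<^sub>R (fst (traj a (real n) z) - ?c *\<^sub>R asym z)"
        by (simp add: scaleR_diff_right)
      then have "norm (fst (traj a (real n) z) /\<^sub>R ?c - asym z) = inverse ?c * norm (fst (traj a (real n) z) - ?c *\<^sub>R asym z)"
        using c by simp
      also have "\<dots> \<le> 1 * norm (fst (traj a (real n) z) - ?c *\<^sub>R asym z)"
        using c by (intro mult_right_mono) (auto simp: inverse_le_1_iff)
      also have "\<dots> \<le> (real n + 2) ^ 1 * exp (- real n) * (bracket (snd z))\<^sup>2"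
        using asym_position[of "real n" z] by simp
      finally show "norm (fst (traj a (real n) z) /\<^sub>R ?c - asym z) \<le> (real n + 2) ^ 1 * exp (- real n) * (bracket (snd z))\<^sup>2" .
    qed
    show "(\<lambda>n. (real n + 2) ^ 1 * exp (- real n) * (bracket (snd z))\<^sup>2) \<longlonglongrightarrow> 0"
      by (intro tendsto_mult_left_zero filterlim_compose[OF power_exp_tendsto_0 filterlim_real_sequentially])
  qed
  have "(\<integral>\<^sup>+z. ennreal (norm (k (y - asym z))) * ennreal (wt z) \<partial>lborel) \<le> (\<integral>\<^sup>+z. liminf (\<lambda>n. ?f n z) \<partial>lborel)"
  proof (rule nn_integral_mono)
    fix z
    show "ennreal (norm (k (y - asym z))) * ennreal (wt z) \<le> liminf (\<lambda>n. ?f n z)"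
    proof (cases "y - asym z = 0")
      case False
      have "(\<lambda>n. k (y - fst (traj a (real n) z) /\<^sub>R cosh (real n))) \<longlonglongrightarrow> k (y - asym z)"
        by (rule isCont_tendsto_compose[OF k[OF False]]) (intro tendsto_intros lim)
      then have "(\<lambda>n. ennreal (norm (k (y - fst (traj a (real n) z) /\<^sub>R cosh (real n))) * wt z)) \<longlonglongrightarrow> ennreal (norm (k (y - asym z)) * wt z)"
        by (intro tendsto_ennrealI tendsto_intros)
      then have "liminf (\<lambda>n. ?f n z) = ennreal (norm (k (y - asym z))) * ennreal (wt z)"
        by (intro lim_imp_Liminf) (simp_all add: ennreal_mult' wt_def)
      then show ?thesis by simp
    qed (simp add: k0)
  qed
  also have "\<dots> \<le> liminf (\<lambda>n. \<integral>\<^sup>+z. ?f n z \<partial>lborel)"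
    by (rule nn_integral_liminf) measurable
  also have "\<dots> \<le> liminf (\<lambda>n :: nat. ennreal B)"
    by (intro Liminf_mono always_eventually allI B) simp
  finally show ?thesis by (simp add: Liminf_const)
qed

text \<open>Homogeneity produces a factor \<open>cosh s\<close> that cancels the decay
  \<open>1 / cosh s\<close> of the bound at time \<open>s\<close>.\<close>

lemma asym_singular:
  "(\<integral>\<^sup>+z. ennreal (norm (coulomb (y - asym z))) * ennreal (wt z) \<partial>lborel) \<le> ennreal (singular_const * \<epsilon>\<^sup>2)"
proof (rule asym_fatou[OF measurable_coulomb _ isCont_coulomb])
  note [measurable] = measurable_position[OF a] measurable_coulomb
  fix s :: real assume s: "s \<ge> 0"
  let ?c = "cosh s"
  have c: "?c > 0" by (rule cosh_real_pos)
  have "(\<integral>\<^sup>+z. ennreal (norm (coulomb (y - fst (traj a s z) /\<^sub>R ?c))) * ennreal (wt z) \<partial>lborel)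
      = (\<integral>\<^sup>+z. ennreal ?c * (ennreal (norm (coulomb (?c *\<^sub>R y - fst (traj a s z)))) * ennreal (wt z)) \<partial>lborel)"
    by (subst coulomb_scale[OF c]) (use c in \<open>simp add: scaleR_diff_right ennreal_mult' mult.assoc\<close>)
  also have "\<dots> = ennreal ?c * (\<integral>\<^sup>+z. ennreal (norm (coulomb (?c *\<^sub>R y - fst (traj a s z)))) * ennreal (wt z) \<partial>lborel)"
    by (rule nn_integral_cmult) measurable
  also have "\<dots> \<le> ennreal ?c * ennreal (singular_const * \<epsilon>\<^sup>2 / ?c)"
    by (intro mult_left_mono nn_integral_singular_kernel[OF a s, where k = "\<lambda>z. norm (coulomb z)"] norm_coulomb) auto
  also have "\<dots> = ennreal (singular_const * \<epsilon>\<^sup>2)" using c by (simp flip: ennreal_mult')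
  finally show "(\<integral>\<^sup>+z. ennreal (norm (coulomb (y - fst (traj a s z) /\<^sub>R ?c))) * ennreal (wt z) \<partial>lborel) \<le> ennreal (singular_const * \<epsilon>\<^sup>2)" .
qed (simp add: coulomb_def)

lemma asym_near:
  assumes d: "d > 0"
  shows "(\<integral>\<^sup>+z. ennreal (norm (coulomb_near d (y - asym z))) * ennreal (wt z) \<partial>lborel) \<le> ennreal (3072 * pi\<^sup>2 * \<epsilon>\<^sup>2 * d)"
proof (rule asym_fatou[OF measurable_coulomb_near])
  note [measurable] = measurable_position[OF a] measurable_coulomb_near
  show "isCont (coulomb_near d) z" if "z \<noteq> 0" for z
    unfolding coulomb_near_def[abs_def] by (intro continuous_intros isCont_coulomb isCont_coulomb_reg d that)
  fix s :: real assume s: "s \<ge> 0"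
  let ?c = "cosh s"
  have c: "?c > 0" by (rule cosh_real_pos)
  have cd: "?c * d > 0" using c d by simp
  have "(\<integral>\<^sup>+z. ennreal (norm (coulomb_near d (y - fst (traj a s z) /\<^sub>R ?c))) * ennreal (wt z) \<partial>lborel)
      = (\<integral>\<^sup>+z. ennreal ?c * (ennreal (norm (coulomb_near (?c * d) (?c *\<^sub>R y - fst (traj a s z)))) * ennreal (wt z)) \<partial>lborel)"
    by (subst coulomb_near_scale[OF c]) (use c in \<open>simp add: scaleR_diff_right ennreal_mult' mult.assoc\<close>)
  also have "\<dots> = ennreal ?c * (\<integral>\<^sup>+z. ennreal (norm (coulomb_near (?c * d) (?c *\<^sub>R y - fst (traj a s z)))) * ennreal (wt z) \<partial>lborel)"
    by (rule nn_integral_cmult) measurable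
  also have "\<dots> \<le> ennreal ?c * ennreal (\<epsilon>\<^sup>2 * density_bound s * (12 * pi * (?c * d)))"
    by (intro mult_left_mono nn_integral_near_kernel[OF a s cd]) auto
  also have "\<dots> = ennreal (3072 * pi\<^sup>2 * \<epsilon>\<^sup>2 * d)"
    using c by (simp add: density_bound_def power2_eq_square mult_ac flip: ennreal_mult')
  finally show "(\<integral>\<^sup>+z. ennreal (norm (coulomb_near d (y - fst (traj a s z) /\<^sub>R ?c))) * ennreal (wt z) \<partial>lborel) \<le> ennreal (3072 * pi\<^sup>2 * \<epsilon>\<^sup>2 * d)" .
qed (simp add: coulomb_near_def coulomb_def coulomb_reg_def)

lemma asym_integral_bound:
  fixes k :: "plane \<Rightarrow> plane"
  assumes k[measurable]: "k \<in> borel_measurable borel"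
    and B: "(\<integral>\<^sup>+z. ennreal (norm (k (y - asym z))) * ennreal (wt z) \<partial>lborel) \<le> ennreal B" and B0: "B \<ge> 0"
  shows "integrable lborel (\<lambda>z. (\<mu>0 z)\<^sup>2 *\<^sub>R k (y - asym z))"
    and "norm (\<integral>z. (\<mu>0 z)\<^sup>2 *\<^sub>R k (y - asym z) \<partial>lborel) \<le> B"
proof -
  have le: "(\<integral>\<^sup>+z. norm ((\<mu>0 z)\<^sup>2 *\<^sub>R k (y - asym z)) \<partial>lborel) \<le> ennreal B"
  proof (rule order_trans[OF nn_integral_mono B])
    fix z
    show "ennreal (norm ((\<mu>0 z)\<^sup>2 *\<^sub>R k (y - asym z))) \<le> ennreal (norm (k (y - asym z))) * ennreal (wt z)"
      using mult_right_mono[OF sq_le_wt[of z], of "norm (k (y - asym z))"]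
      by (simp add: mult.commute flip: ennreal_mult')
  qed
  show i: "integrable lborel (\<lambda>z. (\<mu>0 z)\<^sup>2 *\<^sub>R k (y - asym z))"
    using le by (intro integrableI_bounded) (auto intro: le_less_trans)
  have "ennreal (norm (\<integral>z. (\<mu>0 z)\<^sup>2 *\<^sub>R k (y - asym z) \<partial>lborel)) \<le> ennreal B"
    by (rule order_trans[OF integral_norm_bound_ennreal[OF i] le])
  then show "norm (\<integral>z. (\<mu>0 z)\<^sup>2 *\<^sub>R k (y - asym z) \<partial>lborel) \<le> B" using B0 by simp
qed

text \<open>The two terms of \<open>eps_small\<close> taken separately: \<open>144 = 36 * 4\<close>
  and \<open>3538944 = 36 * 98304\<close>.\<close>

lemma small_constants: "singular_const * \<epsilon>\<^sup>2 \<le> 1 / 144" "pi\<^sup>2 * \<epsilon>\<^sup>2 \<le> 1 / 3538944"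
proof -
  have "singular_const * \<epsilon>\<^sup>2 \<ge> 0" "pi\<^sup>2 * \<epsilon>\<^sup>2 \<ge> 0" using singular_const_pos by auto
  moreover have "144 * (singular_const * \<epsilon>\<^sup>2) + 3538944 * (pi\<^sup>2 * \<epsilon>\<^sup>2) \<le> 1"
    using eps_small by (simp add: algebra_simps)
  ultimately show "singular_const * \<epsilon>\<^sup>2 \<le> 1 / 144" "pi\<^sup>2 * \<epsilon>\<^sup>2 \<le> 1 / 3538944" by linarith+
qed

lemma integrable_coulomb_asym: "integrable lborel (\<lambda>z. (\<mu>0 z)\<^sup>2 *\<^sub>R coulomb (y - asym z))"
  by (rule asym_integral_bound[OF measurable_coulomb asym_singular]) (simp add: singular_const_pos less_imp_le)

lemma norm_Einf: "norm (Einf y) \<le> 1"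
proof -
  have "norm (\<integral>z. (\<mu>0 z)\<^sup>2 *\<^sub>R coulomb (y - asym z) \<partial>lborel) \<le> singular_const * \<epsilon>\<^sup>2"
    by (rule asym_integral_bound[OF measurable_coulomb asym_singular]) (simp add: singular_const_pos less_imp_le)
  then have "norm (\<integral>z. (\<mu>0 z)\<^sup>2 *\<^sub>R coulomb (y - asym z) \<partial>lborel) \<le> 1" using small_constants(1) by linarith
  then show ?thesis using pi_gt3 by (simp add: Einf_def field_simps)
qed

text \<open>Both fields are split at the physical distance 1, which is \<open>1 / cosh t\<close> in
  the variable \<open>y\<close>. After rescaling, each near part is \<open>O(exp (- t))\<close>, and
  the far parts differ through the error of the asymptotic positions, of order
  \<open>(t + 2) * exp (- t)\<close>.\<close>

lemma field_asym:
  assumes t: "t \<ge> 0"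
  shows "norm (cosh t *\<^sub>R a t (cosh t *\<^sub>R y) - Einf y) \<le> (1 + t) * exp (- t)"
proof -
  let ?c = "cosh t" and ?x = "cosh t *\<^sub>R y" and ?\<delta> = "(t + 2) * exp (- t)"
  have c: "?c > 0" by (rule cosh_real_pos)
  have ic: "1 / ?c \<le> 2 * exp (- t)"
    using cosh_bounds(1)[of t] c by (simp add: exp_minus field_simps)
  have cd: "1 / ?c > 0" using c by simp
  define R where "R = (\<integral>z. (\<mu>0 z)\<^sup>2 *\<^sub>R coulomb_reg 1 (?x - ?c *\<^sub>R asym z) \<partial>lborel)"
  define S where "S = (\<integral>z. (\<mu>0 z)\<^sup>2 *\<^sub>R coulomb_near (1 / ?c) (y - asym z) \<partial>lborel)"
  have mr: "(\<lambda>z. ?x - ?c *\<^sub>R asym z) \<in> borel_measurable borel" by measurable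
  have S: "integrable lborel (\<lambda>z. (\<mu>0 z)\<^sup>2 *\<^sub>R coulomb_near (1 / ?c) (y - asym z))" "norm S \<le> 3072 * pi\<^sup>2 * \<epsilon>\<^sup>2 * (1 / ?c)"
    unfolding S_def by (rule asym_integral_bound[OF measurable_coulomb_near asym_near[OF cd]]; use c in simp)+
  have K: "coulomb w = ?c *\<^sub>R coulomb_reg 1 (?c *\<^sub>R w) + coulomb_near (1 / ?c) w" for w
    using c coulomb_near_scale[OF c, of "1 / ?c" w] coulomb_scale[OF c, of w]
    by (simp add: coulomb_near_def scaleR_diff_right)
  have split: "(\<mu>0 z)\<^sup>2 *\<^sub>R (?c *\<^sub>R coulomb_reg 1 (?x - ?c *\<^sub>R asym z)) = (\<mu>0 z)\<^sup>2 *\<^sub>R coulomb (y - asym z) - (\<mu>0 z)\<^sup>2 *\<^sub>R coulomb_near (1 / ?c) (y - asym z)" for z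
    by (subst K) (simp add: scaleR_add_right scaleR_diff_right)
  have "?c *\<^sub>R R = (\<integral>z. (\<mu>0 z)\<^sup>2 *\<^sub>R (?c *\<^sub>R coulomb_reg 1 (?x - ?c *\<^sub>R asym z)) \<partial>lborel)"
    unfolding R_def by (subst integral_scaleR_right[symmetric]) (simp add: mult.commute)
  also have "\<dots> = (\<integral>z. (\<mu>0 z)\<^sup>2 *\<^sub>R coulomb (y - asym z) \<partial>lborel) - S"
    unfolding split S_def by (rule Bochner_Integration.integral_diff[OF integrable_coulomb_asym S(1)])
  finally have E: "Einf y = (1 / (2 * pi)) *\<^sub>R (?c *\<^sub>R R + S)" by (simp add: Einf_def)
  have A: "a t ?x = (1 / (2 * pi)) *\<^sub>R (lagrangian a (coulomb_reg 1) t ?x + lagrangian a (coulomb_near 1) t ?x)"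
    using t by (simp add: fixed fld_def lagrangian_split[OF a t zero_less_one])
  have far: "norm (R - lagrangian a (coulomb_reg 1) t ?x) \<le> ?\<delta> / 1 * (singular_const * \<epsilon>\<^sup>2 / ?c)"
    unfolding R_def
  proof (rule regular_field_diff[OF a t zero_less_one mr])
    show "norm (?x - ?c *\<^sub>R asym z - (?x - fst (traj a t z))) \<le> ?\<delta> * (bracket (snd z))\<^sup>2" for z
      using asym_position[OF t, of z] by (simp add: mult.assoc)
  qed (use t in simp)
  have near: "norm (lagrangian a (coulomb_near 1) t ?x) \<le> \<epsilon>\<^sup>2 * density_bound t * (12 * pi * 1)"
    by (rule lagrangian_near[OF a t zero_less_one])
  let ?P = "?c *\<^sub>R (R - lagrangian a (coulomb_reg 1) t ?x)" and ?Q = "?c *\<^sub>R lagrangian a (coulomb_near 1) t ?x"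
  have P: "norm ?P \<le> ?\<delta> * (singular_const * \<epsilon>\<^sup>2)"
    using mult_left_mono[OF far, of ?c] c by simp
  have Q: "norm ?Q \<le> 3072 * pi\<^sup>2 * \<epsilon>\<^sup>2 * (1 / ?c)"
    using mult_left_mono[OF near, of ?c] c by (simp add: density_bound_def power2_eq_square mult_ac)
  have "?c *\<^sub>R a t ?x - Einf y = (1 / (2 * pi)) *\<^sub>R (?Q - ?P - S)"
    unfolding A E by (simp add: algebra_simps)
  then have "norm (?c *\<^sub>R a t ?x - Einf y) = 1 / (2 * pi) * norm (?Q - ?P - S)" by simp
  also have "\<dots> \<le> 1 * norm (?Q - ?P - S)" using pi_gt3 by (intro mult_right_mono) auto
  also have "\<dots> \<le> norm ?Q + norm ?P + norm S"
    using norm_triangle_ineq4[of "?Q - ?P" S] norm_triangle_ineq4[of ?Q ?P] by linarith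
  also have "\<dots> \<le> ?\<delta> * (singular_const * \<epsilon>\<^sup>2) + 6144 * (pi\<^sup>2 * \<epsilon>\<^sup>2) * (1 / ?c)"
  proof -
    have "p + q + s \<le> d + 6144 * (pi\<^sup>2 * \<epsilon>\<^sup>2) * (1 / ?c)"
      if "q \<le> d" "p \<le> 3072 * pi\<^sup>2 * \<epsilon>\<^sup>2 * (1 / ?c)" "s \<le> 3072 * pi\<^sup>2 * \<epsilon>\<^sup>2 * (1 / ?c)" for p q s d
      using that by simp
    from this[OF P Q S(2)] show ?thesis .
  qed
  also have "\<dots> \<le> ?\<delta> * (1 / 144) + 1 / 576 * (2 * exp (- t))"
    using small_constants ic t c by (intro add_mono mult_left_mono mult_mono) auto
  also have "\<dots> \<le> (1 + t) * exp (- t)"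
  proof -
    have "((t + 2) / 144 + 1 / 288) * exp (- t) \<le> (1 + t) * exp (- t)"
      using t by (intro mult_right_mono) (auto simp: field_simps)
    then show ?thesis by (simp add: algebra_simps add_divide_distrib)
  qed
  finally show ?thesis .
qed

lemma continuous_Einf: "continuous_on UNIV Einf"
proof (rule uniform_limit_theorem)
  show "\<forall>\<^sub>F t in at_top. continuous_on UNIV (\<lambda>y. cosh t *\<^sub>R a t (cosh t *\<^sub>R y))"
    using a by (intro always_eventually allI continuous_intros continuous_on_compose_pair[where f = a]) (simp add: small_field_def)
  show "uniform_limit UNIV (\<lambda>t y. cosh t *\<^sub>R a t (cosh t *\<^sub>R y)) Einf at_top"
  proof (rule uniform_limitI)
    fix e :: real assume e: "e > 0"
    show "\<forall>\<^sub>F t in at_top. \<forall>y\<in>UNIV. dist (cosh t *\<^sub>R a t (cosh t *\<^sub>R y)) (Einf y) < e"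
      using order_tendstoD(2)[OF power_exp_tendsto_0[of 1 1] e] eventually_ge_at_top[of 0]
    proof eventually_elim
      case (elim t)
      then show ?case using field_asym[of t] by (auto simp: dist_norm add.commute intro: le_less_trans)
    qed
  qed
qed simp

end

section \<open>Convergence along the asymptotic trajectories\<close>

locale scattering = vlasov_field +
  assumes grad_decay: "norm (grad \<mu>0 z) \<le> \<epsilon> / bracket (snd z)"
begin

text \<open>The asymptotic trajectory from \<open>(x - v, v)\<close> in profile coordinates. Its
  unstable component is constantly \<open>x\<close> and its stable one drifts with speed
  \<open>- 2 * lam * Einf x\<close>; starting at \<open>x - v\<close> is what makes \<open>x\<close>
  the argument of \<open>Einf\<close>.\<close>

definition free :: "real \<Rightarrow> phase \<Rightarrow> phase" where
  "free t z = (fst z - snd z - (lam * t) *\<^sub>R Einf (fst z), snd z + (lam * t) *\<^sub>R Einf (fst z))"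

definition gam :: "real \<Rightarrow> phase \<Rightarrow> real" where "gam t z = \<mu>0 (flow lam a t (free t z) 0)"

definition muinf :: "phase \<Rightarrow> real" where "muinf z = lim (\<lambda>n. gam (real n) z)"

lemma lin_free: "lin t (free t z) = (Xasym lam Einf t (fst z - snd z) (snd z), Vasym lam Einf t (fst z - snd z) (snd z))"
proof -
  have e: "exp (- t) = cosh t - sinh t" by (rule cosh_minus_sinh[symmetric])
  show ?thesis unfolding lin_def Xasym_def Vasym_def free_def e
    by (simp add: algebra_simps)
qed

lemma mu_asymptotic: "mu a t (Xasym lam Einf t (x - v) v, Vasym lam Einf t (x - v) v) = gam t (x, v)"
proof -
  have e: "(Xasym lam Einf t (x - v) v, Vasym lam Einf t (x - v) v) = lin t (free t (x, v))"
    using lin_free[of t "(x, v)"] by simp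
  show ?thesis unfolding e mu_def orig_def gam_def by simp
qed

lemma uns_free: "uns (free t z) = fst z"
  and sta_free: "sta (free t z) = fst z - 2 *\<^sub>R snd z - (2 * lam * t) *\<^sub>R Einf (fst z)"
  by (simp_all add: uns_def sta_def free_def scaleR_2 algebra_simps flip: scaleR_add_left)

lemma norm_drift: "t \<ge> 0 \<Longrightarrow> norm ((lam * t) *\<^sub>R Einf x) \<le> t"
  using mult_left_mono[OF norm_Einf, of t x] by (simp add: abs_mult abs_lam)

text \<open>\<open>exp t\<close> is \<open>2 * cosh t\<close> up to \<open>exp (- t)\<close>, so the
  stable speed is, apart from the factor \<open>- lam\<close>, close to \<open>2 * Einf x\<close>.
  The distance \<open>M\<close> of the stable component from \<open>x\<close> enters through the
  Lipschitz bound of the field.\<close>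

lemma slope_asym:
  assumes t: "t \<ge> 0" and u: "norm (uns w - x) \<le> 1 / 72 * exp (- 2 * t)" and M: "norm (sta w - x) \<le> M"
  shows "norm (exp t *\<^sub>R a t (fst (lin t w)) - 2 *\<^sub>R Einf x) \<le> exp (- t) * (M + 2 * t + 4)"
proof -
  let ?c = "cosh t" and ?X = "fst (lin t w)"
  have M0: "M \<ge> 0" using M norm_ge_zero order_trans by blast
  have e1: "exp (- t) \<le> 1" using t by simp
  have X: "?X - ?c *\<^sub>R x = (1 / 2) *\<^sub>R (exp t *\<^sub>R (uns w - x) + exp (- t) *\<^sub>R (sta w - x))"
    unfolding fst_lin_eq by (simp add: cosh_def algebra_simps add_divide_distrib)
  have "norm (?X - ?c *\<^sub>R x) \<le> 1 / 2 * (exp t * norm (uns w - x) + exp (- t) * norm (sta w - x))"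
    unfolding X using norm_triangle_ineq[of "exp t *\<^sub>R (uns w - x)" "exp (- t) *\<^sub>R (sta w - x)"] by simp
  also have "\<dots> \<le> 1 / 2 * (exp t * (1 / 72 * exp (- 2 * t)) + exp (- t) * M)"
    using u M by (intro mult_left_mono add_mono) auto
  also have "\<dots> = exp (- t) * (1 / 144 + M / 2)" by (simp add: algebra_simps flip: exp_add)
  finally have XX: "norm (?X - ?c *\<^sub>R x) \<le> exp (- t) * (1 / 144 + M / 2)" .
  have A: "exp t * norm (a t ?X - a t (?c *\<^sub>R x)) \<le> exp (- t) * (1 + M)"
  proof -
    have "norm (a t ?X - a t (?c *\<^sub>R x)) \<le> exp (- \<bar>t\<bar>) / 36 * norm (?X - ?c *\<^sub>R x)"
      using a unfolding small_field_def by blast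
    then have "exp t * norm (a t ?X - a t (?c *\<^sub>R x)) \<le> exp t * (exp (- t) / 36 * norm (?X - ?c *\<^sub>R x))"
      using t by (intro mult_left_mono) auto
    also have "\<dots> = norm (?X - ?c *\<^sub>R x) / 36" by (simp add: exp_minus)
    also have "\<dots> \<le> exp (- t) * (1 / 144 + M / 2) / 36" using XX by (rule divide_right_mono) simp
    also have "\<dots> \<le> exp (- t) * (1 + M)" using M0 by simp
    finally show ?thesis .
  qed
  have B: "norm (?c *\<^sub>R a t (?c *\<^sub>R x) - Einf x) \<le> (1 + t) * exp (- t)" by (rule field_asym[OF t])
  have C: "norm (a t (?c *\<^sub>R x)) \<le> 1"
  proof -
    have "norm (a t (?c *\<^sub>R x)) \<le> exp (- \<bar>t\<bar>) / 36" using a unfolding small_field_def by blast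
    also have "\<dots> \<le> 1" using e1 t unfolding abs_of_nonneg[OF t] by linarith
    finally show ?thesis .
  qed
  have "exp t = 2 * ?c - exp (- t)" by (simp add: cosh_def add_divide_distrib)
  then have eq: "exp t *\<^sub>R a t ?X - 2 *\<^sub>R Einf x = exp t *\<^sub>R (a t ?X - a t (?c *\<^sub>R x))
      + 2 *\<^sub>R (?c *\<^sub>R a t (?c *\<^sub>R x) - Einf x) - exp (- t) *\<^sub>R a t (?c *\<^sub>R x)"
    by (simp only: scaleR_diff_right scaleR_diff_left) (simp add: algebra_simps)
  have "norm (exp t *\<^sub>R a t ?X - 2 *\<^sub>R Einf x) \<le> exp t * norm (a t ?X - a t (?c *\<^sub>R x))
      + 2 * norm (?c *\<^sub>R a t (?c *\<^sub>R x) - Einf x) + exp (- t) * norm (a t (?c *\<^sub>R x))"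
    unfolding eq by (rule order_trans[OF norm_triangle_ineq4 add_mono[OF order_trans[OF norm_triangle_ineq]]]) auto
  also have "\<dots> \<le> exp (- t) * (1 + M) + 2 * ((1 + t) * exp (- t)) + exp (- t) * 1"
    using A B C by (intro add_mono mult_left_mono) auto
  also have "\<dots> = exp (- t) * (M + 2 * t + 4)" by (simp add: algebra_simps)
  finally show ?thesis .
qed

text \<open>The true and the asymptotic trajectory agree at time \<open>t\<close> and are followed
  back over at most one unit of time. The unstable difference is bounded by the integrable speed.
  For the stable one the linear drift is compensated, and what is left has speed
  \<open>O(exp (- s) * (1 + t))\<close> times the velocity weight.\<close>

lemma free_increment:
  assumes s: "0 \<le> s" "s \<le> t" "t \<le> s + 1"
  shows "norm (uns (flow lam a t (free t z) s) - uns (free s z)) \<le> exp (- 2 * s) / 72"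
    and "norm (sta (flow lam a t (free t z) s) - sta (free s z)) \<le> 7 * exp (- s) * (1 + t) * bracket (snd z)"
proof -
  let ?y = "flow lam a t (free t z)" and ?x = "fst z" and ?v = "snd z" and ?b = "bracket (snd z)"
  note y = flow_deriv[OF a, of t "free t z"]
  have yt: "?y t = free t z" by (rule flow_init[OF a])
  have u: "norm (uns (?y r) - ?x) \<le> 1 / 72 * exp (- 2 * r)" if r: "s \<le> r" "r \<le> t" for r
  proof -
    have "norm (uns (?y t) - uns (?y r)) \<le> (exp (- 2 * r) - exp (- 2 * t)) / 72"
      by (rule uns_increment[OF a _ r(2) y]) (use s r in simp)
    also have "\<dots> \<le> 1 / 72 * exp (- 2 * r)" by simp
    finally show ?thesis by (simp add: yt uns_free norm_minus_commute)
  qed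
  show "norm (uns (?y s) - uns (free s z)) \<le> exp (- 2 * s) / 72"
    using u[of s] s by (simp add: uns_free)
  have S: "norm (sta (?y r) - ?x) \<le> 2 * norm ?v + 2 * t + 1" if r: "s \<le> r" "r \<le> t" for r
  proof -
    have "norm (sta (?y t) - sta (?y r)) \<le> (t - r) / 36"
      by (rule sta_increment[OF a _ r(2) y]) (use s r in simp)
    also have "\<dots> \<le> 1" using r s by simp
    finally have 1: "norm (sta (?y t) - sta (?y r)) \<le> 1" .
    have 2: "norm (2 *\<^sub>R ((lam * t) *\<^sub>R Einf ?x)) \<le> 2 * t" using norm_drift[of t ?x] s by simp
    have eq: "sta (?y r) - ?x = - (sta (?y t) - sta (?y r)) - 2 *\<^sub>R ?v - 2 *\<^sub>R ((lam * t) *\<^sub>R Einf ?x)"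
      by (simp add: yt sta_free mult.assoc)
    show ?thesis unfolding eq
      using norm_triangle_ineq4[of "- (sta (?y t) - sta (?y r)) - 2 *\<^sub>R ?v" "2 *\<^sub>R ((lam * t) *\<^sub>R Einf ?x)"]
        norm_triangle_ineq4[of "- (sta (?y t) - sta (?y r))" "2 *\<^sub>R ?v"] 1 2
      unfolding norm_minus_cancel norm_scaleR by simp
  qed
  let ?h = "\<lambda>r. sta (?y r) + r *\<^sub>R ((2 * lam) *\<^sub>R Einf ?x)"
  let ?K = "exp (- s) * (2 * norm ?v + 4 * t + 5)"
  have "norm (?h t - ?h s) \<le> t * ?K - s * ?K"
  proof (rule norm_increment_le[OF s(2)])
    fix r assume r: "s \<le> r" "r \<le> t"
    show "(?h has_vector_derivative - ((lam * exp r) *\<^sub>R a r (fst (lin r (?y r)))) + (2 * lam) *\<^sub>R Einf ?x) (at r)"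
      by (rule has_vector_derivative_add[OF sta_deriv[OF y]]) (auto intro!: derivative_eq_intros)
    show "((\<lambda>r. r * ?K) has_real_derivative ?K) (at r)" by (auto intro!: derivative_eq_intros)
    have "norm (- ((lam * exp r) *\<^sub>R a r (fst (lin r (?y r)))) + (2 * lam) *\<^sub>R Einf ?x)
        = norm ((- lam) *\<^sub>R (exp r *\<^sub>R a r (fst (lin r (?y r))) - 2 *\<^sub>R Einf ?x))"
      by (simp add: scaleR_diff_right mult.commute)
    also have "\<dots> = norm (exp r *\<^sub>R a r (fst (lin r (?y r))) - 2 *\<^sub>R Einf ?x)"
      unfolding norm_scaleR by (simp add: abs_lam)
    also have "\<dots> \<le> exp (- r) * (2 * norm ?v + 2 * t + 1 + 2 * r + 4)"
      by (rule slope_asym[OF _ u[OF r] S[OF r]]) (use s r in simp)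
    also have "\<dots> \<le> ?K"
      using s r by (intro mult_mono) auto
    finally show "norm (- ((lam * exp r) *\<^sub>R a r (fst (lin r (?y r)))) + (2 * lam) *\<^sub>R Einf ?x) \<le> ?K" .
  qed
  moreover have eq: "?h t - ?h s = - (sta (?y s) - sta (free s z))"
    by (simp add: yt sta_free algebra_simps)
  ultimately have "norm (sta (?y s) - sta (free s z)) \<le> t * ?K - s * ?K" unfolding eq norm_minus_cancel by blast
  also have "\<dots> = (t - s) * ?K" by (simp add: algebra_simps)
  also have "\<dots> \<le> 1 * ?K" using s by (intro mult_right_mono) auto
  also have "\<dots> \<le> exp (- s) * (7 * ((1 + t) * ?b))"
  proof -
    have b: "1 \<le> ?b" "norm ?v \<le> ?b" by (rule bracket_ge_1 bracket_ge_norm)+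
    have "(1 + t) * 1 \<le> (1 + t) * ?b" using b s by (intro mult_left_mono) auto
    moreover have "1 * ?b \<le> (1 + t) * ?b" using b s by (intro mult_right_mono) auto
    moreover have "2 * n + 4 * t + 5 \<le> 7 * p" if "(1 + t) * 1 \<le> p" "1 * c \<le> p" "n \<le> c" for n p c :: real
      using that s by simp
    ultimately have "2 * norm ?v + 4 * t + 5 \<le> 7 * ((1 + t) * ?b)" using b by blast
    then show ?thesis by simp
  qed
  finally show "norm (sta (?y s) - sta (free s z)) \<le> 7 * exp (- s) * (1 + t) * ?b" by (simp only: mult_ac)
qed

text \<open>Continuing to time 0 multiplies unstable differences by a constant times
  \<open>exp s\<close> and stable ones by a constant. The former are \<open>O(exp (- 2 * s))\<close>
  and the latter \<open>O(exp (- s))\<close> up to the weights, so both end at the order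
  \<open>exp (- s)\<close>.\<close>

lemma free_flow_diff:
  assumes s: "0 \<le> s" "s \<le> t" "t \<le> s + 1"
  shows "norm (flow lam a t (free t z) 0 - flow lam a s (free s z) 0) \<le> 16 * exp (- s) * (1 + t) * bracket (snd z)"
proof -
  let ?y = "flow lam a t (free t z)" and ?B = "7 * exp (- s) * (1 + t) * bracket (snd z)"
  have "exp s * norm (uns (?y s - free s z)) \<le> exp s * (exp (- 2 * s) / 72)"
    unfolding uns_diff by (intro mult_left_mono free_increment s) simp
  also have "\<dots> \<le> exp (- s)" by (simp flip: exp_add)
  finally have A: "exp s * norm (uns (?y s - free s z)) \<le> exp (- s)" .
  have B: "exp (- s) * norm (sta (?y s - free s z)) \<le> exp (- s) * ?B"
    unfolding sta_diff by (intro mult_left_mono free_increment s) simp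
  have "norm (flow lam a s (?y s) 0 - flow lam a s (free s z) 0) \<le> 2 * exp (- s) + 2 * exp s * (exp (- s) * ?B) + 3 * exp s * 0"
    by (rule flow_backward_diff[OF a a s(1) A B]) simp
  also have "\<dots> = 2 * exp (- s) + 14 * exp (- s) * (1 + t) * bracket (snd z)"
    by (simp add: exp_minus)
  also have "\<dots> = exp (- s) * (2 + 14 * ((1 + t) * bracket (snd z)))" by (simp add: algebra_simps)
  also have "\<dots> \<le> exp (- s) * (16 * ((1 + t) * bracket (snd z)))"
  proof (rule mult_left_mono)
    have "1 * 1 \<le> (1 + t) * bracket (snd z)" using s bracket_ge_1[of "snd z"] by (intro mult_mono) auto
    then show "2 + 14 * ((1 + t) * bracket (snd z)) \<le> 16 * ((1 + t) * bracket (snd z))" by linarith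
  qed simp
  finally show ?thesis unfolding flow_flow[OF a] by (simp only: mult_ac)
qed

text \<open>The true and the asymptotic drift are each at most linear in \<open>t\<close>. This
  keeps the velocity weight at the initial point comparable to that at \<open>snd z\<close>.\<close>

lemma free_flow_velocity:
  assumes t: "t \<ge> 0"
  shows "norm (snd (flow lam a t (free t z) 0) - snd z) \<le> 1 + 2 * t"
proof -
  let ?y = "flow lam a t (free t z)"
  note y = flow_deriv[OF a, of t "free t z"]
  have yt: "?y t = free t z" by (rule flow_init[OF a])
  have "norm (uns (?y t) - uns (?y 0)) \<le> (exp (- 2 * 0) - exp (- 2 * t)) / 72"
    by (rule uns_increment[OF a _ t y]) simp
  also have "\<dots> \<le> 1 / 72" by simp
  finally have u: "norm (uns (?y t) - uns (?y 0)) \<le> 1 / 72" .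
  have s: "norm (sta (?y t) - sta (?y 0)) \<le> (t - 0) / 36"
    by (rule sta_increment[OF a _ t y]) simp
  have "snd p - snd z = (1 / 2) *\<^sub>R ((sta q - sta p) - (uns q - uns p)) + (snd q - snd z)" for p q
    by (simp add: uns_def sta_def vec_eq_iff algebra_simps add_divide_distrib diff_divide_distrib)
  from this[of "?y 0" "?y t"]
  have eq: "snd (?y 0) - snd z = (1 / 2) *\<^sub>R ((sta (?y t) - sta (?y 0)) - (uns (?y t) - uns (?y 0))) + (lam * t) *\<^sub>R Einf (fst z)"
    unfolding yt by (simp add: free_def)
  have "norm (snd (?y 0) - snd z) \<le> norm ((1 / 2) *\<^sub>R ((sta (?y t) - sta (?y 0)) - (uns (?y t) - uns (?y 0)))) + t"
    unfolding eq by (rule norm_triangle_le[OF add_left_mono[OF norm_drift[OF t]]])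
  also have "norm ((1 / 2) *\<^sub>R ((sta (?y t) - sta (?y 0)) - (uns (?y t) - uns (?y 0)))) \<le> 1 + t"
    using norm_triangle_ineq4[of "sta (?y t) - sta (?y 0)" "uns (?y t) - uns (?y 0)"] u s t
    unfolding norm_scaleR by simp
  finally show ?thesis by simp
qed

lemma gam_step:
  assumes s: "0 \<le> s" "s \<le> t" "t \<le> s + 1"
  shows "\<bar>gam t z - gam s z\<bar> \<le> 32 * \<epsilon> * (1 + t)\<^sup>2 * exp (- s)"
proof -
  let ?v = "snd z" and ?p = "flow lam a t (free t z) 0" and ?q = "flow lam a s (free s z) 0"
  \<comment> \<open>A convex strip containing both initial points. On it brackets of velocities are
    comparable to \<open>bracket ?v\<close> up to \<open>2 * (1 + t)\<close>, and the factor
    \<open>1 / bracket ?v\<close> in the gradient bound cancels the weight in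
    \<open>free_flow_diff\<close>.\<close>
  let ?S = "UNIV \<times> cball ?v (1 + 2 * t) :: phase set"
  have b: "bracket ?v > 0" by (rule bracket_pos)
  have "norm (\<mu>0 ?p - \<mu>0 ?q) \<le> 2 * \<epsilon> * (1 + t) / bracket ?v * norm (?p - ?q)"
  proof (rule differentiable_bound[of ?S])
    show "convex ?S" by (intro convex_Times convex_UNIV convex_cball)
    have "dist ?v (snd ?p) \<le> 1 + 2 * t" using free_flow_velocity[of t z] s by (simp add: dist_norm norm_minus_commute)
    then show "?p \<in> ?S" by (simp add: mem_Times_iff)
    have "dist ?v (snd ?q) \<le> 1 + 2 * s" using free_flow_velocity[of s z] s by (simp add: dist_norm norm_minus_commute)
    then show "?q \<in> ?S" using s by (simp add: mem_Times_iff)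
    fix w assume "w \<in> ?S"
    then have w: "norm (?v - snd w) \<le> 1 + 2 * t" by (auto simp: dist_norm)
    show "(\<mu>0 has_derivative (\<lambda>h. h \<bullet> grad \<mu>0 w)) (at w within ?S)"
      by (rule has_derivative_at_withinI[OF mu0_derivative])
    show "onorm (\<lambda>h. h \<bullet> grad \<mu>0 w) \<le> 2 * \<epsilon> * (1 + t) / bracket ?v"
    proof (rule onorm_le)
      fix h :: phase
      have bw: "bracket (snd w) > 0" by (rule bracket_pos)
      have "bracket ?v \<le> (1 + norm (?v - snd w)) * bracket (snd w)" by (rule bracket_peetre)
      also have "\<dots> \<le> (2 * (1 + t)) * bracket (snd w)" using w bw by (intro mult_right_mono) auto
      finally have "\<epsilon> * bracket ?v \<le> \<epsilon> * ((2 * (1 + t)) * bracket (snd w))"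
        using eps by (intro mult_left_mono) auto
      then have "\<epsilon> / bracket (snd w) \<le> 2 * \<epsilon> * (1 + t) / bracket ?v"
        using b bw by (simp add: field_simps)
      then have "norm (grad \<mu>0 w) \<le> 2 * \<epsilon> * (1 + t) / bracket ?v" by (rule order_trans[OF grad_decay])
      then have "norm h * norm (grad \<mu>0 w) \<le> norm h * (2 * \<epsilon> * (1 + t) / bracket ?v)"
        by (rule mult_left_mono) simp
      then show "norm (h \<bullet> grad \<mu>0 w) \<le> 2 * \<epsilon> * (1 + t) / bracket ?v * norm h"
        using Cauchy_Schwarz_ineq2[of h "grad \<mu>0 w"] by (simp add: mult.commute)
    qed
  qed
  also have "\<dots> \<le> 2 * \<epsilon> * (1 + t) / bracket ?v * (16 * exp (- s) * (1 + t) * bracket ?v)"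
    using s eps b by (intro mult_left_mono free_flow_diff) auto
  also have "\<dots> = 32 * \<epsilon> * (1 + t)\<^sup>2 * exp (- s)" using b by (simp add: power2_eq_square)
  finally show ?thesis by (simp add: gam_def)
qed

lemma gam_increment:
  assumes "0 \<le> s" "s \<le> t"
  shows "\<bar>gam t z - gam s z\<bar> \<le> 288 * \<epsilon> * (s + 3)\<^sup>2 * exp (- s)"
proof -
  have "\<bar>gam t z - gam s z\<bar> \<le> 288 * \<epsilon> * (s + 3)\<^sup>2 * exp (- s)" if "0 \<le> s" "s \<le> t" "t \<le> s + real n" for n s
    using that
  proof (induction n arbitrary: s)
    case 0
    then have "s = t" by simp
    then show ?case using eps by simp
  next
    case (Suc n)
    \<comment> \<open>The constant 288 is large enough for this absorption: one unit step costs 32,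
      and the rest starts at \<open>s + 1\<close> with the additional factor
      \<open>exp (- 1) \<le> 1 / 2\<close>.\<close>
    have half: "32 * (2 + s)\<^sup>2 + 288 * (s + 4)\<^sup>2 * (1 / 2) \<le> 288 * (s + 3)\<^sup>2"
      using Suc.prems(1) by (simp add: power2_eq_square algebra_simps)
    show ?case
    proof (cases "t \<le> s + 1")
      case True
      have "\<bar>gam t z - gam s z\<bar> \<le> 32 * \<epsilon> * (1 + t)\<^sup>2 * exp (- s)" by (rule gam_step[OF Suc.prems(1,2) True])
      also have "\<dots> \<le> 32 * \<epsilon> * (s + 3)\<^sup>2 * exp (- s)"
        using eps Suc.prems True by (intro mult_right_mono mult_left_mono power_mono) auto
      also have "\<dots> \<le> 288 * \<epsilon> * (s + 3)\<^sup>2 * exp (- s)" using eps by (intro mult_right_mono) auto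
      finally show ?thesis .
    next
      case False
      have e: "exp (- (s + 1)) \<le> 1 / 2 * exp (- s)"
      proof -
        have "exp (- (s + 1)) = exp (- s) * exp (- 1)" by (simp flip: exp_add)
        moreover have "exp (- 1 :: real) \<le> 1 / 2" using exp_ge_add_one_self[of "1 :: real"] by (simp add: exp_minus field_simps)
        ultimately show ?thesis by simp
      qed
      have "\<bar>gam t z - gam (s + 1) z\<bar> \<le> 288 * \<epsilon> * (s + 1 + 3)\<^sup>2 * exp (- (s + 1))"
        using Suc.IH[of "s + 1"] Suc.prems False by simp
      also have "\<dots> \<le> 288 * \<epsilon> * (s + 4)\<^sup>2 * (1 / 2 * exp (- s))"
        using e eps by (intro mult_mono) (auto simp: add.assoc)
      finally have 1: "\<bar>gam t z - gam (s + 1) z\<bar> \<le> 288 * \<epsilon> * (s + 4)\<^sup>2 * (1 / 2 * exp (- s))" .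
      have 2: "\<bar>gam (s + 1) z - gam s z\<bar> \<le> 32 * \<epsilon> * (1 + (s + 1))\<^sup>2 * exp (- s)"
        by (rule gam_step) (use Suc.prems in auto)
      have "\<bar>gam t z - gam s z\<bar> \<le> 288 * \<epsilon> * (s + 4)\<^sup>2 * (1 / 2 * exp (- s)) + 32 * \<epsilon> * (1 + (s + 1))\<^sup>2 * exp (- s)"
        using 1 2 by linarith
      also have "\<dots> = (\<epsilon> * exp (- s)) * (32 * (2 + s)\<^sup>2 + 288 * (s + 4)\<^sup>2 * (1 / 2))"
        by (simp add: algebra_simps)
      also have "\<dots> \<le> (\<epsilon> * exp (- s)) * (288 * (s + 3)\<^sup>2)" using eps half by (intro mult_left_mono) auto
      finally show ?thesis by (simp add: mult_ac)
    qed
  qed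
  from this[of s "nat \<lceil>t - s\<rceil>"] assms show ?thesis by linarith
qed

lemma gam_rate: "t \<ge> 0 \<Longrightarrow> \<bar>muinf z - gam t z\<bar> \<le> 288 * \<epsilon> * (t + 3)\<^sup>2 * exp (- t)"
  and gam_rate_tendsto: "((\<lambda>t. 288 * \<epsilon> * (t + 3)\<^sup>2 * exp (- t)) \<longlongrightarrow> 0) at_top"
proof -
  show r: "((\<lambda>t. 288 * \<epsilon> * (t + 3)\<^sup>2 * exp (- t)) \<longlongrightarrow> 0) at_top"
    using tendsto_mult_right_zero[OF power_exp_tendsto_0[of 3 2], of "288 * \<epsilon>"] by (simp add: mult.assoc)
  show "\<bar>muinf z - gam t z\<bar> \<le> 288 * \<epsilon> * (t + 3)\<^sup>2 * exp (- t)" if "t \<ge> 0"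
    using lim_rate[OF _ r that, of "\<lambda>t. gam t z"] gam_increment by (simp add: muinf_def)
qed

end

lemma coulomb_reg_tendsto: "(\<lambda>n. coulomb_reg (1 / real (Suc n)) z) \<longlonglongrightarrow> coulomb z"
proof (cases "z = 0")
  case False
  have "(\<lambda>n. z /\<^sub>R ((norm z)\<^sup>2 + (1 / real (Suc n))\<^sup>2)) \<longlonglongrightarrow> z /\<^sub>R ((norm z)\<^sup>2 + 0\<^sup>2)"
    using False by (intro tendsto_intros LIMSEQ_Suc[OF lim_const_over_n]) auto
  then show ?thesis by (simp add: coulomb_reg_def coulomb_def)
qed (simp add: coulomb_reg_def coulomb_def)

section \<open>The limit field as the field of the limit density\<close>

context scattering begin

text \<open>The wave operator at finite time: it sends the label of an asymptotic trajectory to the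
  initial point of the particle that is on it at time \<open>t\<close>, so \<open>gam t\<close> is
  the initial density composed with it. \<open>unwave\<close> below is a right inverse.\<close>

definition wave :: "real \<Rightarrow> phase \<Rightarrow> phase" where "wave t z = flow lam a t (free t z) 0"

definition unfree :: "real \<Rightarrow> phase \<Rightarrow> phase" where
  "unfree t w = (uns w, snd w - (lam * t) *\<^sub>R Einf (uns w))"

definition unwave :: "real \<Rightarrow> phase \<Rightarrow> phase" where "unwave t z = unfree t (flow lam a 0 z t)"

lemma free_unfree: "free t (unfree t w) = w"
  by (simp add: unfree_def free_def uns_def)

lemma wave_unwave: "wave t (unwave t z) = z"
  by (simp add: wave_def unwave_def free_unfree flow_flow[OF a] flow_init[OF a])

lemma gam_wave: "gam t z = \<mu>0 (wave t z)"
  by (simp add: gam_def wave_def)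

lemma fst_unwave: "fst (unwave t z) = uns (flow lam a 0 z t)"
  by (simp add: unwave_def unfree_def)

lemma measurable_Einf: "Einf \<in> borel_measurable borel"
  by (intro borel_measurable_continuous_onI continuous_Einf)

lemma mpres_free: "mpres (free t)"
proof -
  note [measurable] = measurable_Einf
  have "mpres (\<lambda>z :: phase. (fst z, snd z + (lam * t) *\<^sub>R Einf (fst z)))" "mpres (\<lambda>z :: phase. (fst z + - snd z, snd z))"
    by (rule mpres_shear_snd mpres_shear_fst; measurable)+
  from mpres_compose[OF this(2,1)] show ?thesis by (simp add: free_def[abs_def] algebra_simps)
qed

lemma mpres_unfree: "mpres (unfree t)"
proof -
  note [measurable] = measurable_Einf
  have "mpres (\<lambda>z :: phase. (fst z, snd z + (- (lam * t)) *\<^sub>R Einf (fst z)))" "mpres (\<lambda>z :: phase. (fst z + snd z, snd z))"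
    by (rule mpres_shear_snd mpres_shear_fst; measurable)+
  from mpres_compose[OF this] show ?thesis by (simp add: unfree_def[abs_def] uns_def)
qed

lemma mpres_wave: "t \<ge> 0 \<Longrightarrow> mpres (wave t)" and mpres_unwave: "t \<ge> 0 \<Longrightarrow> mpres (unwave t)"
  unfolding wave_def unwave_def
  by (rule mpres_compose[OF mpres_flow(2)[OF a] mpres_free] mpres_compose[OF mpres_unfree mpres_flow(1)[OF a]]; simp)+

lemma continuous_gam: "continuous_on UNIV (gam t)"
proof -
  have "continuous_on UNIV (\<lambda>z. flow lam a t (free t z) 0)"
    unfolding free_def
    by (intro continuous_on_compose_triple[OF continuous_flow[OF a]] continuous_intros
        continuous_on_compose2[OF continuous_Einf]) auto
  then show ?thesis unfolding gam_def[abs_def] by (rule continuous_on_compose2[OF cont]) auto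
qed

lemma gam_limit: "(\<lambda>n. gam (real n) z) \<longlonglongrightarrow> muinf z"
proof (rule Lim_null_comparison[THEN LIM_zero_cancel])
  show "\<forall>\<^sub>F n in sequentially. norm (gam (real n) z - muinf z) \<le> 288 * \<epsilon> * (real n + 3)\<^sup>2 * exp (- real n)"
    using gam_rate[of "real _" z] by (intro always_eventually allI) (simp add: abs_minus_commute)
qed (rule filterlim_compose[OF gam_rate_tendsto filterlim_real_sequentially])

lemma measurable_muinf [measurable]: "muinf \<in> borel_measurable borel"
  by (rule borel_measurable_LIMSEQ_metric[OF _ gam_limit]) (intro borel_measurable_continuous_onI continuous_gam)

lemma muinf_bound: "\<bar>muinf z\<bar> \<le> \<epsilon>"
proof (rule tendsto_upperbound[OF tendsto_rabs[OF gam_limit]])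
  show "\<forall>\<^sub>F n in sequentially. \<bar>gam (real n) z\<bar> \<le> \<epsilon>"
  proof (intro always_eventually allI)
    fix n
    let ?w = "flow lam a (real n) (free (real n) z) 0"
    have "\<epsilon> / bracket (snd ?w) ^ 3 \<le> \<epsilon> / 1"
      using eps one_le_power[OF bracket_ge_1[of "snd ?w"], of 3] by (intro divide_left_mono) (auto simp: bracket_pos)
    then show "\<bar>gam (real n) z\<bar> \<le> \<epsilon>" unfolding gam_def using decay[of ?w] by simp
  qed
qed simp

text \<open>The rate of convergence of \<open>gam\<close> is uniform in \<open>z\<close>, so it may
  be used at the moving points \<open>unwave t z\<close>, where \<open>gam t\<close> takes the value
  \<open>\<mu>0 z\<close>.\<close>

lemma muinf_unwave_limit: "(\<lambda>n. muinf (unwave (real n) z)) \<longlonglongrightarrow> \<mu>0 z"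
proof (rule Lim_null_comparison[THEN LIM_zero_cancel])
  show "\<forall>\<^sub>F n in sequentially. norm (muinf (unwave (real n) z) - \<mu>0 z) \<le> 288 * \<epsilon> * (real n + 3)\<^sup>2 * exp (- real n)"
  proof (intro always_eventually allI)
    fix n
    have "gam (real n) (unwave (real n) z) = \<mu>0 z" by (simp add: gam_wave wave_unwave)
    then show "norm (muinf (unwave (real n) z) - \<mu>0 z) \<le> 288 * \<epsilon> * (real n + 3)\<^sup>2 * exp (- real n)"
      using gam_rate[of "real n" "unwave (real n) z"] by simp
  qed
qed (rule filterlim_compose[OF gam_rate_tendsto filterlim_real_sequentially])

text \<open>\<open>\<mu>0\<close> composed with \<open>wave\<close> tends to \<open>muinf\<close>,
  and \<open>muinf\<close> composed with \<open>unwave\<close> tends to \<open>\<mu>0\<close>; the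
  transport lemma is applied once in each direction.\<close>

lemma muinf_transport:
  shows "(\<integral>\<^sup>+z. ennreal ((muinf z)\<^sup>2) \<partial>lborel) < \<infinity>"
    and "(\<lambda>n. \<integral>\<^sup>+z. ennreal \<bar>(muinf (unwave (real n) z))\<^sup>2 - (\<mu>0 z)\<^sup>2\<bar> \<partial>lborel) \<longlonglongrightarrow> 0"
proof -
  have fin0: "(\<integral>\<^sup>+z. ennreal ((\<mu>0 z)\<^sup>2) \<partial>lborel) < \<infinity>"
    using integrable_sq unfolding integrable_iff_bounded by simp
  have w: "(\<lambda>n. \<mu>0 (wave (real n) z)) \<longlonglongrightarrow> muinf z" for z
    using gam_limit[of z] by (simp add: gam_wave)
  have "(\<integral>\<^sup>+z. ennreal ((muinf z)\<^sup>2) \<partial>lborel) = (\<integral>\<^sup>+z. ennreal ((\<mu>0 z)\<^sup>2) \<partial>lborel)"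
    by (rule tendsto_L1_transport(1)[OF mpres_unwave mpres_wave _ _ fin0 w muinf_unwave_limit]) auto
  then show fin: "(\<integral>\<^sup>+z. ennreal ((muinf z)\<^sup>2) \<partial>lborel) < \<infinity>" using fin0 by simp
  show "(\<lambda>n. \<integral>\<^sup>+z. ennreal \<bar>(muinf (unwave (real n) z))\<^sup>2 - (\<mu>0 z)\<^sup>2\<bar> \<partial>lborel) \<longlonglongrightarrow> 0"
    by (rule tendsto_L1_transport(2)[OF mpres_wave mpres_unwave _ _ fin muinf_unwave_limit w]) auto
qed

lemma integrable_muinf_sq: "integrable lborel (\<lambda>z. (muinf z)\<^sup>2)"
  using muinf_transport(1) by (intro integrableI_bounded) auto

text \<open>The position of \<open>unwave t z\<close> is the unstable component of the trajectory of
  \<open>z\<close>, which tends to \<open>asym z\<close>. Substituting \<open>unwave\<close>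
  therefore turns \<open>fst\<close> into \<open>asym\<close> in the limit, while the square of
  \<open>muinf\<close> tends to that of \<open>\<mu>0\<close> in \<open>L^1\<close>.\<close>

lemma push_forward:
  fixes k :: "plane \<Rightarrow> 'b::{banach, second_countable_topology}"
  assumes k: "continuous_on UNIV k" and C: "\<And>w. norm (k w) \<le> C"
  shows "(\<integral>z. (muinf z)\<^sup>2 *\<^sub>R k (y - fst z) \<partial>lborel) = (\<integral>z. (\<mu>0 z)\<^sup>2 *\<^sub>R k (y - asym z) \<partial>lborel)"
proof -
  have C0: "C \<ge> 0" using C[of 0] norm_ge_zero order_trans by blast
  have [measurable]: "k \<in> borel_measurable borel" using k by (rule borel_measurable_continuous_onI)
  note [measurable] = mpres_measurable[OF mpres_unwave]
  let ?u = "\<lambda>n z. uns (flow lam a 0 z (real n))"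
  have mu[measurable]: "?u n \<in> borel_measurable borel" for n
    unfolding uns_def
    by (intro borel_measurable_continuous_onI continuous_intros continuous_on_compose_triple[OF continuous_flow[OF a]])
  have mm[measurable]: "(\<lambda>z. muinf (unwave (real n) z)) \<in> borel_measurable borel" for n
    by (rule measurable_compose[OF mpres_measurable[OF mpres_unwave] measurable_muinf]) simp
  define J where "J n = (\<integral>z. (\<mu>0 z)\<^sup>2 *\<^sub>R k (y - ?u n z) \<partial>lborel)" for n
  have lim: "J \<longlonglongrightarrow> (\<integral>z. (\<mu>0 z)\<^sup>2 *\<^sub>R k (y - asym z) \<partial>lborel)"
    unfolding J_def
  proof (rule integral_dominated_convergence[where w = "\<lambda>z. (\<mu>0 z)\<^sup>2 * C"])
    show "integrable lborel (\<lambda>z. (\<mu>0 z)\<^sup>2 * C)" by (intro integrable_mult_left integrable_sq)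
    have "isCont k w" for w using k by (simp add: continuous_on_eq_continuous_at)
    then show "AE z in lborel. (\<lambda>n. (\<mu>0 z)\<^sup>2 *\<^sub>R k (y - ?u n z)) \<longlonglongrightarrow> (\<mu>0 z)\<^sup>2 *\<^sub>R k (y - asym z)"
      by (intro AE_I2 tendsto_intros isCont_tendsto_compose[of _ k] asym_limit)
    show "AE z in lborel. norm ((\<mu>0 z)\<^sup>2 *\<^sub>R k (y - ?u n z)) \<le> (\<mu>0 z)\<^sup>2 * C" for n
      using C by (intro AE_I2) (simp add: mult_left_mono)
  qed measurable
  have I: "(\<integral>z. (muinf z)\<^sup>2 *\<^sub>R k (y - fst z) \<partial>lborel) = (\<integral>z. (muinf (unwave (real n) z))\<^sup>2 *\<^sub>R k (y - ?u n z) \<partial>lborel)" for n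
    unfolding fst_unwave[symmetric]
    by (rule mpres_integral[OF mpres_unwave, symmetric, where f = "\<lambda>z. (muinf z)\<^sup>2 *\<^sub>R k (y - fst z)"]) auto
  have "(\<lambda>n. ennreal (norm ((\<integral>z. (muinf z)\<^sup>2 *\<^sub>R k (y - fst z) \<partial>lborel) - J n))) \<longlonglongrightarrow> 0"
  proof (rule tendsto_sandwich[OF _ _ tendsto_const])
    show "(\<lambda>n. ennreal C * (\<integral>\<^sup>+z. ennreal \<bar>(muinf (unwave (real n) z))\<^sup>2 - (\<mu>0 z)\<^sup>2\<bar> \<partial>lborel)) \<longlonglongrightarrow> 0"
      using ennreal_tendsto_cmult[OF _ muinf_transport(2), of "ennreal C"] by simp
    show "\<forall>\<^sub>F n in sequentially. ennreal (norm ((\<integral>z. (muinf z)\<^sup>2 *\<^sub>R k (y - fst z) \<partial>lborel) - J n))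
        \<le> ennreal C * (\<integral>\<^sup>+z. ennreal \<bar>(muinf (unwave (real n) z))\<^sup>2 - (\<mu>0 z)\<^sup>2\<bar> \<partial>lborel)"
    proof (intro always_eventually allI)
      fix n
      let ?m = "\<lambda>z. muinf (unwave (real n) z)" and ?k = "\<lambda>z. k (y - ?u n z)"
      have mk: "?k \<in> borel_measurable borel" by measurable
      have i0: "integrable lborel (\<lambda>z. (?m z)\<^sup>2)"
        using mpres_integrable[OF mpres_unwave[of "real n"], of "\<lambda>z. (muinf z)\<^sup>2"] integrable_muinf_sq by simp
      have b: "integrable lborel (\<lambda>z. (f z)\<^sup>2 *\<^sub>R ?k z)" if "integrable lborel (\<lambda>z. (f z)\<^sup>2)" "f \<in> borel_measurable borel" for f :: "phase \<Rightarrow> real"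
      proof (rule Bochner_Integration.integrable_bound[OF integrable_mult_left[OF that(1), of C]])
        show "(\<lambda>z. (f z)\<^sup>2 *\<^sub>R ?k z) \<in> borel_measurable lborel" using that(2) mk by simp
        show "AE z in lborel. norm ((f z)\<^sup>2 *\<^sub>R ?k z) \<le> norm ((f z)\<^sup>2 * C)"
          using C C0 by (intro AE_I2) (simp add: mult_left_mono)
      qed
      note i1 = b[OF i0 mm] and i2 = b[OF integrable_sq measurable_mu0]
      have "(\<integral>z. (muinf z)\<^sup>2 *\<^sub>R k (y - fst z) \<partial>lborel) - J n = (\<integral>z. (?m z)\<^sup>2 *\<^sub>R ?k z - (\<mu>0 z)\<^sup>2 *\<^sub>R ?k z \<partial>lborel)"
        unfolding I[of n] J_def by (rule Bochner_Integration.integral_diff[OF i1 i2, symmetric])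
      then have "ennreal (norm ((\<integral>z. (muinf z)\<^sup>2 *\<^sub>R k (y - fst z) \<partial>lborel) - J n))
          \<le> (\<integral>\<^sup>+z. norm ((?m z)\<^sup>2 *\<^sub>R ?k z - (\<mu>0 z)\<^sup>2 *\<^sub>R ?k z) \<partial>lborel)"
        using integral_norm_bound_ennreal[OF Bochner_Integration.integrable_diff[OF i1 i2]] by simp
      also have "\<dots> \<le> (\<integral>\<^sup>+z. ennreal C * ennreal \<bar>(?m z)\<^sup>2 - (\<mu>0 z)\<^sup>2\<bar> \<partial>lborel)"
      proof (rule nn_integral_mono)
        fix z
        have "norm ((?m z)\<^sup>2 *\<^sub>R ?k z - (\<mu>0 z)\<^sup>2 *\<^sub>R ?k z) = \<bar>(?m z)\<^sup>2 - (\<mu>0 z)\<^sup>2\<bar> * norm (?k z)"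
          by (simp flip: scaleR_diff_left)
        also have "\<dots> \<le> \<bar>(?m z)\<^sup>2 - (\<mu>0 z)\<^sup>2\<bar> * C" using C by (intro mult_left_mono) auto
        finally show "ennreal (norm ((?m z)\<^sup>2 *\<^sub>R ?k z - (\<mu>0 z)\<^sup>2 *\<^sub>R ?k z)) \<le> ennreal C * ennreal \<bar>(?m z)\<^sup>2 - (\<mu>0 z)\<^sup>2\<bar>"
          using C0 by (simp add: mult.commute ennreal_leI flip: ennreal_mult')
      qed
      also have "\<dots> = ennreal C * (\<integral>\<^sup>+z. ennreal \<bar>(?m z)\<^sup>2 - (\<mu>0 z)\<^sup>2\<bar> \<partial>lborel)"
        by (rule nn_integral_cmult) measurable
      finally show "ennreal (norm ((\<integral>z. (muinf z)\<^sup>2 *\<^sub>R k (y - fst z) \<partial>lborel) - J n))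
          \<le> ennreal C * (\<integral>\<^sup>+z. ennreal \<bar>(?m z)\<^sup>2 - (\<mu>0 z)\<^sup>2\<bar> \<partial>lborel)" .
    qed
  qed simp
  then have "(\<lambda>n. norm ((\<integral>z. (muinf z)\<^sup>2 *\<^sub>R k (y - fst z) \<partial>lborel) - J n)) \<longlonglongrightarrow> 0"
    using tendsto_ennreal_iff[where F = sequentially and x = 0 and f = "\<lambda>n. norm ((\<integral>z. (muinf z)\<^sup>2 *\<^sub>R k (y - fst z) \<partial>lborel) - J n)"] by simp
  then have "(\<lambda>n. (\<integral>z. (muinf z)\<^sup>2 *\<^sub>R k (y - fst z) \<partial>lborel) - J n) \<longlonglongrightarrow> 0" by (rule tendsto_norm_zero_cancel)
  moreover have "(\<lambda>n. (\<integral>z. (muinf z)\<^sup>2 *\<^sub>R k (y - fst z) \<partial>lborel) - J n) \<longlonglongrightarrow> (\<integral>z. (muinf z)\<^sup>2 *\<^sub>R k (y - fst z) \<partial>lborel) - (\<integral>z. (\<mu>0 z)\<^sup>2 *\<^sub>R k (y - asym z) \<partial>lborel)"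
    by (intro tendsto_intros lim)
  ultimately show ?thesis using LIMSEQ_unique by fastforce
qed

text \<open>The Coulomb kernel is neither bounded nor continuous, so the identity is used for
  regularised kernels and \<open>d\<close> tends to 0. For \<open>muinf\<close> no decay in velocity
  is at hand; integrability comes from the identity for the norms of the regularised kernels and
  Fatou's lemma, and dominated convergence then applies on both sides.\<close>

lemma coulomb_muinf:
  shows "integrable lborel (\<lambda>z. (muinf z)\<^sup>2 *\<^sub>R coulomb (y - fst z))"
    and "(\<integral>z. (muinf z)\<^sup>2 *\<^sub>R coulomb (y - fst z) \<partial>lborel) = (\<integral>z. (\<mu>0 z)\<^sup>2 *\<^sub>R coulomb (y - asym z) \<partial>lborel)"
proof -
  note [measurable] = measurable_coulomb
  let ?d = "\<lambda>n. 1 / real (Suc n)"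
  have d: "?d n > 0" for n by simp
  have cr: "continuous_on UNIV (coulomb_reg (?d n))" for n by (rule continuous_on_coulomb_reg[OF d])
  have mr[measurable]: "coulomb_reg (?d n) \<in> borel_measurable borel" for n
    by (rule borel_measurable_continuous_onI[OF cr])
  have [measurable]: "(\<lambda>z :: phase. coulomb (y - fst z)) \<in> borel_measurable borel"
    "(\<lambda>z :: phase. coulomb_reg (?d n) (y - fst z)) \<in> borel_measurable borel"
    "(\<lambda>z :: phase. coulomb_reg (?d n) (y - asym z)) \<in> borel_measurable borel"
    "(\<lambda>z :: phase. coulomb (y - asym z)) \<in> borel_measurable borel" for n
    by (rule measurable_compose[OF _ measurable_coulomb] measurable_compose[OF _ mr]; measurable)+
  have le: "(\<integral>\<^sup>+z. ennreal (norm ((muinf z)\<^sup>2 *\<^sub>R coulomb_reg (?d n) (y - fst z))) \<partial>lborel) \<le> ennreal (singular_const * \<epsilon>\<^sup>2)" for n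
  proof -
    have i: "integrable lborel (\<lambda>z. (muinf z)\<^sup>2 *\<^sub>R norm (coulomb_reg (?d n) (y - fst z)))"
    proof (rule Bochner_Integration.integrable_bound[OF integrable_mult_left[OF integrable_muinf_sq, of "1 / ?d n"]])
      show "AE z in lborel. norm ((muinf z)\<^sup>2 *\<^sub>R norm (coulomb_reg (?d n) (y - fst z))) \<le> norm ((muinf z)\<^sup>2 * (1 / ?d n))"
        using norm_coulomb_reg(2)[OF d] by (intro AE_I2) (simp add: abs_mult mult_left_mono)
    qed measurable
    have "(\<integral>\<^sup>+z. ennreal (norm ((muinf z)\<^sup>2 *\<^sub>R coulomb_reg (?d n) (y - fst z))) \<partial>lborel)
        = ennreal (\<integral>z. (muinf z)\<^sup>2 *\<^sub>R norm (coulomb_reg (?d n) (y - fst z)) \<partial>lborel)"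
      using nn_integral_eq_integral[OF i] by simp
    also have "(\<integral>z. (muinf z)\<^sup>2 *\<^sub>R norm (coulomb_reg (?d n) (y - fst z)) \<partial>lborel) = (\<integral>z. (\<mu>0 z)\<^sup>2 *\<^sub>R norm (coulomb_reg (?d n) (y - asym z)) \<partial>lborel)"
    proof (rule push_forward)
      show "continuous_on UNIV (\<lambda>w. norm (coulomb_reg (?d n) w))" by (intro continuous_intros cr)
      show "norm (norm (coulomb_reg (?d n) w)) \<le> 1 / ?d n" for w using norm_coulomb_reg(2)[OF d] by simp
    qed
    also have "\<dots> \<le> (\<integral>z. norm ((\<mu>0 z)\<^sup>2 *\<^sub>R coulomb (y - asym z)) \<partial>lborel)"
    proof (rule integral_mono_AE')
      show "integrable lborel (\<lambda>z. norm ((\<mu>0 z)\<^sup>2 *\<^sub>R coulomb (y - asym z)))" by (intro integrable_norm integrable_coulomb_asym)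
      show "AE z in lborel. (\<mu>0 z)\<^sup>2 *\<^sub>R norm (coulomb_reg (?d n) (y - asym z)) \<le> norm ((\<mu>0 z)\<^sup>2 *\<^sub>R coulomb (y - asym z))"
        using norm_coulomb_reg(3)[OF d] by (intro AE_I2) (simp add: mult_left_mono)
    qed simp
    also have "ennreal (\<integral>z. norm ((\<mu>0 z)\<^sup>2 *\<^sub>R coulomb (y - asym z)) \<partial>lborel) = (\<integral>\<^sup>+z. norm ((\<mu>0 z)\<^sup>2 *\<^sub>R coulomb (y - asym z)) \<partial>lborel)"
      using nn_integral_eq_integral[OF integrable_norm[OF integrable_coulomb_asym]] by simp
    also have "\<dots> \<le> (\<integral>\<^sup>+z. ennreal (norm (coulomb (y - asym z))) * ennreal (wt z) \<partial>lborel)"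
      by (intro nn_integral_mono norm_lagrangian_integrand)
    also have "\<dots> \<le> ennreal (singular_const * \<epsilon>\<^sup>2)" by (rule asym_singular)
    finally show ?thesis by (simp add: ennreal_leI)
  qed
  have "(\<integral>\<^sup>+z. ennreal (norm ((muinf z)\<^sup>2 *\<^sub>R coulomb (y - fst z))) \<partial>lborel)
      = (\<integral>\<^sup>+z. liminf (\<lambda>n. ennreal (norm ((muinf z)\<^sup>2 *\<^sub>R coulomb_reg (?d n) (y - fst z)))) \<partial>lborel)"
    by (intro nn_integral_cong lim_imp_Liminf[symmetric] tendsto_ennrealI tendsto_intros coulomb_reg_tendsto) simp
  also have "\<dots> \<le> liminf (\<lambda>n. \<integral>\<^sup>+z. ennreal (norm ((muinf z)\<^sup>2 *\<^sub>R coulomb_reg (?d n) (y - fst z))) \<partial>lborel)"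
    by (rule nn_integral_liminf) measurable
  also have "\<dots> \<le> liminf (\<lambda>n :: nat. ennreal (singular_const * \<epsilon>\<^sup>2))"
    by (intro Liminf_mono always_eventually allI le)
  finally have "(\<integral>\<^sup>+z. ennreal (norm ((muinf z)\<^sup>2 *\<^sub>R coulomb (y - fst z))) \<partial>lborel) \<le> ennreal (singular_const * \<epsilon>\<^sup>2)"
    by (simp add: Liminf_const)
  then show i: "integrable lborel (\<lambda>z. (muinf z)\<^sup>2 *\<^sub>R coulomb (y - fst z))"
    by (intro integrableI_bounded) (auto intro: le_less_trans)
  have "(\<lambda>n. \<integral>z. (muinf z)\<^sup>2 *\<^sub>R coulomb_reg (?d n) (y - fst z) \<partial>lborel) \<longlonglongrightarrow> (\<integral>z. (muinf z)\<^sup>2 *\<^sub>R coulomb (y - fst z) \<partial>lborel)"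
  proof (rule integral_dominated_convergence[OF _ _ integrable_norm[OF i]])
    show "AE z in lborel. norm ((muinf z)\<^sup>2 *\<^sub>R coulomb_reg (?d n) (y - fst z)) \<le> norm ((muinf z)\<^sup>2 *\<^sub>R coulomb (y - fst z))" for n
      using norm_coulomb_reg(3)[OF d] by (intro AE_I2) (simp add: mult_left_mono)
  qed (measurable, intro AE_I2 tendsto_intros coulomb_reg_tendsto)
  moreover have "(\<lambda>n. \<integral>z. (\<mu>0 z)\<^sup>2 *\<^sub>R coulomb_reg (?d n) (y - asym z) \<partial>lborel) \<longlonglongrightarrow> (\<integral>z. (\<mu>0 z)\<^sup>2 *\<^sub>R coulomb (y - asym z) \<partial>lborel)"
  proof (rule integral_dominated_convergence[OF _ _ integrable_norm[OF integrable_coulomb_asym]])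
    show "AE z in lborel. norm ((\<mu>0 z)\<^sup>2 *\<^sub>R coulomb_reg (?d n) (y - asym z)) \<le> norm ((\<mu>0 z)\<^sup>2 *\<^sub>R coulomb (y - asym z))" for n
      using norm_coulomb_reg(3)[OF d] by (intro AE_I2) (simp add: mult_left_mono)
  qed (measurable, intro AE_I2 tendsto_intros coulomb_reg_tendsto)
  moreover have "(\<integral>z. (muinf z)\<^sup>2 *\<^sub>R coulomb_reg (?d n) (y - fst z) \<partial>lborel) = (\<integral>z. (\<mu>0 z)\<^sup>2 *\<^sub>R coulomb_reg (?d n) (y - asym z) \<partial>lborel)" for n
    by (rule push_forward[OF cr norm_coulomb_reg(2)[OF d]])
  ultimately show "(\<integral>z. (muinf z)\<^sup>2 *\<^sub>R coulomb (y - fst z) \<partial>lborel) = (\<integral>z. (\<mu>0 z)\<^sup>2 *\<^sub>R coulomb (y - asym z) \<partial>lborel)"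
    by (simp add: LIMSEQ_unique)
qed

lemma field_muinf: "field_defined muinf" "efield muinf = Einf"
  by (simp_all add: field_defined_def field_integrand_eq[abs_def] coulomb_muinf efield_eq[abs_def] kernel_integral_def Einf_def[abs_def])

end

text \<open>The set where the bound fails is open, and a nonempty open set has positive
  measure.\<close>

lemma continuous_le_essential_bound:
  fixes f :: "'a::euclidean_space \<Rightarrow> 'b::real_normed_vector"
  assumes f: "continuous_on UNIV f" and C: "Linf_norm f \<le> ennreal C" "C \<ge> 0"
  shows "norm (f z) \<le> C"
proof (rule ccontr)
  assume "\<not> norm (f z) \<le> C"
  then have ne: "{z. norm (f z) > C} \<noteq> {}" by (auto simp: not_le)
  have op: "open {z. norm (f z) > C}"
    by (intro open_Collect_less continuous_intros f)
  have "AE z in lborel. ennreal (norm (f z)) \<le> ennreal C"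
    using esssup_AE[of "\<lambda>z. ennreal (norm (f z))" lborel]
    by eventually_elim (use C(1) in \<open>simp add: Linf_norm_def order_trans\<close>)
  then have "AE z in lborel. \<not> norm (f z) > C"
    by eventually_elim (use C in simp)
  then have "{z. norm (f z) > C} \<in> null_sets lborel"
    using op by (subst AE_iff_null_sets) auto
  then have "negligible {z. norm (f z) > C}"
    unfolding negligible_iff_null_sets by (rule null_sets_completionI)
  then show False using open_not_negligible[OF op ne] by blast
qed

lemma Linf_norm_le:
  fixes f :: "'a::euclidean_space \<Rightarrow> 'b::real_normed_vector"
  assumes "(\<lambda>z. norm (f z)) \<in> borel_measurable borel" and "\<And>z. norm (f z) \<le> C"
  shows "Linf_norm f \<le> ennreal C"
  unfolding Linf_norm_def using assms by (intro esssup_I AE_I2 ennreal_leI) auto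

context scattering begin

lemma muinf_in_spaces: "in_L2 muinf" "in_Linf muinf" "in_Linf Einf"
proof -
  show "in_L2 muinf" using muinf_transport(1) by (simp add: in_L2_def L2_norm_def)
  have "Linf_norm muinf \<le> ennreal \<epsilon>"
    by (rule Linf_norm_le) (simp_all add: muinf_bound)
  then show "in_Linf muinf" by (simp add: in_Linf_def le_less_trans)
  have "Linf_norm Einf \<le> ennreal 1"
    by (rule Linf_norm_le[OF measurable_compose[OF measurable_Einf borel_measurable_norm] norm_Einf])
  then show "in_Linf Einf" by (simp add: in_Linf_def le_less_trans measurable_Einf)
qed

lemma asymptotics:
  assumes t: "t \<ge> 0"
  shows "Linf_norm (\<lambda>(x, v). mu a t (Xasym lam Einf t (x - v) v, Vasym lam Einf t (x - v) v) - muinf (x, v))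
    \<le> ennreal (4608 * \<epsilon> * bracket t ^ 10 / exp t)"
  unfolding mu_asymptotic case_prod_eta
proof (rule Linf_norm_le)
  show "(\<lambda>z. norm (case z of (x, v) \<Rightarrow> gam t (x, v) - muinf (x, v))) \<in> borel_measurable borel"
    using borel_measurable_continuous_onI[OF continuous_gam[of t]] by simp
  fix z
  have b: "1 \<le> bracket t" "t \<le> bracket t" using bracket_ge_1[of t] bracket_ge_norm[of t] t by auto
  \<comment> \<open>The rate found is quadratic in \<open>t\<close>. Here
    \<open>t + 3 \<le> 4 * bracket t\<close>, and \<open>4608 = 288 * 16\<close>.\<close>
  then have "(t + 3)\<^sup>2 \<le> (4 * bracket t)\<^sup>2" using t by (intro power_mono) auto
  also have "\<dots> = 16 * bracket t ^ 2" by (simp add: power_mult_distrib)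
  also have "\<dots> \<le> 16 * bracket t ^ 10" using b by (intro mult_left_mono power_increasing) auto
  finally have p: "(t + 3)\<^sup>2 \<le> 16 * bracket t ^ 10" .
  have "\<bar>muinf z - gam t z\<bar> \<le> 288 * \<epsilon> * (t + 3)\<^sup>2 * exp (- t)" by (rule gam_rate[OF t])
  also have "\<dots> \<le> 288 * \<epsilon> * (16 * bracket t ^ 10) * exp (- t)"
    using p eps by (intro mult_right_mono mult_left_mono) auto
  also have "\<dots> = 4608 * \<epsilon> * bracket t ^ 10 / exp t" by (simp add: exp_minus divide_inverse)
  finally show "norm (case z of (x, v) \<Rightarrow> gam t (x, v) - muinf (x, v)) \<le> 4608 * \<epsilon> * bracket t ^ 10 / exp t"
    by (simp add: split_beta abs_minus_commute)
qed

lemma solution_unique: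
  assumes "global_solution lam \<mu>0 \<nu>" "t \<ge> 0"
  shows "\<nu> t = mu a t"
proof -
  interpret competitor lam \<mu>0 \<epsilon> a \<nu> by unfold_locales (rule assms(1))
  show ?thesis by (rule unique_solution[OF assms(2)])
qed

lemma solution_with_asymptotics:
  shows "\<exists>\<mu>. global_solution lam \<mu>0 \<mu> \<and>
          (\<forall>\<nu>. global_solution lam \<mu>0 \<nu> \<longrightarrow> (\<forall>t\<ge>0. \<nu> t = \<mu> t)) \<and>
          (\<exists>\<mu>inf Einf.
             in_L2 \<mu>inf \<and> in_Linf \<mu>inf \<and>
             field_defined \<mu>inf \<and> Einf = efield \<mu>inf \<and> in_Linf Einf \<and>
             (\<exists>C>0. \<forall>\<^sub>F t in at_top.
                Linf_norm (\<lambda>(x, v).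
                    \<mu> t (Xasym lam Einf t (x - v) v, Vasym lam Einf t (x - v) v) - \<mu>inf (x, v))
                  \<le> ennreal (C * bracket t ^ 10 / exp t)))"
proof (intro exI conjI)
  show "global_solution lam \<mu>0 (mu a)" by (rule mu_global_solution)
  show "\<forall>\<nu>. global_solution lam \<mu>0 \<nu> \<longrightarrow> (\<forall>t\<ge>0. \<nu> t = mu a t)" by (simp add: solution_unique)
  show "in_L2 muinf" "in_Linf muinf" "in_Linf Einf" by (rule muinf_in_spaces)+
  show "field_defined muinf" "Einf = efield muinf" by (simp_all only: field_muinf)
  show "4608 * \<epsilon> > 0" using eps by simp
  show "\<forall>\<^sub>F t in at_top. Linf_norm (\<lambda>(x, v).
      mu a t (Xasym lam Einf t (x - v) v, Vasym lam Einf t (x - v) v) - muinf (x, v))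
    \<le> ennreal (4608 * \<epsilon> * bracket t ^ 10 / exp t)"
    using eventually_ge_at_top[of 0] by eventually_elim (rule asymptotics)
qed

end

text \<open>Each of the three norms is at most \<open>\<epsilon>\<close>. Continuity of the data and
  of the gradient turns essential bounds into pointwise ones, and the mean value inequality turns
  the gradient bound into a Lipschitz bound.\<close>

lemma initial_data_bounds:
  fixes \<mu>0 :: "phase \<Rightarrow> real"
  assumes C1: "C1_fun \<mu>0" and \<epsilon>: "\<epsilon> > 0"
    and small: "L2_norm (\<lambda>(x, v). bracket v * \<mu>0 (x, v))
      + Linf_norm (\<lambda>(x, v). bracket v *\<^sub>R grad \<mu>0 (x, v))
      + Linf_norm (\<lambda>(x, v). bracket v ^ 3 * \<mu>0 (x, v)) \<le> ennreal \<epsilon>"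
  shows "continuous_on UNIV \<mu>0" and "\<bar>\<mu>0 z\<bar> \<le> \<epsilon> / bracket (snd z) ^ 3"
    and "\<bar>\<mu>0 y - \<mu>0 z\<bar> \<le> \<epsilon> * norm (y - z)" and "norm (grad \<mu>0 z) \<le> \<epsilon> / bracket (snd z)"
    and "(\<integral>\<^sup>+z. ennreal ((bracket (snd z) * \<mu>0 z)\<^sup>2) \<partial>lborel) \<le> ennreal (\<epsilon>\<^sup>2)"
proof -
  let ?f = "\<lambda>z. bracket (snd z) * \<mu>0 z" and ?g = "\<lambda>z. bracket (snd z) *\<^sub>R grad \<mu>0 z" and ?h = "\<lambda>z. bracket (snd z) ^ 3 * \<mu>0 z"
  have "L2_norm ?f + Linf_norm ?g + Linf_norm ?h \<le> ennreal \<epsilon>" using small by (simp add: split_beta')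
  moreover have "p \<le> p + q + r" "q \<le> p + q + r" "r \<le> p + q + r" for p q r :: ennreal
    by (simp_all add: add_increasing add_increasing2)
  ultimately have n: "L2_norm ?f \<le> ennreal \<epsilon>" "Linf_norm ?g \<le> ennreal \<epsilon>" "Linf_norm ?h \<le> ennreal \<epsilon>"
    using order_trans by blast+
  have der: "(\<mu>0 has_derivative (\<lambda>h. h \<bullet> grad \<mu>0 w)) (at w)" for w
    using C1 unfolding C1_fun_def by (intro differentiable_grad) blast
  show c: "continuous_on UNIV \<mu>0"
    using has_derivative_continuous[OF der] by (intro continuous_at_imp_continuous_on) blast
  have cg: "continuous_on UNIV (grad \<mu>0)" using C1 by (simp add: C1_fun_def)
  have "norm (?h z) \<le> \<epsilon>"
    by (rule continuous_le_essential_bound[OF _ n(3) less_imp_le[OF \<epsilon>]]) (intro continuous_intros c)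
  then show "\<bar>\<mu>0 z\<bar> \<le> \<epsilon> / bracket (snd z) ^ 3"
    using bracket_pos[of "snd z"] by (simp add: abs_mult field_simps)
  have g: "norm (grad \<mu>0 w) \<le> \<epsilon> / bracket (snd w)" for w
  proof -
    have "norm (?g w) \<le> \<epsilon>"
      by (rule continuous_le_essential_bound[OF _ n(2) less_imp_le[OF \<epsilon>]]) (intro continuous_intros cg)
    then show ?thesis using bracket_pos[of "snd w"] by (simp add: field_simps)
  qed
  show "norm (grad \<mu>0 z) \<le> \<epsilon> / bracket (snd z)" by (rule g)
  have "norm (\<mu>0 y - \<mu>0 z) \<le> \<epsilon> * norm (y - z)"
  proof (rule differentiable_bound[of UNIV])
    show "(\<mu>0 has_derivative (\<lambda>h. h \<bullet> grad \<mu>0 w)) (at w within UNIV)" for w by (rule der)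
    show "onorm (\<lambda>h. h \<bullet> grad \<mu>0 w) \<le> \<epsilon>" for w
    proof (rule onorm_le)
      fix h :: phase
      have "\<epsilon> / bracket (snd w) \<le> \<epsilon> / 1"
        using \<epsilon> bracket_ge_1[of "snd w"] by (intro divide_left_mono) (auto simp: bracket_pos)
      then have "norm (grad \<mu>0 w) \<le> \<epsilon>" using g[of w] by simp
      then have "norm h * norm (grad \<mu>0 w) \<le> norm h * \<epsilon>" by (rule mult_left_mono) simp
      then show "norm (h \<bullet> grad \<mu>0 w) \<le> \<epsilon> * norm h"
        using Cauchy_Schwarz_ineq2[of h "grad \<mu>0 w"] by (simp add: mult.commute)
    qed
  qed auto
  then show "\<bar>\<mu>0 y - \<mu>0 z\<bar> \<le> \<epsilon> * norm (y - z)" by simp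
  let ?I = "\<integral>\<^sup>+z. ennreal ((?f z)\<^sup>2) \<partial>lborel"
  have "L2_norm ?f < \<infinity>" using n(1) by (simp add: le_less_trans)
  then have fin: "?I < \<infinity>" and eq: "L2_norm ?f = ennreal (sqrt (enn2real ?I))"
    by (auto simp: L2_norm_def Let_def split: if_splits)
  then have "sqrt (enn2real ?I) \<le> \<epsilon>" using n(1) \<epsilon> by simp
  then have "enn2real ?I \<le> \<epsilon>\<^sup>2" by (rule sqrt_le_D)
  then have "ennreal (enn2real ?I) \<le> ennreal (\<epsilon>\<^sup>2)" by (rule ennreal_leI)
  then show "?I \<le> ennreal (\<epsilon>\<^sup>2)" using fin by (simp only: ennreal_enn2real infinity_ennreal_def)
qed

theorem theorem1p1:
  fixes lam :: real
  assumes "lam \<in> {-1, 1}"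
  shows "\<exists>\<epsilon>0 > 0. \<forall>\<mu>0 :: phase \<Rightarrow> real.
    C1_fun \<mu>0 \<and>
    L2_norm (\<lambda>(x, v). bracket v * \<mu>0 (x, v))
      + Linf_norm (\<lambda>(x, v). bracket v *\<^sub>R grad \<mu>0 (x, v))
      + Linf_norm (\<lambda>(x, v). bracket v ^ 3 * \<mu>0 (x, v)) \<le> ennreal \<epsilon>0
    \<longrightarrow> (\<exists>\<mu>. global_solution lam \<mu>0 \<mu> \<and>
          (\<forall>\<nu>. global_solution lam \<mu>0 \<nu> \<longrightarrow> (\<forall>t\<ge>0. \<nu> t = \<mu> t)) \<and>
          (\<exists>\<mu>inf Einf.
             in_L2 \<mu>inf \<and> in_Linf \<mu>inf \<and>
             field_defined \<mu>inf \<and> Einf = efield \<mu>inf \<and> in_Linf Einf \<and>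
             (\<exists>C>0. \<forall>\<^sub>F t in at_top.
                Linf_norm (\<lambda>(x, v).
                    \<mu> t (Xasym lam Einf t (x - v) v, Vasym lam Einf t (x - v) v) - \<mu>inf (x, v))
                  \<le> ennreal (C * bracket t ^ 10 / exp t))))"
proof -
  define K where "K = 36 * (4 * singular_const + 98304 * pi\<^sup>2)"
  have K: "K > 0" using singular_const_pos by (simp add: K_def add_pos_pos)
  \<comment> \<open>The largest value compatible with \<open>eps_small\<close>, the same for both
    signs of \<open>lam\<close>.\<close>
  define \<epsilon> where "\<epsilon> = sqrt (1 / K)"
  have \<epsilon>: "\<epsilon> > 0" "K * \<epsilon>\<^sup>2 \<le> 1" using K by (simp_all add: \<epsilon>_def)
  show ?thesis
  proof (intro exI[of _ \<epsilon>] conjI allI impI; (elim conjE)?)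
    show "\<epsilon> > 0" by (rule \<epsilon>(1))
    fix \<mu>0 :: "phase \<Rightarrow> real"
    assume C1: "C1_fun \<mu>0" and small: "L2_norm (\<lambda>(x, v). bracket v * \<mu>0 (x, v))
      + Linf_norm (\<lambda>(x, v). bracket v *\<^sub>R grad \<mu>0 (x, v))
      + Linf_norm (\<lambda>(x, v). bracket v ^ 3 * \<mu>0 (x, v)) \<le> ennreal \<epsilon>"
    note data = initial_data_bounds[OF C1 \<epsilon>(1) small]
    have sd: "small_data lam \<mu>0 \<epsilon>"
      using assms \<epsilon> data by unfold_locales (auto simp: K_def)
    obtain a where a: "small_field a" "\<And>t x. a t x = transported_data.fld lam \<mu>0 a \<bar>t\<bar> x"
      by (rule small_data.fixed_point_field[OF sd]) (rule that; assumption)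
    have "scattering lam \<mu>0 \<epsilon> a"
      by (intro scattering.intro vlasov_field.intro vlasov_field_axioms.intro scattering_axioms.intro sd a C1 data)
    then show "\<exists>\<mu>. global_solution lam \<mu>0 \<mu> \<and>
          (\<forall>\<nu>. global_solution lam \<mu>0 \<nu> \<longrightarrow> (\<forall>t\<ge>0. \<nu> t = \<mu> t)) \<and>
          (\<exists>\<mu>inf Einf.
             in_L2 \<mu>inf \<and> in_Linf \<mu>inf \<and>
             field_defined \<mu>inf \<and> Einf = efield \<mu>inf \<and> in_Linf Einf \<and>
             (\<exists>C>0. \<forall>\<^sub>F t in at_top.
                Linf_norm (\<lambda>(x, v).
                    \<mu> t (Xasym lam Einf t (x - v) v, Vasym lam Einf t (x - v) v) - \<mu>inf (x, v))
                  \<le> ennreal (C * bracket t ^ 10 / exp t)))"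
      by (rule scattering.solution_with_asymptotics)
  qed
qed

end
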